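(* As $h \to 0$, the functionals $\overline{E}_h$ $\Gamma$-converge on $X$ (with respect to the strong $W^{1,4}$ topology) to the functional $\overline{E}_0$.
   Context: Let $B_1\subset\mathbb{R}^2$ be the open unit disc and $\mathbb{S}^1=\partial B_1$; $\mathbb{S}^2\subset\mathbb{R}^3$ is the unit sphere. Let $O(2,3)=\{P\in M^{3\times 2}: P^TP=I_{2\times 2}\}$. For $h\in(0,1)$ and ${\bf u}\in W^{2,2}(B_1;\mathbb{R}^3)$ set $$E_h({\bf u}) := h^2\int_{B_1}|D^2{\bf u}|^2\,dx+\int_{B_1}\mathrm{dist}^2(D{\bf u},O(2,3))\,dx.$$ Let $X:=\{{\bf u}\in W^{1,4}(B_1;\mathbb{R}^3): {\bf u}(0)=0,\ {\bf u}|_{\mathbb{S}^1}\in\mathbb{S}^2\}$, equipped with the $W^{1,4}$ norm. Define $\overline{E}_h({\bf u}) := \frac{1}{h^2|\log h|}E_h({\bf u})$ if ${\bf u}\in X\cap W^{2,2}(B_1)$ and $\overline{E}_h({\bf u})=+\infty$ for other ${\bf u}\in X$. Define $\overline{E}_0({\bf u}):=\frac{1}{\log 2}\int_{B_1\setminus B_{1/2}}|D^2{\bf u}|^2\,dx$ if ${\bf u}\in X\cap W^{2,2}(B_1\setminus B_{1/2})$ is a one-homogeneous isometry (i.e. ${\bf u}(x)=|x|\gamma(x/|x|)$ for some map $\gamma$ and $D{\bf u}\in O(2,3)$ a.e.), and $\overline{E}_0({\bf u})=+\infty$ otherwise. $\Gamma$-convergence means: for every sequence $h_k\to 0$, (i)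 for every ${\bf u}\in X$ and every ${\bf u}^k\to{\bf u}$ in $X$, $\liminf_k \overline{E}_{h_k}({\bf u}^k)\ge \overline{E}_0({\bf u})$; (ii) for every ${\bf u}\in X$ there exist ${\bf u}^k\to{\bf u}$ in $X$ with $\limsup_k\overline{E}_{h_k}({\bf u}^k)\le\overline{E}_0({\bf u})$. *)

theory Defs
  imports "HOL-Analysis.Analysis"
begin

definition pd :: "'n::finite \<Rightarrow> (real^'n \<Rightarrow> real) \<Rightarrow> real^'n \<Rightarrow> real" where
  "pd i \<phi> x = frechet_derivative \<phi> (at x) (axis i 1)"

fun iter_pd :: "'n::finite list \<Rightarrow> (real^'n \<Rightarrow> real) \<Rightarrow> real^'n \<Rightarrow> real" where
  "iter_pd [] \<phi> = \<phi>"
| "iter_pd (i # is) \<phi> = pd i (iter_pd is \<phi>)"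

definition smooth_fn :: "(real^'n::finite \<Rightarrow> real) \<Rightarrow> bool" where
  "smooth_fn \<phi> \<longleftrightarrow> (\<forall>is x. iter_pd is \<phi> differentiable (at x))"

definition test_fn :: "(real^'n::finite) set \<Rightarrow> (real^'n \<Rightarrow> real) \<Rightarrow> bool" where
  "test_fn U \<phi> \<longleftrightarrow> smooth_fn \<phi> \<and> compact (closure {x. \<phi> x \<noteq> 0})
      \<and> closure {x. \<phi> x \<noteq> 0} \<subseteq> U"

definition loc_int :: "(real^'n::finite) set \<Rightarrow> (real^'n \<Rightarrow> 'b::euclidean_space) \<Rightarrow> bool" where
  "loc_int U f \<longleftrightarrow> (\<forall>K. compact K \<and> K \<subseteq> U \<longrightarrow> set_integrable lebesgue K f)"

definition weak_partial :: "(real^'n::finite) set \<Rightarrow> (real^'n \<Rightarrow> 'b::euclidean_space) \<Rightarrow> 'n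
    \<Rightarrow> (real^'n \<Rightarrow> 'b) \<Rightarrow> bool" where
  "weak_partial U u i g \<longleftrightarrow> loc_int U u \<and> loc_int U g \<and>
     (\<forall>\<phi>. test_fn U \<phi> \<longrightarrow>
        (LINT x:U|lebesgue. pd i \<phi> x *\<^sub>R u x) = - (LINT x:U|lebesgue. \<phi> x *\<^sub>R g x))"

text \<open>A (chosen) weak partial derivative; unique up to null sets when it exists.\<close>
definition wd :: "(real^'n::finite) set \<Rightarrow> (real^'n \<Rightarrow> 'b::euclidean_space) \<Rightarrow> 'n
    \<Rightarrow> real^'n \<Rightarrow> 'b" where
  "wd U u i = (SOME g. weak_partial U u i g)"

definition Lp :: "nat \<Rightarrow> (real^'n::finite) set \<Rightarrow> (real^'n \<Rightarrow> 'b::euclidean_space) \<Rightarrow> bool" where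
  "Lp p U f \<longleftrightarrow> f \<in> borel_measurable (lebesgue_on U) \<and>
     (\<integral>\<^sup>+ x \<in> U. ennreal (norm (f x) ^ p) \<partial>lebesgue) < \<infinity>"

definition W1 :: "nat \<Rightarrow> (real^'n::finite) set \<Rightarrow> (real^'n \<Rightarrow> 'b::euclidean_space) \<Rightarrow> bool" where
  "W1 p U u \<longleftrightarrow> Lp p U u \<and> (\<forall>i. \<exists>g. weak_partial U u i g \<and> Lp p U g)"

definition W2 :: "nat \<Rightarrow> (real^'n::finite) set \<Rightarrow> (real^'n \<Rightarrow> 'b::euclidean_space) \<Rightarrow> bool" where
  "W2 p U u \<longleftrightarrow> Lp p U u \<and> (\<forall>i. \<exists>g. weak_partial U u i g \<and> Lp p U g \<and>
      (\<forall>j. \<exists>g2. weak_partial U g j g2 \<and> Lp p U g2))"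

abbreviation B1 :: "(real^2) set" where "B1 \<equiv> ball 0 1"
abbreviation Ann :: "(real^2) set" where "Ann \<equiv> ball 0 1 - cball 0 (1/2)"

definition Du :: "(real^2) set \<Rightarrow> (real^2 \<Rightarrow> real^3) \<Rightarrow> real^2 \<Rightarrow> real^2^3" where
  "Du U u x = (\<chi> k j. wd U u j x $ k)"

definition hess_sq :: "(real^2) set \<Rightarrow> (real^2 \<Rightarrow> real^3) \<Rightarrow> real^2 \<Rightarrow> real" where
  "hess_sq U u x = (\<Sum>i\<in>UNIV. \<Sum>j\<in>UNIV. (norm (wd U (wd U u i) j x))\<^sup>2)"

definition O23 :: "(real^2^3) set" where
  "O23 = {P. transpose P ** P = mat 1}"

text \<open>The space X; elements are represented by their continuous representatives
  (W^{1,4} embeds into C^0 of the closed disc in dimension 2).\<close>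
definition Xsp :: "(real^2 \<Rightarrow> real^3) set" where
  "Xsp = {u. continuous_on (cball 0 1) u \<and> W1 4 B1 u \<and> u 0 = 0 \<and>
             (\<forall>x. norm x = 1 \<longrightarrow> u x \<in> sphere 0 1)}"

definition W14_conv :: "(nat \<Rightarrow> real^2 \<Rightarrow> real^3) \<Rightarrow> (real^2 \<Rightarrow> real^3) \<Rightarrow> bool" where
  "W14_conv us u \<longleftrightarrow>
     ((\<lambda>k. \<integral>\<^sup>+ x \<in> B1. ennreal (norm (us k x - u x) ^ 4)
              + ennreal (norm (Du B1 (us k) x - Du B1 u x) ^ 4) \<partial>lebesgue) \<longlonglongrightarrow> 0)"

definition Eh :: "real \<Rightarrow> (real^2 \<Rightarrow> real^3) \<Rightarrow> ennreal" where
  "Eh h u = ennreal (h\<^sup>2) * (\<integral>\<^sup>+ x \<in> B1. ennreal (hess_sq B1 u x) \<partial>lebesgue)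
          + (\<integral>\<^sup>+ x \<in> B1. ennreal ((infdist (Du B1 u x) O23)\<^sup>2) \<partial>lebesgue)"

definition Ebar :: "real \<Rightarrow> (real^2 \<Rightarrow> real^3) \<Rightarrow> ennreal" where
  "Ebar h u = (if u \<in> Xsp \<and> W2 2 B1 u then ennreal (1 / (h\<^sup>2 * \<bar>ln h\<bar>)) * Eh h u else \<infinity>)"

definition one_hom_isometry :: "(real^2 \<Rightarrow> real^3) \<Rightarrow> bool" where
  "one_hom_isometry u \<longleftrightarrow>
     (\<exists>\<gamma>. \<forall>x\<in>B1. x \<noteq> 0 \<longrightarrow> u x = norm x *\<^sub>R \<gamma> (x /\<^sub>R norm x)) \<and>
     (AE x in lebesgue_on B1. Du B1 u x \<in> O23)"

definition E0 :: "(real^2 \<Rightarrow> real^3) \<Rightarrow> ennreal" where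
  "E0 u = (if u \<in> Xsp \<and> W2 2 Ann u \<and> one_hom_isometry u
           then ennreal (1 / ln 2) * (\<integral>\<^sup>+ x \<in> Ann. ennreal (hess_sq Ann u x) \<partial>lebesgue)
           else \<infinity>)"

end

theory Submission imports Defs begin

text \<open>
  \<^emph>\<open>Lower bound.\<close> Since \<open>u 0 = 0\<close> and \<open>\<bar>u\<bar> = 1\<close> on the circle, the image of each radius has length at least 1, while
  \<open>dist(Du, O(2,3))\<close> controls its stretching; the excess of the radial energy therefore bounds
  \<open>\<bar>u (r x) - r u x\<bar>\<close> in \<open>L\<^sup>2\<close> by a power of \<open>h\<close> at every scale \<open>r\<close> above \<open>h\<close>. Of about \<open>log\<^sub>2 (1/h)\<close>
  dyadic annuli, one carries at most the average share of the Hessian energy. Blown up to unit size, \<open>u\<close>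
  on that annulus still converges to the limit, and weak compactness in \<open>L\<^sup>2\<close> gives the bound.

  \<^emph>\<open>Upper bound.\<close> A one-homogeneous isometry has the same Hessian energy on every dyadic annulus.
  Cutting it off at radius comparable to \<open>h\<close> leaves \<open>log\<^sub>2 (1/h)\<close> annuli plus an error bounded uniformly in \<open>h\<close>.
\<close>


section \<open>Smooth functions and test functions\<close>

text \<open>The isometry defect enters the stretching of a ray linearly, although only its square is
  known to be small. Weighting Young's inequality by t/h at ray parameter t makes both halves
  contribute h/t up to logarithms, so the excess sums to order h (ln h)^2. For t below h the defect
  gives nothing useful; there the gradient is compared with the one at scale h through the Hessian,
  at the price of a squared logarithm that is integrable at 0. The squared deviation at scale r is
  therefore of order h (ln h)^2 / r, which vanishes in the limit for r above h^(1-e) with any e > 0.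
  The annuli between h and h^(1-e) are given up; together with rounding this costs a factor
  1/(1-2e), removed at the end by letting e tend to 0. The logarithm itself reflects that in two
  dimensions the Hessian energy of x -> u (r x) / r does not depend on r. Weak derivatives have no
  values on single rays, so integration along rays is established by duality with test
  functions.\<close>

lemma iter_pd_snoc: "iter_pd (is @ [i]) \<phi> = iter_pd is (pd i \<phi>)"
  by (induction "is") auto

lemma pd_eq: "(\<phi> has_derivative D) (at x) \<Longrightarrow> pd i \<phi> x = D (axis i 1)"
  unfolding pd_def using frechet_derivative_at by metis

lemma smooth_fn_differentiable: "smooth_fn \<phi> \<Longrightarrow> \<phi> differentiable (at x)"
  unfolding smooth_fn_def by (metis iter_pd.simps(1))

lemma smooth_fn_has_derivative:
  "smooth_fn \<phi> \<Longrightarrow> (\<phi> has_derivative frechet_derivative \<phi> (at x)) (at x)"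
  by (simp add: frechet_derivative_works[symmetric] smooth_fn_differentiable)

lemma smooth_fn_pd: "smooth_fn \<phi> \<Longrightarrow> smooth_fn (pd i \<phi>)"
  unfolding smooth_fn_def by (metis iter_pd_snoc)

text \<open>Coinduction: smoothness asks for differentiability of every iterated partial derivative,
  so membership in a class of differentiable functions closed under \<open>pd\<close> is enough.
  This replaces formulas for higher derivatives of products, quotients and composites.\<close>

lemma smooth_fnI:
  assumes "f \<in> S" and "\<And>f x. f \<in> S \<Longrightarrow> f differentiable (at x)" and "\<And>f i. f \<in> S \<Longrightarrow> pd i f \<in> S"
  shows "smooth_fn f"
proof -
  have "iter_pd is f \<in> S" for "is"
    by (induction "is") (auto simp: assms)
  then show ?thesis by (auto simp: smooth_fn_def assms)
qed

text \<open>Powers of \<open>t\<close> in the denominator make this family closed under differentiation.\<close>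
definition flat :: "nat \<Rightarrow> real \<Rightarrow> real" where
  "flat n t = (if t \<le> 0 then 0 else exp (- 1 / t) / t ^ n)"

text \<open>Keeping only the term of degree \<open>n + 2\<close> in the series of
  \<open>exp (1/t)\<close> beats the denominator \<open>t ^ n\<close> by two orders. Decay of second
  order makes the difference quotient at the origin tend to 0.\<close>

lemma flat_le_square: "0 \<le> flat n t \<and> flat n t \<le> fact (n + 2) * t\<^sup>2"
proof (cases "t \<le> 0")
  case False
  then have t: "t > 0" by simp
  have "(\<Sum>k\<in>{n+2}. (1/t) ^ k / fact k) \<le> (\<Sum>k. (1/t) ^ k / fact k)"
    using t summable_exp[of "1/t"] by (intro sum_le_suminf) (auto simp: field_simps)
  then have "(1/t) ^ (n+2) / fact (n+2) \<le> exp (1/t)"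
    unfolding exp_def by (simp only: sum.insert sum.empty finite.emptyI empty_iff not_False_eq_True
      add_0_right scaleR_conv_of_real of_real_inverse of_real_fact divide_inverse mult.commute)
  then have le: "(1/t) ^ (n+2) \<le> fact (n+2) * exp (1/t)"
    by (simp only: divide_le_eq fact_gt_zero if_True mult.commute)
  have "flat n t = t\<^sup>2 * ((1/t) ^ (n+2)) * exp (- (1/t))"
    using t by (simp add: flat_def power_add power_one_over field_simps power2_eq_square)
  also have "\<dots> \<le> t\<^sup>2 * (fact (n+2) * exp (1/t)) * exp (- (1/t))"
    by (intro mult_right_mono mult_left_mono le) auto
  also have "\<dots> = fact (n+2) * t\<^sup>2"
    by (simp add: mult.assoc exp_add[symmetric] del: fact_Suc)
  finally show ?thesis using t by (simp add: flat_def del: fact_Suc)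
qed (simp add: flat_def)

text \<open>Off the origin this is the derivative of an explicit formula on a half-line. At the
  origin the quadratic bound forces derivative 0, and the right-hand side is 0 there as
  well.\<close>

lemma flat_deriv: "(flat n has_real_derivative (flat (n + 2) t - n * flat (n + 1) t)) (at t)"
proof -
  consider "t < 0" | "t = 0" | "t > 0" by linarith
  then show ?thesis
  proof cases
    case 1
    have "((\<lambda>_. 0) has_real_derivative 0) (at t)" by simp
    moreover have "\<forall>\<^sub>F s in nhds t. (0::real) = flat n s"
      using eventually_nhds_in_open[of "{..<0}" t] 1 by (auto simp: flat_def elim: eventually_mono)
    ultimately show ?thesis using 1
      using DERIV_cong_ev[OF refl, of "\<lambda>_. 0" "flat n" t 0 0] by (simp add: flat_def)
  next
    case 2
    have "((\<lambda>h. (flat n (0 + h) - flat n 0) / h) \<longlongrightarrow> 0) (at 0)"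
    proof (rule Lim_null_comparison)
      show "\<forall>\<^sub>F h in at 0. norm ((flat n (0 + h) - flat n 0) / h) \<le> fact (n+2) * \<bar>h\<bar>"
      proof (rule eventually_mono[OF eventually_at_ball[of 1 0 UNIV]])
        fix h :: real
        have "\<bar>flat n h\<bar> / \<bar>h\<bar> \<le> fact (n+2) * h\<^sup>2 / \<bar>h\<bar>"
          using flat_le_square[of n h] by (intro divide_right_mono) (auto simp del: fact_Suc)
        also have "\<dots> = fact (n+2) * \<bar>h\<bar>"
          by (cases "h = 0") (auto simp: power2_eq_square abs_if)
        finally show "norm ((flat n (0 + h) - flat n 0) / h) \<le> fact (n+2) * \<bar>h\<bar>"
          by (simp add: flat_def[of n 0] del: fact_Suc)
      qed auto
      show "((\<lambda>h. fact (n+2) * \<bar>h\<bar>) \<longlongrightarrow> (0::real)) (at 0)"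
        by (auto intro!: tendsto_eq_intros)
    qed
    then show ?thesis using 2 by (simp add: DERIV_def flat_def)
  next
    case 3
    have "((\<lambda>t. exp (- 1 / t) / t ^ n) has_real_derivative (flat (n + 2) t - n * flat (n + 1) t)) (at t)"
    proof -
      have "((\<lambda>t. exp (- 1 / t) / t ^ n) has_real_derivative
          ((exp (- 1 / t) * (1 / t\<^sup>2)) * t ^ n - exp (- 1 / t) * (n * t ^ (n - 1))) / (t ^ n * t ^ n)) (at t)"
        using 3 by (auto intro!: derivative_eq_intros simp: power2_eq_square)
      moreover have "((E * (1 / t\<^sup>2)) * t ^ n - E * (n * t ^ (n - 1))) / (t ^ n * t ^ n)
          = E / t ^ (n + 2) - n * (E / t ^ (n + 1))" for E
      proof -
        define P where "P = t ^ n"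
        have P: "P > 0" "t ^ n = P" using 3 by (auto simp: P_def)
        have n: "n * t ^ (n - 1) = n * (P / t)" using 3 by (cases n) (auto simp: P_def)
        have "(E * (1 / t\<^sup>2) * P - E * (n * (P / t))) / (P * P) = E / (P * t\<^sup>2) - n * (E / (P * t))"
          using P(1) 3 by (simp add: divide_simps power2_eq_square) (simp add: algebra_simps)
        then show ?thesis unfolding n P power_add by simp
      qed
      ultimately show ?thesis using 3 by (simp add: flat_def del: power_Suc)
    qed
    moreover have "\<forall>\<^sub>F s in nhds t. exp (- 1 / s) / s ^ n = flat n s"
      using eventually_nhds_in_open[of "{0<..}" t] 3 by (auto simp: flat_def elim: eventually_mono)
    ultimately show ?thesis
      using DERIV_cong_ev[OF refl, of "\<lambda>t. exp (- 1 / t) / t ^ n" "flat n" t] by simp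
  qed
qed

text \<open>The witness class for \<open>smooth_fnI\<close>. It is closed under the wanted
  operations by construction, so a single induction showing closure under \<open>pd\<close> yields
  all closure rules of \<open>smooth_fn\<close>; \<open>base\<close> makes them apply to arbitrary
  smooth functions.\<close>

inductive_set smooth_alg :: "(real^'n::finite \<Rightarrow> real) set" where
  base: "smooth_fn f \<Longrightarrow> f \<in> smooth_alg"
| const: "(\<lambda>_. c) \<in> smooth_alg"
| coord: "(\<lambda>x. x $ i) \<in> smooth_alg"
| add: "f \<in> smooth_alg \<Longrightarrow> g \<in> smooth_alg \<Longrightarrow> (\<lambda>x. f x + g x) \<in> smooth_alg"
| mult: "f \<in> smooth_alg \<Longrightarrow> g \<in> smooth_alg \<Longrightarrow> (\<lambda>x. f x * g x) \<in> smooth_alg"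
| inv: "f \<in> smooth_alg \<Longrightarrow> (\<And>x. f x \<noteq> 0) \<Longrightarrow> (\<lambda>x. inverse (f x)) \<in> smooth_alg"
| flat: "f \<in> smooth_alg \<Longrightarrow> (\<lambda>x. flat n (f x)) \<in> smooth_alg"
| scale: "f \<in> smooth_alg \<Longrightarrow> (\<lambda>x. f (c *\<^sub>R x)) \<in> smooth_alg"

lemma smooth_alg_differentiable:
  "f \<in> smooth_alg \<Longrightarrow> f differentiable (at x)"
proof (induction arbitrary: x rule: smooth_alg.induct)
  case (base f) then show ?case by (rule smooth_fn_differentiable)
next
  case (coord i) then show ?case
    using bounded_linear_vec_nth bounded_linear_imp_differentiable by blast
next
  case (inv f) then show ?case
    using differentiable_inverse by blast
next
  case (flat f n)
  have "flat n differentiable (at (f x))"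
    using flat_deriv by (meson field_differentiable_def field_differentiable_imp_differentiable)
  then show ?case using differentiable_chain_at[OF flat.IH, of "flat n"] by (simp add: o_def)
next
  case (scale f c)
  have "(\<lambda>x. c *\<^sub>R x) differentiable (at x)" by simp
  from differentiable_chain_at[OF this, of f] scale.IH show ?case by (simp add: o_def)
qed auto

lemma smooth_alg_has_derivative:
  "f \<in> smooth_alg \<Longrightarrow> (f has_derivative frechet_derivative f (at x)) (at x)"
  by (simp add: frechet_derivative_works[symmetric] smooth_alg_differentiable)

lemma pd_add:
  "f differentiable (at x) \<Longrightarrow> g differentiable (at x) \<Longrightarrow> pd i (\<lambda>x. f x + g x) x = pd i f x + pd i g x"
  by (subst pd_eq[OF has_derivative_add]) (auto simp: frechet_derivative_works pd_def)

lemma pd_mult: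
  "f differentiable (at x) \<Longrightarrow> g differentiable (at x) \<Longrightarrow>
    pd i (\<lambda>x. f x * g x) x = f x * pd i g x + pd i f x * g x"
  by (subst pd_eq[OF has_derivative_mult]) (auto simp: frechet_derivative_works pd_def)

lemma pd_scale:
  assumes "f differentiable (at (c *\<^sub>R x))"
  shows "pd i (\<lambda>x. f (c *\<^sub>R x)) x = c * pd i f (c *\<^sub>R x)"
proof -
  have 1: "(f has_derivative frechet_derivative f (at (c *\<^sub>R x))) (at (c *\<^sub>R x))"
    using assms by (simp add: frechet_derivative_works)
  have 2: "((\<lambda>x. c *\<^sub>R x) has_derivative (\<lambda>x. c *\<^sub>R x)) (at x)"
    by (auto intro!: derivative_eq_intros)
  have "((\<lambda>x. f (c *\<^sub>R x)) has_derivative (\<lambda>y. frechet_derivative f (at (c *\<^sub>R x)) (c *\<^sub>R y))) (at x)"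
    by (rule has_derivative_compose[where g=f, OF 2 1])
  from pd_eq[OF this] show ?thesis
    using linear_cmul[OF linear_frechet_derivative[OF assms]] by (simp add: pd_def)
qed

lemma pd_const: "pd i (\<lambda>_. c) x = 0"
  by (subst pd_eq[of _ "\<lambda>_. 0"]) auto

lemma pd_coord: "pd j (\<lambda>x. x $ i) x = (if i = j then 1 else 0)"
  by (subst pd_eq[OF bounded_linear_imp_has_derivative[OF bounded_linear_vec_nth]]) (auto simp: axis_def)

lemma smooth_alg_pd: "f \<in> smooth_alg \<Longrightarrow> pd i f \<in> smooth_alg"
proof (induction rule: smooth_alg.induct)
  case (base f) then show ?case by (simp add: smooth_alg.base smooth_fn_pd)
next
  case (const c)
  have "pd i (\<lambda>_. c) = (\<lambda>_. 0)" by (auto simp: pd_const)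
  then show ?case by (simp add: smooth_alg.const)
next
  case (coord j)
  have "pd i (\<lambda>x. x $ j) = (\<lambda>_. if j = i then 1 else 0)" by (auto simp: pd_coord)
  then show ?case by (simp add: smooth_alg.const)
next
  case (add f g)
  then have "pd i (\<lambda>x. f x + g x) = (\<lambda>x. pd i f x + pd i g x)"
    by (auto simp: pd_add smooth_alg_differentiable)
  then show ?case using add by (simp add: smooth_alg.add)
next
  case (mult f g)
  then have "pd i (\<lambda>x. f x * g x) = (\<lambda>x. f x * pd i g x + pd i f x * g x)"
    by (auto simp: pd_mult smooth_alg_differentiable)
  then show ?case using mult by (simp add: smooth_alg.add smooth_alg.mult)
next
  case (inv f)
  \<comment> \<open>The sign is written as a product with the constant -1 because the rules of the
    class offer products and constants but no negation.\<close>
  have "pd i (\<lambda>x. inverse (f x)) = (\<lambda>x. (-1) * (pd i f x * (inverse (f x) * inverse (f x))))"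
  proof
    fix x
    have "((\<lambda>x. inverse (f x)) has_derivative
       (\<lambda>h. - (inverse (f x) * frechet_derivative f (at x) h * inverse (f x)))) (at x)"
      using inv smooth_alg_has_derivative[OF inv(1)] by (auto intro!: derivative_eq_intros)
    from pd_eq[OF this] show "pd i (\<lambda>x. inverse (f x)) x = (-1) * (pd i f x * (inverse (f x) * inverse (f x)))"
      by (simp add: pd_def)
  qed
  moreover have "(\<lambda>x. inverse (f x)) \<in> smooth_alg" using inv by (simp add: smooth_alg.inv)
  ultimately show ?case using inv by (simp only: smooth_alg.mult smooth_alg.const)
next
  case (flat f n)
  have "pd i (\<lambda>x. flat n (f x)) = (\<lambda>x. (flat (n + 2) (f x) + (- real n) * flat (n + 1) (f x)) * pd i f x)"
  proof
    fix x
    have "((\<lambda>x. flat n (f x)) has_derivative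
       (\<lambda>h. frechet_derivative f (at x) h * (flat (n + 2) (f x) - n * flat (n + 1) (f x)))) (at x)"
      using DERIV_compose_FDERIV[OF flat_deriv smooth_alg_has_derivative[OF flat(1)]] .
    from pd_eq[OF this] show "pd i (\<lambda>x. flat n (f x)) x = (flat (n + 2) (f x) + (- real n) * flat (n + 1) (f x)) * pd i f x"
      by (simp add: pd_def)
  qed
  then show ?case using flat by (simp only: smooth_alg.mult smooth_alg.const smooth_alg.flat smooth_alg.add)
next
  case (scale f c)
  then have "pd i (\<lambda>x. f (c *\<^sub>R x)) = (\<lambda>x. c * pd i f (c *\<^sub>R x))"
    by (auto simp: pd_scale smooth_alg_differentiable)
  then show ?case using scale smooth_alg.scale[of "pd i f" c] by (simp add: smooth_alg.mult smooth_alg.const)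
qed

lemma smooth_alg_smooth_fn: "f \<in> smooth_alg \<Longrightarrow> smooth_fn f"
  by (rule smooth_fnI[of f smooth_alg]) (auto simp: smooth_alg_differentiable smooth_alg_pd)

lemma smooth_fn_const: "smooth_fn (\<lambda>_. c)"
  and smooth_fn_coord: "smooth_fn (\<lambda>x. x $ i)"
  and smooth_fn_add: "smooth_fn f \<Longrightarrow> smooth_fn g \<Longrightarrow> smooth_fn (\<lambda>x. f x + g x)"
  and smooth_fn_mult: "smooth_fn f \<Longrightarrow> smooth_fn g \<Longrightarrow> smooth_fn (\<lambda>x. f x * g x)"
  and smooth_fn_scale: "smooth_fn f \<Longrightarrow> smooth_fn (\<lambda>x. f (c *\<^sub>R x))"
  and smooth_fn_flat: "smooth_fn f \<Longrightarrow> smooth_fn (\<lambda>x. flat n (f x))"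
  and smooth_fn_inverse: "smooth_fn f \<Longrightarrow> (\<And>x. f x \<noteq> 0) \<Longrightarrow> smooth_fn (\<lambda>x. inverse (f x))"
  by (simp_all add: smooth_alg_smooth_fn smooth_alg.intros)

lemma smooth_fn_diff: "smooth_fn f \<Longrightarrow> smooth_fn g \<Longrightarrow> smooth_fn (\<lambda>x. f x - g x)"
  using smooth_fn_add[OF _ smooth_fn_mult[OF smooth_fn_const[of "-1"]], of f g] by simp

lemma smooth_fn_sum: "finite A \<Longrightarrow> (\<And>a. a \<in> A \<Longrightarrow> smooth_fn (f a)) \<Longrightarrow> smooth_fn (\<lambda>x. \<Sum>a\<in>A. f a x)"
  by (induction A rule: finite_induct) (auto simp: smooth_fn_const smooth_fn_add)

lemma smooth_fn_prod: "finite A \<Longrightarrow> (\<And>a. a \<in> A \<Longrightarrow> smooth_fn (f a)) \<Longrightarrow> smooth_fn (\<lambda>x. \<Prod>a\<in>A. f a x)"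
  by (induction A rule: finite_induct) (auto simp: smooth_fn_const smooth_fn_mult)

lemma smooth_fn_norm_sq: "smooth_fn (\<lambda>x::real^'n::finite. (norm x)\<^sup>2)"
proof -
  have "(\<lambda>x::real^'n. (norm x)\<^sup>2) = (\<lambda>x. \<Sum>i\<in>UNIV. x $ i * x $ i)"
    by (simp add: norm_vec_def L2_set_def sum_nonneg power2_eq_square)
  then show ?thesis by (simp add: smooth_fn_sum smooth_fn_mult smooth_fn_coord)
qed

text \<open>The usual quotient construction of a smooth step: \<open>t\<close> and
  \<open>1 - t\<close> are never both nonpositive, so the denominator stays positive and the
  quotient remains in the smooth class.\<close>

definition sstep :: "real \<Rightarrow> real" where
  "sstep t = flat 0 t * inverse (flat 0 t + flat 0 (1 - t))"

lemma sstep_denom_pos: "flat 0 t + flat 0 (1 - t) > 0"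
  by (auto simp: flat_def intro: add_pos_pos)

lemma sstep_bounds: "0 \<le> sstep t" "sstep t \<le> 1"
  using sstep_denom_pos[of t] flat_le_square[of 0 t] flat_le_square[of 0 "1 - t"]
  by (auto simp: sstep_def field_simps)

lemma sstep_eq_0: "t \<le> 0 \<Longrightarrow> sstep t = 0"
  by (simp add: sstep_def flat_def)

lemma sstep_eq_1: "t \<ge> 1 \<Longrightarrow> sstep t = 1"
  by (simp add: sstep_def flat_def)

lemma smooth_fn_sstep: "smooth_fn f \<Longrightarrow> smooth_fn (\<lambda>x. sstep (f x))"
  unfolding sstep_def using sstep_denom_pos
  by (intro smooth_fn_mult smooth_fn_inverse smooth_fn_add smooth_fn_flat smooth_fn_diff smooth_fn_const)
     (auto simp: less_imp_neq[symmetric])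

lemma smooth_fn_continuous: "smooth_fn f \<Longrightarrow> continuous_on A f"
  by (meson continuous_at_imp_continuous_on differentiable_imp_continuous_within smooth_fn_differentiable)

lemma smooth_fn_borel: "smooth_fn f \<Longrightarrow> f \<in> borel_measurable borel"
  by (simp add: borel_measurable_continuous_onI smooth_fn_continuous)

section \<open>Test functions and their supports\<close>

lemma test_fn_smooth: "test_fn U \<phi> \<Longrightarrow> smooth_fn \<phi>"
  by (simp add: test_fn_def)

lemma test_fnI:
  assumes "smooth_fn \<phi>" "compact K" "K \<subseteq> U" "\<And>x. x \<notin> K \<Longrightarrow> \<phi> x = 0"
  shows "test_fn U \<phi>"
proof -
  have "closure {x. \<phi> x \<noteq> 0} \<subseteq> K"
    using assms by (intro closure_minimal compact_imp_closed) auto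
  moreover from this have "compact (closure {x. \<phi> x \<noteq> 0})"
    by (meson assms(2) closed_closure compact_closure compact_imp_bounded bounded_subset closure_subset)
  ultimately show ?thesis using assms by (auto simp: test_fn_def)
qed

lemma test_fnE:
  assumes "test_fn U \<phi>"
  obtains K where "compact K" "K \<subseteq> U" "\<And>x. x \<notin> K \<Longrightarrow> \<phi> x = 0"
proof (rule that)
  show "compact (closure {x. \<phi> x \<noteq> 0})" "closure {x. \<phi> x \<noteq> 0} \<subseteq> U"
    using assms unfolding test_fn_def by blast+
  show "\<phi> x = 0" if "x \<notin> closure {x. \<phi> x \<noteq> 0}" for x
    using that closure_subset[of "{x. \<phi> x \<noteq> 0}"] by blast
qed

lemma test_fn_mono: "test_fn U \<phi> \<Longrightarrow> U \<subseteq> V \<Longrightarrow> test_fn V \<phi>"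
  by (auto simp: test_fn_def)

lemma test_fn_mult: "test_fn U \<phi> \<Longrightarrow> smooth_fn f \<Longrightarrow> test_fn U (\<lambda>x. f x * \<phi> x)"
  by (frule test_fn_smooth, erule test_fnE, rule test_fnI) (auto simp: smooth_fn_mult)

lemma pd_eq_0_outside:
  assumes "closed K" "\<And>x. x \<notin> K \<Longrightarrow> \<phi> x = 0" "x \<notin> K"
  shows "pd i \<phi> x = 0"
proof -
  have "((\<lambda>_. 0) has_derivative (\<lambda>_. 0)) (at x)" by simp
  then have "(\<phi> has_derivative (\<lambda>_. 0)) (at x)"
    by (rule has_derivative_transform_within_open[of _ _ _ _ "- K"]) (use assms in auto)
  then show ?thesis by (rule pd_eq)
qed

lemma test_fn_pd: "test_fn U \<phi> \<Longrightarrow> test_fn U (pd i \<phi>)"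
  by (frule test_fn_smooth, erule test_fnE, rule test_fnI)
     (auto simp: smooth_fn_pd intro: pd_eq_0_outside[OF compact_imp_closed])

lemma test_fn_scale:
  assumes "test_fn U \<phi>" "c \<noteq> 0"
  shows "test_fn ((\<lambda>x. x /\<^sub>R c) ` U) (\<lambda>x. \<phi> (c *\<^sub>R x))"
  using assms(1)
proof (rule test_fnE)
  fix K assume K: "compact K" "K \<subseteq> U" "\<And>x. x \<notin> K \<Longrightarrow> \<phi> x = 0"
  show ?thesis
  proof (rule test_fnI[of _ "(\<lambda>x. x /\<^sub>R c) ` K"])
    show "smooth_fn (\<lambda>x. \<phi> (c *\<^sub>R x))" using assms by (simp add: smooth_fn_scale test_fn_smooth)
    show "compact ((\<lambda>x. x /\<^sub>R c) ` K)"
      by (intro compact_continuous_image continuous_intros K)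
    show "\<phi> (c *\<^sub>R x) = 0" if "x \<notin> (\<lambda>x. x /\<^sub>R c) ` K" for x
      using that K(3)[of "c *\<^sub>R x"] assms(2) by (force simp: image_iff)
  qed (use K in auto)
qed

lemma test_fn_bounded:
  assumes \<phi>: "test_fn U \<phi>"
  shows "\<exists>B. \<forall>x. \<bar>\<phi> x\<bar> \<le> B"
  using \<phi>
proof (rule test_fnE)
  fix K assume K: "compact K" "\<And>x. x \<notin> K \<Longrightarrow> \<phi> x = 0"
  have "bounded (\<phi> ` K)"
    by (intro compact_imp_bounded compact_continuous_image smooth_fn_continuous test_fn_smooth[OF \<phi>] K)
  then obtain B where "\<And>x. x \<in> K \<Longrightarrow> \<bar>\<phi> x\<bar> \<le> B" by (auto simp: bounded_iff)
  then have "\<bar>\<phi> x\<bar> \<le> max B 0" for x using K(2)[of x] by (cases "x \<in> K") (auto simp: le_max_iff_disj)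
  then show ?thesis by blast
qed

section \<open>Weak derivatives\<close>

lemma lebesgue_scale:
  fixes c :: real
  assumes "c \<noteq> 0"
  shows "(lebesgue :: 'a::euclidean_space measure) =
    density (distr lebesgue lebesgue (\<lambda>x. c *\<^sub>R x)) (\<lambda>_. ennreal (\<bar>c\<bar> ^ DIM('a)))"
proof -
  have "(\<Sum>j\<in>Basis. (c * (x \<bullet> j)) *\<^sub>R j) = c *\<^sub>R x" for x :: 'a
    unfolding scaleR_scaleR[symmetric] scaleR_sum_right[symmetric] euclidean_representation ..
  then show ?thesis
    using lebesgue_affine_euclidean[of "\<lambda>_::'a. c" 0] assms by (simp add: prod_constant)
qed

lemma nn_integral_lebesgue_scale:
  fixes f :: "'a::euclidean_space \<Rightarrow> ennreal"
  assumes f: "f \<in> borel_measurable lebesgue" and c: "c \<noteq> 0"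
  shows "(\<integral>\<^sup>+x. f x \<partial>lebesgue) = ennreal (\<bar>c\<bar> ^ DIM('a)) * (\<integral>\<^sup>+x. f (c *\<^sub>R x) \<partial>lebesgue)"
proof -
  have 1: "f \<in> borel_measurable (distr lebesgue lebesgue (\<lambda>x. c *\<^sub>R x))"
    using f by (simp add: measurable_distr_eq1)
  show ?thesis
    by (subst lebesgue_scale[OF c], subst nn_integral_density)
       (use f 1 in \<open>auto simp: nn_integral_cmult nn_integral_distr\<close>)
qed

lemma
  fixes f :: "'a::euclidean_space \<Rightarrow> 'b::{banach,second_countable_topology}"
  assumes f: "f \<in> borel_measurable lebesgue" and c: "c \<noteq> 0"
  shows integrable_lebesgue_scale: "integrable lebesgue (\<lambda>x. f (c *\<^sub>R x)) \<longleftrightarrow> integrable lebesgue f"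
    and integral_lebesgue_scale: "integral\<^sup>L lebesgue f = (\<bar>c\<bar> ^ DIM('a)) *\<^sub>R integral\<^sup>L lebesgue (\<lambda>x. f (c *\<^sub>R x))"
proof -
  have 1: "f \<in> borel_measurable (distr lebesgue lebesgue (\<lambda>x. c *\<^sub>R x))"
    using f by (simp add: measurable_distr_eq1)
  have "integrable lebesgue f \<longleftrightarrow> integrable (density (distr lebesgue lebesgue (\<lambda>x. c *\<^sub>R x)) (\<lambda>_. ennreal (\<bar>c\<bar> ^ DIM('a)))) f"
    using lebesgue_scale[OF c, where 'a='a] by simp
  also have "\<dots> \<longleftrightarrow> integrable lebesgue (\<lambda>x. f (c *\<^sub>R x))"
  proof -
    define k where "k = \<bar>c\<bar> ^ DIM('a)"
    have k: "k > 0" using c by (simp add: k_def)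
    have "integrable lebesgue (\<lambda>x. k *\<^sub>R f (c *\<^sub>R x)) \<longleftrightarrow> integrable lebesgue (\<lambda>x. f (c *\<^sub>R x))"
      using k integrable_scaleR_right[of "1 / k" lebesgue "\<lambda>x. k *\<^sub>R f (c *\<^sub>R x)"] by auto
    then show ?thesis unfolding k_def[symmetric] using k f
      by (subst integrable_density[OF 1]) (simp_all add: integrable_distr_eq)
  qed
  finally show "integrable lebesgue (\<lambda>x. f (c *\<^sub>R x)) \<longleftrightarrow> integrable lebesgue f" ..
  have "integral\<^sup>L lebesgue f = integral\<^sup>L (density (distr lebesgue lebesgue (\<lambda>x. c *\<^sub>R x)) (\<lambda>_. ennreal (\<bar>c\<bar> ^ DIM('a)))) f"
    using lebesgue_scale[OF c, where 'a='a] by simp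
  also have "\<dots> = (\<bar>c\<bar> ^ DIM('a)) *\<^sub>R integral\<^sup>L lebesgue (\<lambda>x. f (c *\<^sub>R x))"
    using c by (subst integral_density[OF 1]) (auto simp: integral_distr f)
  finally show "integral\<^sup>L lebesgue f = (\<bar>c\<bar> ^ DIM('a)) *\<^sub>R integral\<^sup>L lebesgue (\<lambda>x. f (c *\<^sub>R x))" .
qed

text \<open>Completeness of the measure: every subset of the exceptional null set is measurable, so
  preimages under \<open>f\<close> and \<open>g\<close> differ only by measurable sets.\<close>

lemma lebesgue_measurable_cong_AE:
  fixes f g :: "'a::euclidean_space \<Rightarrow> 'b::topological_space"
  assumes f: "f \<in> borel_measurable lebesgue" and ae: "AE x in lebesgue. f x = g x"
  shows "g \<in> borel_measurable lebesgue"
proof (rule measurableI)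
  fix A :: "'b set" assume A: "A \<in> sets borel"
  have "{x. f x \<noteq> g x} \<in> null_sets lebesgue"
    using ae by (simp add: completion.AE_iff_null_sets)
  then have "\<And>B. B \<subseteq> {x. f x \<noteq> g x} \<Longrightarrow> B \<in> sets lebesgue"
    using completion.complete2 by (metis null_setsD2)
  moreover have "g -` A = (f -` A - (f -` A \<inter> {x. f x \<noteq> g x})) \<union> (g -` A \<inter> {x. f x \<noteq> g x})"
    by auto
  moreover have "f -` A \<in> sets lebesgue" using measurable_sets[OF f A] by simp
  ultimately show "g -` A \<inter> space lebesgue \<in> sets lebesgue"
    by (metis (no_types, lifting) Int_lower2 sets.Diff sets.Un sets.Int_space_eq2)
qed auto

lemma lebesgue_set_integrable_cong_AE:
  fixes f g :: "'a::euclidean_space \<Rightarrow> 'b::euclidean_space"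
  assumes f: "set_integrable lebesgue K f" and ae: "AE x in lebesgue. x \<in> K \<longrightarrow> f x = g x"
  shows "set_integrable lebesgue K g"
proof -
  have ae': "AE x in lebesgue. indicator K x *\<^sub>R f x = indicator K x *\<^sub>R g x"
    using ae by eventually_elim (auto simp: indicator_def)
  have m: "(\<lambda>x. indicator K x *\<^sub>R f x) \<in> borel_measurable lebesgue"
    using f by (auto simp: set_integrable_def)
  show ?thesis unfolding set_integrable_def
    by (rule integrable_cong_AE_imp[OF f[unfolded set_integrable_def] lebesgue_measurable_cong_AE[OF m ae'] ae'])
qed

lemma loc_int_cong_AE:
  "loc_int U f \<Longrightarrow> AE x in lebesgue. x \<in> U \<longrightarrow> f x = g x \<Longrightarrow> loc_int U g"
  unfolding loc_int_def
  by (intro allI impI, rule lebesgue_set_integrable_cong_AE[of _ f]) (auto elim!: eventually_mono)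

lemma loc_int_mono: "loc_int U f \<Longrightarrow> V \<subseteq> U \<Longrightarrow> loc_int V f"
  by (auto simp: loc_int_def)

lemma smooth_fn_lebesgue: "smooth_fn f \<Longrightarrow> f \<in> borel_measurable lebesgue"
  by (rule measurable_completion) (simp add: smooth_fn_borel)

lemma integrable_scaleR_bounded_lebesgue:
  fixes g :: "'a::euclidean_space \<Rightarrow> 'b::euclidean_space"
  assumes g: "integrable lebesgue g" and \<phi>: "\<phi> \<in> borel_measurable lebesgue" "\<And>x. \<bar>\<phi> x\<bar> \<le> B"
  shows "integrable lebesgue (\<lambda>x. \<phi> x *\<^sub>R g x)"
proof (rule Bochner_Integration.integrable_bound[OF integrable_scaleR_right[OF g, of B]])
  show "(\<lambda>x. \<phi> x *\<^sub>R g x) \<in> borel_measurable lebesgue" using g \<phi> by auto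
  have "\<bar>\<phi> x\<bar> * norm (g x) \<le> \<bar>B\<bar> * norm (g x)" for x
    using \<phi>(2)[of x] by (intro mult_right_mono) auto
  then show "AE x in lebesgue. norm (\<phi> x *\<^sub>R g x) \<le> norm (B *\<^sub>R g x)" by simp
qed

lemma test_fn_integrable:
  fixes g :: "real^'n::finite \<Rightarrow> 'b::euclidean_space"
  assumes \<phi>: "test_fn U \<phi>" and g: "loc_int U g"
  shows "integrable lebesgue (\<lambda>x. \<phi> x *\<^sub>R g x)"
  using \<phi>
proof (rule test_fnE)
  fix K assume K: "compact K" "K \<subseteq> U" "\<And>x. x \<notin> K \<Longrightarrow> \<phi> x = 0"
  obtain B where B: "\<And>x. \<bar>\<phi> x\<bar> \<le> B" using test_fn_bounded[OF \<phi>] by auto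
  have "integrable lebesgue (\<lambda>x. indicator K x *\<^sub>R g x)"
    using g K unfolding loc_int_def set_integrable_def by blast
  then have "integrable lebesgue (\<lambda>x. \<phi> x *\<^sub>R (indicator K x *\<^sub>R g x))"
    by (rule integrable_scaleR_bounded_lebesgue[OF _ smooth_fn_lebesgue[OF test_fn_smooth[OF \<phi>]] B])
  moreover have "(\<lambda>x. \<phi> x *\<^sub>R (indicator K x *\<^sub>R g x)) = (\<lambda>x. \<phi> x *\<^sub>R g x)"
    using K(3) by (force simp: indicator_def)
  ultimately show ?thesis by simp
qed

lemma set_integral_test_fn:
  assumes "test_fn U \<phi>"
  shows "(LINT x:U|lebesgue. \<phi> x *\<^sub>R g x) = (LINT x|lebesgue. \<phi> x *\<^sub>R g x)"
proof -
  have "(\<lambda>x. indicator U x *\<^sub>R \<phi> x *\<^sub>R g x) = (\<lambda>x. \<phi> x *\<^sub>R g x)"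
    using assms by (elim test_fnE) (force simp: indicator_def)
  then show ?thesis by (simp add: set_lebesgue_integral_def)
qed

text \<open>Test functions and their derivatives vanish outside \<open>U\<close>, so the integrals
  may run over the whole space. In this form dilations and changes of the domain do not touch the
  domain of integration.\<close>

lemma weak_partial_iff:
  "weak_partial U u i g \<longleftrightarrow> loc_int U u \<and> loc_int U g \<and>
     (\<forall>\<phi>. test_fn U \<phi> \<longrightarrow>
        (LINT x|lebesgue. pd i \<phi> x *\<^sub>R u x) = - (LINT x|lebesgue. \<phi> x *\<^sub>R g x))"
  unfolding weak_partial_def by (auto simp: set_integral_test_fn test_fn_pd)

lemma weak_partial_mono: "weak_partial U u i g \<Longrightarrow> V \<subseteq> U \<Longrightarrow> weak_partial V u i g"
  unfolding weak_partial_iff by (auto intro: loc_int_mono test_fn_mono)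

lemma integral_test_fn_cong_AE:
  fixes u :: "real^'n::finite \<Rightarrow> 'b::euclidean_space"
  assumes \<phi>: "test_fn U \<phi>" and "loc_int U u" "AE x in lebesgue. x \<in> U \<longrightarrow> u x = u' x"
  shows "(LINT x|lebesgue. \<phi> x *\<^sub>R u x) = (LINT x|lebesgue. \<phi> x *\<^sub>R u' x)"
proof (rule integral_cong_AE)
  show "(\<lambda>x. \<phi> x *\<^sub>R u x) \<in> borel_measurable lebesgue" "(\<lambda>x. \<phi> x *\<^sub>R u' x) \<in> borel_measurable lebesgue"
    using test_fn_integrable[OF \<phi> assms(2)] test_fn_integrable[OF \<phi> loc_int_cong_AE[OF assms(2,3)]] by auto
  obtain K where "K \<subseteq> U" "\<And>x. x \<notin> K \<Longrightarrow> \<phi> x = 0" using test_fnE[OF \<phi>] by metis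
  with assms(3) show "AE x in lebesgue. \<phi> x *\<^sub>R u x = \<phi> x *\<^sub>R u' x"
    by (auto elim!: eventually_mono)
qed

lemma weak_partial_cong_AE:
  assumes w: "weak_partial U u i g" and u: "AE x in lebesgue. x \<in> U \<longrightarrow> u x = u' x"
    and g: "AE x in lebesgue. x \<in> U \<longrightarrow> g x = g' x"
  shows "weak_partial U u' i g'"
  using w integral_test_fn_cong_AE[OF _ _ u] integral_test_fn_cong_AE[OF _ _ g]
  unfolding weak_partial_iff by (auto intro: loc_int_cong_AE[OF _ u] loc_int_cong_AE[OF _ g] simp: test_fn_pd)

text \<open>A product of \<open>flat\<close> factors is smooth and positive exactly on the open box.
  Applying \<open>sstep\<close> to its integer multiples gives test functions that tend pointwise to
  the indicator of the box, and dominated convergence passes to the limit.\<close>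

lemma integral_box_eq_0:
  fixes g :: "real^'n::finite \<Rightarrow> 'b::euclidean_space"
  assumes g: "loc_int U g" and K: "cbox a b \<subseteq> U"
    and 0: "\<And>\<phi>. test_fn U \<phi> \<Longrightarrow> (LINT x|lebesgue. \<phi> x *\<^sub>R g x) = 0"
  shows "(LINT x:box a b|lebesgue. g x) = 0"
proof -
  define f where "f x = (\<Prod>i\<in>UNIV. flat 0 (x $ i - a $ i) * flat 0 (b $ i - x $ i))" for x :: "real^'n"
  have f_smooth: "smooth_fn f"
    unfolding f_def by (intro smooth_fn_prod smooth_fn_mult smooth_fn_flat smooth_fn_diff smooth_fn_coord smooth_fn_const) auto
  have f_pos: "f x > 0" if "x \<in> box a b" for x
    using that unfolding f_def by (intro prod_pos ballI mult_pos_pos) (simp_all add: flat_def mem_box_cart not_le)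
  have f_0: "f x = 0" if x: "x \<notin> box a b" for x
  proof -
    obtain i where "\<not> (a $ i < x $ i \<and> x $ i < b $ i)" using x by (auto simp: mem_box_cart)
    then show ?thesis unfolding f_def by (intro prod_zero) (auto simp: flat_def intro!: exI[of _ i])
  qed
  have f_0': "f x = 0" if "x \<notin> cbox a b" for x
    using f_0 that box_subset_cbox[of a b] by blast
  define \<phi> where "\<phi> n x = sstep (real n * f x)" for n x
  have \<phi>: "test_fn U (\<phi> n)" for n
  proof (rule test_fnI[of _ "cbox a b"])
    show "smooth_fn (\<phi> n)" unfolding \<phi>_def
      by (intro smooth_fn_sstep smooth_fn_mult f_smooth smooth_fn_const)
    show "\<phi> n x = 0" if "x \<notin> cbox a b" for x
      using f_0'[OF that] by (simp add: \<phi>_def sstep_eq_0)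
  qed (use K in auto)
  have int: "integrable lebesgue (\<lambda>x. indicator (cbox a b) x *\<^sub>R g x)"
    using g K compact_cbox[of a b] by (auto simp: loc_int_def set_integrable_def)
  have "(\<lambda>n. LINT x|lebesgue. \<phi> n x *\<^sub>R g x) \<longlonglongrightarrow> (LINT x|lebesgue. indicator (box a b) x *\<^sub>R g x)"
  proof (rule integral_dominated_convergence[where w="\<lambda>x. norm (indicator (cbox a b) x *\<^sub>R g x)"])
    have "(\<lambda>x. indicator (box a b) x *\<^sub>R (indicator (cbox a b) x *\<^sub>R g x)) \<in> borel_measurable lebesgue"
      by (intro borel_measurable_scaleR[OF borel_measurable_indicator] borel_measurable_integrable[OF int]) auto
    also have "(\<lambda>x. indicator (box a b) x *\<^sub>R (indicator (cbox a b) x *\<^sub>R g x)) = (\<lambda>x. indicator (box a b) x *\<^sub>R g x)"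
      using box_subset_cbox[of a b] by (force simp: indicator_def)
    finally show "(\<lambda>x. indicator (box a b) x *\<^sub>R g x) \<in> borel_measurable lebesgue" .
    show "(\<lambda>x. \<phi> n x *\<^sub>R g x) \<in> borel_measurable lebesgue" for n
      using test_fn_integrable[OF \<phi> g] by auto
    show "integrable lebesgue (\<lambda>x. norm (indicator (cbox a b) x *\<^sub>R g x))" by (rule integrable_norm[OF int])
    show "AE x in lebesgue. norm (\<phi> n x *\<^sub>R g x) \<le> norm (indicator (cbox a b) x *\<^sub>R g x)" for n
    proof (rule AE_I2)
      fix x
      show "norm (\<phi> n x *\<^sub>R g x) \<le> norm (indicator (cbox a b) x *\<^sub>R g x)"
        using f_0'[of x] sstep_bounds[of "real n * f x"]
        by (cases "x \<in> cbox a b") (simp_all add: \<phi>_def sstep_eq_0 mult_left_le_one_le)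
    qed
    show "AE x in lebesgue. (\<lambda>n. \<phi> n x *\<^sub>R g x) \<longlonglongrightarrow> indicator (box a b) x *\<^sub>R g x"
    proof (rule AE_I2)
      fix x
      show "(\<lambda>n. \<phi> n x *\<^sub>R g x) \<longlonglongrightarrow> indicator (box a b) x *\<^sub>R g x"
      proof (cases "x \<in> box a b")
        case True
        obtain N where N: "1 / f x < real N" using reals_Archimedean2 by blast
        have "\<phi> n x = 1" if "n \<ge> N" for n
        proof -
          have "1 / f x \<le> real n" using N that by linarith
          then have "real n * f x \<ge> 1" using f_pos[OF True] by (simp add: divide_le_eq)
          then show ?thesis by (simp add: \<phi>_def sstep_eq_1)
        qed
        then have "\<forall>\<^sub>F n in sequentially. indicator (box a b) x *\<^sub>R g x = \<phi> n x *\<^sub>R g x"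
          using True by (auto simp: eventually_sequentially intro!: exI[of _ N])
        then show ?thesis by (rule Lim_transform_eventually[OF tendsto_const])
      qed (auto simp: \<phi>_def f_0 sstep_eq_0)
    qed
  qed
  then have "(\<lambda>n. 0) \<longlonglongrightarrow> (LINT x|lebesgue. indicator (box a b) x *\<^sub>R g x)"
    using 0[OF \<phi>] by simp
  then show ?thesis using LIMSEQ_unique tendsto_const unfolding set_lebesgue_integral_def by metis
qed

lemma sigma_finite_lebesgue: "sigma_finite_measure (lebesgue :: 'a::euclidean_space measure)"
proof
  obtain A :: "'a set set" where "countable A" "A \<subseteq> sets lborel" "\<Union>A = space lborel"
    "\<And>a. a \<in> A \<Longrightarrow> emeasure lborel a \<noteq> \<infinity>"
    using lborel.sigma_finite_countable by metis
  then show "\<exists>A::'a set set. countable A \<and> A \<subseteq> sets lebesgue \<and> \<Union>A = space lebesgue \<and> (\<forall>a\<in>A. emeasure lebesgue a \<noteq> \<infinity>)"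
    by (intro exI[of _ A]) (auto simp: emeasure_completion)
qed

text \<open>Open boxes are an intersection-stable generator of the Borel sets, so vanishing
  integrals extend to all Borel sets by Dynkin's argument; the vanishing total integral handles
  complements. A Lebesgue set differs from a Borel set by a null set.\<close>

lemma AE_eq_0_if_integral_boxes_eq_0:
  fixes g :: "'a::euclidean_space \<Rightarrow> 'b::euclidean_space"
  assumes g: "integrable lebesgue g" and 0: "\<And>c d. (LINT x:box c d|lebesgue. g x) = 0"
    and UN: "integral\<^sup>L lebesgue g = 0"
  shows "AE x in lebesgue. g x = 0"
proof (rule sigma_finite_measure.density_zero[OF _ g])
  show "sigma_finite_measure (lebesgue :: 'a measure)"
    by (rule sigma_finite_lebesgue)
next
  have borel0: "(LINT x:S|lebesgue. g x) = 0" if S: "S \<in> sets borel" for S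
  proof -
    have "Int_stable (range (\<lambda>(a, b). box a b :: 'a set))"
      by (auto simp: Int_stable_def box_Int_box image_iff)
    moreover have "range (\<lambda>(a, b). box a b :: 'a set) \<subseteq> Pow UNIV" by simp
    moreover have "S \<in> sigma_sets UNIV (range (\<lambda>(a, b). box a b))"
      using S by (simp add: borel_eq_box)
    ultimately show ?thesis
    proof (induction rule: sigma_sets_induct_disjoint)
      case (compl A)
      then have A: "A \<in> sets lebesgue"
        by (metis borel_eq_box sets_completionI_sets sets_lborel sets_measure_of top_greatest Pow_UNIV)
      have int: "integrable lebesgue (\<lambda>x. indicator A x *\<^sub>R g x)"
        using A g by (rule integrable_mult_indicator)
      have "(\<lambda>x. indicator (UNIV - A) x *\<^sub>R g x) = (\<lambda>x. g x - indicator A x *\<^sub>R g x)"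
        by (auto simp: indicator_def)
      then show ?case using compl UN g int by (simp add: set_lebesgue_integral_def)
    next
      case (union A)
      have A: "A i \<in> sets lebesgue" for i
        using union(2) by (metis borel_eq_box sets_completionI_sets sets_lborel sets_measure_of top_greatest Pow_UNIV range_subsetD)
      have "(LINT x:(\<Union>i. A i)|lebesgue. g x) = (\<Sum>i. (LINT x:A i|lebesgue. g x))"
        using A union(1) g by (intro lebesgue_integral_countable_add)
          (auto simp: disjoint_family_on_def set_integrable_def intro!: integrable_mult_indicator)
      then show ?case using union by simp
    qed (use 0 in \<open>auto simp: set_lebesgue_integral_def\<close>)
  qed
  fix A :: "'a set" assume "A \<in> sets lebesgue"
  then obtain S N N' where A: "A = S \<union> N" "N \<subseteq> N'" "N' \<in> null_sets lborel" "S \<in> sets lborel"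
    by (rule sets_completionE)
  have "AE x in lebesgue. x \<notin> N'"
    using A(3) by (intro AE_completion AE_not_in)
  then have "AE x in lebesgue. indicator A x *\<^sub>R g x = indicator S x *\<^sub>R g x"
    by eventually_elim (use A in \<open>auto simp: indicator_def\<close>)
  then have "(LINT x:A|lebesgue. g x) = (LINT x:S|lebesgue. g x)"
    unfolding set_lebesgue_integral_def using \<open>A \<in> sets lebesgue\<close> A(4) g
    by (intro integral_cong_AE borel_measurable_scaleR borel_measurable_indicator) auto
  then show "(LINT x:A|lebesgue. g x) = 0" using borel0 A(4) by simp
qed

text \<open>Localization to countably many closed boxes that exhaust \<open>U\<close>. Cut off to
  one open box, \<open>g\<close> becomes integrable, and its integral over any second box is an
  integral over a box inside \<open>U\<close>, because boxes intersect in boxes.\<close>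

theorem fundamental_lemma:
  fixes g :: "real^'n::finite \<Rightarrow> 'b::euclidean_space"
  assumes U: "open U" and g: "loc_int U g"
    and 0: "\<And>\<phi>. test_fn U \<phi> \<Longrightarrow> (LINT x|lebesgue. \<phi> x *\<^sub>R g x) = 0"
  shows "AE x in lebesgue. x \<in> U \<longrightarrow> g x = 0"
proof -
  obtain \<D> where D: "countable \<D>" "\<D> \<subseteq> Pow U" "\<And>X. X \<in> \<D> \<Longrightarrow> \<exists>a b. X = cbox a b" "\<Union>\<D> = U"
    using open_countable_Union_open_cbox[OF U] by metis
  have "AE x in lebesgue. x \<in> X \<longrightarrow> g x = 0" if X: "X \<in> \<D>" for X
  proof -
    obtain a b where ab: "X = cbox a b" using D(3)[OF X] by auto
    have K: "cbox a b \<subseteq> U" using D(2) X ab by auto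
    have int: "integrable lebesgue (\<lambda>x. indicator (cbox a b) x *\<^sub>R g x)"
      using g K compact_cbox[of a b] by (auto simp: loc_int_def set_integrable_def)
    have "integrable lebesgue (\<lambda>x. indicator (box a b) x *\<^sub>R (indicator (cbox a b) x *\<^sub>R g x))"
      by (intro integrable_mult_indicator int) auto
    also have "(\<lambda>x. indicator (box a b) x *\<^sub>R (indicator (cbox a b) x *\<^sub>R g x)) = (\<lambda>x. indicator (box a b) x *\<^sub>R g x)"
      using box_subset_cbox[of a b] by (force simp: indicator_def)
    finally have int': "integrable lebesgue (\<lambda>x. indicator (box a b) x *\<^sub>R g x)" .
    have "AE x in lebesgue. indicator (box a b) x *\<^sub>R g x = 0"
    proof (rule AE_eq_0_if_integral_boxes_eq_0[OF int'])
      fix c d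
      obtain a' b' where ab': "box a b \<inter> box c d = box a' b'" using box_Int_box by blast
      have "(LINT x:box c d|lebesgue. indicator (box a b) x *\<^sub>R g x) = (LINT x:box a' b'|lebesgue. g x)"
        unfolding set_lebesgue_integral_def by (simp add: indicator_inter_arith ab'[symmetric] mult.commute)
      also have "\<dots> = 0"
      proof (cases "box a' b' = {}")
        case False
        then have "cbox a' b' \<subseteq> cbox a b"
          using ab' closure_box[of a' b'] box_subset_cbox[of a b] by (metis Int_lower1 closed_cbox closure_minimal order_trans)
        then show ?thesis using integral_box_eq_0[OF g _ 0] K by blast
      qed (simp add: set_lebesgue_integral_def)
      finally show "(LINT x:box c d|lebesgue. indicator (box a b) x *\<^sub>R g x) = 0" .
    next
      show "(LINT x|lebesgue. indicator (box a b) x *\<^sub>R g x) = 0"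
        using integral_box_eq_0[OF g K 0] by (simp add: set_lebesgue_integral_def)
    qed
    \<comment> \<open>The faces lost in passing from the closed to the open box are
      negligible.\<close>
    moreover have "AE x in lebesgue. x \<notin> cbox a b - box a b"
      using negligible_frontier_interval[of a b] by (intro AE_not_in) (simp add: negligible_iff_null_sets)
    ultimately show ?thesis unfolding ab by eventually_elim (auto simp: indicator_def)
  qed
  then have "AE x in lebesgue. \<forall>X\<in>\<D>. x \<in> X \<longrightarrow> g x = 0"
    using D(1) by (subst AE_ball_countable) auto
  then show ?thesis by eventually_elim (use D(4) in auto)
qed

section \<open>Calculus of weak derivatives\<close>

lemma loc_int_add: "loc_int U f \<Longrightarrow> loc_int U g \<Longrightarrow> loc_int U (\<lambda>x. f x + g x)"
  unfolding loc_int_def by (auto intro: set_integral_add)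

lemma loc_int_diff: "loc_int U f \<Longrightarrow> loc_int U g \<Longrightarrow> loc_int U (\<lambda>x. f x - g x)"
  unfolding loc_int_def by (auto intro: set_integral_diff)

lemma weak_partial_unique:
  fixes u :: "real^'n::finite \<Rightarrow> 'b::euclidean_space"
  assumes U: "open U" and g: "weak_partial U u i g" and g': "weak_partial U u i g'"
  shows "AE x in lebesgue. x \<in> U \<longrightarrow> g x = g' x"
proof -
  have l: "loc_int U g" "loc_int U g'" using g g' by (auto simp: weak_partial_def)
  have "AE x in lebesgue. x \<in> U \<longrightarrow> g x - g' x = 0"
  proof (rule fundamental_lemma[OF U loc_int_diff[OF l]])
    fix \<phi> :: "real^'n \<Rightarrow> real" assume \<phi>: "test_fn U \<phi>"
    have "- (LINT x|lebesgue. \<phi> x *\<^sub>R g x) = - (LINT x|lebesgue. \<phi> x *\<^sub>R g' x)"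
      using g g' \<phi> unfolding weak_partial_iff by metis
    then show "(LINT x|lebesgue. \<phi> x *\<^sub>R (g x - g' x)) = 0"
      by (simp add: scaleR_diff_right test_fn_integrable[OF \<phi>] l)
  qed
  then show ?thesis by eventually_elim auto
qed

lemma weak_partial_wd: "weak_partial U u i g \<Longrightarrow> weak_partial U u i (wd U u i)"
  unfolding wd_def by (rule someI[of "weak_partial U u i"])

text \<open>Uniqueness allows the arbitrary choice made by \<open>wd\<close> to be replaced, up to a
  null set, by whichever weak derivative is convenient.\<close>

lemma wd_AE_eq: "open U \<Longrightarrow> weak_partial U u i g \<Longrightarrow> AE x in lebesgue. x \<in> U \<longrightarrow> wd U u i x = g x"
  using weak_partial_unique weak_partial_wd by blast

lemma loc_int_scale:
  fixes g :: "real^'n::finite \<Rightarrow> 'b::euclidean_space"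
  assumes g: "loc_int U g" and c: "c > 0" and V: "\<And>x. x \<in> V \<Longrightarrow> c *\<^sub>R x \<in> U"
  shows "loc_int V (\<lambda>x. g (c *\<^sub>R x))"
  unfolding loc_int_def
proof (intro allI impI)
  fix K assume K: "compact K \<and> K \<subseteq> V"
  let ?K = "(\<lambda>x. c *\<^sub>R x) ` K"
  have "compact ?K" "?K \<subseteq> U" using K V by (auto intro!: compact_continuous_image continuous_intros)
  then have "integrable lebesgue (\<lambda>x. indicator ?K x *\<^sub>R g x)"
    using g by (auto simp: loc_int_def set_integrable_def)
  then have "integrable lebesgue (\<lambda>x. indicator ?K (c *\<^sub>R x) *\<^sub>R g (c *\<^sub>R x))"
    using c by (subst integrable_lebesgue_scale) auto
  moreover have "c *\<^sub>R x \<in> ?K \<longleftrightarrow> x \<in> K" for x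
    using c by auto
  then have "(\<lambda>x. indicator ?K (c *\<^sub>R x) *\<^sub>R g (c *\<^sub>R x)) = (\<lambda>x. indicator K x *\<^sub>R g (c *\<^sub>R x))"
    by (simp add: indicator_def)
  ultimately show "set_integrable lebesgue K (\<lambda>x. g (c *\<^sub>R x))"
    by (simp add: set_integrable_def)
qed

lemma weak_partial_scale:
  fixes u :: "real^'n::finite \<Rightarrow> 'b::euclidean_space"
  assumes w: "weak_partial U u i g" and c: "c > 0" and V: "\<And>x. x \<in> V \<Longrightarrow> c *\<^sub>R x \<in> U"
  shows "weak_partial V (\<lambda>x. u (c *\<^sub>R x)) i (\<lambda>x. c *\<^sub>R g (c *\<^sub>R x))"
  unfolding weak_partial_iff
proof (intro conjI allI impI)
  have l: "loc_int U u" "loc_int U g" using w by (auto simp: weak_partial_def)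
  show "loc_int V (\<lambda>x. u (c *\<^sub>R x))" by (rule loc_int_scale[OF l(1) c V])
  have "loc_int V (\<lambda>x. g (c *\<^sub>R x))" by (rule loc_int_scale[OF l(2) c V])
  then show "loc_int V (\<lambda>x. c *\<^sub>R g (c *\<^sub>R x))"
    by (auto simp: loc_int_def intro: set_integrable_scaleR_right)
  fix \<phi> :: "real^'n \<Rightarrow> real" assume \<phi>: "test_fn V \<phi>"
  \<comment> \<open>The test function on \<open>U\<close> whose dilation is \<open>\<phi>\<close>.
    Testing with it and changing variables produces the factor \<open>c\<close> of the chain
    rule.\<close>
  define \<psi> where "\<psi> x = \<phi> ((1/c) *\<^sub>R x)" for x
  have "test_fn ((\<lambda>x. x /\<^sub>R (1/c)) ` V) \<psi>"
    using test_fn_scale[OF \<phi>, of "1/c"] c by (simp add: \<psi>_def[abs_def])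
  then have \<psi>: "test_fn U \<psi>"
    by (rule test_fn_mono) (use V c in auto)
  have pd\<psi>: "pd i \<psi> (c *\<^sub>R x) = pd i \<phi> x / c" for x
    using pd_scale[of \<phi> "1/c" "c *\<^sub>R x" i] smooth_fn_differentiable[OF test_fn_smooth[OF \<phi>]] c
    by (simp add: \<psi>_def[abs_def])
  have \<psi>c: "\<psi> (c *\<^sub>R x) = \<phi> x" for x using c by (simp add: \<psi>_def)
  have m: "(\<lambda>x. pd i \<psi> x *\<^sub>R u x) \<in> borel_measurable lebesgue" "(\<lambda>x. \<psi> x *\<^sub>R g x) \<in> borel_measurable lebesgue"
    using test_fn_integrable[OF \<psi> l(2)] test_fn_integrable[OF test_fn_pd[OF \<psi>] l(1)] by auto
  have "(LINT x|lebesgue. pd i \<psi> x *\<^sub>R u x) = - (LINT x|lebesgue. \<psi> x *\<^sub>R g x)"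
    using w \<psi> by (simp add: weak_partial_iff)
  then have "\<bar>c\<bar> ^ DIM(real^'n) *\<^sub>R (LINT x|lebesgue. (pd i \<phi> x / c) *\<^sub>R u (c *\<^sub>R x))
    = - (\<bar>c\<bar> ^ DIM(real^'n) *\<^sub>R (LINT x|lebesgue. \<phi> x *\<^sub>R g (c *\<^sub>R x)))"
    using c integral_lebesgue_scale[OF m(1), of c] integral_lebesgue_scale[OF m(2), of c]
    by (simp only: pd\<psi> \<psi>c)
  then have "\<bar>c\<bar> ^ DIM(real^'n) *\<^sub>R (LINT x|lebesgue. (pd i \<phi> x / c) *\<^sub>R u (c *\<^sub>R x))
    = \<bar>c\<bar> ^ DIM(real^'n) *\<^sub>R (- (LINT x|lebesgue. \<phi> x *\<^sub>R g (c *\<^sub>R x)))"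
    by simp
  then have eq: "(LINT x|lebesgue. (pd i \<phi> x / c) *\<^sub>R u (c *\<^sub>R x)) = - (LINT x|lebesgue. \<phi> x *\<^sub>R g (c *\<^sub>R x))"
    unfolding scaleR_cancel_left using c by simp
  have "(LINT x|lebesgue. pd i \<phi> x *\<^sub>R u (c *\<^sub>R x)) = c *\<^sub>R (LINT x|lebesgue. (pd i \<phi> x / c) *\<^sub>R u (c *\<^sub>R x))"
    unfolding integral_scaleR_right[symmetric] using c by simp
  also have "\<dots> = - (c *\<^sub>R (LINT x|lebesgue. \<phi> x *\<^sub>R g (c *\<^sub>R x)))" by (simp add: eq)
  also have "c *\<^sub>R (LINT x|lebesgue. \<phi> x *\<^sub>R g (c *\<^sub>R x)) = (LINT x|lebesgue. \<phi> x *\<^sub>R c *\<^sub>R g (c *\<^sub>R x))"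
    unfolding integral_scaleR_right[symmetric] by (simp add: mult.commute)
  finally show "(LINT x|lebesgue. pd i \<phi> x *\<^sub>R u (c *\<^sub>R x)) = - (LINT x|lebesgue. \<phi> x *\<^sub>R c *\<^sub>R g (c *\<^sub>R x))" .
qed

lemma loc_int_mult_smooth:
  fixes g :: "real^'n::finite \<Rightarrow> 'b::euclidean_space"
  assumes g: "loc_int U g" and f: "smooth_fn f"
  shows "loc_int U (\<lambda>x. f x *\<^sub>R g x)"
  unfolding loc_int_def
proof (intro allI impI)
  fix K assume K: "compact K \<and> K \<subseteq> U"
  then have int: "integrable lebesgue (\<lambda>x. indicator K x *\<^sub>R g x)"
    using g by (auto simp: loc_int_def set_integrable_def)
  have "bounded (f ` K)"
    by (intro compact_imp_bounded compact_continuous_image smooth_fn_continuous f) (use K in auto)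
  then obtain B where B: "\<And>x. x \<in> K \<Longrightarrow> \<bar>f x\<bar> \<le> B" by (auto simp: bounded_iff)
  have "integrable lebesgue (\<lambda>x. (indicator K x * f x) *\<^sub>R (indicator K x *\<^sub>R g x))"
  proof (rule integrable_scaleR_bounded_lebesgue[OF int, of _ "max B 0"])
    have "K \<in> sets lebesgue" using K by (simp add: borel_compact)
    then show "(\<lambda>x. indicator K x * f x) \<in> borel_measurable lebesgue"
      using smooth_fn_lebesgue[OF f] by (intro borel_measurable_times borel_measurable_indicator)
    show "\<bar>indicator K x * f x\<bar> \<le> max B 0" for x
      using B[of x] by (auto simp: indicator_def)
  qed
  also have "(\<lambda>x. (indicator K x * f x) *\<^sub>R (indicator K x *\<^sub>R g x)) = (\<lambda>x. indicator K x *\<^sub>R (f x *\<^sub>R g x))"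
    by (auto simp: indicator_def)
  finally show "set_integrable lebesgue K (\<lambda>x. f x *\<^sub>R g x)" by (simp add: set_integrable_def)
qed

text \<open>The smooth factor is moved onto the test function: \<open>f x * \<phi> x\<close> is
  again a test function, and the classical product rule for it splits the identity into the two
  terms.\<close>

lemma weak_partial_mult_smooth:
  fixes u :: "real^'n::finite \<Rightarrow> 'b::euclidean_space"
  assumes w: "weak_partial U u i g" and f: "smooth_fn f"
  shows "weak_partial U (\<lambda>x. f x *\<^sub>R u x) i (\<lambda>x. pd i f x *\<^sub>R u x + f x *\<^sub>R g x)"
  unfolding weak_partial_iff
proof (intro conjI allI impI)
  have l: "loc_int U u" "loc_int U g" using w by (auto simp: weak_partial_def)
  show "loc_int U (\<lambda>x. f x *\<^sub>R u x)" "loc_int U (\<lambda>x. pd i f x *\<^sub>R u x + f x *\<^sub>R g x)"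
    using l f smooth_fn_pd[OF f] by (auto intro!: loc_int_mult_smooth loc_int_add)
  fix \<phi> :: "real^'n \<Rightarrow> real" assume \<phi>: "test_fn U \<phi>"
  have f\<phi>: "test_fn U (\<lambda>x. f x * \<phi> x)" by (rule test_fn_mult[OF \<phi> f])
  have pdf: "pd i (\<lambda>x. f x * \<phi> x) = (\<lambda>x. f x * pd i \<phi> x + pd i f x * \<phi> x)"
    using pd_mult[OF smooth_fn_differentiable[OF f] smooth_fn_differentiable[OF test_fn_smooth[OF \<phi>]]] by auto
  have i1: "integrable lebesgue (\<lambda>x. (f x * pd i \<phi> x) *\<^sub>R u x)"
    by (rule test_fn_integrable[OF test_fn_mult[OF test_fn_pd[OF \<phi>] f] l(1)])
  have i2: "integrable lebesgue (\<lambda>x. (pd i f x * \<phi> x) *\<^sub>R u x)"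
    by (rule test_fn_integrable[OF test_fn_mult[OF \<phi> smooth_fn_pd[OF f]] l(1)])
  have i3: "integrable lebesgue (\<lambda>x. (f x * \<phi> x) *\<^sub>R g x)"
    by (rule test_fn_integrable[OF f\<phi> l(2)])
  have "(LINT x|lebesgue. pd i (\<lambda>x. f x * \<phi> x) x *\<^sub>R u x) = - (LINT x|lebesgue. (f x * \<phi> x) *\<^sub>R g x)"
    using w f\<phi> unfolding weak_partial_iff by blast
  then have "(LINT x|lebesgue. (f x * pd i \<phi> x) *\<^sub>R u x) + (LINT x|lebesgue. (pd i f x * \<phi> x) *\<^sub>R u x)
    = - (LINT x|lebesgue. (f x * \<phi> x) *\<^sub>R g x)"
    unfolding pdf scaleR_add_left using Bochner_Integration.integral_add[OF i1 i2] by simp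
  moreover have "(LINT x|lebesgue. \<phi> x *\<^sub>R (pd i f x *\<^sub>R u x + f x *\<^sub>R g x))
    = (LINT x|lebesgue. (pd i f x * \<phi> x) *\<^sub>R u x) + (LINT x|lebesgue. (f x * \<phi> x) *\<^sub>R g x)"
    unfolding Bochner_Integration.integral_add[OF i2 i3, symmetric]
    by (simp add: scaleR_add_right mult.commute)
  ultimately have "(LINT x|lebesgue. (f x * pd i \<phi> x) *\<^sub>R u x) =
    - (LINT x|lebesgue. \<phi> x *\<^sub>R (pd i f x *\<^sub>R u x + f x *\<^sub>R g x))"
    by (simp only: eq_neg_iff_add_eq_0 add.assoc)
  then show "(LINT x|lebesgue. pd i \<phi> x *\<^sub>R f x *\<^sub>R u x) =
    - (LINT x|lebesgue. \<phi> x *\<^sub>R (pd i f x *\<^sub>R u x + f x *\<^sub>R g x))"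
    by (simp add: mult.commute)
qed

section \<open>Restriction to rays\<close>

text \<open>Each coordinate of the function, extended by 0, has a Borel version by the theory of
  completed measures; the coordinates are then reassembled.\<close>

lemma borel_representative:
  fixes f :: "'a::euclidean_space \<Rightarrow> 'b::euclidean_space"
  assumes U: "U \<in> sets borel" and f: "f \<in> borel_measurable (lebesgue_on U)"
  obtains f' where "f' \<in> borel_measurable borel" "\<And>x. x \<notin> U \<Longrightarrow> f' x = 0"
    "AE x in lebesgue. x \<in> U \<longrightarrow> f' x = f x"
proof -
  have "(\<lambda>x. indicator U x *\<^sub>R f x) \<in> borel_measurable lebesgue"
    using f U by (simp add: borel_measurable_restrict_space_iff)
  then have "(\<lambda>x. (indicator U x *\<^sub>R f x) \<bullet> b) \<in> borel_measurable (completion lborel)" for b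
    by (intro borel_measurable_inner) auto
  then have "\<forall>b. \<exists>g\<in>borel_measurable lborel. AE x in lborel. (indicator U x *\<^sub>R f x) \<bullet> b = g x"
    using completion_ex_borel_measurable_real by blast
  then obtain g where g: "\<And>b. g b \<in> borel_measurable lborel"
    "\<And>b. AE x in lborel. (indicator U x *\<^sub>R f x) \<bullet> b = g b x" by metis
  define f' where "f' x = indicator U x *\<^sub>R (\<Sum>b\<in>Basis. g b x *\<^sub>R b)" for x
  show ?thesis
  proof
    show "f' \<in> borel_measurable borel"
      unfolding f'_def using g(1) U by (auto intro!: borel_measurable_scaleR borel_measurable_sum borel_measurable_indicator)
    show "f' x = 0" if "x \<notin> U" for x using that by (simp add: f'_def)
    have "AE x in lborel. \<forall>b\<in>Basis. (indicator U x *\<^sub>R f x) \<bullet> b = g b x"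
      using g(2) by (intro AE_finite_allI) auto
    then have "AE x in lborel. x \<in> U \<longrightarrow> f' x = f x"
    proof eventually_elim
      fix x assume x: "\<forall>b\<in>Basis. (indicator U x *\<^sub>R f x) \<bullet> b = g b x"
      have "(\<Sum>b\<in>Basis. g b x *\<^sub>R b) = (\<Sum>b\<in>Basis. ((indicator U x *\<^sub>R f x) \<bullet> b) *\<^sub>R b)"
        by (intro sum.cong) (use x in auto)
      also have "\<dots> = indicator U x *\<^sub>R f x" by (rule euclidean_representation)
      finally show "x \<in> U \<longrightarrow> f' x = f x" by (simp add: f'_def)
    qed
    then show "AE x in lebesgue. x \<in> U \<longrightarrow> f' x = f x" by (rule AE_completion)
  qed
qed

lemma compact_subset_ball_shrink:
  fixes K :: "'a::real_normed_vector set"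
  assumes K: "compact K" "K \<subseteq> ball 0 r" and r: "r > 0"
  obtains \<rho> where "0 \<le> \<rho>" "\<rho> < r" "K \<subseteq> cball 0 \<rho>"
proof (cases "K = {}")
  case False
  obtain y where "y \<in> K" "\<And>x. x \<in> K \<Longrightarrow> norm x \<le> norm y"
    using continuous_attains_sup[OF K(1) False, of norm] by (auto intro: continuous_intros)
  then show ?thesis using K by (intro that[of "norm y"]) auto
qed (use r that in auto)

text \<open>For \<open>x\<close> in the support of \<open>\<phi>\<close> and \<open>t\<close> at
  most \<open>q\<close>, the point \<open>t *\<^sub>R x\<close> stays in the ball of radius
  \<open>\<rho>\<close>, where \<open>g\<close> is integrable; \<open>t\<close> at least
  \<open>p\<close> bounds the Jacobian of the dilation. This justifies Fubini in
  \<open>ray_bound\<close>.\<close>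

lemma ray_product_integrable:
  fixes g :: "real^'n::finite \<Rightarrow> 'b::euclidean_space"
  assumes [measurable]: "g \<in> borel_measurable borel" "\<phi> \<in> borel_measurable borel"
    and int: "integrable lborel (\<lambda>y. indicator (cball 0 \<rho>) y *\<^sub>R g y)"
    and pq: "0 < p" "p \<le> q"
    and B: "\<And>x. \<bar>\<phi> x\<bar> \<le> B" and supp: "\<And>x. x \<notin> cball 0 (\<rho> / q) \<Longrightarrow> \<phi> x = 0"
  shows "integrable (lborel \<Otimes>\<^sub>M lborel) (\<lambda>(t, x). (indicator {p..q} t * \<phi> x) *\<^sub>R g (t *\<^sub>R x))"
proof -
  have [measurable]: "cball (0::real^'n) \<rho> \<in> sets borel" by simp
  define I where "I = (\<integral>\<^sup>+y. ennreal (norm (indicator (cball 0 \<rho>) y *\<^sub>R g y)) \<partial>lborel)"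
  have I: "I < \<infinity>" using int unfolding I_def by (simp add: integrable_iff_bounded)
  have B0: "B \<ge> 0" using B[of 0] by linarith
  have inner: "(\<integral>\<^sup>+x. ennreal (norm ((indicator {p..q} t * \<phi> x) *\<^sub>R g (t *\<^sub>R x))) \<partial>lborel)
      \<le> ennreal (B / p ^ CARD('n)) * I * indicator {p..q} t" for t
  proof (cases "t \<in> {p..q}")
    case True
    then have t: "t > 0" "t \<le> q" "p \<le> t" using pq by auto
    have "(\<integral>\<^sup>+x. ennreal (norm ((indicator {p..q} t * \<phi> x) *\<^sub>R g (t *\<^sub>R x))) \<partial>lborel)
      \<le> (\<integral>\<^sup>+x. ennreal B * ennreal (norm (indicator (cball 0 \<rho>) (t *\<^sub>R x) *\<^sub>R g (t *\<^sub>R x))) \<partial>lborel)"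
    proof (rule nn_integral_mono)
      fix x
      show "ennreal (norm ((indicator {p..q} t * \<phi> x) *\<^sub>R g (t *\<^sub>R x)))
        \<le> ennreal B * ennreal (norm (indicator (cball 0 \<rho>) (t *\<^sub>R x) *\<^sub>R g (t *\<^sub>R x)))"
      proof (cases "x \<in> cball 0 (\<rho> / q)")
        case True
        then have "norm x * q \<le> \<rho>" using t by (simp add: field_simps)
        moreover have "t * norm x \<le> norm x * q" using t mult_right_mono[OF t(2) norm_ge_zero[of x]] by (simp add: mult.commute)
        ultimately have "t *\<^sub>R x \<in> cball 0 \<rho>" using t by simp
        then show ?thesis using B[of x] B0 t
          by (auto simp: ennreal_mult[symmetric] indicator_def simp del: mem_cball intro!: ennreal_leI mult_right_mono)
      qed (simp add: supp)
    qed
    also have "\<dots> = ennreal B * (\<integral>\<^sup>+x. ennreal (norm (indicator (cball 0 \<rho>) (t *\<^sub>R x) *\<^sub>R g (t *\<^sub>R x))) \<partial>lborel)"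
      by (rule nn_integral_cmult) measurable
    also have "\<dots> \<le> ennreal B * (ennreal (1 / p ^ CARD('n)) * I)"
    proof (rule mult_left_mono)
      have "I = (\<integral>\<^sup>+y. ennreal (norm (indicator (cball 0 \<rho>) y *\<^sub>R g y)) \<partial>lebesgue)"
        unfolding I_def by (simp add: nn_integral_completion)
      also have "\<dots> = ennreal (\<bar>t\<bar> ^ DIM(real^'n)) * (\<integral>\<^sup>+x. ennreal (norm (indicator (cball 0 \<rho>) (t *\<^sub>R x) *\<^sub>R g (t *\<^sub>R x))) \<partial>lebesgue)"
        by (rule nn_integral_lebesgue_scale, rule measurable_completion) (use t in auto)
      also have "\<dots> = ennreal (t ^ CARD('n)) * (\<integral>\<^sup>+x. ennreal (norm (indicator (cball 0 \<rho>) (t *\<^sub>R x) *\<^sub>R g (t *\<^sub>R x))) \<partial>lborel)"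
        (is "_ = _ * ?J") using t by (simp add: nn_integral_completion)
      finally have "I = ennreal (t ^ CARD('n)) * ?J" .
      moreover have "?J \<le> ennreal (1 / p ^ CARD('n)) * (ennreal (t ^ CARD('n)) * ?J)"
      proof -
        have "p ^ CARD('n) \<le> t ^ CARD('n)" using t pq by (intro power_mono) auto
        then have "1 \<le> 1 / p ^ CARD('n) * t ^ CARD('n)" using pq by (simp add: field_simps)
        then have "1 \<le> ennreal (1 / p ^ CARD('n) * t ^ CARD('n))" by (simp add: ennreal_ge_1)
        then have "1 * ?J \<le> ennreal (1 / p ^ CARD('n) * t ^ CARD('n)) * ?J" by (rule mult_right_mono) simp
        moreover have "ennreal (1 / p ^ CARD('n) * t ^ CARD('n)) = ennreal (1 / p ^ CARD('n)) * ennreal (t ^ CARD('n))"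
          using t pq by (intro ennreal_mult) auto
        ultimately show ?thesis by (simp only: mult.assoc mult_1_left)
      qed
      ultimately show "?J \<le> ennreal (1 / p ^ CARD('n)) * I" by simp
    qed simp
    also have "\<dots> = ennreal (B / p ^ CARD('n)) * I * indicator {p..q} t"
      using B0 pq True by (simp add: mult.assoc[symmetric] ennreal_mult[symmetric])
    finally show ?thesis .
  qed simp
  have "(\<integral>\<^sup>+z. ennreal (norm (case z of (t, x) \<Rightarrow> (indicator {p..q} t * \<phi> x) *\<^sub>R g (t *\<^sub>R x))) \<partial>(lborel \<Otimes>\<^sub>M lborel))
     = (\<integral>\<^sup>+t. \<integral>\<^sup>+x. ennreal (norm ((indicator {p..q} t * \<phi> x) *\<^sub>R g (t *\<^sub>R x))) \<partial>lborel \<partial>lborel)"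
    by (subst lborel.nn_integral_fst[symmetric]) auto
  also have "\<dots> \<le> (\<integral>\<^sup>+t. ennreal (B / p ^ CARD('n)) * I * indicator {p..q} t \<partial>lborel)"
    by (intro nn_integral_mono inner)
  also have "\<dots> = ennreal (B / p ^ CARD('n)) * I * ennreal (q - p)"
    using pq by (subst nn_integral_cmult_indicator) auto
  also have "\<dots> < \<infinity>" using I by (simp add: ennreal_mult_less_top)
  finally show ?thesis by (intro integrableI_bounded) auto
qed

lemma continuous_on_test_ray: "smooth_fn \<zeta> \<Longrightarrow> 0 < p \<Longrightarrow> continuous_on {p..q} (\<lambda>t. \<zeta> ((1/t) *\<^sub>R y))"
  by (rule continuous_on_compose2[OF smooth_fn_continuous[of \<zeta> UNIV]]) (auto intro!: continuous_intros)

text \<open>The bracket is the divergence of the field z -> \<phi>(z) z at z = y/t. The substitution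
  y = t x moves the dependence on \<open>t\<close> from the map to the test function, so this
  formula is the dual of differentiating t -> u(t x).\<close>

lemma ray_test_derivative:
  fixes \<phi> :: "real^'n::finite \<Rightarrow> real"
  assumes \<phi>: "smooth_fn \<phi>" and t: "t > 0"
  shows "((\<lambda>t. (1/t) ^ CARD('n) * \<phi> ((1/t) *\<^sub>R y)) has_real_derivative
     - ((1/t) ^ (CARD('n) + 1) * (real CARD('n) * \<phi> ((1/t) *\<^sub>R y) + (\<Sum>i\<in>UNIV. ((1/t) *\<^sub>R y) $ i * pd i \<phi> ((1/t) *\<^sub>R y))))) (at t)"
proof -
  let ?D = "frechet_derivative \<phi> (at ((1/t) *\<^sub>R y))"
  have lin: "linear ?D" by (rule linear_frechet_derivative[OF smooth_fn_differentiable[OF \<phi>]])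
  have D: "?D z = (\<Sum>i\<in>UNIV. z $ i * pd i \<phi> ((1/t) *\<^sub>R y))" for z
  proof -
    have "?D z = ?D (\<Sum>i\<in>UNIV. z $ i *\<^sub>R axis i 1)" using basis_expansion[of z] by (simp add: scalar_mult_eq_scaleR)
    then show ?thesis by (simp add: linear_sum[OF lin] linear_cmul[OF lin] pd_def)
  qed
  have "((\<lambda>t. (1/t) *\<^sub>R y) has_vector_derivative (- (1/t\<^sup>2)) *\<^sub>R y) (at t)"
    using t by (auto intro!: derivative_eq_intros simp: has_vector_derivative_def power2_eq_square field_simps)
  then have "((\<lambda>t. \<phi> ((1/t) *\<^sub>R y)) has_vector_derivative ?D ((- (1/t\<^sup>2)) *\<^sub>R y)) (at t)"
    unfolding has_vector_derivative_def
    by (rule has_derivative_eq_rhs[OF has_derivative_compose[where g=\<phi>, OF _ smooth_fn_has_derivative[OF \<phi>]]])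
       (auto simp: linear_cmul[OF lin] linear_neg[OF lin] fun_eq_iff)
  then have 1: "((\<lambda>t. \<phi> ((1/t) *\<^sub>R y)) has_real_derivative - (1/t) * ?D ((1/t) *\<^sub>R y)) (at t)"
    by (simp add: has_real_derivative_iff_has_vector_derivative linear_cmul[OF lin] linear_neg[OF lin] power2_eq_square)
  have 2: "((\<lambda>t. (1/t) ^ CARD('n)) has_real_derivative - (real CARD('n) * (1/t) ^ (CARD('n) + 1))) (at t)"
  proof -
    obtain m where m: "CARD('n) = Suc m" using zero_less_card_finite[where 'a='n] gr0_implies_Suc by blast
    show ?thesis unfolding m using t
      by (auto intro!: derivative_eq_intros simp: power2_eq_square divide_simps)
         (cases m; simp add: algebra_simps)
  qed
  show ?thesis
    by (rule DERIV_cong[OF DERIV_mult[OF 2 1]]) (simp add: D algebra_simps)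
qed

text \<open>A quantitative form of absolute continuity along rays. By the fundamental lemma it is
  enough to pair \<open>u (q *\<^sub>R x) - u (p *\<^sub>R x)\<close> with test functions: change of
  variables, the fundamental theorem of calculus for the transported test function, Fubini and the
  weak derivative identify it with the ray integral of the radial derivative. The exceptional null
  set depends on \<open>p\<close> and \<open>q\<close>.\<close>

theorem ray_bound:
  fixes u :: "real^'n::finite \<Rightarrow> 'b::euclidean_space"
  assumes u[measurable]: "u \<in> borel_measurable borel" and g[measurable]: "\<And>i. g i \<in> borel_measurable borel"
    and w: "\<And>i. weak_partial (ball 0 R) u i (g i)" and pq: "0 < p" "p \<le> q"
  shows "AE x in lborel. q * norm x < R \<longrightarrow>
    ennreal (norm (u (q *\<^sub>R x) - u (p *\<^sub>R x))) \<le> (\<integral>\<^sup>+t\<in>{p..q}. ennreal (norm (\<Sum>i\<in>UNIV. x $ i *\<^sub>R g i (t *\<^sub>R x))) \<partial>lborel)"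
proof (cases "R > 0")
  case False
  then have "\<not> q * norm x < R" for x :: "real^'n" using pq by (auto simp: not_less intro: order_trans)
  then show ?thesis by simp
next
  case R: True
  have cball_borel[measurable]: "cball (0::real^'n) r \<in> sets borel" for r by simp
  \<comment> \<open>The points whose ray up to parameter \<open>q\<close> stays inside the ball of
    radius \<open>R\<close>.\<close>
  define V where "V = ball (0::real^'n) (R / q)"
  let ?n = "CARD('n)"
  define S where "S t x = (\<Sum>i\<in>UNIV. x $ i *\<^sub>R g i (t *\<^sub>R x))" for t x
  have S[measurable]: "(\<lambda>(t, x). S t x) \<in> borel_measurable (borel \<Otimes>\<^sub>M borel)"
  proof -
    have [measurable]: "(\<lambda>x::real^'n. x $ i) \<in> borel_measurable borel" for i
      by (intro borel_measurable_continuous_onI continuous_intros)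
    have [measurable]: "(\<lambda>z::real \<times> (real^'n). g i (fst z *\<^sub>R snd z)) \<in> borel_measurable (borel \<Otimes>\<^sub>M borel)" for i
      by (rule measurable_compose[OF _ g]) measurable
    show ?thesis unfolding S_def split_beta' by measurable
  qed
  \<comment> \<open>\<open>S t x\<close> is the formal derivative of t -> u(t x), so
    \<open>h\<close> is the candidate for the increment of \<open>u\<close> along the ray.\<close>
  define h where "h x = (LINT t|lborel. indicator {p..q} t *\<^sub>R S t x)" for x
  have lu: "loc_int (ball 0 R) u" and lg: "loc_int (ball 0 R) (g i)" for i
    using w by (auto simp: weak_partial_def)
  have q: "q > 0" using pq by simp
  have V: "t *\<^sub>R x \<in> ball 0 R" if "x \<in> V" "0 < t" "t \<le> q" for t x
  proof -
    have "t * norm x \<le> q * norm x" using that by (intro mult_right_mono) auto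
    then show ?thesis using that q by (simp add: V_def field_simps)
  qed
  have intC: "integrable lborel (\<lambda>y. indicator (cball 0 \<rho>) y *\<^sub>R f y)"
    if "\<rho> < R" "loc_int (ball 0 R) f" "f \<in> borel_measurable borel" for \<rho> and f :: "real^'n \<Rightarrow> 'b"
  proof -
    have "compact (cball (0::real^'n) \<rho>)" "cball (0::real^'n) \<rho> \<subseteq> ball 0 R" using that by auto
    then have "integrable lebesgue (\<lambda>y. indicator (cball 0 \<rho>) y *\<^sub>R f y)"
      using that(2) by (simp add: loc_int_def set_integrable_def)
    moreover have "(\<lambda>y. indicator (cball 0 \<rho>) y *\<^sub>R f y) \<in> borel_measurable lborel"
      using that(3) by (auto intro!: borel_measurable_scaleR borel_measurable_indicator)
    ultimately show ?thesis by (simp add: integrable_completion)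
  qed
  have Sint: "integrable (lborel \<Otimes>\<^sub>M lborel) (\<lambda>(t, x). (indicator {p..q} t * \<phi> x) *\<^sub>R S t x)"
    if \<phi>[measurable]: "\<phi> \<in> borel_measurable borel" and B: "\<And>x. \<bar>\<phi> x\<bar> \<le> B"
      and supp: "\<And>x. x \<notin> cball 0 (\<rho> / q) \<Longrightarrow> \<phi> x = 0" and \<rho>: "0 \<le> \<rho>" "\<rho> < R" for \<phi> B \<rho>
  proof -
    have "integrable (lborel \<Otimes>\<^sub>M lborel) (\<lambda>(t, x). (indicator {p..q} t * (\<phi> x * x $ i)) *\<^sub>R g i (t *\<^sub>R x))" for i
    proof (rule ray_product_integrable[where B="B * (\<rho> / q)", OF _ _ intC[OF \<rho>(2) lg g] pq])
      show "\<bar>\<phi> x * x $ i\<bar> \<le> B * (\<rho> / q)" for x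
      proof (cases "x \<in> cball 0 (\<rho> / q)")
        case True
        then have "\<bar>x $ i\<bar> \<le> \<rho> / q" using component_le_norm_cart[of x i] by simp
        then show ?thesis using B[of x] unfolding abs_mult by (intro mult_mono) auto
      next
        case False
        then show ?thesis using supp[OF False] B[of x] \<rho> q by simp
      qed
    qed (use supp in auto)
    then have "integrable (lborel \<Otimes>\<^sub>M lborel) (\<lambda>z. \<Sum>i\<in>UNIV. (case z of (t, x) \<Rightarrow> (indicator {p..q} t * (\<phi> x * x $ i)) *\<^sub>R g i (t *\<^sub>R x)))"
      by (intro Bochner_Integration.integrable_sum) auto
    also have "(\<lambda>z. \<Sum>i\<in>UNIV. (case z of (t, x) \<Rightarrow> (indicator {p..q} t * (\<phi> x * x $ i)) *\<^sub>R g i (t *\<^sub>R x)))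
      = (\<lambda>(t, x). (indicator {p..q} t * \<phi> x) *\<^sub>R S t x)"
      by (auto simp: S_def scaleR_sum_right mult.assoc)
    finally show ?thesis .
  qed
  have h[measurable]: "h \<in> borel_measurable borel" unfolding h_def by measurable
  have lh: "loc_int V h"
    unfolding loc_int_def
  proof (intro allI impI)
    fix K assume K: "compact K \<and> K \<subseteq> V"
    then obtain r where r: "0 \<le> r" "r < R / q" "K \<subseteq> cball 0 r"
      using compact_subset_ball_shrink[of K "R / q"] R q unfolding V_def by auto
    have [measurable]: "K \<in> sets borel" using K by (simp add: borel_compact)
    have "integrable (lborel \<Otimes>\<^sub>M lborel) (\<lambda>(t, x). (indicator {p..q} t * indicator K x) *\<^sub>R S t x)"
      by (rule Sint[where B=1 and \<rho>="r * q"]) (use r q in \<open>auto simp: indicator_def field_simps\<close>)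
    then have "integrable lborel (\<lambda>x. LINT t|lborel. (indicator {p..q} t * indicator K x) *\<^sub>R S t x)"
      by (rule lborel_pair.integrable_snd)
    also have "(\<lambda>x. LINT t|lborel. (indicator {p..q} t * indicator K x) *\<^sub>R S t x) = (\<lambda>x. indicator K x *\<^sub>R h x)"
      unfolding h_def by (auto simp: indicator_def)
    finally show "set_integrable lebesgue K h"
      unfolding set_integrable_def by (subst integrable_completion) auto
  qed
  have lq: "loc_int V (\<lambda>x. u (t *\<^sub>R x))" if "t \<in> {p..q}" for t
    by (rule loc_int_scale[OF lu]) (use that V pq in auto)
  define D where "D x = u (q *\<^sub>R x) - u (p *\<^sub>R x) - h x" for x
  have lD: "loc_int V D"
    unfolding D_def using lq[of q] lq[of p] lh pq by (intro loc_int_diff) auto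
  have "AE x in lebesgue. x \<in> V \<longrightarrow> D x = 0"
  proof (rule fundamental_lemma[OF _ lD])
    show "open V" by (simp add: V_def)
    fix \<phi> :: "real^'n \<Rightarrow> real" assume \<phi>: "test_fn V \<phi>"
    then have s\<phi>: "smooth_fn \<phi>" by (rule test_fn_smooth)
    note [measurable] = smooth_fn_borel[OF s\<phi>]
    obtain K where K: "compact K" "K \<subseteq> V" "\<And>x. x \<notin> K \<Longrightarrow> \<phi> x = 0" using test_fnE[OF \<phi>] by metis
    obtain r where r: "0 \<le> r" "r < R / q" "K \<subseteq> cball 0 r"
      using compact_subset_ball_shrink[of K "R / q"] R q K unfolding V_def by auto
    define \<rho> where "\<rho> = r * q"
    have \<rho>: "0 \<le> \<rho>" "\<rho> < R" "K \<subseteq> cball 0 (\<rho> / q)" using r q by (auto simp: \<rho>_def field_simps)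
    have \<phi>0: "\<phi> x = 0" if "x \<notin> cball 0 (\<rho> / q)" for x using K(3) \<rho>(3) that by blast
    obtain B where B: "\<And>x. \<bar>\<phi> x\<bar> \<le> B" using test_fn_bounded[OF \<phi>] by auto
    \<comment> \<open>Divergence of the vector field x -> \<phi>(x) x.\<close>
    define \<zeta> where "\<zeta> x = real ?n * \<phi> x + (\<Sum>i\<in>UNIV. x $ i * pd i \<phi> x)" for x
    have s\<zeta>: "smooth_fn \<zeta>"
      unfolding \<zeta>_def using s\<phi>
      by (intro smooth_fn_add smooth_fn_mult smooth_fn_sum smooth_fn_const smooth_fn_coord smooth_fn_pd) auto
    have \<zeta>0: "\<zeta> x = 0" if "x \<notin> cball 0 (\<rho> / q)" for x
      unfolding \<zeta>_def using \<phi>0[OF that] pd_eq_0_outside[of "cball 0 (\<rho> / q)" \<phi> x] \<phi>0 that by simp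
    have t\<zeta>: "test_fn V \<zeta>"
      by (rule test_fnI[of _ "cball 0 (\<rho> / q)"])
         (use s\<zeta> \<zeta>0 \<rho> q in \<open>auto simp: V_def divide_less_cancel field_simps\<close>)
    note [measurable] = smooth_fn_borel[OF s\<zeta>]
    obtain B' where B': "\<And>x. \<bar>\<zeta> x\<bar> \<le> B'" using test_fn_bounded[OF t\<zeta>] by auto
    have scale0: "\<phi> ((1/t) *\<^sub>R y) = 0" "\<zeta> ((1/t) *\<^sub>R y) = 0" if "t \<in> {p..q}" "y \<notin> cball 0 \<rho>" for t y
    proof -
      have "norm y > \<rho>" "t > 0" "t \<le> q" using that pq by auto
      then have "norm y / t > \<rho> / q" using \<rho>(1) q
        by (meson divide_left_mono divide_strict_right_mono le_less_trans mult_pos_pos)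
      then have "(1/t) *\<^sub>R y \<notin> cball 0 (\<rho> / q)" using \<open>t > 0\<close> by simp
      then show "\<phi> ((1/t) *\<^sub>R y) = 0" "\<zeta> ((1/t) *\<^sub>R y) = 0" by (rule \<phi>0, rule \<zeta>0)
    qed
    have tt: "test_fn (ball 0 R) (\<lambda>y. \<phi> ((1/t) *\<^sub>R y))" "test_fn (ball 0 R) (\<lambda>y. \<zeta> ((1/t) *\<^sub>R y))" if "t \<in> {p..q}" for t
      using that \<rho> s\<phi> s\<zeta> scale0[OF that]
      by (auto intro!: test_fnI[of _ "cball 0 \<rho>"] smooth_fn_scale)
    text \<open>Testing the weak derivatives with the fields \<open>y\<^sub>i \<phi>(y/t)\<close>.\<close>
    have div: "(LINT y|lborel. \<zeta> ((1/t) *\<^sub>R y) *\<^sub>R u y) = - (t ^ (?n + 1) *\<^sub>R (LINT x|lborel. \<phi> x *\<^sub>R S t x))"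
      if t: "t \<in> {p..q}" for t
    proof -
      have t0: "t > 0" using t pq by auto
      define \<eta> where "\<eta> i y = y $ i * \<phi> ((1/t) *\<^sub>R y)" for i and y :: "real^'n"
      have \<eta>: "test_fn (ball 0 R) (\<eta> i)" for i
        unfolding \<eta>_def by (rule test_fn_mult[OF tt(1)[OF t] smooth_fn_coord])
      have pd\<eta>: "pd i (\<eta> i) y = \<phi> ((1/t) *\<^sub>R y) + ((1/t) *\<^sub>R y) $ i * pd i \<phi> ((1/t) *\<^sub>R y)" for i y
      proof -
        have "pd i (\<eta> i) y = y $ i * pd i (\<lambda>y. \<phi> ((1/t) *\<^sub>R y)) y + pd i (\<lambda>y. y $ i) y * \<phi> ((1/t) *\<^sub>R y)"
          unfolding \<eta>_def using s\<phi>
          by (intro pd_mult smooth_fn_differentiable smooth_fn_coord smooth_fn_scale)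
        then show ?thesis
          by (simp add: pd_coord pd_scale[OF smooth_fn_differentiable[OF s\<phi>]])
      qed
      have sum\<eta>: "(\<Sum>i\<in>UNIV. pd i (\<eta> i) y) = \<zeta> ((1/t) *\<^sub>R y)" for y
        by (simp add: pd\<eta> \<zeta>_def sum.distrib)
      have i1: "integrable lebesgue (\<lambda>y. pd i (\<eta> i) y *\<^sub>R u y)" for i
        by (rule test_fn_integrable[OF test_fn_pd[OF \<eta>] lu])
      have i2: "integrable lebesgue (\<lambda>y. \<eta> i y *\<^sub>R g i y)" for i
        by (rule test_fn_integrable[OF \<eta> lg])
      have sc: "\<eta> i (t *\<^sub>R x) *\<^sub>R g i (t *\<^sub>R x) = t *\<^sub>R (\<phi> x *\<^sub>R (x $ i *\<^sub>R g i (t *\<^sub>R x)))" for i x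
        using t0 by (simp add: \<eta>_def mult_ac)
      have i3: "integrable lebesgue (\<lambda>x. \<phi> x *\<^sub>R (x $ i *\<^sub>R g i (t *\<^sub>R x)))" for i
      proof -
        have "integrable lebesgue (\<lambda>x. \<eta> i (t *\<^sub>R x) *\<^sub>R g i (t *\<^sub>R x))"
          using integrable_lebesgue_scale[OF borel_measurable_integrable[OF i2], of t i] i2 t0 by simp
        then have "integrable lebesgue (\<lambda>x. (1/t) *\<^sub>R (\<eta> i (t *\<^sub>R x) *\<^sub>R g i (t *\<^sub>R x)))"
          by (rule integrable_scaleR_right)
        then show ?thesis unfolding sc using t0 by simp
      qed
      have "(LINT y|lborel. \<zeta> ((1/t) *\<^sub>R y) *\<^sub>R u y) = (LINT y|lebesgue. \<zeta> ((1/t) *\<^sub>R y) *\<^sub>R u y)"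
        by (rule integral_completion[symmetric]) measurable
      also have "\<dots> = (LINT y|lebesgue. (\<Sum>i\<in>UNIV. pd i (\<eta> i) y *\<^sub>R u y))"
        by (simp add: sum\<eta>[symmetric] scaleR_sum_left)
      also have "\<dots> = (\<Sum>i\<in>UNIV. (LINT y|lebesgue. pd i (\<eta> i) y *\<^sub>R u y))"
        by (intro Bochner_Integration.integral_sum i1)
      also have "\<dots> = (\<Sum>i\<in>UNIV. - (LINT y|lebesgue. \<eta> i y *\<^sub>R g i y))"
        by (intro sum.cong refl) (use w \<eta> in \<open>auto simp: weak_partial_iff\<close>)
      also have "\<dots> = (\<Sum>i\<in>UNIV. - (t ^ ?n *\<^sub>R (LINT x|lebesgue. t *\<^sub>R (\<phi> x *\<^sub>R (x $ i *\<^sub>R g i (t *\<^sub>R x))))))"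
        using t0 integral_lebesgue_scale[OF borel_measurable_integrable[OF i2], of t] by (simp add: sc)
      also have "\<dots> = - (t ^ (?n + 1) *\<^sub>R (\<Sum>i\<in>UNIV. (LINT x|lebesgue. \<phi> x *\<^sub>R (x $ i *\<^sub>R g i (t *\<^sub>R x)))))"
        by (simp only: integral_scaleR_right) (simp add: sum_negf scaleR_sum_right mult.commute)
      also have "(\<Sum>i\<in>UNIV. (LINT x|lebesgue. \<phi> x *\<^sub>R (x $ i *\<^sub>R g i (t *\<^sub>R x)))) = (LINT x|lebesgue. \<phi> x *\<^sub>R S t x)"
        unfolding S_def scaleR_sum_right by (intro Bochner_Integration.integral_sum[symmetric] i3)
      also have "\<dots> = (LINT x|lborel. \<phi> x *\<^sub>R S t x)"
        by (rule integral_completion) measurable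
      finally show ?thesis .
    qed
    \<comment> \<open>Minus the derivative in \<open>t\<close> of the transported test function of
      \<open>ray_test_derivative\<close>.\<close>
    define a where "a t y = (1/t) ^ (?n + 1) * \<zeta> ((1/t) *\<^sub>R y)" for t y
    have [measurable]: "(\<lambda>(t, y). a t y) \<in> borel_measurable (borel \<Otimes>\<^sub>M borel)"
      unfolding a_def by measurable
    have acont: "continuous_on {p..q} (\<lambda>t. a t y)" for y
      unfolding a_def by (intro continuous_on_mult continuous_on_power continuous_on_divide continuous_on_const
          continuous_on_id continuous_on_test_ray[OF s\<zeta> pq(1)]) (use pq in force)
    have ftc: "(1/q) ^ ?n * \<phi> ((1/q) *\<^sub>R y) - (1/p) ^ ?n * \<phi> ((1/p) *\<^sub>R y) = - (LINT t|lborel. indicator {p..q} t * a t y)" for y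
    proof -
      have "(LINT t|lborel. indicator {p..q} t *\<^sub>R (- a t y)) = (1/q) ^ ?n * \<phi> ((1/q) *\<^sub>R y) - (1/p) ^ ?n * \<phi> ((1/p) *\<^sub>R y)"
      proof (rule integral_FTC_Icc[OF pq(2)])
        show "((\<lambda>t. (1/t) ^ ?n * \<phi> ((1/t) *\<^sub>R y)) has_vector_derivative (- a t y)) (at t within {p..q})"
          if "p \<le> t" "t \<le> q" for t
        proof -
          have "((\<lambda>t. (1/t) ^ ?n * \<phi> ((1/t) *\<^sub>R y)) has_real_derivative (- a t y)) (at t)"
            unfolding a_def \<zeta>_def by (rule ray_test_derivative[OF s\<phi>]) (use that pq in linarith)
          then show ?thesis
            unfolding has_real_derivative_iff_has_vector_derivative[symmetric]
            by (rule has_field_derivative_at_within)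
        qed
        show "continuous_on {p..q} (\<lambda>t. - a t y)"
          by (intro continuous_on_minus acont)
      qed
      then show ?thesis by simp
    qed
    have Fub1: "integrable (lborel \<Otimes>\<^sub>M lborel) (\<lambda>(t, y). (indicator {p..q} t * a t y) *\<^sub>R u y)"
    proof -
      define J where "J = (\<integral>\<^sup>+y. ennreal (norm (indicator (cball 0 \<rho>) y *\<^sub>R u y)) \<partial>lborel)"
      have J: "J < \<infinity>" using intC[OF \<rho>(2) lu u] unfolding J_def by (simp add: integrable_iff_bounded)
      define A where "A = (1/p) ^ (?n + 1) * B'"
      have A: "A \<ge> 0" using B'[of 0] pq by (auto simp: A_def)
      have aA: "\<bar>a t y\<bar> \<le> A" if "t \<in> {p..q}" for t y
        unfolding a_def A_def abs_mult
      proof (intro mult_mono B')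
        show "\<bar>(1/t) ^ (?n + 1)\<bar> \<le> (1/p) ^ (?n + 1)"
          unfolding power_abs using that pq by (intro power_mono) (auto simp: frac_le)
      qed (use pq in auto)
      have "(\<integral>\<^sup>+z. ennreal (norm (case z of (t, y) \<Rightarrow> (indicator {p..q} t * a t y) *\<^sub>R u y)) \<partial>(lborel \<Otimes>\<^sub>M lborel))
        = (\<integral>\<^sup>+t. \<integral>\<^sup>+y. ennreal (norm ((indicator {p..q} t * a t y) *\<^sub>R u y)) \<partial>lborel \<partial>lborel)"
        by (subst lborel.nn_integral_fst[symmetric]) auto
      also have "\<dots> \<le> (\<integral>\<^sup>+t. (ennreal A * J) * indicator {p..q} t \<partial>lborel)"
      proof (rule nn_integral_mono)
        fix t :: real
        have "(\<integral>\<^sup>+y. ennreal (norm ((indicator {p..q} t * a t y) *\<^sub>R u y)) \<partial>lborel)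
          \<le> (\<integral>\<^sup>+y. (ennreal A * indicator {p..q} t) * ennreal (norm (indicator (cball 0 \<rho>) y *\<^sub>R u y)) \<partial>lborel)"
        proof (rule nn_integral_mono)
          fix y
          show "ennreal (norm ((indicator {p..q} t * a t y) *\<^sub>R u y))
            \<le> (ennreal A * indicator {p..q} t) * ennreal (norm (indicator (cball 0 \<rho>) y *\<^sub>R u y))"
          proof (cases "t \<in> {p..q} \<and> y \<in> cball 0 \<rho>")
            case True
            then show ?thesis using aA[of t y] A
              by (simp add: ennreal_mult[symmetric] mult_right_mono)
          next
            case False
            then have "(indicator {p..q} t * a t y) *\<^sub>R u y = 0"
              using scale0(2)[of t y] by (cases "t \<in> {p..q}") (auto simp: a_def)
            then show ?thesis by (simp only: norm_zero ennreal_0 zero_le)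
          qed
        qed
        also have "\<dots> = (ennreal A * J) * indicator {p..q} t"
          unfolding J_def by (subst nn_integral_cmult) (auto simp: mult_ac)
        finally show "(\<integral>\<^sup>+y. ennreal (norm ((indicator {p..q} t * a t y) *\<^sub>R u y)) \<partial>lborel) \<le> (ennreal A * J) * indicator {p..q} t" .
      qed
      also have "\<dots> = ennreal A * J * ennreal (q - p)"
        using pq by (subst nn_integral_cmult_indicator) auto
      also have "\<dots> < \<infinity>" using J by (simp add: ennreal_mult_less_top)
      finally show ?thesis by (intro integrableI_bounded) auto
    qed
    have shift: "(LINT x|lebesgue. \<phi> x *\<^sub>R u (t *\<^sub>R x)) = (LINT y|lborel. ((1/t) ^ ?n * \<phi> ((1/t) *\<^sub>R y)) *\<^sub>R u y)"
      and shift_int: "integrable lborel (\<lambda>y. ((1/t) ^ ?n * \<phi> ((1/t) *\<^sub>R y)) *\<^sub>R u y)"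
      if t: "t \<in> {p..q}" for t
    proof -
      have t0: "t > 0" using t pq by auto
      have i: "integrable lebesgue (\<lambda>y. \<phi> ((1/t) *\<^sub>R y) *\<^sub>R u y)"
        by (rule test_fn_integrable[OF tt(1)[OF t] lu])
      then have "integrable lborel (\<lambda>y. \<phi> ((1/t) *\<^sub>R y) *\<^sub>R u y)"
        by (subst (asm) integrable_completion) auto
      from integrable_scaleR_right[OF this, of "(1/t) ^ ?n"]
      show "integrable lborel (\<lambda>y. ((1/t) ^ ?n * \<phi> ((1/t) *\<^sub>R y)) *\<^sub>R u y)"
        by (simp only: scaleR_scaleR)
      have "(LINT y|lborel. ((1/t) ^ ?n * \<phi> ((1/t) *\<^sub>R y)) *\<^sub>R u y) = (LINT y|lborel. (1/t) ^ ?n *\<^sub>R (\<phi> ((1/t) *\<^sub>R y) *\<^sub>R u y))"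
        by (simp only: scaleR_scaleR)
      also have "\<dots> = (1/t) ^ ?n *\<^sub>R (LINT y|lborel. \<phi> ((1/t) *\<^sub>R y) *\<^sub>R u y)"
        by (rule integral_scaleR_right)
      also have "(LINT y|lborel. \<phi> ((1/t) *\<^sub>R y) *\<^sub>R u y) = (LINT y|lebesgue. \<phi> ((1/t) *\<^sub>R y) *\<^sub>R u y)"
        by (rule integral_completion[symmetric]) measurable
      also have "\<dots> = t ^ ?n *\<^sub>R (LINT x|lebesgue. \<phi> x *\<^sub>R u (t *\<^sub>R x))"
        using integral_lebesgue_scale[OF borel_measurable_integrable[OF i], of t] t0 by simp
      finally show "(LINT x|lebesgue. \<phi> x *\<^sub>R u (t *\<^sub>R x)) = (LINT y|lborel. ((1/t) ^ ?n * \<phi> ((1/t) *\<^sub>R y)) *\<^sub>R u y)"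
        using t0 by (simp add: power_one_over)
    qed
    have Fub2: "integrable (lborel \<Otimes>\<^sub>M lborel) (\<lambda>(t, x). (indicator {p..q} t * \<phi> x) *\<^sub>R S t x)"
      by (rule Sint[OF _ B \<phi>0 \<rho>(1,2)]) auto
    have "(LINT x|lebesgue. \<phi> x *\<^sub>R u (q *\<^sub>R x)) - (LINT x|lebesgue. \<phi> x *\<^sub>R u (p *\<^sub>R x))
      = (LINT y|lborel. ((1/q) ^ ?n * \<phi> ((1/q) *\<^sub>R y)) *\<^sub>R u y) - (LINT y|lborel. ((1/p) ^ ?n * \<phi> ((1/p) *\<^sub>R y)) *\<^sub>R u y)"
      using pq by (simp add: shift)
    also have "\<dots> = (LINT y|lborel. ((1/q) ^ ?n * \<phi> ((1/q) *\<^sub>R y)) *\<^sub>R u y - ((1/p) ^ ?n * \<phi> ((1/p) *\<^sub>R y)) *\<^sub>R u y)"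
      using pq by (intro Bochner_Integration.integral_diff[symmetric] shift_int) auto
    also have "\<dots> = (LINT y|lborel. - (LINT t|lborel. indicator {p..q} t * a t y) *\<^sub>R u y)"
      by (simp only: scaleR_diff_left[symmetric] ftc)
    also have "\<dots> = - (LINT y|lborel. (LINT t|lborel. (indicator {p..q} t * a t y) *\<^sub>R u y))"
    proof -
      have "(LINT t|lborel. (indicator {p..q} t * a t y) *\<^sub>R u y) = (LINT t|lborel. indicator {p..q} t * a t y) *\<^sub>R u y" for y
      proof -
        have "integrable lborel (\<lambda>t. indicator {p..q} t * a t y)"
          using borel_integrable_compact[of "{p..q}" "\<lambda>t. a t y"] acont by (simp add: set_integrable_def)
        then show ?thesis by (intro integral_scaleR_left) auto
      qed
      then show ?thesis by simp
    qed
    also have "(LINT y|lborel. (LINT t|lborel. (indicator {p..q} t * a t y) *\<^sub>R u y))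
      = (LINT t|lborel. (LINT y|lborel. (indicator {p..q} t * a t y) *\<^sub>R u y))"
      by (rule lborel_pair.Fubini_integral[OF Fub1])
    also have "- \<dots> = (LINT t|lborel. (LINT x|lborel. (indicator {p..q} t * \<phi> x) *\<^sub>R S t x))"
    proof -
      have "(LINT y|lborel. (indicator {p..q} t * a t y) *\<^sub>R u y) = - (LINT x|lborel. (indicator {p..q} t * \<phi> x) *\<^sub>R S t x)" for t
      proof (cases "t \<in> {p..q}")
        case True
        then have t0: "t > 0" using pq by auto
        have "(LINT y|lborel. (indicator {p..q} t * a t y) *\<^sub>R u y) = (LINT y|lborel. (1/t) ^ (?n + 1) *\<^sub>R (\<zeta> ((1/t) *\<^sub>R y) *\<^sub>R u y))"
          using True by (simp only: a_def scaleR_scaleR indicator_simps mult_1_left)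
        also have "\<dots> = (1/t) ^ (?n + 1) *\<^sub>R (LINT y|lborel. \<zeta> ((1/t) *\<^sub>R y) *\<^sub>R u y)"
          by (rule integral_scaleR_right)
        also have "\<dots> = - (LINT x|lborel. \<phi> x *\<^sub>R S t x)"
          unfolding div[OF True] using t0 by (simp add: power_one_over)
        finally show ?thesis using True by simp
      qed simp
      then show ?thesis by simp
    qed
    also have "\<dots> = (LINT x|lborel. (LINT t|lborel. (indicator {p..q} t * \<phi> x) *\<^sub>R S t x))"
      by (rule lborel_pair.Fubini_integral[OF Fub2, symmetric])
    also have "\<dots> = (LINT x|lborel. \<phi> x *\<^sub>R h x)"
    proof -
      have "(LINT t|lborel. (indicator {p..q} t * \<phi> x) *\<^sub>R S t x) = \<phi> x *\<^sub>R h x" for x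
        unfolding h_def integral_scaleR_right[symmetric] by (simp add: mult_ac)
      then show ?thesis by simp
    qed
    also have "\<dots> = (LINT x|lebesgue. \<phi> x *\<^sub>R h x)"
      by (rule integral_completion[symmetric]) measurable
    finally have eq: "(LINT x|lebesgue. \<phi> x *\<^sub>R u (q *\<^sub>R x)) - (LINT x|lebesgue. \<phi> x *\<^sub>R u (p *\<^sub>R x)) = (LINT x|lebesgue. \<phi> x *\<^sub>R h x)" .
    have iq: "integrable lebesgue (\<lambda>x. \<phi> x *\<^sub>R u (q *\<^sub>R x))" "integrable lebesgue (\<lambda>x. \<phi> x *\<^sub>R u (p *\<^sub>R x))"
      "integrable lebesgue (\<lambda>x. \<phi> x *\<^sub>R h x)"
      using test_fn_integrable[OF \<phi>] lq[of q] lq[of p] lh pq by auto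
    have "(LINT x|lebesgue. \<phi> x *\<^sub>R D x) = (LINT x|lebesgue. \<phi> x *\<^sub>R u (q *\<^sub>R x)) - (LINT x|lebesgue. \<phi> x *\<^sub>R u (p *\<^sub>R x)) - (LINT x|lebesgue. \<phi> x *\<^sub>R h x)"
      unfolding D_def scaleR_diff_right using iq by simp
    then show "(LINT x|lebesgue. \<phi> x *\<^sub>R D x) = 0" using eq by simp
  qed
  then have "AE x in lborel. x \<in> V \<longrightarrow> D x = 0" by (simp add: AE_completion_iff)
  then show ?thesis
  proof eventually_elim
    fix x assume x: "x \<in> V \<longrightarrow> D x = 0"
    show "q * norm x < R \<longrightarrow>
      ennreal (norm (u (q *\<^sub>R x) - u (p *\<^sub>R x))) \<le> (\<integral>\<^sup>+t\<in>{p..q}. ennreal (norm (\<Sum>i\<in>UNIV. x $ i *\<^sub>R g i (t *\<^sub>R x))) \<partial>lborel)"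
    proof
      assume "q * norm x < R"
      then have "x \<in> V" using q by (simp add: V_def field_simps)
      then have eq: "u (q *\<^sub>R x) - u (p *\<^sub>R x) = h x" using x by (simp add: D_def)
      have "ennreal (norm (h x)) \<le> (\<integral>\<^sup>+t. ennreal (norm (indicator {p..q} t *\<^sub>R S t x)) \<partial>lborel)"
      \<comment> \<open>Where the ray integral does not exist, \<open>h x\<close> is 0 by the
        convention for Bochner integrals and the bound is trivial.\<close>
      proof (cases "integrable lborel (\<lambda>t. indicator {p..q} t *\<^sub>R S t x)")
        case True
        then show ?thesis unfolding h_def by (rule integral_norm_bound_ennreal)
      qed (simp add: h_def not_integrable_integral_eq)
      also have "\<dots> = (\<integral>\<^sup>+t\<in>{p..q}. ennreal (norm (S t x)) \<partial>lborel)"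
        by (intro nn_integral_cong) (auto simp: indicator_def)
      finally show "ennreal (norm (u (q *\<^sub>R x) - u (p *\<^sub>R x))) \<le> (\<integral>\<^sup>+t\<in>{p..q}. ennreal (norm (\<Sum>i\<in>UNIV. x $ i *\<^sub>R g i (t *\<^sub>R x))) \<partial>lborel)"
        unfolding eq S_def .
    qed
  qed
qed

section \<open>Weak compactness\<close>

lemma norm_sq_vec: "(norm (x :: 'a::real_inner ^ 'n::finite))\<^sup>2 = (\<Sum>i\<in>UNIV. (norm (x $ i))\<^sup>2)"
  by (simp add: norm_vec_def L2_set_def sum_nonneg)

text \<open>A substitute for the convex hull of the tail from index \<open>n\<close> on: the
  parallelogram identity needs only midpoints, and every linear estimate passes to midpoints by
  induction.\<close>

inductive_set midpoint_hull :: "(nat \<Rightarrow> 'a \<Rightarrow> 'b::real_vector) \<Rightarrow> nat \<Rightarrow> ('a \<Rightarrow> 'b) set"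
  for H :: "nat \<Rightarrow> 'a \<Rightarrow> 'b" and n :: nat where
  base: "n \<le> k \<Longrightarrow> H k \<in> midpoint_hull H n"
| mid: "f \<in> midpoint_hull H n \<Longrightarrow> g \<in> midpoint_hull H n \<Longrightarrow> (\<lambda>x. (1/2) *\<^sub>R (f x + g x)) \<in> midpoint_hull H n"

lemma midpoint_hull_antimono: "m \<le> n \<Longrightarrow> midpoint_hull H n \<subseteq> midpoint_hull H m"
proof
  fix f assume "f \<in> midpoint_hull H n" "m \<le> n"
  then show "f \<in> midpoint_hull H m"
    by (induction rule: midpoint_hull.induct) (auto intro: midpoint_hull.intros)
qed

lemma norm_midpoint_sq:
  fixes a b :: "'b::real_inner"
  shows "(norm ((1/2) *\<^sub>R (a + b)))\<^sup>2 = (1/2) * (norm a)\<^sup>2 + (1/2) * (norm b)\<^sup>2 - (1/4) * (norm (a - b))\<^sup>2"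
  by (simp add: power2_norm_eq_inner inner_add inner_diff inner_commute algebra_simps)

lemma integrable_norm_if_square:
  fixes f :: "'a \<Rightarrow> 'b::euclidean_space"
  assumes "finite_measure M" "f \<in> borel_measurable M" "integrable M (\<lambda>x. (norm (f x))\<^sup>2)"
  shows "integrable M f"
proof (rule Bochner_Integration.integrable_bound[of M "\<lambda>x. 1 + (norm (f x))\<^sup>2"])
  interpret finite_measure M by fact
  show "integrable M (\<lambda>x. 1 + (norm (f x))\<^sup>2)" using assms(3) by auto
  have "t \<le> 1 + t\<^sup>2" for t :: real
  proof -
    have "2 * t \<le> t\<^sup>2 + 1" using sum_squares_bound[of t 1] by simp
    then show ?thesis using zero_le_power2[of t] by linarith
  qed
  then show "AE x in M. norm (f x) \<le> norm (1 + (norm (f x))\<^sup>2)" by (simp add: abs_of_nonneg)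
qed fact

text \<open>Almost norm-minimal elements of the tail hulls form a Cauchy sequence by the parallelogram identity;
  their limit inherits every limit of bounded linear functionals along the original sequence.\<close>
theorem weak_compactness_L2:
  fixes H :: "nat \<Rightarrow> 'a \<Rightarrow> 'b::euclidean_space"
  assumes M: "finite_measure M" and Hm: "\<And>k. H k \<in> borel_measurable M"
    and HC: "\<And>k. (\<integral>\<^sup>+x. ennreal ((norm (H k x))\<^sup>2) \<partial>M) \<le> ennreal C" and C: "C \<ge> 0"
  shows "\<exists>f. f \<in> borel_measurable M \<and> (\<integral>\<^sup>+x. ennreal ((norm (f x))\<^sup>2) \<partial>M) \<le> ennreal C \<and>
    (\<forall>\<phi> B l. \<phi> \<in> borel_measurable M \<longrightarrow> (\<forall>x. \<bar>\<phi> x\<bar> \<le> (B::real)) \<longrightarrow>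
       (\<lambda>k. LINT x|M. \<phi> x *\<^sub>R H k x) \<longlonglongrightarrow> l \<longrightarrow> (LINT x|M. \<phi> x *\<^sub>R f x) = l)"
proof -
  interpret finite_measure M by fact
  define sq where "sq f = (LINT x|M. (norm (f x))\<^sup>2)" for f :: "'a \<Rightarrow> 'b"
  define L where "L = {f :: 'a \<Rightarrow> 'b. f \<in> borel_measurable M \<and> integrable M (\<lambda>x. (norm (f x))\<^sup>2)}"
  define K where "K = midpoint_hull H"
  have sq0: "sq f \<ge> 0" for f by (simp add: sq_def)
  have sqnn: "(\<integral>\<^sup>+x. ennreal ((norm (f x))\<^sup>2) \<partial>M) = ennreal (sq f)" if "f \<in> L" for f
    unfolding sq_def by (rule nn_integral_eq_integral) (use that in \<open>auto simp: L_def\<close>)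
  have HL: "H k \<in> L" for k
  proof -
    have "(\<integral>\<^sup>+x. ennreal (norm ((norm (H k x))\<^sup>2)) \<partial>M) < \<infinity>"
      using HC[of k] by (simp add: le_less_trans ennreal_less_top)
    then show ?thesis unfolding L_def using Hm[of k] by (auto intro!: integrableI_bounded)
  qed
  have Hsq: "sq (H k) \<le> C" for k using HC[of k] sqnn[OF HL[of k]] C by simp
  have diffL: "(\<lambda>x. f x - g x) \<in> L" and midL: "(\<lambda>x. (1/2) *\<^sub>R (f x + g x)) \<in> L"
    and midsq: "sq (\<lambda>x. (1/2) *\<^sub>R (f x + g x)) = (1/2) * sq f + (1/2) * sq g - (1/4) * sq (\<lambda>x. f x - g x)"
    if f: "f \<in> L" and g: "g \<in> L" for f g
  proof -
    have [measurable]: "f \<in> borel_measurable M" "g \<in> borel_measurable M" using f g by (simp_all add: L_def)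
    have i: "integrable M (\<lambda>x. (norm (f x))\<^sup>2)" "integrable M (\<lambda>x. (norm (g x))\<^sup>2)"
      using f g by (auto simp: L_def)
    have le: "(norm (a - b))\<^sup>2 \<le> 2 * (norm a)\<^sup>2 + 2 * (norm b)\<^sup>2" for a b :: 'b
      using norm_midpoint_sq[of a b] zero_le_power2[of "norm ((1/2) *\<^sub>R (a + b))"] by linarith
    have d: "integrable M (\<lambda>x. (norm (f x - g x))\<^sup>2)"
    proof (rule Bochner_Integration.integrable_bound)
      show "integrable M (\<lambda>x. 2 * (norm (f x))\<^sup>2 + 2 * (norm (g x))\<^sup>2)"
        by (intro Bochner_Integration.integrable_add integrable_mult_right i)
      show "AE x in M. norm ((norm (f x - g x))\<^sup>2) \<le> norm (2 * (norm (f x))\<^sup>2 + 2 * (norm (g x))\<^sup>2)"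
        using le by (intro AE_I2) (simp add: abs_of_nonneg)
    qed measurable
    then show "(\<lambda>x. f x - g x) \<in> L" by (simp add: L_def)
    show "(\<lambda>x. (1/2) *\<^sub>R (f x + g x)) \<in> L"
      unfolding L_def mem_Collect_eq norm_midpoint_sq
      by (intro conjI Bochner_Integration.integrable_add Bochner_Integration.integrable_diff integrable_mult_right i d) measurable
    show "sq (\<lambda>x. (1/2) *\<^sub>R (f x + g x)) = (1/2) * sq f + (1/2) * sq g - (1/4) * sq (\<lambda>x. f x - g x)"
      unfolding sq_def norm_midpoint_sq using i d by simp
  qed
  have KL: "f \<in> L \<and> sq f \<le> C" if "f \<in> K n" for f n
    using that unfolding K_def
  proof (induction rule: midpoint_hull.induct)
    case (mid f g)
    then show ?case using midL[of f g] midsq[of f g] sq0[of "\<lambda>x. f x - g x"] by simp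
  qed (simp add: HL Hsq)
  \<comment> \<open>Least squared norm on the tail hull. The hulls shrink, so \<open>d\<close>
    increases; it is bounded by \<open>C\<close> and hence converges, which is what makes
    near-minimizers of different hulls close to each other.\<close>
  define d where "d n = Inf (sq ` K n)" for n
  have bdd: "bdd_below (sq ` K n)" for n using sq0 by (intro bdd_belowI[of _ 0]) auto
  have HK: "H n \<in> K n" for n unfolding K_def by (rule midpoint_hull.base) simp
  have d_le: "d n \<le> sq f" if "f \<in> K n" for f n
    unfolding d_def by (rule cInf_lower[OF imageI[OF that] bdd])
  have d_mono: "d m \<le> d n" if "m \<le> n" for m n
    unfolding d_def
    by (rule cInf_superset_mono) (use HK[of n] bdd midpoint_hull_antimono[OF that, of H] in \<open>auto simp: K_def\<close>)
  have dC: "d n \<le> C" for n using d_le[OF HK[of n]] Hsq[of n] by linarith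
  have "convergent d"
  proof -
    have "incseq d" using d_mono by (simp add: incseq_def)
    then obtain l where "d \<longlonglongrightarrow> l" using incseq_convergent[of d C] dC by blast
    then show ?thesis by (rule convergentI)
  qed
  have "\<exists>f. f \<in> K n \<and> sq f < d n + 1 / (real n + 1)" for n
  proof -
    have "\<exists>y\<in>sq ` K n. y < d n + 1 / (real n + 1)"
      using HK[of n] bdd[of n] unfolding d_def by (subst cInf_less_iff[symmetric]) auto
    then show ?thesis by auto
  qed
  then obtain F where F: "\<And>n. F n \<in> K n" "\<And>n. sq (F n) < d n + 1 / (real n + 1)" by metis
  have FL: "F n \<in> L" for n using KL F(1) by blast
  have diff_est: "sq (\<lambda>x. F n x - F m x) \<le> 2 * (d m - d n) + 4 / (real n + 1)" if nm: "n \<le> m" for n m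
  proof -
    \<comment> \<open>Both functions, and therefore their midpoint, lie in the larger hull
      \<open>K n\<close>, so the squared norm of the midpoint is at least
      \<open>d n\<close>.\<close>
    have "F m \<in> K n" using F(1)[of m] midpoint_hull_antimono[OF nm, of H] by (auto simp: K_def)
    then have "(\<lambda>x. (1/2) *\<^sub>R (F n x + F m x)) \<in> K n"
      using F(1)[of n] unfolding K_def by (intro midpoint_hull.mid)
    from d_le[OF this] have A: "d n \<le> (1/2) * sq (F n) + (1/2) * sq (F m) - (1/4) * sq (\<lambda>x. F n x - F m x)"
      by (simp add: midsq FL)
    have E: "1 / (real m + 1) \<le> 1 / (real n + 1)" using nm by (simp add: frac_le)
    have lin: "s \<le> 2 * (dm - dn) + 4 * en"
      if "dn \<le> (1/2) * fn + (1/2) * fm - (1/4) * s" "em \<le> en" "fn \<le> dn + en" "fm \<le> dm + em" for s dn dm fn fm en em :: real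
      using that by argo
    show ?thesis
      using lin[OF A E less_imp_le[OF F(2)] less_imp_le[OF F(2)]] by simp
  qed
  \<comment> \<open>A rate (1/4)^i for squared distances gives distances in L1 of order (1/2)^i,
    which are summable and force pointwise convergence almost everywhere.\<close>
  have "\<exists>N. \<forall>n\<ge>N. \<forall>m\<ge>n. sq (\<lambda>x. F n x - F m x) \<le> (1/4) ^ i" for i :: nat
  proof -
    define e where "e = (1/4::real) ^ i / 8"
    have e: "e > 0" by (simp add: e_def)
    obtain N1 where N1: "\<And>m n. m \<ge> N1 \<Longrightarrow> n \<ge> N1 \<Longrightarrow> \<bar>d m - d n\<bar> < e"
      using \<open>convergent d\<close> e unfolding Cauchy_convergent_iff[symmetric] Cauchy_def dist_real_def by metis
    obtain N2 where N2: "1 / e < real N2" using reals_Archimedean2 by blast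
    have "sq (\<lambda>x. F n x - F m x) \<le> (1/4) ^ i" if "n \<ge> max N1 N2" "m \<ge> n" for n m
    proof -
      have "1 / e < real n + 1" using N2 that by simp
      then have "4 / (real n + 1) < 4 * e" using e by (simp add: field_simps)
      moreover have "d m - d n < e" using N1[of m n] that by auto
      ultimately have "sq (\<lambda>x. F n x - F m x) \<le> 8 * e" using diff_est[OF that(2)] e by argo
      then show ?thesis by (simp add: e_def)
    qed
    then show ?thesis by blast
  qed
  then obtain N where N: "\<And>i n m. n \<ge> N i \<Longrightarrow> m \<ge> n \<Longrightarrow> sq (\<lambda>x. F n x - F m x) \<le> (1/4) ^ i" by metis
  \<comment> \<open>Summing the thresholds makes the indices monotone while still dominating each
    \<open>N i\<close>; the summand \<open>i\<close> sends them to infinity.\<close>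
  define r where "r i = (\<Sum>j\<le>i. N j) + i" for i
  have r_mono: "r i \<le> r j" if "i \<le> j" for i j
    unfolding r_def using that by (intro add_mono sum_mono2) auto
  have rN: "r i \<ge> N i" for i unfolding r_def by (simp add: sum.atMost_Suc_shift member_le_sum trans_le_add1)
  have r_ge: "r i \<ge> i" for i by (simp add: r_def)
  define G where "G i = F (r i)" for i
  have GL: "G i \<in> L" for i by (simp add: G_def FL)
  then have Gm[measurable]: "G i \<in> borel_measurable M" for i by (simp add: L_def)
  have Gd: "sq (\<lambda>x. G i x - G j x) \<le> (1/4) ^ i" if "i \<le> j" for i j
    unfolding G_def using N[OF rN r_mono[OF that]] .
  define \<mu> where "\<mu> = measure M (space M)"
  have \<mu>: "\<mu> \<ge> 0" by (simp add: \<mu>_def)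
  have L1: "(\<integral>\<^sup>+x. ennreal (norm (f x)) \<partial>M) \<le> ennreal ((1/2) ^ i * (1 + \<mu>))" if f: "f \<in> L" "sq f \<le> (1/4) ^ i" for f i
  proof -
    have "norm (f x) \<le> 2 ^ i * (norm (f x))\<^sup>2 + (1/2) ^ i" for x
    proof -
      have "2 * norm (f x) \<le> 2 ^ i * (norm (f x))\<^sup>2 + (1/2) ^ i"
      proof -
        have "2 * (norm (f x) * 2 ^ i) * 1 \<le> (norm (f x) * 2 ^ i)\<^sup>2 + 1\<^sup>2" by (rule sum_squares_bound)
        then have "(2 * (norm (f x) * 2 ^ i)) * (1/2) ^ i \<le> ((norm (f x) * 2 ^ i)\<^sup>2 + 1) * (1/2) ^ i"
          by (intro mult_right_mono) auto
        then show ?thesis by (simp add: power2_eq_square power_one_over field_simps)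
      qed
      then show ?thesis using norm_ge_zero[of "f x"] by argo
    qed
    then have "(\<integral>\<^sup>+x. ennreal (norm (f x)) \<partial>M) \<le> (\<integral>\<^sup>+x. ennreal (2 ^ i * (norm (f x))\<^sup>2 + (1/2) ^ i) \<partial>M)"
      by (intro nn_integral_mono ennreal_leI)
    also have "\<dots> = ennreal (LINT x|M. (2 ^ i * (norm (f x))\<^sup>2 + (1/2) ^ i))"
      using f by (intro nn_integral_eq_integral) (auto simp: L_def)
    also have "(LINT x|M. (2 ^ i * (norm (f x))\<^sup>2 + (1/2) ^ i)) = 2 ^ i * sq f + (1/2) ^ i * \<mu>"
      using f by (subst Bochner_Integration.integral_add) (auto simp: L_def sq_def \<mu>_def mult.commute)
    also have "\<dots> \<le> 2 ^ i * (1/4) ^ i + (1/2) ^ i * \<mu>" using f by (intro add_right_mono mult_left_mono) auto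
    also have "2 ^ i * (1/4::real) ^ i = (1/2) ^ i" by (simp add: power_mult_distrib[symmetric])
    also have "(1/2) ^ i + (1/2) ^ i * \<mu> = (1/2) ^ i * (1 + \<mu>)" by (simp add: algebra_simps)
    finally show ?thesis by (simp add: ennreal_leI)
  qed
  have "(\<integral>\<^sup>+x. (\<Sum>i. ennreal (norm (G (Suc i) x - G i x))) \<partial>M) = (\<Sum>i. (\<integral>\<^sup>+x. ennreal (norm (G (Suc i) x - G i x)) \<partial>M))"
    by (rule nn_integral_suminf) measurable
  also have "\<dots> \<le> (\<Sum>i. ennreal ((1/2) ^ i * (1 + \<mu>)))"
  proof (rule suminf_le)
    fix i
    have "sq (\<lambda>x. G (Suc i) x - G i x) = sq (\<lambda>x. G i x - G (Suc i) x)" by (simp add: sq_def norm_minus_commute)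
    then show "(\<integral>\<^sup>+x. ennreal (norm (G (Suc i) x - G i x)) \<partial>M) \<le> ennreal ((1/2) ^ i * (1 + \<mu>))"
      using L1[OF diffL[OF GL GL], of "Suc i" i i] Gd[of i "Suc i"] by simp
  qed auto
  also have "\<dots> = ennreal (\<Sum>i. (1/2) ^ i * (1 + \<mu>))"
    using \<mu> by (intro suminf_ennreal2 summable_mult2) (auto simp: summable_geometric)
  also have "\<dots> < \<infinity>" by simp
  finally have "(\<integral>\<^sup>+x. (\<Sum>i. ennreal (norm (G (Suc i) x - G i x))) \<partial>M) \<noteq> \<infinity>" by simp
  then have "AE x in M. (\<Sum>i. ennreal (norm (G (Suc i) x - G i x))) \<noteq> \<infinity>"
    by (intro nn_integral_noteq_infinite) auto
  then have conv: "AE x in M. convergent (\<lambda>i. G i x)"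
  proof eventually_elim
    fix x assume "(\<Sum>i. ennreal (norm (G (Suc i) x - G i x))) \<noteq> \<infinity>"
    then have "summable (\<lambda>i. norm (G (Suc i) x - G i x))"
      by (intro summable_suminf_not_top) auto
    then have "summable (\<lambda>i. G (Suc i) x - G i x)" by (rule summable_norm_cancel)
    then have "convergent (\<lambda>n. \<Sum>i<n. G (Suc i) x - G i x)" by (simp add: summable_iff_convergent)
    then have "convergent (\<lambda>n. G n x - G 0 x)" using sum_lessThan_telescope[of "\<lambda>i. G i x"] by simp
    then show "convergent (\<lambda>i. G i x)" using convergent_diff_const_right_iff[of "\<lambda>n. G n x" "G 0 x"] by simp
  qed
  define f where "f x = lim (\<lambda>i. G i x)" for x
  have fm[measurable]: "f \<in> borel_measurable M" unfolding f_def by measurable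
  have lim: "AE x in M. (\<lambda>i. G i x) \<longlonglongrightarrow> f x"
    using conv by eventually_elim (simp add: f_def convergent_LIMSEQ_iff)
  have fC: "(\<integral>\<^sup>+x. ennreal ((norm (f x))\<^sup>2) \<partial>M) \<le> ennreal C"
  proof -
    have "(\<integral>\<^sup>+x. ennreal ((norm (f x))\<^sup>2) \<partial>M) = (\<integral>\<^sup>+x. liminf (\<lambda>i. ennreal ((norm (G i x))\<^sup>2)) \<partial>M)"
    proof (rule nn_integral_cong_AE)
      show "AE x in M. ennreal ((norm (f x))\<^sup>2) = liminf (\<lambda>i. ennreal ((norm (G i x))\<^sup>2))"
        using lim
      proof eventually_elim
        fix x assume "(\<lambda>i. G i x) \<longlonglongrightarrow> f x"
        then have "(\<lambda>i. ennreal ((norm (G i x))\<^sup>2)) \<longlonglongrightarrow> ennreal ((norm (f x))\<^sup>2)"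
          by (intro tendsto_ennrealI tendsto_power tendsto_norm)
        then show "ennreal ((norm (f x))\<^sup>2) = liminf (\<lambda>i. ennreal ((norm (G i x))\<^sup>2))"
          by (intro lim_imp_Liminf[symmetric]) auto
      qed
    qed
    also have "\<dots> \<le> liminf (\<lambda>i. (\<integral>\<^sup>+x. ennreal ((norm (G i x))\<^sup>2) \<partial>M))"
      by (rule nn_integral_liminf) measurable
    also have "\<dots> \<le> ennreal C"
    proof (rule Liminf_le)
      have "sq (G i) \<le> C" for i using KL[OF F(1)] by (simp add: G_def)
      then show "\<forall>\<^sub>F i in sequentially. (\<integral>\<^sup>+x. ennreal ((norm (G i x))\<^sup>2) \<partial>M) \<le> ennreal C"
        using sqnn[OF GL] by (auto intro!: always_eventually ennreal_leI)
    qed auto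
    finally show ?thesis .
  qed
  have fL: "f \<in> L"
  proof -
    have "(\<integral>\<^sup>+x. ennreal (norm ((norm (f x))\<^sup>2)) \<partial>M) < \<infinity>"
      using fC by (simp add: le_less_trans ennreal_less_top)
    then show ?thesis unfolding L_def by (auto intro!: integrableI_bounded)
  qed
  \<comment> \<open>Fatou's lemma in the second index turns the Cauchy estimate into a rate of
    convergence to the pointwise limit.\<close>
  have fG: "sq (\<lambda>x. G i x - f x) \<le> (1/4) ^ i" for i
  proof -
    have "ennreal (sq (\<lambda>x. G i x - f x)) = (\<integral>\<^sup>+x. ennreal ((norm (G i x - f x))\<^sup>2) \<partial>M)"
      using sqnn[OF diffL[OF GL fL]] by simp
    also have "\<dots> = (\<integral>\<^sup>+x. liminf (\<lambda>j. ennreal ((norm (G i x - G j x))\<^sup>2)) \<partial>M)"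
    proof (rule nn_integral_cong_AE)
      show "AE x in M. ennreal ((norm (G i x - f x))\<^sup>2) = liminf (\<lambda>j. ennreal ((norm (G i x - G j x))\<^sup>2))"
        using lim
      proof eventually_elim
        fix x assume "(\<lambda>i. G i x) \<longlonglongrightarrow> f x"
        then have "(\<lambda>j. ennreal ((norm (G i x - G j x))\<^sup>2)) \<longlonglongrightarrow> ennreal ((norm (G i x - f x))\<^sup>2)"
          by (intro tendsto_ennrealI tendsto_power tendsto_norm tendsto_diff tendsto_const)
        then show "ennreal ((norm (G i x - f x))\<^sup>2) = liminf (\<lambda>j. ennreal ((norm (G i x - G j x))\<^sup>2))"
          by (intro lim_imp_Liminf[symmetric]) auto
      qed
    qed
    also have "\<dots> \<le> liminf (\<lambda>j. (\<integral>\<^sup>+x. ennreal ((norm (G i x - G j x))\<^sup>2) \<partial>M))"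
      by (rule nn_integral_liminf) measurable
    also have "\<dots> \<le> ennreal ((1/4) ^ i)"
    proof (rule Liminf_le)
      show "\<forall>\<^sub>F j in sequentially. (\<integral>\<^sup>+x. ennreal ((norm (G i x - G j x))\<^sup>2) \<partial>M) \<le> ennreal ((1/4) ^ i)"
        using eventually_ge_at_top[of i]
      proof eventually_elim
        case (elim j)
        then show ?case using sqnn[OF diffL[OF GL GL], of i j] Gd[of i j] by (simp add: ennreal_leI)
      qed
    qed auto
    finally show ?thesis by simp
  qed
  have int: "integrable M g" if "g \<in> L" for g
    by (rule integrable_norm_if_square[OF M]) (use that in \<open>simp_all add: L_def\<close>)
  show ?thesis
  proof (intro exI[of _ f] conjI fm fC allI impI)
    fix \<phi> :: "'a \<Rightarrow> real" and B l
    assume \<phi>[measurable]: "\<phi> \<in> borel_measurable M" and "\<forall>x. \<bar>\<phi> x\<bar> \<le> B"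
      and "(\<lambda>k. LINT x|M. \<phi> x *\<^sub>R H k x) \<longlonglongrightarrow> l"
    then have B: "\<And>x. \<bar>\<phi> x\<bar> \<le> B"
      and l: "(\<lambda>k. LINT x|M. \<phi> x *\<^sub>R H k x) \<longlonglongrightarrow> l" by auto
    have B0: "B \<ge> 0" using B abs_ge_zero order_trans by blast
    have \<phi>int: "integrable M (\<lambda>x. \<phi> x *\<^sub>R g x)" if "g \<in> L" for g
    proof (rule Bochner_Integration.integrable_bound[OF integrable_scaleR_right[OF int[OF that], of B]])
      show "(\<lambda>x. \<phi> x *\<^sub>R g x) \<in> borel_measurable M" using that by (auto simp: L_def)
      show "AE x in M. norm (\<phi> x *\<^sub>R g x) \<le> norm (B *\<^sub>R g x)"
        using B B0 by (auto intro!: mult_right_mono)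
    qed
    \<comment> \<open>The distance to \<open>l\<close> is convex, so a bound on the tail of the
      sequence persists on the whole hull. This transfers the limit from \<open>H\<close> to the
      midpoint combinations \<open>G\<close>.\<close>
    have hull: "norm ((LINT x|M. \<phi> x *\<^sub>R g x) - l) \<le> e"
      if "g \<in> K n" "\<And>k. k \<ge> n \<Longrightarrow> norm ((LINT x|M. \<phi> x *\<^sub>R H k x) - l) \<le> e" for g n e
      using that(1) unfolding K_def
    proof (induction rule: midpoint_hull.induct)
      case (mid g g')
      have gL: "g \<in> L" "g' \<in> L" using mid(1,2) KL[of _ n] by (auto simp: K_def)
      have "(LINT x|M. \<phi> x *\<^sub>R ((1/2) *\<^sub>R (g x + g' x))) = (LINT x|M. (1/2) *\<^sub>R (\<phi> x *\<^sub>R g x + \<phi> x *\<^sub>R g' x))"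
        by (simp add: scaleR_add_right mult.commute)
      also have "\<dots> = (1/2) *\<^sub>R ((LINT x|M. \<phi> x *\<^sub>R g x) + (LINT x|M. \<phi> x *\<^sub>R g' x))"
        unfolding integral_scaleR_right using gL by (simp add: \<phi>int)
      finally have "(LINT x|M. \<phi> x *\<^sub>R ((1/2) *\<^sub>R (g x + g' x))) - l
         = (1/2) *\<^sub>R (((LINT x|M. \<phi> x *\<^sub>R g x) - l) + ((LINT x|M. \<phi> x *\<^sub>R g' x) - l))"
        by (simp add: algebra_simps scaleR_2[symmetric] flip: scaleR_add_left)
      then have "norm ((LINT x|M. \<phi> x *\<^sub>R ((1/2) *\<^sub>R (g x + g' x))) - l)
         = norm (((LINT x|M. \<phi> x *\<^sub>R g x) - l) + ((LINT x|M. \<phi> x *\<^sub>R g' x) - l)) / 2" by simp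
      also have "\<dots> \<le> (e + e) / 2" using mid norm_triangle_mono[OF mid(3,4)] by (intro divide_right_mono) auto
      finally show ?case by simp
    qed (use that(2) in auto)
    have "(\<lambda>i. LINT x|M. \<phi> x *\<^sub>R G i x) \<longlonglongrightarrow> l"
    proof (rule LIMSEQ_I)
      fix e :: real assume "e > 0"
      then obtain n0 where n0: "\<And>k. k \<ge> n0 \<Longrightarrow> norm ((LINT x|M. \<phi> x *\<^sub>R H k x) - l) < e / 2"
        using LIMSEQ_D[OF l, of "e/2"] by auto
      have "norm ((LINT x|M. \<phi> x *\<^sub>R G i x) - l) < e" if "i \<ge> n0" for i
      proof -
        have "norm ((LINT x|M. \<phi> x *\<^sub>R G i x) - l) \<le> e / 2"
          by (rule hull[of "G i" "r i"]) (use F(1) n0 r_ge[of i] that in \<open>auto simp: G_def less_imp_le\<close>)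
        then show ?thesis using \<open>e > 0\<close> by linarith
      qed
      then show "\<exists>n0. \<forall>i\<ge>n0. norm ((LINT x|M. \<phi> x *\<^sub>R G i x) - l) < e" by blast
    qed
    moreover have "(\<lambda>i. LINT x|M. \<phi> x *\<^sub>R G i x) \<longlonglongrightarrow> (LINT x|M. \<phi> x *\<^sub>R f x)"
    proof (rule metric_tendsto_imp_tendsto)
      show "(\<lambda>i. B * ((1/2) ^ i * (1 + \<mu>))) \<longlonglongrightarrow> 0"
        by (intro tendsto_mult_right_zero tendsto_mult_left_zero LIMSEQ_power_zero) simp
      have "norm ((LINT x|M. \<phi> x *\<^sub>R G i x) - (LINT x|M. \<phi> x *\<^sub>R f x)) \<le> B * ((1/2) ^ i * (1 + \<mu>))" for i
      proof -
        have i1: "integrable M (\<lambda>x. G i x - f x)" by (rule int[OF diffL[OF GL fL]])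
        have "(LINT x|M. \<phi> x *\<^sub>R G i x) - (LINT x|M. \<phi> x *\<^sub>R f x) = (LINT x|M. \<phi> x *\<^sub>R (G i x - f x))"
          unfolding scaleR_diff_right using \<phi>int[OF GL] \<phi>int[OF fL] by simp
        also have "norm \<dots> \<le> (LINT x|M. norm (\<phi> x *\<^sub>R (G i x - f x)))" by (rule integral_norm_bound)
        also have "\<dots> \<le> (LINT x|M. B * norm (G i x - f x))"
          by (rule integral_mono[OF integrable_norm[OF \<phi>int[OF diffL[OF GL fL]]] integrable_mult_right[OF integrable_norm[OF i1]]])
             (use B in \<open>auto intro!: mult_right_mono\<close>)
        also have "\<dots> = B * (LINT x|M. norm (G i x - f x))" by simp
        also have "\<dots> \<le> B * ((1/2) ^ i * (1 + \<mu>))"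
        proof (rule mult_left_mono[OF _ B0])
          have "ennreal (LINT x|M. norm (G i x - f x)) = (\<integral>\<^sup>+x. ennreal (norm (G i x - f x)) \<partial>M)"
            using i1 by (intro nn_integral_eq_integral[symmetric]) auto
          also have "\<dots> \<le> ennreal ((1/2) ^ i * (1 + \<mu>))" by (rule L1[OF diffL[OF GL fL] fG])
          finally show "(LINT x|M. norm (G i x - f x)) \<le> (1/2) ^ i * (1 + \<mu>)"
            using \<mu> by (subst (asm) ennreal_le_iff) auto
        qed
        finally show ?thesis .
      qed
      then show "\<forall>\<^sub>F i in sequentially. dist (LINT x|M. \<phi> x *\<^sub>R G i x) (LINT x|M. \<phi> x *\<^sub>R f x) \<le> dist (B * ((1/2) ^ i * (1 + \<mu>))) 0"
        using B0 \<mu> by (auto simp: dist_norm intro!: always_eventually)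
    qed
    ultimately show "(LINT x|M. \<phi> x *\<^sub>R f x) = l" using LIMSEQ_unique by blast
  qed
qed

text \<open>Removes the choices hidden in \<open>hess_sq\<close>. The inner \<open>wd\<close> agrees
  with \<open>g i\<close> only almost everywhere, so weak differentiability has to be carried over
  to it before the outer one can be compared.\<close>

lemma hess_sq_AE_eq:
  assumes U: "open U" and g: "\<And>i. weak_partial U u i (g i)" and H: "\<And>i j. weak_partial U (g i) j (H i j)"
  shows "AE x in lebesgue. x \<in> U \<longrightarrow> hess_sq U u x = (\<Sum>i\<in>UNIV. \<Sum>j\<in>UNIV. (norm (H i j x))\<^sup>2)"
proof -
  have "AE x in lebesgue. x \<in> U \<longrightarrow> wd U (wd U u i) j x = H i j x" for i j
  proof (rule wd_AE_eq[OF U])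
    show "weak_partial U (wd U u i) j (H i j)"
      by (rule weak_partial_cong_AE[OF H[of i j]])
         (use wd_AE_eq[OF U g[of i]] in \<open>auto elim!: eventually_mono\<close>)
  qed
  then have "AE x in lebesgue. \<forall>i\<in>UNIV. \<forall>j\<in>UNIV. x \<in> U \<longrightarrow> wd U (wd U u i) j x = H i j x"
    by (intro AE_finite_allI) auto
  then show ?thesis by eventually_elim (auto simp: hess_sq_def)
qed

section \<open>Lower semicontinuity of the Hessian energy\<close>

lemma Lp2_set_integrable:
  fixes f :: "real^'n::finite \<Rightarrow> 'b::euclidean_space"
  assumes f: "Lp 2 U f" and U: "U \<in> lmeasurable"
  shows "set_integrable lebesgue U f"
proof -
  have fin: "finite_measure (lebesgue_on U)" using U by (rule finite_measure_lebesgue_on)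
  have m: "f \<in> borel_measurable (lebesgue_on U)" using f by (simp add: Lp_def)
  have "(\<integral>\<^sup>+x. ennreal (norm ((norm (f x))\<^sup>2)) \<partial>lebesgue_on U) < \<infinity>"
    using f U by (simp add: Lp_def nn_integral_restrict_space fmeasurableD)
  then have "integrable (lebesgue_on U) (\<lambda>x. (norm (f x))\<^sup>2)"
    using m by (intro integrableI_bounded) auto
  then have "integrable (lebesgue_on U) f" by (rule integrable_norm_if_square[OF fin m])
  then show ?thesis using U
    by (subst (asm) integrable_restrict_space) (auto simp: set_integrable_def fmeasurableD)
qed

lemma Lp2_loc_int:
  assumes "Lp 2 U f" "U \<in> lmeasurable"
  shows "loc_int U f"
  unfolding loc_int_def
  by (auto intro!: set_integrable_subset[OF Lp2_set_integrable[OF assms]] simp: borel_compact)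

text \<open>The bounded Hessians have a weak limit in L2 with the same bound. After two integrations
  by parts against a test function, distributional convergence of the maps \<open>v k\<close>
  identifies this limit with the second derivatives of \<open>u\<close>.\<close>

theorem W2_lower_semicontinuity:
  fixes u :: "real^2 \<Rightarrow> real^3"
  assumes U: "open U" "U \<in> lmeasurable"
    and u: "Lp 2 U u" and g: "\<And>i. weak_partial U u i (g i)" "\<And>i. Lp 2 U (g i)"
    and v: "\<And>k i. weak_partial U (v k) i (G k i)" and G: "\<And>k i j. weak_partial U (G k i) j (H k i j)"
    and H: "\<And>k i j. H k i j \<in> borel_measurable (lebesgue_on U)"
    and C: "\<And>k. (\<integral>\<^sup>+x\<in>U. ennreal (\<Sum>i\<in>UNIV. \<Sum>j\<in>UNIV. (norm (H k i j x))\<^sup>2) \<partial>lebesgue) \<le> ennreal C" "C \<ge> 0"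
    and conv: "\<And>\<phi>. test_fn U \<phi> \<Longrightarrow> (\<lambda>k. LINT x|lebesgue. \<phi> x *\<^sub>R v k x) \<longlonglongrightarrow> (LINT x|lebesgue. \<phi> x *\<^sub>R u x)"
  shows "W2 2 U u \<and> (\<integral>\<^sup>+x\<in>U. ennreal (hess_sq U u x) \<partial>lebesgue) \<le> ennreal C"
proof -
  let ?M = "lebesgue_on U"
  have Us: "U \<in> sets lebesgue" using U by (simp add: fmeasurableD)
  \<comment> \<open>All second derivatives are packed into one vector-valued function, so that one
    weak limit and one norm bound control their sum of squares.\<close>
  define HH :: "nat \<Rightarrow> real^2 \<Rightarrow> real^3^2^2" where "HH k x = (\<chi> i j. H k i j x)" for k x
  have HHn: "(norm (HH k x))\<^sup>2 = (\<Sum>i\<in>UNIV. \<Sum>j\<in>UNIV. (norm (H k i j x))\<^sup>2)" for k x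
    by (simp add: norm_sq_vec HH_def)
  have Hc: "(\<lambda>x. H k i j x $ l) \<in> borel_measurable ?M" for k i j l
    by (rule measurable_compose[OF H borel_measurable_continuous_onI]) (intro continuous_intros)
  have HHm: "HH k \<in> borel_measurable ?M" for k
    by (subst borel_measurable_euclidean_space) (auto simp: Basis_vec_def inner_axis HH_def Hc)
  have fin: "finite_measure ?M" using U(2) by (rule finite_measure_lebesgue_on)
  have HHC: "(\<integral>\<^sup>+x. ennreal ((norm (HH k x))\<^sup>2) \<partial>?M) \<le> ennreal C" for k
    using C(1)[of k] Us unfolding HHn by (subst nn_integral_restrict_space) auto
  have HHint: "integrable ?M F" if "F \<in> borel_measurable ?M" "(\<integral>\<^sup>+x. ennreal ((norm (F x))\<^sup>2) \<partial>?M) \<le> ennreal C"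
    for F :: "real^2 \<Rightarrow> real^3^2^2"
  proof (rule integrable_norm_if_square[OF fin that(1)])
    show "integrable ?M (\<lambda>x. (norm (F x))\<^sup>2)"
      using that by (intro integrableI_bounded) (auto simp: le_less_trans ennreal_less_top)
  qed
  obtain f where fm: "f \<in> borel_measurable ?M" and fC: "(\<integral>\<^sup>+x. ennreal ((norm (f x))\<^sup>2) \<partial>?M) \<le> ennreal C"
    and fl: "\<forall>\<phi> B l. \<phi> \<in> borel_measurable ?M \<longrightarrow> (\<forall>x. \<bar>\<phi> x\<bar> \<le> (B::real)) \<longrightarrow>
       (\<lambda>k. LINT x|?M. \<phi> x *\<^sub>R HH k x) \<longlonglongrightarrow> l \<longrightarrow> (LINT x|?M. \<phi> x *\<^sub>R f x) = l"
    using weak_compactness_L2[of ?M HH, OF fin HHm HHC C(2)] by (elim exE conjE)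
  define h where "h i j x = f x $ i $ j" for i j x
  have bl: "bounded_linear (\<lambda>y::real^3^2^2. y $ i $ j)" for i j
    using bounded_linear_compose[OF bounded_linear_vec_nth bounded_linear_vec_nth] .
  have hm: "h i j \<in> borel_measurable ?M" for i j
    unfolding h_def by (rule measurable_compose[OF fm borel_measurable_continuous_onI])
      (intro linear_continuous_on bl)
  have fn: "(norm (f x))\<^sup>2 = (\<Sum>i\<in>UNIV. \<Sum>j\<in>UNIV. (norm (h i j x))\<^sup>2)" for x
    by (simp add: norm_sq_vec h_def)
  have fC': "(\<integral>\<^sup>+x\<in>U. ennreal (\<Sum>i\<in>UNIV. \<Sum>j\<in>UNIV. (norm (h i j x))\<^sup>2) \<partial>lebesgue) \<le> ennreal C"
    using fC Us unfolding fn by (subst (asm) nn_integral_restrict_space) auto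
  have hL: "Lp 2 U (h i j)" for i j
  proof -
    have "(\<integral>\<^sup>+x\<in>U. ennreal ((norm (h i j x))\<^sup>2) \<partial>lebesgue) \<le> (\<integral>\<^sup>+x\<in>U. ennreal (\<Sum>i\<in>UNIV. \<Sum>j\<in>UNIV. (norm (h i j x))\<^sup>2) \<partial>lebesgue)"
    proof (intro nn_integral_mono mult_right_mono ennreal_leI)
      fix x
      have "(norm (h i j x))\<^sup>2 \<le> (\<Sum>j\<in>UNIV. (norm (h i j x))\<^sup>2)" by (rule member_le_sum) auto
      also have "\<dots> \<le> (\<Sum>i\<in>UNIV. \<Sum>j\<in>UNIV. (norm (h i j x))\<^sup>2)"
        by (rule member_le_sum[of i UNIV "\<lambda>i. \<Sum>j\<in>UNIV. (norm (h i j x))\<^sup>2"]) (auto intro: sum_nonneg)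
      finally show "(norm (h i j x))\<^sup>2 \<le> (\<Sum>i\<in>UNIV. \<Sum>j\<in>UNIV. (norm (h i j x))\<^sup>2)" .
    qed auto
    also have "\<dots> < \<infinity>" using fC' by (simp add: le_less_trans ennreal_less_top)
    finally show ?thesis using hm by (simp add: Lp_def)
  qed
  have Mint: "(LINT x|?M. \<phi> x *\<^sub>R F x) = (LINT x|lebesgue. \<phi> x *\<^sub>R F x)"
    if "test_fn U \<phi>" for \<phi> and F :: "real^2 \<Rightarrow> 'c::{banach,second_countable_topology}"
    using Us set_integral_test_fn[OF that, of F]
    by (subst integral_restrict_space) (auto simp: set_lebesgue_integral_def)
  have wf: "weak_partial U (g i) j (h i j)" for i j
    unfolding weak_partial_iff
  proof (intro conjI allI impI)
    show "loc_int U (g i)" by (rule Lp2_loc_int[OF g(2) U(2)])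
    show "loc_int U (h i j)" by (rule Lp2_loc_int[OF hL U(2)])
    fix \<phi> :: "real^2 \<Rightarrow> real" assume \<phi>: "test_fn U \<phi>"
    obtain B where B: "\<And>x. \<bar>\<phi> x\<bar> \<le> B" using test_fn_bounded[OF \<phi>] by auto
    have \<phi>m: "\<phi> \<in> borel_measurable ?M"
      using smooth_fn_lebesgue[OF test_fn_smooth[OF \<phi>]] by (rule measurable_restrict_space1)
    have \<phi>int: "integrable ?M (\<lambda>x. \<phi> x *\<^sub>R F x)" if F: "integrable ?M F" for F :: "real^2 \<Rightarrow> real^3^2^2"
    proof (rule Bochner_Integration.integrable_bound[OF integrable_scaleR_right[OF F, of B]])
      show "(\<lambda>x. \<phi> x *\<^sub>R F x) \<in> borel_measurable ?M" using F \<phi>m by auto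
      have "\<bar>\<phi> x\<bar> \<le> \<bar>B\<bar>" for x using B[of x] by linarith
      then show "AE x in ?M. norm (\<phi> x *\<^sub>R F x) \<le> norm (B *\<^sub>R F x)"
        by (auto intro!: mult_right_mono)
    qed
    have comp: "(LINT x|?M. \<phi> x *\<^sub>R F x) $ i $ j = (LINT x|lebesgue. \<phi> x *\<^sub>R (F x $ i $ j))"
      if F: "integrable ?M F" for F :: "real^2 \<Rightarrow> real^3^2^2" and i j
      using integral_bounded_linear[OF bl[of i j] \<phi>int[OF F]] Mint[OF \<phi>, of "\<lambda>x. F x $ i $ j"] by simp
    \<comment> \<open>The limit of the pairings is prescribed by \<open>u\<close>: two integrations
      by parts reduce them to pairings of \<open>v k\<close> with second derivatives of
      \<open>\<phi>\<close>, which converge by assumption.\<close>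
    define l :: "real^3^2^2" where "l = (\<chi> i j. - (LINT x|lebesgue. pd j \<phi> x *\<^sub>R g i x))"
    have "(\<lambda>k. LINT x|?M. \<phi> x *\<^sub>R HH k x) \<longlonglongrightarrow> l"
    proof (rule vec_tendstoI, rule vec_tendstoI)
      fix i j
      have "(LINT x|?M. \<phi> x *\<^sub>R HH k x) $ i $ j = (LINT x|lebesgue. pd i (pd j \<phi>) x *\<^sub>R v k x)" for k
      proof -
        have "(LINT x|?M. \<phi> x *\<^sub>R HH k x) $ i $ j = (LINT x|lebesgue. \<phi> x *\<^sub>R H k i j x)"
          by (subst comp[OF HHint[OF HHm HHC]]) (simp add: HH_def)
        also have "\<dots> = - (LINT x|lebesgue. pd j \<phi> x *\<^sub>R G k i x)"
          using G[of k i j] \<phi> by (simp add: weak_partial_iff)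
        also have "\<dots> = (LINT x|lebesgue. pd i (pd j \<phi>) x *\<^sub>R v k x)"
          using v[of k i] test_fn_pd[OF \<phi>, of j] by (simp add: weak_partial_iff)
        finally show ?thesis .
      qed
      moreover have "l $ i $ j = (LINT x|lebesgue. pd i (pd j \<phi>) x *\<^sub>R u x)"
        using g(1)[of i] test_fn_pd[OF \<phi>, of j] by (simp add: weak_partial_iff l_def)
      ultimately show "(\<lambda>k. (LINT x|?M. \<phi> x *\<^sub>R HH k x) $ i $ j) \<longlonglongrightarrow> l $ i $ j"
        using conv[OF test_fn_pd[OF test_fn_pd[OF \<phi>]], of i j] by simp
    qed
    with fl \<phi>m B have "(LINT x|?M. \<phi> x *\<^sub>R f x) = l" by blast
    then have "(LINT x|?M. \<phi> x *\<^sub>R f x) $ i $ j = l $ i $ j" by simp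
    then have "(LINT x|lebesgue. \<phi> x *\<^sub>R h i j x) = - (LINT x|lebesgue. pd j \<phi> x *\<^sub>R g i x)"
      by (subst (asm) comp[OF HHint[OF fm fC]]) (simp add: h_def l_def)
    then show "(LINT x|lebesgue. pd j \<phi> x *\<^sub>R g i x) = - (LINT x|lebesgue. \<phi> x *\<^sub>R h i j x)" by simp
  qed
  have "W2 2 U u" unfolding W2_def using u g wf hL by blast
  moreover have "(\<integral>\<^sup>+x\<in>U. ennreal (hess_sq U u x) \<partial>lebesgue)
    = (\<integral>\<^sup>+x\<in>U. ennreal (\<Sum>i\<in>UNIV. \<Sum>j\<in>UNIV. (norm (h i j x))\<^sup>2) \<partial>lebesgue)"
    by (rule nn_integral_cong_AE)
       (use hess_sq_AE_eq[OF U(1) g(1) wf] in \<open>auto elim!: eventually_mono simp: indicator_def\<close>)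
  ultimately show ?thesis using fC' by simp
qed

section \<open>Energy along rays\<close>

lemma O23_iff: "Q \<in> O23 \<longleftrightarrow> (\<forall>i j. (\<Sum>k\<in>UNIV. Q $ k $ i * Q $ k $ j) = (if i = j then 1 else 0))"
  by (auto simp: O23_def vec_eq_iff matrix_matrix_mult_def transpose_def mat_def)

lemma closed_O23: "closed O23"
proof -
  have "O23 = {Q. \<forall>i j. (\<Sum>k\<in>UNIV. Q $ k $ i * Q $ k $ j) = (if i = j then 1 else 0)}"
    by (auto simp: O23_iff)
  also have "closed \<dots>"
    by (intro closed_Collect_all closed_Collect_eq continuous_intros)
  finally show ?thesis .
qed

lemma O23_nonempty: "O23 \<noteq> {}"
proof -
  define Q :: "real^2^3" where "Q = (\<chi> k j. if k = 1 then (if j = 1 then 1 else 0) else if k = 2 then (if j = 2 then 1 else 0) else 0)"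
  have "Q \<in> O23" unfolding O23_iff forall_2 sum_3 by (simp add: Q_def)
  then show ?thesis by auto
qed

lemma norm_O23:
  assumes "Q \<in> O23"
  shows "(norm Q)\<^sup>2 = 2"
proof -
  have "(norm Q)\<^sup>2 = (\<Sum>k\<in>UNIV. \<Sum>i\<in>UNIV. Q $ k $ i * Q $ k $ i)"
    by (simp add: norm_sq_vec) (simp add: power2_eq_square)
  also have "\<dots> = (\<Sum>i\<in>UNIV. \<Sum>k\<in>UNIV. Q $ k $ i * Q $ k $ i)" by (rule sum.swap)
  also have "\<dots> = 2" using assms by (simp add: O23_iff)
  finally show ?thesis .
qed

lemma norm_O23_mult:
  assumes "Q \<in> O23"
  shows "norm (Q *v x) = norm x"
proof -
  have q: "(\<Sum>k\<in>UNIV. Q $ k $ 1 * Q $ k $ 1) = 1" "(\<Sum>k\<in>UNIV. Q $ k $ 2 * Q $ k $ 2) = 1"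
    "(\<Sum>k\<in>UNIV. Q $ k $ 1 * Q $ k $ 2) = 0"
    using assms by (auto simp: O23_iff)
  have "(norm (Q *v x))\<^sup>2 = (\<Sum>k\<in>UNIV. (Q $ k $ 1 * x $ 1 + Q $ k $ 2 * x $ 2)\<^sup>2)"
    by (simp add: norm_sq_vec matrix_vector_mult_def sum_2)
  also have "\<dots> = (\<Sum>k\<in>UNIV. Q $ k $ 1 * Q $ k $ 1 * (x $ 1)\<^sup>2 + Q $ k $ 2 * Q $ k $ 2 * (x $ 2)\<^sup>2 + Q $ k $ 1 * Q $ k $ 2 * (2 * x $ 1 * x $ 2))"
    by (intro sum.cong) (auto simp: power2_eq_square algebra_simps)
  also have "\<dots> = (x $ 1)\<^sup>2 + (x $ 2)\<^sup>2"
    by (simp only: sum.distrib sum_distrib_right[symmetric] q mult_1_left mult_zero_left add_0_right)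
  also have "\<dots> = (norm x)\<^sup>2" by (simp add: norm_sq_vec sum_2)
  finally show ?thesis by (simp add: power2_eq_iff_nonneg)
qed

lemma norm_matrix_mult_le:
  fixes A :: "real^'n::finite^'m::finite"
  shows "norm (A *v x) \<le> norm A * norm x"
proof -
  have "((A *v x) $ k)\<^sup>2 \<le> (norm (A $ k))\<^sup>2 * (norm x)\<^sup>2" for k
  proof -
    have "(A *v x) $ k = A $ k \<bullet> x" by (simp add: matrix_vector_mult_def inner_vec_def)
    then show ?thesis using Cauchy_Schwarz_ineq[of "A $ k" x] by (simp add: power2_norm_eq_inner)
  qed
  then have "(norm (A *v x))\<^sup>2 \<le> (\<Sum>k\<in>UNIV. (norm (A $ k))\<^sup>2 * (norm x)\<^sup>2)"
    unfolding norm_sq_vec[of "A *v x"] by (intro sum_mono) simp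
  also have "\<dots> = (norm A * norm x)\<^sup>2"
    by (simp add: sum_distrib_right[symmetric] norm_sq_vec[of A] power_mult_distrib)
  finally show ?thesis by (rule power2_le_imp_le) simp
qed

text \<open>\<open>O23\<close> is closed, so a nearest element \<open>Q\<close> exists. In
  \<open>P = Q + (P - Q)\<close> the first part preserves lengths and has squared norm 2, and the
  second has the distance as its norm.\<close>

lemma infdist_O23_bounds:
  fixes P :: "real^2^3"
  shows "norm (P *v x) \<le> norm x * (1 + infdist P O23)"
    and "(norm P)\<^sup>2 \<le> 4 + 2 * (infdist P O23)\<^sup>2"
proof -
  obtain Q where Q: "Q \<in> O23" "infdist P O23 = dist P Q"
    using infdist_attains_inf[OF closed_O23 O23_nonempty] by metis
  have "P *v x = Q *v x + (P - Q) *v x"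
    by (simp add: matrix_vector_mult_diff_rdistrib)
  then have "norm (P *v x) \<le> norm (Q *v x) + norm ((P - Q) *v x)" by (metis norm_triangle_ineq)
  also have "\<dots> \<le> norm x + norm (P - Q) * norm x"
    using norm_O23_mult[OF Q(1)] norm_matrix_mult_le[of "P - Q" x] by simp
  finally show "norm (P *v x) \<le> norm x * (1 + infdist P O23)"
    by (simp add: Q(2) dist_norm algebra_simps)
  have "norm P \<le> norm Q + norm (P - Q)" by (metis add.commute diff_add_cancel norm_triangle_ineq)
  then have "(norm P)\<^sup>2 \<le> (norm Q + norm (P - Q))\<^sup>2" by (intro power_mono) auto
  also have "\<dots> \<le> 2 * (norm Q)\<^sup>2 + 2 * (norm (P - Q))\<^sup>2"
    using sum_squares_bound[of "norm Q" "norm (P - Q)"] by (simp add: power2_sum)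
  finally show "(norm P)\<^sup>2 \<le> 4 + 2 * (infdist P O23)\<^sup>2"
    by (simp add: norm_O23[OF Q(1)] Q(2) dist_norm)
qed

lemma nn_integral_lborel_scale:
  fixes f :: "'a::euclidean_space \<Rightarrow> ennreal"
  assumes f: "f \<in> borel_measurable borel" and t: "t > 0"
  shows "(\<integral>\<^sup>+x. f (t *\<^sub>R x) \<partial>lborel) = ennreal (1 / t ^ DIM('a)) * (\<integral>\<^sup>+x. f x \<partial>lborel)"
proof -
  have "f \<in> borel_measurable lebesgue" using f by (intro measurable_completion) simp
  from nn_integral_lebesgue_scale[OF this, of t] t
  have "(\<integral>\<^sup>+x. f x \<partial>lborel) = ennreal (t ^ DIM('a)) * (\<integral>\<^sup>+x. f (t *\<^sub>R x) \<partial>lborel)"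
    by (simp add: nn_integral_completion)
  then have "ennreal (1 / t ^ DIM('a)) * (\<integral>\<^sup>+x. f x \<partial>lborel)
    = (ennreal (1 / t ^ DIM('a)) * ennreal (t ^ DIM('a))) * (\<integral>\<^sup>+x. f (t *\<^sub>R x) \<partial>lborel)"
    by (simp only: mult.assoc)
  also have "ennreal (1 / t ^ DIM('a)) * ennreal (t ^ DIM('a)) = 1"
    using t by (simp add: ennreal_mult[symmetric])
  finally show ?thesis by simp
qed

lemma nn_integral_inverse_Icc:
  assumes "0 < a" "a \<le> b"
  shows "(\<integral>\<^sup>+s\<in>{a..b}. ennreal (1 / s) \<partial>lborel) = ennreal (ln (b / a))"
proof -
  have "(\<integral>\<^sup>+s. ennreal (1 / s) * indicator {a..b} s \<partial>lborel) = ennreal (ln b - ln a)"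
    by (rule nn_integral_FTC_Icc) (use assms in \<open>auto intro!: derivative_eq_intros\<close>)
  then show ?thesis using assms by (simp add: ln_div)
qed

text \<open>Cauchy-Schwarz on the interval from \<open>p\<close> to \<open>q\<close>, applied to
  \<open>ray_bound\<close>.\<close>

lemma ray_energy:
  fixes u :: "real^'n::finite \<Rightarrow> 'b::euclidean_space"
  assumes u: "u \<in> borel_measurable borel" and g[measurable]: "\<And>i. g i \<in> borel_measurable borel"
    and w: "\<And>i. weak_partial (ball 0 R) u i (g i)" and pq: "0 < p" "p \<le> q"
  shows "AE x in lborel. q * norm x < R \<longrightarrow>
    ennreal ((norm (u (q *\<^sub>R x) - u (p *\<^sub>R x)))\<^sup>2)
      \<le> ennreal (q - p) * (\<integral>\<^sup>+t\<in>{p..q}. ennreal ((norm (\<Sum>i\<in>UNIV. x $ i *\<^sub>R g i (t *\<^sub>R x)))\<^sup>2) \<partial>lborel)"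
  using ray_bound[OF u g w pq]
proof eventually_elim
  fix x :: "real^'n"
  define S where "S t = norm (\<Sum>i\<in>UNIV. x $ i *\<^sub>R g i (t *\<^sub>R x))" for t
  have [measurable]: "S \<in> borel_measurable borel" unfolding S_def by measurable
  assume le: "q * norm x < R \<longrightarrow>
    ennreal (norm (u (q *\<^sub>R x) - u (p *\<^sub>R x))) \<le> (\<integral>\<^sup>+t\<in>{p..q}. ennreal (norm (\<Sum>i\<in>UNIV. x $ i *\<^sub>R g i (t *\<^sub>R x))) \<partial>lborel)"
  have "(\<integral>\<^sup>+t\<in>{p..q}. ennreal (S t) \<partial>lborel)\<^sup>2 = (\<integral>\<^sup>+t. indicator {p..q} t * (ennreal (S t) * indicator {p..q} t) \<partial>lborel)\<^sup>2"
    by (intro arg_cong[of _ _ "\<lambda>z. z\<^sup>2"] nn_integral_cong) (auto simp: indicator_def)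
  also have "\<dots> \<le> (\<integral>\<^sup>+t. (indicator {p..q} t)\<^sup>2 \<partial>lborel) * (\<integral>\<^sup>+t. (ennreal (S t) * indicator {p..q} t)\<^sup>2 \<partial>lborel)"
    by (rule Cauchy_Schwarz_nn_integral) measurable
  also have "(\<integral>\<^sup>+t. (indicator {p..q} t)\<^sup>2 \<partial>lborel) = (\<integral>\<^sup>+t. indicator {p..q} t \<partial>lborel)"
    by (intro nn_integral_cong) (auto simp: indicator_def)
  also have "\<dots> = ennreal (q - p)" using pq by simp
  also have "(\<integral>\<^sup>+t. (ennreal (S t) * indicator {p..q} t)\<^sup>2 \<partial>lborel) = (\<integral>\<^sup>+t\<in>{p..q}. ennreal ((S t)\<^sup>2) \<partial>lborel)"
    by (intro nn_integral_cong) (auto simp: indicator_def ennreal_power S_def)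
  finally have cs: "(\<integral>\<^sup>+t\<in>{p..q}. ennreal (S t) \<partial>lborel)\<^sup>2 \<le> ennreal (q - p) * (\<integral>\<^sup>+t\<in>{p..q}. ennreal ((S t)\<^sup>2) \<partial>lborel)" .
  show "q * norm x < R \<longrightarrow>
    ennreal ((norm (u (q *\<^sub>R x) - u (p *\<^sub>R x)))\<^sup>2)
      \<le> ennreal (q - p) * (\<integral>\<^sup>+t\<in>{p..q}. ennreal ((norm (\<Sum>i\<in>UNIV. x $ i *\<^sub>R g i (t *\<^sub>R x)))\<^sup>2) \<partial>lborel)"
  proof
    assume "q * norm x < R"
    then have "(ennreal (norm (u (q *\<^sub>R x) - u (p *\<^sub>R x))))\<^sup>2 \<le> (\<integral>\<^sup>+t\<in>{p..q}. ennreal (S t) \<partial>lborel)\<^sup>2"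
      using le unfolding S_def by (intro power_mono) auto
    with cs show "ennreal ((norm (u (q *\<^sub>R x) - u (p *\<^sub>R x)))\<^sup>2)
      \<le> ennreal (q - p) * (\<integral>\<^sup>+t\<in>{p..q}. ennreal ((norm (\<Sum>i\<in>UNIV. x $ i *\<^sub>R g i (t *\<^sub>R x)))\<^sup>2) \<partial>lborel)"
      unfolding S_def by (simp add: ennreal_power)
  qed
qed

text \<open>The ray estimate holds outside a null set that depends on the endpoints, so only
  countably many pairs can be treated at once, and these avoid the centre and the boundary circle.
  Continuity extends it to all real endpoints, including 0 and \<open>T\<close>; approximating from
  inside the interval only decreases the right-hand side.\<close>

lemma ray_energy_endpoints:
  fixes f :: "real \<Rightarrow> 'b::real_normed_vector"
  assumes rat: "\<And>p q::rat. 0 < p \<Longrightarrow> p \<le> q \<Longrightarrow> of_rat q < T \<Longrightarrow>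
      ennreal ((norm (f (of_rat q) - f (of_rat p)))\<^sup>2) \<le> ennreal (of_rat q - of_rat p) * (\<integral>\<^sup>+t\<in>{of_rat p..of_rat q}. S t \<partial>lborel)"
    and cont: "continuous_on {0..T} f" and pq: "0 \<le> p" "p < q" "q \<le> T"
  shows "ennreal ((norm (f q - f p))\<^sup>2) \<le> ennreal (q - p) * (\<integral>\<^sup>+t\<in>{p..q}. S t \<partial>lborel)"
proof -
  \<comment> \<open>At most half the length of the interval, so that the rational approximations of
    the two endpoints stay in the right order.\<close>
  define e where "e n = (q - p) / (2 * (real n + 1))" for n
  have e: "0 < e n" "e n \<le> (q - p) / 2" for n
  proof -
    show "0 < e n" using pq by (simp add: e_def)
    then have "e n * 1 \<le> e n * (real n + 1)" by (intro mult_left_mono) auto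
    also have "e n * (real n + 1) = (q - p) / 2" by (simp add: e_def divide_simps)
    finally show "e n \<le> (q - p) / 2" by simp
  qed
  have elim: "e \<longlonglongrightarrow> 0"
  proof -
    have "(\<lambda>n. ((q - p) / 2) * inverse (real (Suc n))) \<longlonglongrightarrow> ((q - p) / 2) * 0"
      by (intro tendsto_mult tendsto_const LIMSEQ_inverse_real_of_nat)
    moreover have "e = (\<lambda>n. ((q - p) / 2) * inverse (real (Suc n)))"
      by (auto simp: e_def fun_eq_iff divide_simps)
    ultimately show ?thesis by simp
  qed
  have "\<exists>a::rat. p < of_rat a \<and> of_rat a < p + e n" for n
    using of_rat_dense[of p "p + e n"] e by auto
  then obtain a :: "nat \<Rightarrow> rat" where a: "\<And>n. p < of_rat (a n)" "\<And>n. of_rat (a n) < p + e n" by metis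
  have "\<exists>b::rat. q - e n < of_rat b \<and> of_rat b < q" for n
    using of_rat_dense[of "q - e n" q] e by auto
  then obtain b :: "nat \<Rightarrow> rat" where b: "\<And>n. q - e n < of_rat (b n)" "\<And>n. of_rat (b n) < q" by metis
  have ab: "(of_rat (a n)::real) < of_rat (b n)" for n
    using a(2)[of n] b(1)[of n] e[of n] by argo
  have alim: "(\<lambda>n. of_rat (a n)) \<longlonglongrightarrow> p"
  proof (rule tendsto_sandwich[of "\<lambda>_. p"])
    show "(\<lambda>n. p + e n) \<longlonglongrightarrow> p" using tendsto_add[OF tendsto_const elim, of p] by simp
  qed (use a less_imp_le in \<open>auto intro!: always_eventually\<close>)
  have blim: "(\<lambda>n. of_rat (b n)) \<longlonglongrightarrow> q"
  proof (rule tendsto_sandwich[of "\<lambda>n. q - e n" _ _ "\<lambda>_. q"])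
    show "(\<lambda>n. q - e n) \<longlonglongrightarrow> q" using tendsto_diff[OF tendsto_const elim, of q] by simp
  qed (use b less_imp_le in \<open>auto intro!: always_eventually\<close>)
  have in0T: "of_rat (a n) \<in> {0..T}" "of_rat (b n) \<in> {0..T}" for n
    unfolding atLeastAtMost_iff using a(1)[of n] b(2)[of n] ab[of n] pq by linarith+
  have "(\<lambda>n. f (of_rat (a n))) \<longlonglongrightarrow> f p" "(\<lambda>n. f (of_rat (b n))) \<longlonglongrightarrow> f q"
    using pq in0T by (auto intro!: continuous_on_tendsto_compose[OF cont] alim blim)
  then have "(\<lambda>n. ennreal ((norm (f (of_rat (b n)) - f (of_rat (a n))))\<^sup>2)) \<longlonglongrightarrow> ennreal ((norm (f q - f p))\<^sup>2)"
    by (intro tendsto_ennrealI tendsto_power tendsto_norm tendsto_diff)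
  then show ?thesis
  proof (rule LIMSEQ_le_const2, intro exI allI impI)
    fix n :: nat
    have "(0::real) < of_rat (a n)" "of_rat (b n) < T" using a(1)[of n] b(2)[of n] pq by linarith+
    moreover have "a n \<le> b n" using ab[of n] by (simp add: of_rat_less less_imp_le)
    ultimately have "ennreal ((norm (f (of_rat (b n)) - f (of_rat (a n))))\<^sup>2)
      \<le> ennreal (of_rat (b n) - of_rat (a n)) * (\<integral>\<^sup>+t\<in>{of_rat (a n)..of_rat (b n)}. S t \<partial>lborel)"
      by (intro rat) simp_all
    also have "\<dots> \<le> ennreal (q - p) * (\<integral>\<^sup>+t\<in>{p..q}. S t \<partial>lborel)"
      using a(1)[of n] b(2)[of n]
      by (intro mult_mono ennreal_leI nn_integral_mono) (auto simp: indicator_def)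
    finally show "ennreal ((norm (f (of_rat (b n)) - f (of_rat (a n))))\<^sup>2) \<le> ennreal (q - p) * (\<integral>\<^sup>+t\<in>{p..q}. S t \<partial>lborel)" .
  qed
qed

text \<open>Two applications of Jensen's inequality on \<open>[0,r]\<close> and \<open>[r,R]\<close>: the kinetic energy of a path from
  the origin to the unit sphere exceeds that of the straight path by the squared deviation at time \<open>r\<close>.\<close>
lemma path_energy_excess:
  fixes f :: "real \<Rightarrow> 'b::real_inner"
  assumes en: "\<And>p q. 0 \<le> p \<Longrightarrow> p < q \<Longrightarrow> q \<le> R \<Longrightarrow>
      ennreal ((norm (f q - f p))\<^sup>2) \<le> ennreal (q - p) * (\<integral>\<^sup>+t\<in>{p..q}. S t \<partial>lborel)"
    and S[measurable]: "S \<in> borel_measurable borel"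
    and f0: "f 0 = 0" and fR: "norm (f R) = 1" and r: "0 < r" "r < R"
  shows "ennreal (1 / R + (1 / r) * (norm (f r - (r / R) *\<^sub>R f R))\<^sup>2) \<le> (\<integral>\<^sup>+t\<in>{0..R}. S t \<partial>lborel)"
proof -
  have half: "ennreal ((norm (f q - f p))\<^sup>2 / (q - p)) \<le> (\<integral>\<^sup>+t\<in>{p..q}. S t \<partial>lborel)" if "0 \<le> p" "p < q" "q \<le> R" for p q
  proof -
    have "ennreal ((norm (f q - f p))\<^sup>2 / (q - p)) = ennreal (1 / (q - p)) * ennreal ((norm (f q - f p))\<^sup>2)"
      using that by (simp add: ennreal_mult[symmetric])
    also have "\<dots> \<le> ennreal (1 / (q - p)) * (ennreal (q - p) * (\<integral>\<^sup>+t\<in>{p..q}. S t \<partial>lborel))"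
      by (intro mult_left_mono en that) auto
    also have "\<dots> = (\<integral>\<^sup>+t\<in>{p..q}. S t \<partial>lborel)"
      using that by (simp add: mult.assoc[symmetric] ennreal_mult[symmetric])
    finally show ?thesis .
  qed
  define a where "a = f r"
  define b where "b = f R"
  have bb: "b \<bullet> b = 1" using fR by (simp add: b_def dot_square_norm)
  have "1 / R + (1 / r) * (norm (a - (r / R) *\<^sub>R b))\<^sup>2 \<le> (norm a)\<^sup>2 / r + (norm (b - a))\<^sup>2 / (R - r)"
  proof -
    define \<alpha> where "\<alpha> = a \<bullet> a"
    define \<beta> where "\<beta> = a \<bullet> b"
    have n: "(norm a)\<^sup>2 = \<alpha>" "(norm (b - a))\<^sup>2 = 1 - 2 * \<beta> + \<alpha>" "(norm (a - (r / R) *\<^sub>R b))\<^sup>2 = \<alpha> - 2 * (r / R) * \<beta> + (r / R)\<^sup>2"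
      unfolding power2_norm_eq_inner
      by (simp_all add: inner_diff inner_commute \<alpha>_def \<beta>_def bb power2_eq_square algebra_simps)
    have pos: "0 < r" "0 < R" "0 < R - r" using r by auto
    \<comment> \<open>The gap between the two Jensen bounds and the claim is itself a nonnegative
      multiple of the squared deviation.\<close>
    have "\<alpha> / r + (1 - 2 * \<beta> + \<alpha>) / (R - r) - (1 / R + (1 / r) * (\<alpha> - 2 * (r / R) * \<beta> + (r / R)\<^sup>2))
      = (\<alpha> - 2 * (r / R) * \<beta> + (r / R)\<^sup>2) / (R - r)"
      using pos by (simp add: divide_simps power2_eq_square) (simp add: algebra_simps)
    also have "\<dots> \<ge> 0" using pos unfolding n(3)[symmetric] by simp
    finally show ?thesis unfolding n by simp
  qed
  then have "ennreal (1 / R + (1 / r) * (norm (a - (r / R) *\<^sub>R b))\<^sup>2) \<le> ennreal ((norm a)\<^sup>2 / r + (norm (b - a))\<^sup>2 / (R - r))"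
    by (rule ennreal_leI)
  also have "\<dots> = ennreal ((norm a)\<^sup>2 / r) + ennreal ((norm (b - a))\<^sup>2 / (R - r))"
    using r by (intro ennreal_plus) auto
  also have "\<dots> \<le> (\<integral>\<^sup>+t\<in>{0..r}. S t \<partial>lborel) + (\<integral>\<^sup>+t\<in>{r..R}. S t \<partial>lborel)"
    using half[of 0 r] half[of r R] r f0 by (intro add_mono) (auto simp: a_def b_def)
  also have "\<dots> = (\<integral>\<^sup>+t. S t * indicator {0..r} t + S t * indicator {r..R} t \<partial>lborel)"
    by (rule nn_integral_add[symmetric]) measurable
  also have "\<dots> = (\<integral>\<^sup>+t\<in>{0..R}. S t \<partial>lborel)"
    by (rule nn_integral_cong_AE, rule AE_mp[OF AE_lborel_singleton[of r]])
       (use r in \<open>auto simp: indicator_def intro!: AE_I2\<close>)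
  finally show ?thesis by (simp add: a_def b_def)
qed

lemma Ann_borel[measurable]: "Ann \<in> sets borel" and B1_borel[measurable]: "B1 \<in> sets borel"
  by auto

lemma nn_integral_Ann_scale_le:
  fixes f :: "real^2 \<Rightarrow> ennreal"
  assumes [measurable]: "f \<in> borel_measurable borel" and s: "0 < s" "s \<le> 1"
  shows "(\<integral>\<^sup>+x\<in>Ann. f (s *\<^sub>R x) \<partial>lborel) \<le> ennreal (1 / s\<^sup>2) * (\<integral>\<^sup>+x\<in>B1. f x \<partial>lborel)"
proof -
  have "(\<integral>\<^sup>+x\<in>Ann. f (s *\<^sub>R x) \<partial>lborel) \<le> (\<integral>\<^sup>+x. f (s *\<^sub>R x) * indicator B1 (s *\<^sub>R x) \<partial>lborel)"
  proof (rule nn_integral_mono)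
    fix x :: "real^2"
    have "s *\<^sub>R x \<in> B1" if "x \<in> Ann"
      using that s mult_le_less_imp_less[of s 1 "norm x" 1] by auto
    then show "f (s *\<^sub>R x) * indicator Ann x \<le> f (s *\<^sub>R x) * indicator B1 (s *\<^sub>R x)"
      by (auto simp: indicator_def)
  qed
  also have "\<dots> = ennreal (1 / s ^ DIM(real^2)) * (\<integral>\<^sup>+x\<in>B1. f x \<partial>lborel)"
    by (rule nn_integral_lborel_scale[where f="\<lambda>y. f y * indicator B1 y", OF _ s(1)])
       (intro borel_measurable_times_ennreal assms(1) borel_measurable_indicator B1_borel)
  finally show ?thesis by simp
qed

text \<open>The increment along a ray is an integral over s from t to h. Cauchy-Schwarz with the
  weights 1/s and s gives one factor ln (h / t); in two dimensions the Jacobian 1/s^2 of the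
  dilation turns the remaining weight s into 1/s, and the outer integral gives the second.\<close>

lemma gradient_oscillation:
  fixes f :: "real^2 \<Rightarrow> 'b::euclidean_space"
  assumes f[measurable]: "f \<in> borel_measurable borel" and H[measurable]: "\<And>j. H j \<in> borel_measurable borel"
    and w: "\<And>j. weak_partial B1 f j (H j)" and th: "0 < t" "t \<le> h" "h \<le> 1"
  shows "(\<integral>\<^sup>+x\<in>Ann. ennreal ((norm (f (h *\<^sub>R x) - f (t *\<^sub>R x)))\<^sup>2) \<partial>lborel)
    \<le> ennreal ((ln (h / t))\<^sup>2) * (\<integral>\<^sup>+x\<in>B1. ennreal (\<Sum>j\<in>UNIV. (norm (H j x))\<^sup>2) \<partial>lborel)"
proof -
  define K where "K x = (\<Sum>j\<in>UNIV. (norm (H j x))\<^sup>2)" for x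
  have K0: "K x \<ge> 0" for x by (simp add: K_def sum_nonneg)
  have Km[measurable]: "K \<in> borel_measurable borel" unfolding K_def by measurable
  define E where "E = (\<integral>\<^sup>+x\<in>B1. ennreal (K x) \<partial>lborel)"
  have Kp[measurable]: "(\<lambda>z::real \<times> (real^2). K (fst z *\<^sub>R snd z)) \<in> borel_measurable (borel \<Otimes>\<^sub>M borel)"
    by (rule measurable_compose[OF _ Km]) measurable
  have Kq[measurable]: "(\<lambda>z::(real^2) \<times> real. K (snd z *\<^sub>R fst z)) \<in> borel_measurable (borel \<Otimes>\<^sub>M borel)"
    by (rule measurable_compose[OF _ Km]) measurable
  define L where "L = ln (h / t)"
  have L: "L \<ge> 0" using th by (simp add: L_def)
  have "AE x in lborel. x \<in> Ann \<longrightarrow> ennreal ((norm (f (h *\<^sub>R x) - f (t *\<^sub>R x)))\<^sup>2)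
      \<le> ennreal L * (\<integral>\<^sup>+s\<in>{t..h}. ennreal (s * K (s *\<^sub>R x)) \<partial>lborel)"
    using ray_bound[OF f H w th(1,2)]
  proof eventually_elim
    fix x :: "real^2"
    assume le: "h * norm x < 1 \<longrightarrow> ennreal (norm (f (h *\<^sub>R x) - f (t *\<^sub>R x))) \<le>
      (\<integral>\<^sup>+s\<in>{t..h}. ennreal (norm (\<Sum>j\<in>UNIV. x $ j *\<^sub>R H j (s *\<^sub>R x))) \<partial>lborel)"
    show "x \<in> Ann \<longrightarrow> ennreal ((norm (f (h *\<^sub>R x) - f (t *\<^sub>R x)))\<^sup>2)
      \<le> ennreal L * (\<integral>\<^sup>+s\<in>{t..h}. ennreal (s * K (s *\<^sub>R x)) \<partial>lborel)"
    proof
      assume x: "x \<in> Ann"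
      then have nx: "norm x < 1" by simp
      then have "h * norm x < 1" using th mult_le_less_imp_less[of h 1 "norm x" 1] x by auto
      have pt: "norm (\<Sum>j\<in>UNIV. x $ j *\<^sub>R H j (s *\<^sub>R x)) \<le> sqrt (K (s *\<^sub>R x))" for s
      proof -
        have "norm (\<Sum>j\<in>UNIV. x $ j *\<^sub>R H j (s *\<^sub>R x)) \<le> (\<Sum>j\<in>UNIV. \<bar>x $ j\<bar> * norm (H j (s *\<^sub>R x)))"
          by (rule order_trans[OF norm_sum]) simp
        also have "\<dots> \<le> L2_set (\<lambda>j. x $ j) UNIV * L2_set (\<lambda>j. norm (H j (s *\<^sub>R x))) UNIV"
          using L2_set_mult_ineq[of "\<lambda>j. x $ j" "\<lambda>j. norm (H j (s *\<^sub>R x))" UNIV] by simp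
        also have "L2_set (\<lambda>j. x $ j) UNIV = norm x" by (simp add: norm_vec_def L2_set_def)
        also have "norm x * L2_set (\<lambda>j. norm (H j (s *\<^sub>R x))) UNIV \<le> 1 * L2_set (\<lambda>j. norm (H j (s *\<^sub>R x))) UNIV"
          using nx by (intro mult_right_mono) (auto intro: L2_set_nonneg)
        finally show ?thesis by (simp add: L2_set_def K_def)
      qed
      have "ennreal (norm (f (h *\<^sub>R x) - f (t *\<^sub>R x))) \<le>
        (\<integral>\<^sup>+s\<in>{t..h}. ennreal (norm (\<Sum>j\<in>UNIV. x $ j *\<^sub>R H j (s *\<^sub>R x))) \<partial>lborel)"
        using le \<open>h * norm x < 1\<close> by simp
      \<comment> \<open>The factor 1 is written as \<open>sqrt (1 / s)\<close> times
        \<open>sqrt s\<close>, which prepares the weighted Cauchy-Schwarz inequality.\<close>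
      also have "\<dots> \<le> (\<integral>\<^sup>+s. (ennreal (sqrt (1 / s)) * indicator {t..h} s) * (ennreal (sqrt (s * K (s *\<^sub>R x))) * indicator {t..h} s) \<partial>lborel)"
      proof (rule nn_integral_mono)
        fix s :: real
        have "sqrt (K (s *\<^sub>R x)) = sqrt (1 / s) * sqrt (s * K (s *\<^sub>R x))" if "s \<in> {t..h}"
          using that th by (simp add: real_sqrt_mult[symmetric])
        then show "ennreal (norm (\<Sum>j\<in>UNIV. x $ j *\<^sub>R H j (s *\<^sub>R x))) * indicator {t..h} s
          \<le> (ennreal (sqrt (1 / s)) * indicator {t..h} s) * (ennreal (sqrt (s * K (s *\<^sub>R x))) * indicator {t..h} s)"
          using pt[of s] th K0 by (auto simp: indicator_def ennreal_mult[symmetric] intro!: ennreal_leI)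
      qed
      finally have "(ennreal (norm (f (h *\<^sub>R x) - f (t *\<^sub>R x))))\<^sup>2
        \<le> (\<integral>\<^sup>+s. (ennreal (sqrt (1 / s)) * indicator {t..h} s) * (ennreal (sqrt (s * K (s *\<^sub>R x))) * indicator {t..h} s) \<partial>lborel)\<^sup>2"
        by (intro power_mono) auto
      also have "\<dots> \<le> (\<integral>\<^sup>+s. (ennreal (sqrt (1 / s)) * indicator {t..h} s)\<^sup>2 \<partial>lborel)
         * (\<integral>\<^sup>+s. (ennreal (sqrt (s * K (s *\<^sub>R x))) * indicator {t..h} s)\<^sup>2 \<partial>lborel)"
        by (rule Cauchy_Schwarz_nn_integral) measurable
      also have "(\<integral>\<^sup>+s. (ennreal (sqrt (1 / s)) * indicator {t..h} s)\<^sup>2 \<partial>lborel) = (\<integral>\<^sup>+s\<in>{t..h}. ennreal (1 / s) \<partial>lborel)"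
        using th by (intro nn_integral_cong) (auto simp: indicator_def ennreal_power)
      also have "\<dots> = ennreal L" unfolding L_def by (rule nn_integral_inverse_Icc[OF th(1,2)])
      also have "(\<integral>\<^sup>+s. (ennreal (sqrt (s * K (s *\<^sub>R x))) * indicator {t..h} s)\<^sup>2 \<partial>lborel) = (\<integral>\<^sup>+s\<in>{t..h}. ennreal (s * K (s *\<^sub>R x)) \<partial>lborel)"
        using th K0 by (intro nn_integral_cong) (auto simp: indicator_def ennreal_power)
      finally show "ennreal ((norm (f (h *\<^sub>R x) - f (t *\<^sub>R x)))\<^sup>2)
        \<le> ennreal L * (\<integral>\<^sup>+s\<in>{t..h}. ennreal (s * K (s *\<^sub>R x)) \<partial>lborel)" by (simp add: ennreal_power)
    qed
  qed
  then have "(\<integral>\<^sup>+x\<in>Ann. ennreal ((norm (f (h *\<^sub>R x) - f (t *\<^sub>R x)))\<^sup>2) \<partial>lborel)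
    \<le> (\<integral>\<^sup>+x. ennreal L * ((\<integral>\<^sup>+s\<in>{t..h}. ennreal (s * K (s *\<^sub>R x)) \<partial>lborel) * indicator Ann x) \<partial>lborel)"
    by (intro nn_integral_mono_AE) (auto elim!: eventually_mono simp: indicator_def)
  also have "\<dots> = ennreal L * (\<integral>\<^sup>+x. (\<integral>\<^sup>+s. (ennreal (s * K (s *\<^sub>R x)) * indicator {t..h} s) * indicator Ann x \<partial>lborel) \<partial>lborel)"
  proof -
    have m: "(\<lambda>x. \<integral>\<^sup>+s\<in>{t..h}. ennreal (s * K (s *\<^sub>R x)) \<partial>lborel) \<in> borel_measurable lborel"
      by (rule lborel.borel_measurable_nn_integral) (simp add: split_beta')
    have "(\<integral>\<^sup>+s\<in>{t..h}. ennreal (s * K (s *\<^sub>R x)) \<partial>lborel) * indicator Ann x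
      = (\<integral>\<^sup>+s. (ennreal (s * K (s *\<^sub>R x)) * indicator {t..h} s) * indicator Ann x \<partial>lborel)" for x
      by (rule nn_integral_multc[symmetric]) measurable
    moreover have "(\<integral>\<^sup>+x. ennreal L * ((\<integral>\<^sup>+s\<in>{t..h}. ennreal (s * K (s *\<^sub>R x)) \<partial>lborel) * indicator Ann x) \<partial>lborel)
      = ennreal L * (\<integral>\<^sup>+x. ((\<integral>\<^sup>+s\<in>{t..h}. ennreal (s * K (s *\<^sub>R x)) \<partial>lborel) * indicator Ann x) \<partial>lborel)"
      by (rule nn_integral_cmult, rule borel_measurable_times_ennreal[OF m borel_measurable_indicator]) simp
    ultimately show ?thesis by simp
  qed
  finally have A1: "(\<integral>\<^sup>+x\<in>Ann. ennreal ((norm (f (h *\<^sub>R x) - f (t *\<^sub>R x)))\<^sup>2) \<partial>lborel) \<le>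
    ennreal L * (\<integral>\<^sup>+x. (\<integral>\<^sup>+s. (ennreal (s * K (s *\<^sub>R x)) * indicator {t..h} s) * indicator Ann x \<partial>lborel) \<partial>lborel)" .
  have "(\<integral>\<^sup>+x. (\<integral>\<^sup>+s. (ennreal (s * K (s *\<^sub>R x)) * indicator {t..h} s) * indicator Ann x \<partial>lborel) \<partial>lborel)
    = (\<integral>\<^sup>+s. (\<integral>\<^sup>+x. (ennreal (s * K (s *\<^sub>R x)) * indicator {t..h} s) * indicator Ann x \<partial>lborel) \<partial>lborel)"
    by (rule lborel_pair.Fubini') (simp add: split_beta')
  also have "\<dots> \<le> (\<integral>\<^sup>+s. E * (ennreal (1 / s) * indicator {t..h} s) \<partial>lborel)"
  proof (rule nn_integral_mono)
    fix s :: real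
    show "(\<integral>\<^sup>+x. (ennreal (s * K (s *\<^sub>R x)) * indicator {t..h} s) * indicator Ann x \<partial>lborel) \<le> E * (ennreal (1 / s) * indicator {t..h} s)"
    proof (cases "s \<in> {t..h}")
      case True
      then have s: "0 < s" "s \<le> 1" using th by auto
      have "(\<integral>\<^sup>+x. (ennreal (s * K (s *\<^sub>R x)) * indicator {t..h} s) * indicator Ann x \<partial>lborel)
        = (\<integral>\<^sup>+x. ennreal s * (ennreal (K (s *\<^sub>R x)) * indicator Ann x) \<partial>lborel)"
        using True s K0 by (intro nn_integral_cong) (simp add: ennreal_mult mult.assoc)
      also have "\<dots> = ennreal s * (\<integral>\<^sup>+x\<in>Ann. ennreal (K (s *\<^sub>R x)) \<partial>lborel)"
        by (rule nn_integral_cmult) measurable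
      also have "\<dots> \<le> ennreal s * (ennreal (1 / s\<^sup>2) * E)"
        unfolding E_def by (intro mult_left_mono nn_integral_Ann_scale_le s) auto
      also have "\<dots> = E * ennreal (1 / s)"
      proof -
        have "ennreal s * ennreal (1 / s\<^sup>2) = ennreal (1 / s)"
          using s by (simp add: ennreal_mult[symmetric] power2_eq_square)
        then show ?thesis by (subst mult.assoc[symmetric]) (simp only: mult.commute)
      qed
      finally show ?thesis using True by simp
    qed simp
  qed
  also have "\<dots> = E * ennreal L"
    unfolding L_def nn_integral_inverse_Icc[OF th(1,2), symmetric] by (rule nn_integral_cmult) measurable
  finally have A2: "(\<integral>\<^sup>+x. (\<integral>\<^sup>+s. (ennreal (s * K (s *\<^sub>R x)) * indicator {t..h} s) * indicator Ann x \<partial>lborel) \<partial>lborel)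
    \<le> E * ennreal L" .
  have "ennreal L * (E * ennreal L) = ennreal (L\<^sup>2) * E"
    using L by (simp add: power2_eq_square ennreal_mult) (simp only: mult_ac)
  then show ?thesis
    using order_trans[OF A1 mult_left_mono[OF A2, of "ennreal L"]] unfolding E_def K_def L_def by simp
qed

section \<open>Deviation from conical maps\<close>

lemma borel_measurable_scale_pair:
  fixes f :: "'a::euclidean_space \<Rightarrow> 'b::topological_space"
  assumes f: "f \<in> borel_measurable borel"
  shows "(\<lambda>(x, t). f (t *\<^sub>R x)) \<in> borel_measurable (borel \<Otimes>\<^sub>M borel)"
  unfolding split_beta' by (rule measurable_compose[OF _ f]) measurable

lemma nn_integral_swap_sets:
  fixes f :: "'a::euclidean_space \<Rightarrow> real \<Rightarrow> ennreal"
  assumes f[measurable]: "(\<lambda>(x, t). f x t) \<in> borel_measurable (borel \<Otimes>\<^sub>M borel)"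
    and A[measurable]: "A \<in> sets borel" and T[measurable]: "T \<in> sets borel"
  shows "(\<integral>\<^sup>+x\<in>A. (\<integral>\<^sup>+t\<in>T. f x t \<partial>lborel) \<partial>lborel) = (\<integral>\<^sup>+t\<in>T. (\<integral>\<^sup>+x\<in>A. f x t \<partial>lborel) \<partial>lborel)"
proof -
  have m1: "(\<lambda>t. f x t) \<in> borel_measurable lborel" for x
    using measurable_compose[OF measurable_Pair1'[of x borel borel] f] by simp
  have m2: "(\<lambda>x. f x t) \<in> borel_measurable lborel" for t
    using measurable_compose[OF measurable_Pair2'[of t borel borel] f] by simp
  have "(\<integral>\<^sup>+x\<in>A. (\<integral>\<^sup>+t\<in>T. f x t \<partial>lborel) \<partial>lborel) = (\<integral>\<^sup>+x. (\<integral>\<^sup>+t. f x t * indicator T t * indicator A x \<partial>lborel) \<partial>lborel)"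
    by (intro nn_integral_cong nn_integral_multc[symmetric] borel_measurable_times_ennreal m1) measurable
  also have "\<dots> = (\<integral>\<^sup>+t. (\<integral>\<^sup>+x. f x t * indicator T t * indicator A x \<partial>lborel) \<partial>lborel)"
    by (rule lborel_pair.Fubini'[symmetric]) (simp add: split_beta', measurable)
  also have "\<dots> = (\<integral>\<^sup>+t. (\<integral>\<^sup>+x. f x t * indicator A x * indicator T t \<partial>lborel) \<partial>lborel)"
    by (simp only: mult.assoc mult.commute[of "indicator T _"])
  also have "\<dots> = (\<integral>\<^sup>+t\<in>T. (\<integral>\<^sup>+x\<in>A. f x t \<partial>lborel) \<partial>lborel)"
    by (intro nn_integral_cong nn_integral_multc borel_measurable_times_ennreal m2) measurable
  finally show ?thesis .
qed

lemma emeasure_Ann: "emeasure lborel Ann = ennreal (measure lborel Ann)"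
  by (rule emeasure_eq_ennreal_measure)
     (metis emeasure_bounded_finite bounded_ball bounded_diff less_irrefl infinity_ennreal_def)

text \<open>Here \<open>ln y \<le> 4 y\<^bsup>1/4\<^esup>\<close> makes the squared logarithm integrable by a power.\<close>
lemma nn_integral_ln_square_le:
  assumes h: "h > 0"
  shows "(\<integral>\<^sup>+t\<in>{0<..h}. ennreal ((ln (h / t))\<^sup>2) \<partial>lborel) \<le> ennreal (32 * h)"
proof -
  have ln_le: "(ln y)\<^sup>2 \<le> 16 * sqrt y" if y: "y \<ge> 1" for y :: real
  proof -
    have "ln y = 4 * ln (y powr (1/4))" using y by (simp add: ln_powr)
    also have "\<dots> \<le> 4 * (y powr (1/4) - 1)" using y by (intro mult_left_mono ln_le_minus_one) auto
    finally have "ln y \<le> 4 * y powr (1/4)" by simp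
    then have "(ln y)\<^sup>2 \<le> (4 * y powr (1/4))\<^sup>2" using y by (intro power_mono) auto
    also have "\<dots> = 16 * sqrt y" using y by (simp add: power_mult_distrib powr_half_sqrt[symmetric] powr_powr flip: powr_numeral)
    finally show ?thesis .
  qed
  have "(\<integral>\<^sup>+t\<in>{0<..h}. ennreal ((ln (h / t))\<^sup>2) \<partial>lborel) \<le> (\<integral>\<^sup>+t\<in>{0..h}. ennreal (16 * sqrt h * t powr (-1/2)) \<partial>lborel)"
  proof (rule nn_integral_mono)
    fix t
    show "ennreal ((ln (h / t))\<^sup>2) * indicator {0<..h} t \<le> ennreal (16 * sqrt h * t powr (-1/2)) * indicator {0..h} t"
    proof (cases "t \<in> {0<..h}")
      case True
      then have "(ln (h / t))\<^sup>2 \<le> 16 * sqrt (h / t)" by (intro ln_le) (auto simp: field_simps)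
      also have "\<dots> = 16 * sqrt h * t powr (-1/2)"
        using True by (simp add: real_sqrt_divide powr_minus_divide powr_half_sqrt)
      finally show ?thesis using True by (auto intro: ennreal_leI)
    qed simp
  qed
  also have "\<dots> = ennreal (32 * h)"
  proof -
    have "((\<lambda>t. t powr (-1/2)) has_integral (h powr (-1/2 + 1) / (-1/2 + 1))) {0..h}"
      by (rule has_integral_powr_from_0) (use h in auto)
    then have "((\<lambda>t. 16 * sqrt h * t powr (-1/2)) has_integral (16 * sqrt h * (h powr (-1/2 + 1) / (-1/2 + 1)))) {0..h}"
      by (rule has_integral_mult_right)
    moreover have "16 * sqrt h * (h powr (-1/2 + 1) / (-1/2 + 1)) = 32 * h"
      using h by (simp add: powr_half_sqrt)
    ultimately have "((\<lambda>t. 16 * sqrt h * t powr (-1/2)) has_integral 32 * h) {0..h}" by simp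
    from nn_integral_has_integral_lebesgue[OF _ this] h
    have "(\<integral>\<^sup>+t. ennreal (indicator {0..h} t * (16 * sqrt h * t powr (-1/2))) \<partial>lborel) = ennreal (32 * h)"
      by simp
    moreover have "ennreal (indicator {0..h} t * (16 * sqrt h * t powr (-1/2))) = ennreal (16 * sqrt h * t powr (-1/2)) * indicator {0..h} t" for t
      by (simp add: indicator_def)
    ultimately show ?thesis by simp
  qed
  finally show ?thesis .
qed

text \<open>The matrix of \<open>Du\<close>, built from explicit representatives of the partial
  derivatives as columns instead of from the choices of \<open>wd\<close>.\<close>

definition jac :: "(2 \<Rightarrow> real^2 \<Rightarrow> real^3) \<Rightarrow> real^2 \<Rightarrow> real^2^3" where
  "jac g x = (\<chi> k j. g j x $ k)"

lemma jac_measurable: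
  assumes "\<And>j. g j \<in> borel_measurable M"
  shows "jac g \<in> borel_measurable M"
proof -
  have "(\<lambda>x. g j x $ k) \<in> borel_measurable M" for j k
    by (rule measurable_compose[OF assms borel_measurable_continuous_onI]) (intro continuous_intros)
  then show ?thesis
    by (subst borel_measurable_euclidean_space) (auto simp: Basis_vec_def inner_axis jac_def)
qed

lemma norm_jac: "(norm (jac g x))\<^sup>2 = (\<Sum>j\<in>UNIV. (norm (g j x))\<^sup>2)"
  unfolding norm_sq_vec by (subst sum.swap) (simp add: jac_def)

lemma jac_mult: "jac g y *v x = (\<Sum>j\<in>UNIV. x $ j *\<^sub>R g j y)"
  by (simp add: vec_eq_iff jac_def matrix_vector_mult_def mult.commute)

text \<open>Extended by 0 outside the disc, so that dilated integrals may run over the whole plane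
  without tracking domains.\<close>

definition dist_sq :: "(2 \<Rightarrow> real^2 \<Rightarrow> real^3) \<Rightarrow> real^2 \<Rightarrow> real" where
  "dist_sq g x = indicator B1 x * (infdist (jac g x) O23)\<^sup>2"

lemma dist_sq_measurable:
  assumes "\<And>j. g j \<in> borel_measurable borel"
  shows "dist_sq g \<in> borel_measurable borel"
proof -
  have "(\<lambda>x. infdist (jac g x) O23) \<in> borel_measurable borel"
    by (rule measurable_compose[OF jac_measurable[OF assms] borel_measurable_continuous_onI]) (intro continuous_intros)
  then show ?thesis unfolding dist_sq_def by (intro borel_measurable_times borel_measurable_power borel_measurable_indicator) auto
qed

text \<open>The straight path has energy (norm x)^2 times the length 1 / norm x, that is norm x. For
  t up to h the full gradient is kept as error. Beyond h, stretching by at most 1 + d adds 2 d +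
  d^2, and the linear term is split by Young's inequality. The ray meets the unit circle before t =
  2 because norm x exceeds 1/2.\<close>

lemma ray_energy_upper:
  fixes g :: "2 \<Rightarrow> real^2 \<Rightarrow> real^3"
  assumes g[measurable]: "\<And>j. g j \<in> borel_measurable borel" and h: "0 < h" "h \<le> 1/2" and x: "x \<in> Ann"
  shows "(\<integral>\<^sup>+t\<in>{0..1 / norm x}. ennreal ((norm (\<Sum>j\<in>UNIV. x $ j *\<^sub>R g j (t *\<^sub>R x)))\<^sup>2) \<partial>lborel)
    \<le> ennreal (norm x) + ((\<integral>\<^sup>+t\<in>{0<..h}. ennreal (\<Sum>j\<in>UNIV. (norm (g j (t *\<^sub>R x)))\<^sup>2) \<partial>lborel)
       + (\<integral>\<^sup>+t\<in>{h..2}. ennreal ((1 + t / h) * dist_sq g (t *\<^sub>R x) + h / t) \<partial>lborel))"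
proof -
  define R where "R = 1 / norm x"
  have nx: "1/2 < norm x" "norm x < 1" using x by auto
  have "norm x > 0" using nx by linarith
  then have R: "1 < R" "R \<le> 2" "R * norm x = 1" using nx by (simp_all add: R_def divide_simps)
  define S where "S t = (norm (\<Sum>j\<in>UNIV. x $ j *\<^sub>R g j (t *\<^sub>R x)))\<^sup>2" for t
  define A where "A t = (\<Sum>j\<in>UNIV. (norm (g j (t *\<^sub>R x)))\<^sup>2)" for t
  define D where "D t = (1 + t / h) * dist_sq g (t *\<^sub>R x) + h / t" for t
  note [measurable] = dist_sq_measurable[OF g]
  have [measurable]: "A \<in> borel_measurable borel" "D \<in> borel_measurable borel"
    unfolding A_def D_def by measurable
  have S: "S t = (norm (jac g (t *\<^sub>R x) *v x))\<^sup>2" for t by (simp add: S_def jac_mult)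
  have A: "A t = (norm (jac g (t *\<^sub>R x)))\<^sup>2" for t by (simp add: A_def norm_jac)
  have SA: "S t \<le> A t" for t
  proof -
    have "norm (jac g (t *\<^sub>R x) *v x) \<le> norm (jac g (t *\<^sub>R x)) * norm x" by (rule norm_matrix_mult_le)
    also have "\<dots> \<le> norm (jac g (t *\<^sub>R x)) * 1" using nx by (intro mult_left_mono) auto
    finally show ?thesis unfolding S A by (intro power_mono) auto
  qed
  have D0: "D t \<ge> 0" if "t > 0" for t
    using that h by (auto simp: D_def dist_sq_def)
  have SD: "S t \<le> (norm x)\<^sup>2 + D t" if t: "h < t" "t < R" for t
  proof -
    define d where "d = infdist (jac g (t *\<^sub>R x)) O23"
    have "t * norm x < R * norm x" using t nx by (intro mult_strict_right_mono) auto
    then have "t *\<^sub>R x \<in> B1" using R t h by simp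
    then have ds: "dist_sq g (t *\<^sub>R x) = d\<^sup>2" by (simp add: dist_sq_def d_def)
    have d0: "d \<ge> 0" by (simp add: d_def infdist_nonneg)
    \<comment> \<open>Young's weight. After integration over the annulus the term with
      \<open>c * d\<^sup>2\<close> is a multiple of \<Delta>/(h t), where \<Delta> is the total
      squared defect, and \<open>1 / c\<close> is h/t; the two are comparable when \<Delta> is of
      order h^2.\<close>
    define c where "c = t / h"
    have c: "c > 0" using t h by (simp add: c_def)
    have "0 \<le> (c * d - 1)\<^sup>2 / c" using c by simp
    also have "\<dots> = c * d\<^sup>2 - 2 * d + 1 / c" using c by (simp add: power2_eq_square divide_simps) (simp add: algebra_simps)
    finally have amgm: "2 * d \<le> c * d\<^sup>2 + 1 / c" by simp
    have "S t \<le> (norm x * (1 + d))\<^sup>2"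
      unfolding S d_def by (intro power_mono infdist_O23_bounds(1)) auto
    also have "\<dots> = (norm x)\<^sup>2 + (norm x)\<^sup>2 * (2 * d + d\<^sup>2)" by (simp add: power2_eq_square algebra_simps)
    also have "(norm x)\<^sup>2 * (2 * d + d\<^sup>2) \<le> 1 * (2 * d + d\<^sup>2)"
      using nx d0 by (intro mult_right_mono) (auto simp: power_le_one)
    also have "1 * (2 * d + d\<^sup>2) \<le> D t" using amgm unfolding D_def ds c_def by (simp add: algebra_simps)
    finally show ?thesis by simp
  qed
  have "(\<integral>\<^sup>+t\<in>{0..R}. ennreal (S t) \<partial>lborel)
    \<le> (\<integral>\<^sup>+t. ennreal ((norm x)\<^sup>2) * indicator {0..R} t + (ennreal (A t) * indicator {0<..h} t + ennreal (D t) * indicator {h..2} t) \<partial>lborel)"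
  proof (rule nn_integral_mono_AE)
    show "AE t in lborel. ennreal (S t) * indicator {0..R} t \<le>
      ennreal ((norm x)\<^sup>2) * indicator {0..R} t + (ennreal (A t) * indicator {0<..h} t + ennreal (D t) * indicator {h..2} t)"
      \<comment> \<open>At \<open>t = R\<close> the point lies on the unit circle, where
        \<open>dist_sq\<close> is 0 by its definition and does not see the gradient;
        \<open>t = 0\<close> belongs to neither of the two error intervals.\<close>
      using AE_lborel_singleton[of R] AE_lborel_singleton[of 0]
    proof eventually_elim
      fix t :: real assume t: "t \<noteq> R" "t \<noteq> 0"
      consider "t \<notin> {0..R}" | "0 < t" "t \<le> h" | "h < t" "t < R" using t by force
      then show "ennreal (S t) * indicator {0..R} t \<le>
        ennreal ((norm x)\<^sup>2) * indicator {0..R} t + (ennreal (A t) * indicator {0<..h} t + ennreal (D t) * indicator {h..2} t)"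
      proof cases
        case 2
        have "ennreal (S t) \<le> ennreal (A t)" using SA by (rule ennreal_leI)
        then have "ennreal (S t) * indicator {0..R} t \<le> ennreal (A t) * indicator {0<..h} t" using 2 R h by simp
        also have "\<dots> \<le> ennreal ((norm x)\<^sup>2) * indicator {0..R} t + (ennreal (A t) * indicator {0<..h} t + ennreal (D t) * indicator {h..2} t)"
          by (rule add_increasing[OF zero_le add_increasing2[OF zero_le order_refl]])
        finally show ?thesis .
      next
        case 3
        have "ennreal (S t) \<le> ennreal ((norm x)\<^sup>2) + ennreal (D t)"
          using ennreal_leI[OF SD[OF 3]] D0[of t] 3 h by (simp add: ennreal_plus)
        then show ?thesis using 3 R h by (simp add: indicator_def)
      qed simp
    qed
  qed
  also have "\<dots> = (\<integral>\<^sup>+t\<in>{0..R}. ennreal ((norm x)\<^sup>2) \<partial>lborel)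
     + ((\<integral>\<^sup>+t\<in>{0<..h}. ennreal (A t) \<partial>lborel) + (\<integral>\<^sup>+t\<in>{h..2}. ennreal (D t) \<partial>lborel))"
  proof -
    have "(\<integral>\<^sup>+t. ennreal (A t) * indicator {0<..h} t + ennreal (D t) * indicator {h..2} t \<partial>lborel)
      = (\<integral>\<^sup>+t\<in>{0<..h}. ennreal (A t) \<partial>lborel) + (\<integral>\<^sup>+t\<in>{h..2}. ennreal (D t) \<partial>lborel)"
      by (rule nn_integral_add) measurable
    moreover have "(\<integral>\<^sup>+t. ennreal ((norm x)\<^sup>2) * indicator {0..R} t + (ennreal (A t) * indicator {0<..h} t + ennreal (D t) * indicator {h..2} t) \<partial>lborel)
      = (\<integral>\<^sup>+t\<in>{0..R}. ennreal ((norm x)\<^sup>2) \<partial>lborel)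
        + (\<integral>\<^sup>+t. ennreal (A t) * indicator {0<..h} t + ennreal (D t) * indicator {h..2} t \<partial>lborel)"
      by (rule nn_integral_add) measurable
    ultimately show ?thesis by (simp only:)
  qed
  also have "(\<integral>\<^sup>+t\<in>{0..R}. ennreal ((norm x)\<^sup>2) \<partial>lborel) = ennreal (norm x)"
  proof -
    have "(norm x)\<^sup>2 * R = norm x" using R(3) by (simp add: power2_eq_square mult.assoc mult.commute[of R])
    then show ?thesis using R by (subst nn_integral_cmult_indicator) (auto simp: ennreal_mult[symmetric])
  qed
  finally show ?thesis unfolding S_def A_def D_def R_def .
qed

text \<open>At scale h the gradient is controlled by its distance to \<open>O23\<close>, the
  dilation contributing 1/h^2. Passing from scale h to a smaller scale t costs only the oscillation,
  hence a squared logarithm, which is integrable as t tends to 0.\<close>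

lemma gradient_annulus_bound:
  fixes g :: "2 \<Rightarrow> real^2 \<Rightarrow> real^3"
  assumes g[measurable]: "\<And>j. g j \<in> borel_measurable borel" and H[measurable]: "\<And>i j. H i j \<in> borel_measurable borel"
    and gH: "\<And>i j. weak_partial B1 (g i) j (H i j)"
    and \<Delta>: "(\<integral>\<^sup>+x. ennreal (dist_sq g x) \<partial>lborel) \<le> ennreal \<Delta>" "\<Delta> \<ge> 0"
    and E: "(\<integral>\<^sup>+x\<in>B1. ennreal (\<Sum>i\<in>UNIV. \<Sum>j\<in>UNIV. (norm (H i j x))\<^sup>2) \<partial>lborel) \<le> ennreal E" "E \<ge> 0"
    and h: "0 < t" "t \<le> h" "h \<le> 1/2"
  shows "(\<integral>\<^sup>+x\<in>Ann. ennreal (\<Sum>j\<in>UNIV. (norm (g j (t *\<^sub>R x)))\<^sup>2) \<partial>lborel)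
    \<le> ennreal (2 * (4 * measure lborel Ann + 2 * \<Delta> / h\<^sup>2)) + ennreal (2 * E) * ennreal ((ln (h / t))\<^sup>2)"
proof -
  note [measurable] = dist_sq_measurable[OF g]
  define \<kappa> where "\<kappa> = measure lborel Ann"
  have \<kappa>: "\<kappa> \<ge> 0" by (simp add: \<kappa>_def)
  define L where "L = (ln (h / t))\<^sup>2"
  define e where "e i = (\<integral>\<^sup>+x\<in>B1. ennreal (\<Sum>j\<in>UNIV. (norm (H i j x))\<^sup>2) \<partial>lborel)" for i
  have "(\<Sum>i\<in>UNIV. e i) = (\<integral>\<^sup>+x. (\<Sum>i\<in>UNIV. ennreal (\<Sum>j\<in>UNIV. (norm (H i j x))\<^sup>2) * indicator B1 x) \<partial>lborel)"
    unfolding e_def by (rule nn_integral_sum[symmetric]) measurable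
  also have "\<dots> = (\<integral>\<^sup>+x\<in>B1. ennreal (\<Sum>i\<in>UNIV. \<Sum>j\<in>UNIV. (norm (H i j x))\<^sup>2) \<partial>lborel)"
    by (simp add: sum_distrib_right[symmetric] sum_ennreal sum_nonneg)
  finally have eE: "(\<Sum>i\<in>UNIV. e i) \<le> ennreal E" using E by simp
  have mh: "(\<integral>\<^sup>+x\<in>Ann. ennreal (\<Sum>j\<in>UNIV. (norm (g j (h *\<^sub>R x)))\<^sup>2) \<partial>lborel) \<le> ennreal (4 * \<kappa> + 2 * \<Delta> / h\<^sup>2)"
  proof -
    have "(\<integral>\<^sup>+x\<in>Ann. ennreal (\<Sum>j\<in>UNIV. (norm (g j (h *\<^sub>R x)))\<^sup>2) \<partial>lborel)
      \<le> (\<integral>\<^sup>+x. 4 * indicator Ann x + 2 * ennreal (dist_sq g (h *\<^sub>R x)) \<partial>lborel)"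
    proof (rule nn_integral_mono)
      fix x :: "real^2"
      show "ennreal (\<Sum>j\<in>UNIV. (norm (g j (h *\<^sub>R x)))\<^sup>2) * indicator Ann x \<le> 4 * indicator Ann x + 2 * ennreal (dist_sq g (h *\<^sub>R x))"
      proof (cases "x \<in> Ann")
        case True
        then have "h *\<^sub>R x \<in> B1" using h mult_le_less_imp_less[of h 1 "norm x" 1] by auto
        then have ds: "dist_sq g (h *\<^sub>R x) = (infdist (jac g (h *\<^sub>R x)) O23)\<^sup>2" by (simp add: dist_sq_def)
        have "ennreal (\<Sum>j\<in>UNIV. (norm (g j (h *\<^sub>R x)))\<^sup>2) \<le> ennreal (4 + 2 * dist_sq g (h *\<^sub>R x))"
          unfolding norm_jac[symmetric] ds by (intro ennreal_leI infdist_O23_bounds(2))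
        also have "\<dots> = 4 + 2 * ennreal (dist_sq g (h *\<^sub>R x))"
          by (simp add: ds ennreal_plus ennreal_mult)
        finally show ?thesis using True by simp
      qed simp
    qed
    also have "\<dots> = 4 * emeasure lborel Ann + 2 * (\<integral>\<^sup>+x. ennreal (dist_sq g (h *\<^sub>R x)) \<partial>lborel)"
      by (rule trans[OF nn_integral_add arg_cong2[of _ _ _ _ "(+)", OF nn_integral_cmult_indicator nn_integral_cmult]]) measurable
    also have "(\<integral>\<^sup>+x. ennreal (dist_sq g (h *\<^sub>R x)) \<partial>lborel) = ennreal (1 / h ^ DIM(real^2)) * (\<integral>\<^sup>+x. ennreal (dist_sq g x) \<partial>lborel)"
      by (rule nn_integral_lborel_scale[where f="\<lambda>y. ennreal (dist_sq g y)"]) (use h in auto)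
    also have "4 * emeasure lborel Ann + 2 * (ennreal (1 / h ^ DIM(real^2)) * (\<integral>\<^sup>+x. ennreal (dist_sq g x) \<partial>lborel))
      \<le> 4 * ennreal \<kappa> + 2 * (ennreal (1 / h ^ DIM(real^2)) * ennreal \<Delta>)"
      unfolding emeasure_Ann \<kappa>_def by (intro add_mono mult_left_mono \<Delta>) auto
    also have "\<dots> = ennreal (4 * \<kappa> + 2 * \<Delta> / h\<^sup>2)"
      using \<kappa> \<Delta>(2) h by (simp add: ennreal_plus ennreal_mult[symmetric] ennreal_numeral[symmetric] del: ennreal_numeral)
    finally show ?thesis .
  qed
  have "(\<integral>\<^sup>+x\<in>Ann. ennreal (\<Sum>j\<in>UNIV. (norm (g j (t *\<^sub>R x)))\<^sup>2) \<partial>lborel)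
    \<le> (\<integral>\<^sup>+x. 2 * (ennreal (\<Sum>j\<in>UNIV. (norm (g j (h *\<^sub>R x)))\<^sup>2) * indicator Ann x)
         + 2 * (\<Sum>j\<in>UNIV. ennreal ((norm (g j (h *\<^sub>R x) - g j (t *\<^sub>R x)))\<^sup>2) * indicator Ann x) \<partial>lborel)"
  proof (rule nn_integral_mono)
    fix x :: "real^2"
    have "(norm b)\<^sup>2 \<le> 2 * (norm a)\<^sup>2 + 2 * (norm (a - b))\<^sup>2" for a b :: "real^3"
    proof -
      have "norm b \<le> norm a + norm (a - b)" using norm_triangle_ineq4[of a "a - b"] by simp
      then have "(norm b)\<^sup>2 \<le> (norm a + norm (a - b))\<^sup>2" by (intro power_mono) auto
      also have "\<dots> \<le> 2 * (norm a)\<^sup>2 + 2 * (norm (a - b))\<^sup>2"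
        using sum_squares_bound[of "norm a" "norm (a - b)"] by (simp add: power2_sum)
      finally show ?thesis .
    qed
    then have "(\<Sum>j\<in>UNIV. (norm (g j (t *\<^sub>R x)))\<^sup>2) \<le> (\<Sum>j\<in>UNIV. 2 * (norm (g j (h *\<^sub>R x)))\<^sup>2 + 2 * (norm (g j (h *\<^sub>R x) - g j (t *\<^sub>R x)))\<^sup>2)"
      by (intro sum_mono)
    also have "\<dots> = 2 * (\<Sum>j\<in>UNIV. (norm (g j (h *\<^sub>R x)))\<^sup>2) + 2 * (\<Sum>j\<in>UNIV. (norm (g j (h *\<^sub>R x) - g j (t *\<^sub>R x)))\<^sup>2)"
      by (simp add: sum.distrib sum_distrib_left)
    finally have "ennreal (\<Sum>j\<in>UNIV. (norm (g j (t *\<^sub>R x)))\<^sup>2)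
      \<le> ennreal (2 * (\<Sum>j\<in>UNIV. (norm (g j (h *\<^sub>R x)))\<^sup>2) + 2 * (\<Sum>j\<in>UNIV. (norm (g j (h *\<^sub>R x) - g j (t *\<^sub>R x)))\<^sup>2))"
      by (rule ennreal_leI)
    also have "\<dots> = 2 * ennreal (\<Sum>j\<in>UNIV. (norm (g j (h *\<^sub>R x)))\<^sup>2) + 2 * (\<Sum>j\<in>UNIV. ennreal ((norm (g j (h *\<^sub>R x) - g j (t *\<^sub>R x)))\<^sup>2))"
      by (simp add: ennreal_plus ennreal_mult sum_nonneg sum_ennreal)
    finally show "ennreal (\<Sum>j\<in>UNIV. (norm (g j (t *\<^sub>R x)))\<^sup>2) * indicator Ann x
      \<le> 2 * (ennreal (\<Sum>j\<in>UNIV. (norm (g j (h *\<^sub>R x)))\<^sup>2) * indicator Ann x)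
         + 2 * (\<Sum>j\<in>UNIV. ennreal ((norm (g j (h *\<^sub>R x) - g j (t *\<^sub>R x)))\<^sup>2) * indicator Ann x)"
      by (cases "x \<in> Ann") simp_all
  qed
  also have "\<dots> = 2 * (\<integral>\<^sup>+x\<in>Ann. ennreal (\<Sum>j\<in>UNIV. (norm (g j (h *\<^sub>R x)))\<^sup>2) \<partial>lborel)
     + 2 * (\<Sum>j\<in>UNIV. (\<integral>\<^sup>+x\<in>Ann. ennreal ((norm (g j (h *\<^sub>R x) - g j (t *\<^sub>R x)))\<^sup>2) \<partial>lborel))"
  proof -
    have s: "(\<integral>\<^sup>+x. (\<Sum>j\<in>UNIV. ennreal ((norm (g j (h *\<^sub>R x) - g j (t *\<^sub>R x)))\<^sup>2) * indicator Ann x) \<partial>lborel)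
      = (\<Sum>j\<in>UNIV. (\<integral>\<^sup>+x\<in>Ann. ennreal ((norm (g j (h *\<^sub>R x) - g j (t *\<^sub>R x)))\<^sup>2) \<partial>lborel))"
      by (rule nn_integral_sum) measurable
    show ?thesis
      unfolding s[symmetric]
      by (rule trans[OF nn_integral_add arg_cong2[of _ _ _ _ "(+)", OF nn_integral_cmult nn_integral_cmult]]) measurable
  qed
  also have "\<dots> \<le> 2 * ennreal (4 * \<kappa> + 2 * \<Delta> / h\<^sup>2) + 2 * (ennreal L * ennreal E)"
  proof (intro add_mono mult_left_mono mh)
    have "(\<Sum>j\<in>UNIV. (\<integral>\<^sup>+x\<in>Ann. ennreal ((norm (g j (h *\<^sub>R x) - g j (t *\<^sub>R x)))\<^sup>2) \<partial>lborel)) \<le> (\<Sum>j\<in>UNIV. ennreal L * e j)"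
      unfolding L_def e_def by (intro sum_mono gradient_oscillation g H gH) (use h in auto)
    also have "\<dots> = ennreal L * (\<Sum>j\<in>UNIV. e j)" by (simp add: sum_distrib_left)
    also have "\<dots> \<le> ennreal L * ennreal E" by (intro mult_left_mono eE) auto
    finally show "(\<Sum>j\<in>UNIV. (\<integral>\<^sup>+x\<in>Ann. ennreal ((norm (g j (h *\<^sub>R x) - g j (t *\<^sub>R x)))\<^sup>2) \<partial>lborel)) \<le> ennreal L * ennreal E" .
  qed auto
  also have "\<dots> = ennreal (2 * (4 * \<kappa> + 2 * \<Delta> / h\<^sup>2)) + ennreal (2 * E) * ennreal L"
  proof -
    have "2 * ennreal (4 * \<kappa> + 2 * \<Delta> / h\<^sup>2) = ennreal (2 * (4 * \<kappa> + 2 * \<Delta> / h\<^sup>2))"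
      using \<kappa> \<Delta>(2) by (subst ennreal_mult) auto
    moreover have "2 * (ennreal L * ennreal E) = ennreal (2 * E) * ennreal L"
      using E(2) by (simp add: ennreal_mult mult_ac)
    ultimately show ?thesis by simp
  qed
  finally show ?thesis unfolding \<kappa>_def L_def .
qed

text \<open>The first summand comes from the size of the gradient for t up to h, the second from its
  oscillation there, as \<open>2 * E\<close> times the \<open>32 * h\<close> of
  \<open>nn_integral_ln_square_le\<close>. The third comes from the isometry defect between h and 2,
  with \<open>ln (2 / h)\<close> as the integral of 1/t.\<close>

definition dev_bound :: "real \<Rightarrow> real \<Rightarrow> real \<Rightarrow> real" where
  "dev_bound h \<Delta> E = 2 * h * (4 * measure lborel Ann + 2 * \<Delta> / h\<^sup>2) + 64 * h * E
     + (2 * \<Delta> / h + h * measure lborel Ann) * ln (2 / h)"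

text \<open>Compares the rescaled map with the one-homogeneous extension of the boundary values. On
  almost every ray, \<open>path_energy_excess\<close> bounds the energy from below and
  \<open>ray_energy_upper\<close> from above; the energy of the straight path cancels. Fubini then
  puts the ray parameter t outside, where each inner integral is a dilated integral over the
  annulus.\<close>

theorem conical_deviation:
  fixes w :: "real^2 \<Rightarrow> real^3" and g :: "2 \<Rightarrow> real^2 \<Rightarrow> real^3"
  assumes w[measurable]: "w \<in> borel_measurable borel" and cont: "continuous_on (cball 0 1) w"
    and w0: "w 0 = 0" and w1: "\<And>x. norm x = 1 \<Longrightarrow> norm (w x) = 1"
    and g[measurable]: "\<And>j. g j \<in> borel_measurable borel" and H[measurable]: "\<And>i j. H i j \<in> borel_measurable borel"
    and wg: "\<And>j. weak_partial B1 w j (g j)" and gH: "\<And>i j. weak_partial B1 (g i) j (H i j)"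
    and \<Delta>: "(\<integral>\<^sup>+x. ennreal (dist_sq g x) \<partial>lborel) \<le> ennreal \<Delta>" "\<Delta> \<ge> 0"
    and E: "(\<integral>\<^sup>+x\<in>B1. ennreal (\<Sum>i\<in>UNIV. \<Sum>j\<in>UNIV. (norm (H i j x))\<^sup>2) \<partial>lborel) \<le> ennreal E" "E \<ge> 0"
    and h: "0 < h" "h \<le> 1/2" and r: "0 < r" "r \<le> 1"
  shows "(\<integral>\<^sup>+x\<in>Ann. ennreal ((norm ((1 / r) *\<^sub>R w (r *\<^sub>R x) - norm x *\<^sub>R w ((1 / norm x) *\<^sub>R x)))\<^sup>2) \<partial>lborel)
    \<le> ennreal ((1 / r) * dev_bound h \<Delta> E)"
proof -
  note [measurable] = dist_sq_measurable[OF g]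
  define \<kappa> where "\<kappa> = measure lborel Ann"
  have \<kappa>: "\<kappa> \<ge> 0" by (simp add: \<kappa>_def)
  define A where "A y = (\<Sum>j\<in>UNIV. (norm (g j y))\<^sup>2)" for y
  have Am[measurable]: "A \<in> borel_measurable borel" unfolding A_def by measurable
  define Y where "Y x = (\<integral>\<^sup>+t\<in>{0<..h}. ennreal (A (t *\<^sub>R x)) \<partial>lborel)
       + (\<integral>\<^sup>+t\<in>{h..2}. ennreal ((1 + t / h) * dist_sq g (t *\<^sub>R x) + h / t) \<partial>lborel)" for x
  define F where "F x = (norm ((1 / r) *\<^sub>R w (r *\<^sub>R x) - norm x *\<^sub>R w ((1 / norm x) *\<^sub>R x)))\<^sup>2" for x
  \<comment> \<open>Rational endpoints keep the union of the exceptional null sets null; the real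
    ones follow from continuity of \<open>w\<close>.\<close>
  have "AE x in lborel. \<forall>p q::rat. 0 < p \<and> p \<le> q \<longrightarrow> of_rat q * norm x < 1 \<longrightarrow>
     ennreal ((norm (w (of_rat q *\<^sub>R x) - w (of_rat p *\<^sub>R x)))\<^sup>2)
      \<le> ennreal (of_rat q - of_rat p) * (\<integral>\<^sup>+t\<in>{of_rat p..of_rat q}. ennreal ((norm (\<Sum>j\<in>UNIV. x $ j *\<^sub>R g j (t *\<^sub>R x)))\<^sup>2) \<partial>lborel)"
    (is "AE x in lborel. \<forall>p q. ?C p q \<longrightarrow> ?Q p q x")
  proof -
    have "AE x in lborel. ?C p q \<longrightarrow> ?Q p q x" for p q
    proof (cases "?C p q")
      case True
      then have "(0::real) < of_rat p" "(of_rat p :: real) \<le> of_rat q" by (auto simp: of_rat_less_eq)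
      from ray_energy[OF w g wg this] show ?thesis by eventually_elim simp
    qed (rule AE_I2, blast)
    then show ?thesis by (simp only: AE_all_countable) blast
  qed
  then have main: "AE x in lborel. x \<in> Ann \<longrightarrow> ennreal (F x) \<le> ennreal (1 / r) * Y x"
  proof eventually_elim
    fix x assume rat: "\<forall>p q::rat. 0 < p \<and> p \<le> q \<longrightarrow> of_rat q * norm x < 1 \<longrightarrow>
     ennreal ((norm (w (of_rat q *\<^sub>R x) - w (of_rat p *\<^sub>R x)))\<^sup>2)
      \<le> ennreal (of_rat q - of_rat p) * (\<integral>\<^sup>+t\<in>{of_rat p..of_rat q}. ennreal ((norm (\<Sum>j\<in>UNIV. x $ j *\<^sub>R g j (t *\<^sub>R x)))\<^sup>2) \<partial>lborel)"
    show "x \<in> Ann \<longrightarrow> ennreal (F x) \<le> ennreal (1 / r) * Y x"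
    proof
      assume x: "x \<in> Ann"
      define R where "R = 1 / norm x"
      have nx: "1/2 < norm x" "norm x < 1" using x by auto
      have "norm x > 0" using nx by linarith
      then have R: "1 < R" "R * norm x = 1" using nx by (simp_all add: R_def divide_simps)
      define S where "S t = ennreal ((norm (\<Sum>j\<in>UNIV. x $ j *\<^sub>R g j (t *\<^sub>R x)))\<^sup>2)" for t
      have Sm: "S \<in> borel_measurable borel" unfolding S_def by measurable
      have cf: "continuous_on {0..R} (\<lambda>t. w (t *\<^sub>R x))"
      proof (rule continuous_on_compose2[OF cont])
        have "t * norm x \<le> 1" if "t \<le> R" for t
          using mult_right_mono[OF that, of "norm x"] R by simp
        then show "(\<lambda>t. t *\<^sub>R x) ` {0..R} \<subseteq> cball 0 1" by auto
      qed (intro continuous_intros)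
      have en: "ennreal ((norm (w (q *\<^sub>R x) - w (p *\<^sub>R x)))\<^sup>2) \<le> ennreal (q - p) * (\<integral>\<^sup>+t\<in>{p..q}. S t \<partial>lborel)"
        if pq: "0 \<le> p" "p < q" "q \<le> R" for p q
      proof (rule ray_energy_endpoints[where f="\<lambda>t. w (t *\<^sub>R x)" and T=R, OF _ cf pq])
        fix p q :: rat assume a: "0 < p" "p \<le> q" "of_rat q < R"
        have "of_rat q * norm x < R * norm x" using a(3) nx by (intro mult_strict_right_mono) auto
        then show "ennreal ((norm (w (of_rat q *\<^sub>R x) - w (of_rat p *\<^sub>R x)))\<^sup>2)
          \<le> ennreal (of_rat q - of_rat p) * (\<integral>\<^sup>+t\<in>{of_rat p..of_rat q}. S t \<partial>lborel)"
          using rat a R unfolding S_def by simp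
      qed
      have nR: "norm (R *\<^sub>R x) = 1" using R by simp
      have "ennreal (1 / R + (1 / r) * (norm (w (r *\<^sub>R x) - (r / R) *\<^sub>R w (R *\<^sub>R x)))\<^sup>2) \<le> (\<integral>\<^sup>+t\<in>{0..R}. S t \<partial>lborel)"
        by (rule path_energy_excess[where f="\<lambda>t. w (t *\<^sub>R x)", OF en Sm]) (use w0 w1[OF nR] r R in auto)
      also have "\<dots> \<le> ennreal (norm x) + Y x"
        using ray_energy_upper[OF g h x] unfolding S_def Y_def A_def R_def .
      \<comment> \<open>Isolates the straight energy \<open>1 / R = norm x\<close>, so that it can
        be cancelled against the same term of the upper bound.\<close>
      also have "ennreal (1 / R + (1 / r) * (norm (w (r *\<^sub>R x) - (r / R) *\<^sub>R w (R *\<^sub>R x)))\<^sup>2) = ennreal (norm x) + ennreal (r * F x)"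
      proof -
        have "w (r *\<^sub>R x) - (r / R) *\<^sub>R w (R *\<^sub>R x) = r *\<^sub>R ((1 / r) *\<^sub>R w (r *\<^sub>R x) - norm x *\<^sub>R w ((1 / norm x) *\<^sub>R x))"
          using r by (simp add: R_def scaleR_diff_right)
        then have "(norm (w (r *\<^sub>R x) - (r / R) *\<^sub>R w (R *\<^sub>R x)))\<^sup>2 = r\<^sup>2 * F x"
          by (simp add: F_def power_mult_distrib)
        then have "1 / R + (1 / r) * (norm (w (r *\<^sub>R x) - (r / R) *\<^sub>R w (R *\<^sub>R x)))\<^sup>2 = norm x + r * F x"
          using r by (simp add: R_def power2_eq_square)
        then show ?thesis using r by (simp add: F_def)
      qed
      finally have "ennreal (r * F x) \<le> Y x" by simp
      then have "ennreal (1 / r) * ennreal (r * F x) \<le> ennreal (1 / r) * Y x" by (intro mult_left_mono) auto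
      then show "ennreal (F x) \<le> ennreal (1 / r) * Y x" using r by (simp add: ennreal_mult[symmetric] F_def)
    qed
  qed
  have pm1: "(\<lambda>(x, t). ennreal (A (t *\<^sub>R x))) \<in> borel_measurable (borel \<Otimes>\<^sub>M borel)"
    using borel_measurable_scale_pair[OF Am] by (simp add: split_beta')
  have pm2: "(\<lambda>(x, t). ennreal ((1 + t / h) * dist_sq g (t *\<^sub>R x) + h / t)) \<in> borel_measurable (borel \<Otimes>\<^sub>M borel)"
    using borel_measurable_scale_pair[OF dist_sq_measurable[OF g]] by (simp add: split_beta')
  have Y1: "(\<integral>\<^sup>+x\<in>Ann. (\<integral>\<^sup>+t\<in>{0<..h}. ennreal (A (t *\<^sub>R x)) \<partial>lborel) \<partial>lborel)
    \<le> ennreal (2 * h * (4 * \<kappa> + 2 * \<Delta> / h\<^sup>2) + 64 * h * E)"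
  proof -
    define c where "c = 2 * (4 * \<kappa> + 2 * \<Delta> / h\<^sup>2)"
    have c: "c \<ge> 0" using \<kappa> \<Delta>(2) by (simp add: c_def)
    have "(\<integral>\<^sup>+x\<in>Ann. (\<integral>\<^sup>+t\<in>{0<..h}. ennreal (A (t *\<^sub>R x)) \<partial>lborel) \<partial>lborel)
      = (\<integral>\<^sup>+t\<in>{0<..h}. (\<integral>\<^sup>+x\<in>Ann. ennreal (A (t *\<^sub>R x)) \<partial>lborel) \<partial>lborel)"
      by (rule nn_integral_swap_sets[OF pm1]) measurable
    also have "\<dots> \<le> (\<integral>\<^sup>+t. ennreal c * indicator {0<..h} t + ennreal (2 * E) * (ennreal ((ln (h / t))\<^sup>2) * indicator {0<..h} t) \<partial>lborel)"
    proof (rule nn_integral_mono)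
      fix t :: real
      show "(\<integral>\<^sup>+x\<in>Ann. ennreal (A (t *\<^sub>R x)) \<partial>lborel) * indicator {0<..h} t
        \<le> ennreal c * indicator {0<..h} t + ennreal (2 * E) * (ennreal ((ln (h / t))\<^sup>2) * indicator {0<..h} t)"
      proof (cases "t \<in> {0<..h}")
        case True
        then show ?thesis using gradient_annulus_bound[OF g H gH \<Delta> E, of t h] h unfolding A_def c_def \<kappa>_def by simp
      qed simp
    qed
    also have "\<dots> = ennreal c * ennreal h + ennreal (2 * E) * (\<integral>\<^sup>+t\<in>{0<..h}. ennreal ((ln (h / t))\<^sup>2) \<partial>lborel)"
    proof -
      have "(\<integral>\<^sup>+t. ennreal c * indicator {0<..h} t \<partial>lborel) = ennreal c * ennreal h"
        using h by (subst nn_integral_cmult_indicator) auto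
      moreover have "(\<integral>\<^sup>+t. ennreal c * indicator {0<..h} t + ennreal (2 * E) * (ennreal ((ln (h / t))\<^sup>2) * indicator {0<..h} t) \<partial>lborel)
        = (\<integral>\<^sup>+t. ennreal c * indicator {0<..h} t \<partial>lborel) + ennreal (2 * E) * (\<integral>\<^sup>+t\<in>{0<..h}. ennreal ((ln (h / t))\<^sup>2) \<partial>lborel)"
        by (rule trans[OF nn_integral_add arg_cong2[of _ _ _ _ "(+)", OF refl nn_integral_cmult]]) measurable
      ultimately show ?thesis by (simp only:)
    qed
    also have "\<dots> \<le> ennreal c * ennreal h + ennreal (2 * E) * ennreal (32 * h)"
      by (intro add_left_mono mult_left_mono nn_integral_ln_square_le h) auto
    also have "\<dots> = ennreal (c * h + 2 * E * (32 * h))"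
    proof -
      have "ennreal c * ennreal h = ennreal (c * h)" using c h by (intro ennreal_mult[symmetric]) auto
      moreover have "ennreal (2 * E) * ennreal (32 * h) = ennreal (2 * E * (32 * h))"
        using h E(2) by (intro ennreal_mult[symmetric]) auto
      moreover have "ennreal (c * h + 2 * E * (32 * h)) = ennreal (c * h) + ennreal (2 * E * (32 * h))"
        using c h E(2) by (intro ennreal_plus) auto
      ultimately show ?thesis by (simp only:)
    qed
    also have "c * h + 2 * E * (32 * h) = 2 * h * (4 * \<kappa> + 2 * \<Delta> / h\<^sup>2) + 64 * h * E"
      by (simp add: c_def algebra_simps)
    finally show ?thesis .
  qed
  have Y2: "(\<integral>\<^sup>+x\<in>Ann. (\<integral>\<^sup>+t\<in>{h..2}. ennreal ((1 + t / h) * dist_sq g (t *\<^sub>R x) + h / t) \<partial>lborel) \<partial>lborel)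
    \<le> ennreal ((2 * \<Delta> / h + h * \<kappa>) * ln (2 / h))"
  proof -
    have "(\<integral>\<^sup>+x\<in>Ann. (\<integral>\<^sup>+t\<in>{h..2}. ennreal ((1 + t / h) * dist_sq g (t *\<^sub>R x) + h / t) \<partial>lborel) \<partial>lborel)
      = (\<integral>\<^sup>+t\<in>{h..2}. (\<integral>\<^sup>+x\<in>Ann. ennreal ((1 + t / h) * dist_sq g (t *\<^sub>R x) + h / t) \<partial>lborel) \<partial>lborel)"
      by (rule nn_integral_swap_sets[OF pm2]) measurable
    also have "\<dots> \<le> (\<integral>\<^sup>+t. ennreal (2 * \<Delta> / h + h * \<kappa>) * (ennreal (1 / t) * indicator {h..2} t) \<partial>lborel)"
    proof (rule nn_integral_mono)
      fix t :: real
      show "(\<integral>\<^sup>+x\<in>Ann. ennreal ((1 + t / h) * dist_sq g (t *\<^sub>R x) + h / t) \<partial>lborel) * indicator {h..2} t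
        \<le> ennreal (2 * \<Delta> / h + h * \<kappa>) * (ennreal (1 / t) * indicator {h..2} t)"
      proof (cases "t \<in> {h..2}")
        case True
        then have t: "h \<le> t" "t > 0" using h by auto
        have "(\<integral>\<^sup>+x\<in>Ann. ennreal ((1 + t / h) * dist_sq g (t *\<^sub>R x) + h / t) \<partial>lborel)
          \<le> (\<integral>\<^sup>+x. ennreal (2 * t / h) * ennreal (dist_sq g (t *\<^sub>R x)) + ennreal (h / t) * indicator Ann x \<partial>lborel)"
        proof (rule nn_integral_mono)
          fix x :: "real^2"
          have ds0: "dist_sq g (t *\<^sub>R x) \<ge> 0" by (simp add: dist_sq_def)
          have "1 + t / h \<le> 2 * t / h" using t h by (simp add: field_simps)
          then have "ennreal ((1 + t / h) * dist_sq g (t *\<^sub>R x) + h / t) \<le> ennreal (2 * t / h * dist_sq g (t *\<^sub>R x) + h / t)"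
            using ds0 by (intro ennreal_leI add_right_mono mult_right_mono)
          also have "\<dots> = ennreal (2 * t / h) * ennreal (dist_sq g (t *\<^sub>R x)) + ennreal (h / t)"
            using ds0 t h by (simp add: ennreal_plus ennreal_mult[symmetric])
          finally show "ennreal ((1 + t / h) * dist_sq g (t *\<^sub>R x) + h / t) * indicator Ann x
            \<le> ennreal (2 * t / h) * ennreal (dist_sq g (t *\<^sub>R x)) + ennreal (h / t) * indicator Ann x"
            by (cases "x \<in> Ann") simp_all
        qed
        also have "\<dots> = ennreal (2 * t / h) * (\<integral>\<^sup>+x. ennreal (dist_sq g (t *\<^sub>R x)) \<partial>lborel) + ennreal (h / t) * emeasure lborel Ann"
          by (rule trans[OF nn_integral_add arg_cong2[of _ _ _ _ "(+)", OF nn_integral_cmult nn_integral_cmult_indicator]]) measurable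
        \<comment> \<open>The Jacobian 1/t^2 reduces the weight 2 t/h to 2/(h t), so both
          contributions become multiples of 1/t.\<close>
        also have "(\<integral>\<^sup>+x. ennreal (dist_sq g (t *\<^sub>R x)) \<partial>lborel) = ennreal (1 / t ^ DIM(real^2)) * (\<integral>\<^sup>+x. ennreal (dist_sq g x) \<partial>lborel)"
          by (rule nn_integral_lborel_scale[where f="\<lambda>y. ennreal (dist_sq g y)"]) (use t in auto)
        also have "ennreal (2 * t / h) * (ennreal (1 / t ^ DIM(real^2)) * (\<integral>\<^sup>+x. ennreal (dist_sq g x) \<partial>lborel)) + ennreal (h / t) * emeasure lborel Ann
          \<le> ennreal (2 * t / h) * (ennreal (1 / t ^ DIM(real^2)) * ennreal \<Delta>) + ennreal (h / t) * ennreal \<kappa>"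
          unfolding emeasure_Ann \<kappa>_def by (intro add_mono mult_left_mono \<Delta>) auto
        also have "\<dots> = ennreal (2 * t / h * (1 / t\<^sup>2 * \<Delta>) + h / t * \<kappa>)"
          using t h \<kappa> \<Delta>(2) by (simp add: ennreal_plus ennreal_mult[symmetric])
        also have "2 * t / h * (1 / t\<^sup>2 * \<Delta>) + h / t * \<kappa> = (2 * \<Delta> / h + h * \<kappa>) * (1 / t)"
          using t h by (simp add: divide_simps power2_eq_square)
        also have "ennreal \<dots> = ennreal (2 * \<Delta> / h + h * \<kappa>) * ennreal (1 / t)"
          using t h \<kappa> \<Delta>(2) by (intro ennreal_mult) auto
        finally show ?thesis using True by simp
      qed simp
    qed
    also have "\<dots> = ennreal (2 * \<Delta> / h + h * \<kappa>) * ennreal (ln (2 / h))"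
      using h by (subst nn_integral_cmult, measurable) (simp add: nn_integral_inverse_Icc)
    also have "\<dots> = ennreal ((2 * \<Delta> / h + h * \<kappa>) * ln (2 / h))"
      using h \<kappa> \<Delta>(2) by (intro ennreal_mult[symmetric]) auto
    finally show ?thesis .
  qed
  have m1: "(\<lambda>x. \<integral>\<^sup>+t\<in>{0<..h}. ennreal (A (t *\<^sub>R x)) \<partial>lborel) \<in> borel_measurable lborel"
    by (rule lborel.borel_measurable_nn_integral)
       (use pm1 in \<open>simp add: split_beta' borel_measurable_times_ennreal\<close>)
  have m2: "(\<lambda>x. \<integral>\<^sup>+t\<in>{h..2}. ennreal ((1 + t / h) * dist_sq g (t *\<^sub>R x) + h / t) \<partial>lborel) \<in> borel_measurable lborel"
    by (rule lborel.borel_measurable_nn_integral)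
       (use pm2 in \<open>simp add: split_beta' borel_measurable_times_ennreal\<close>)
  have Ym: "Y \<in> borel_measurable lborel" unfolding Y_def by (intro borel_measurable_add m1 m2)
  have "(\<integral>\<^sup>+x\<in>Ann. ennreal (F x) \<partial>lborel) \<le> (\<integral>\<^sup>+x. ennreal (1 / r) * (Y x * indicator Ann x) \<partial>lborel)"
    using main by (intro nn_integral_mono_AE) (auto elim!: eventually_mono simp: indicator_def)
  also have "\<dots> = ennreal (1 / r) * (\<integral>\<^sup>+x\<in>Ann. Y x \<partial>lborel)"
    by (rule nn_integral_cmult) (intro borel_measurable_times_ennreal Ym borel_measurable_indicator, simp)
  also have "(\<integral>\<^sup>+x\<in>Ann. Y x \<partial>lborel) = (\<integral>\<^sup>+x\<in>Ann. (\<integral>\<^sup>+t\<in>{0<..h}. ennreal (A (t *\<^sub>R x)) \<partial>lborel) \<partial>lborel)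
      + (\<integral>\<^sup>+x\<in>Ann. (\<integral>\<^sup>+t\<in>{h..2}. ennreal ((1 + t / h) * dist_sq g (t *\<^sub>R x) + h / t) \<partial>lborel) \<partial>lborel)"
    unfolding Y_def distrib_right
    by (rule nn_integral_add; intro borel_measurable_times_ennreal m1 m2 borel_measurable_indicator; simp)
  also have "ennreal (1 / r) * \<dots> \<le> ennreal (1 / r) * (ennreal (2 * h * (4 * \<kappa> + 2 * \<Delta> / h\<^sup>2) + 64 * h * E) + ennreal ((2 * \<Delta> / h + h * \<kappa>) * ln (2 / h)))"
    by (intro mult_left_mono add_mono Y1 Y2) auto
  also have "\<dots> = ennreal ((1 / r) * dev_bound h \<Delta> E)"
  proof -
    have "ln (2 / h) \<ge> 0" using h by simp
    then show ?thesis unfolding dev_bound_def \<kappa>_def[symmetric] using r h \<kappa> \<Delta>(2) E(2)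
      by (simp add: ennreal_plus[symmetric] ennreal_mult[symmetric] del: ennreal_plus)
  qed
  finally show ?thesis unfolding F_def .
qed

section \<open>Rescaling\<close>

text \<open>Pointwise \<open>f\<close> is at most \<open>d + f\<^sup>2 / d\<close>: trivially below
  \<open>d\<close>, and above \<open>d\<close> because then \<open>f / d\<close> exceeds 1. The
  constant part is small since the measure is finite, and \<open>d\<close> is fixed before the limit
  is taken.\<close>

lemma nn_integral_tendsto_0_if_square:
  fixes f :: "nat \<Rightarrow> 'a \<Rightarrow> real"
  assumes M: "finite_measure M" and m[measurable]: "\<And>k. f k \<in> borel_measurable M" and f0: "\<And>k x. f k x \<ge> 0"
    and lim: "(\<lambda>k. \<integral>\<^sup>+x. ennreal ((f k x)\<^sup>2) \<partial>M) \<longlonglongrightarrow> 0"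
  shows "(\<lambda>k. \<integral>\<^sup>+x. ennreal (f k x) \<partial>M) \<longlonglongrightarrow> 0"
proof -
  interpret finite_measure M by fact
  define \<mu> where "\<mu> = measure M (space M)"
  have \<mu>: "\<mu> \<ge> 0" by (simp add: \<mu>_def)
  have est: "(\<integral>\<^sup>+x. ennreal (f k x) \<partial>M) \<le> ennreal (d * \<mu>) + ennreal (1 / d) * (\<integral>\<^sup>+x. ennreal ((f k x)\<^sup>2) \<partial>M)" if d: "d > 0" for d k
  proof -
    have "(\<integral>\<^sup>+x. ennreal (f k x) \<partial>M) \<le> (\<integral>\<^sup>+x. ennreal d + ennreal (1 / d) * ennreal ((f k x)\<^sup>2) \<partial>M)"
    proof (rule nn_integral_mono)
      fix x
      have "f k x \<le> d + (1 / d) * (f k x)\<^sup>2"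
      proof (cases "f k x \<le> d")
        case False
        then have "d * f k x \<le> f k x * f k x" using d by (intro mult_right_mono) auto
        then have "f k x \<le> (1 / d) * (f k x)\<^sup>2" using d by (simp add: field_simps power2_eq_square)
        then show ?thesis using d by linarith
      qed (use d in \<open>simp add: add_increasing2\<close>)
      then have "ennreal (f k x) \<le> ennreal (d + (1 / d) * (f k x)\<^sup>2)" by (rule ennreal_leI)
      also have "\<dots> = ennreal d + ennreal (1 / d) * ennreal ((f k x)\<^sup>2)"
        using d by (subst ennreal_plus) (auto simp: ennreal_mult[symmetric])
      finally show "ennreal (f k x) \<le> ennreal d + ennreal (1 / d) * ennreal ((f k x)\<^sup>2)" .
    qed
    also have "\<dots> = (\<integral>\<^sup>+x. ennreal d \<partial>M) + ennreal (1 / d) * (\<integral>\<^sup>+x. ennreal ((f k x)\<^sup>2) \<partial>M)"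
      by (rule trans[OF nn_integral_add arg_cong2[of _ _ _ _ "(+)", OF refl nn_integral_cmult]]) measurable
    also have "(\<integral>\<^sup>+x. ennreal d \<partial>M) = ennreal (d * \<mu>)"
      using d \<mu> by (simp add: emeasure_eq_measure \<mu>_def ennreal_mult)
    finally show ?thesis .
  qed
  show ?thesis
  proof (rule tendsto_zero_ennreal)
    fix e :: real assume e: "e > 0"
    define d where "d = e / (2 * (\<mu> + 1))"
    have d: "d > 0" "d * \<mu> \<le> e / 2" using e \<mu> by (auto simp: d_def field_simps)
    have "\<forall>\<^sub>F k in sequentially. (\<integral>\<^sup>+x. ennreal ((f k x)\<^sup>2) \<partial>M) < ennreal (d * e / 4)"
      by (rule order_tendstoD(2)[OF lim]) (use d e in simp)
    then show "\<forall>\<^sub>F k in sequentially. (\<integral>\<^sup>+x. ennreal (f k x) \<partial>M) < ennreal e"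
    proof eventually_elim
      fix k assume k: "(\<integral>\<^sup>+x. ennreal ((f k x)\<^sup>2) \<partial>M) < ennreal (d * e / 4)"
      have "(\<integral>\<^sup>+x. ennreal (f k x) \<partial>M) \<le> ennreal (d * \<mu>) + ennreal (1 / d) * ennreal (d * e / 4)"
        by (rule order_trans[OF est[OF d(1)]]) (intro add_left_mono mult_left_mono less_imp_le[OF k], simp)
      also have "\<dots> = ennreal (d * \<mu> + e / 4)"
        using d e \<mu> by (simp add: ennreal_mult[symmetric] ennreal_plus[symmetric] del: ennreal_plus)
      also have "\<dots> < ennreal e" using d e by (intro ennreal_lessI) auto
      finally show "(\<integral>\<^sup>+x. ennreal (f k x) \<partial>M) < ennreal e" .
    qed
  qed
qed

lemma borel_measurable_lebesgue_on_cong_AE: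
  fixes f g :: "'a::euclidean_space \<Rightarrow> 'b::euclidean_space"
  assumes f: "f \<in> borel_measurable (lebesgue_on U)" and U: "U \<in> sets lebesgue"
    and ae: "AE x in lebesgue. x \<in> U \<longrightarrow> f x = g x"
  shows "g \<in> borel_measurable (lebesgue_on U)"
proof -
  have "(\<lambda>x. indicator U x *\<^sub>R f x) \<in> borel_measurable lebesgue"
    using f U by (simp add: borel_measurable_restrict_space_iff)
  then have "(\<lambda>x. indicator U x *\<^sub>R g x) \<in> borel_measurable lebesgue"
    by (rule lebesgue_measurable_cong_AE) (use ae in \<open>auto elim!: eventually_mono simp: indicator_def\<close>)
  then show ?thesis using U by (simp add: borel_measurable_restrict_space_iff)
qed

lemma Du_eq_jac: "Du U u = jac (wd U u)"
  by (simp add: fun_eq_iff Du_def jac_def)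

lemma Xsp_wd:
  assumes "u \<in> Xsp"
  shows "weak_partial B1 u i (wd B1 u i)" and "Lp 4 B1 (wd B1 u i)"
proof -
  obtain g where g: "weak_partial B1 u i g" "Lp 4 B1 g" using assms unfolding Xsp_def W1_def by blast
  show "weak_partial B1 u i (wd B1 u i)" using weak_partial_wd[OF g(1)] .
  have ae: "AE x in lebesgue. x \<in> B1 \<longrightarrow> g x = wd B1 u i x"
    using wd_AE_eq[OF open_ball g(1)] by (auto elim!: eventually_mono)
  have "(\<integral>\<^sup>+x\<in>B1. ennreal (norm (wd B1 u i x) ^ 4) \<partial>lebesgue) = (\<integral>\<^sup>+x\<in>B1. ennreal (norm (g x) ^ 4) \<partial>lebesgue)"
    by (rule nn_integral_cong_AE) (use ae in \<open>auto elim!: eventually_mono simp: indicator_def\<close>)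
  then show "Lp 4 B1 (wd B1 u i)"
    using g(2) borel_measurable_lebesgue_on_cong_AE[OF _ _ ae] by (simp add: Lp_def)
qed

lemma Xsp_Du_measurable: "u \<in> Xsp \<Longrightarrow> Du B1 u \<in> borel_measurable (lebesgue_on B1)"
  unfolding Du_eq_jac using Xsp_wd(2) by (intro jac_measurable) (simp add: Lp_def)

lemma Lp_4_imp_2:
  assumes U: "U \<in> lmeasurable" and f: "Lp 4 U f"
  shows "Lp 2 U f"
proof -
  have Us: "U \<in> sets lebesgue" using U by (rule fmeasurableD)
  have m[measurable]: "f \<in> borel_measurable (lebesgue_on U)" using f by (simp add: Lp_def)
  have "(\<integral>\<^sup>+x\<in>U. ennreal (norm (f x) ^ 2) \<partial>lebesgue) = (\<integral>\<^sup>+x. ennreal (norm (f x) ^ 2) \<partial>lebesgue_on U)"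
    using Us by (simp add: nn_integral_restrict_space)
  also have "\<dots> \<le> (\<integral>\<^sup>+x. 1 + ennreal (norm (f x) ^ 4) \<partial>lebesgue_on U)"
  proof (rule nn_integral_mono)
    fix x
    have "t \<le> 1 + t\<^sup>2" for t :: real
    proof -
      have "2 * t \<le> t\<^sup>2 + 1" using sum_squares_bound[of t 1] by simp
      then show ?thesis using zero_le_power2[of t] by linarith
    qed
    from this[of "norm (f x) ^ 2"] have "norm (f x) ^ 2 \<le> 1 + norm (f x) ^ 4" by simp
    then have "ennreal (norm (f x) ^ 2) \<le> ennreal (1 + norm (f x) ^ 4)" by (rule ennreal_leI)
    then show "ennreal (norm (f x) ^ 2) \<le> 1 + ennreal (norm (f x) ^ 4)" by (simp add: ennreal_plus)
  qed
  also have "\<dots> = (\<integral>\<^sup>+x. 1 \<partial>lebesgue_on U) + (\<integral>\<^sup>+x. ennreal (norm (f x) ^ 4) \<partial>lebesgue_on U)"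
    by (rule nn_integral_add) measurable
  also have "\<dots> < \<infinity>"
  proof -
    have "(\<integral>\<^sup>+x. 1 \<partial>lebesgue_on U) < \<infinity>"
      using finite_measure.emeasure_finite[OF finite_measure_lebesgue_on[OF U]] by (simp only: nn_integral_const mult_1_left less_top infinity_ennreal_def not_False_eq_True)
    moreover have "(\<integral>\<^sup>+x. ennreal (norm (f x) ^ 4) \<partial>lebesgue_on U) < \<infinity>"
      using Us f by (simp add: nn_integral_restrict_space Lp_def)
    ultimately show ?thesis by (simp only: ennreal_add_less_top infinity_ennreal_def simp_thms)
  qed
  finally show ?thesis using m by (simp add: Lp_def)
qed

lemma Lp_mono:
  assumes f: "Lp p U f" and V: "V \<subseteq> U" "V \<in> sets lebesgue"
  shows "Lp p V f"
proof -
  have "(\<integral>\<^sup>+x\<in>V. ennreal (norm (f x) ^ p) \<partial>lebesgue) \<le> (\<integral>\<^sup>+x\<in>U. ennreal (norm (f x) ^ p) \<partial>lebesgue)"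
    using V by (intro nn_integral_mono) (auto simp: indicator_def)
  then have "(\<integral>\<^sup>+x\<in>V. ennreal (norm (f x) ^ p) \<partial>lebesgue) < \<infinity>"
    using f unfolding Lp_def by (blast intro: le_less_trans)
  moreover have "f \<in> borel_measurable (lebesgue_on V)"
    using f unfolding Lp_def by (intro measurable_restrict_mono[OF _ V(1)]) blast
  ultimately show ?thesis unfolding Lp_def by blast
qed

text \<open>Borel rather than Lebesgue measurability makes Fubini's theorem on product spaces available.\<close>
lemma representatives:
  assumes u: "u \<in> Xsp" and W: "W2 2 B1 u"
  obtains w :: "real^2 \<Rightarrow> real^3" and g :: "2 \<Rightarrow> real^2 \<Rightarrow> real^3" and H :: "2 \<Rightarrow> 2 \<Rightarrow> real^2 \<Rightarrow> real^3"
  where "w \<in> borel_measurable borel" "\<And>x. x \<in> cball 0 1 \<Longrightarrow> w x = u x"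
    "\<And>i. g i \<in> borel_measurable borel" "\<And>i j. H i j \<in> borel_measurable borel"
    "\<And>i. weak_partial B1 w i (g i)" "\<And>i j. weak_partial B1 (g i) j (H i j)"
    "(\<integral>\<^sup>+x. ennreal (dist_sq g x) \<partial>lborel) = (\<integral>\<^sup>+x\<in>B1. ennreal ((infdist (Du B1 u x) O23)\<^sup>2) \<partial>lebesgue)"
    "(\<integral>\<^sup>+x\<in>B1. ennreal (\<Sum>i\<in>UNIV. \<Sum>j\<in>UNIV. (norm (H i j x))\<^sup>2) \<partial>lborel) = (\<integral>\<^sup>+x\<in>B1. ennreal (hess_sq B1 u x) \<partial>lebesgue)"
proof -
  have B1s: "B1 \<in> sets borel" by simp
  obtain g0 where g0: "\<And>i. weak_partial B1 u i (g0 i)" "\<And>i. Lp 2 B1 (g0 i)"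
    "\<And>i. \<forall>j. \<exists>g2. weak_partial B1 (g0 i) j g2 \<and> Lp 2 B1 g2"
    using W unfolding W2_def by metis
  then obtain H0 where H0: "\<And>i j. weak_partial B1 (g0 i) j (H0 i j)" "\<And>i j. Lp 2 B1 (H0 i j)" by metis
  have rep: "\<exists>f'. f' \<in> borel_measurable borel \<and> (AE x in lebesgue. x \<in> B1 \<longrightarrow> f' x = f x)"
    if "Lp 2 B1 f" for f :: "real^2 \<Rightarrow> real^3"
  proof -
    have m: "f \<in> borel_measurable (lebesgue_on B1)" using that by (simp add: Lp_def)
    show ?thesis by (rule borel_representative[OF B1s m]) blast
  qed
  define g where "g i = (SOME f'. f' \<in> borel_measurable borel \<and> (AE x in lebesgue. x \<in> B1 \<longrightarrow> f' x = g0 i x))" for i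
  have g: "g i \<in> borel_measurable borel" "AE x in lebesgue. x \<in> B1 \<longrightarrow> g i x = g0 i x" for i
    using someI_ex[OF rep[OF g0(2)[of i]]] unfolding g_def by blast+
  define H where "H i j = (SOME f'. f' \<in> borel_measurable borel \<and> (AE x in lebesgue. x \<in> B1 \<longrightarrow> f' x = H0 i j x))" for i j
  have H: "H i j \<in> borel_measurable borel" "AE x in lebesgue. x \<in> B1 \<longrightarrow> H i j x = H0 i j x" for i j
    using someI_ex[OF rep[OF H0(2)[of i j]]] unfolding H_def by blast+
  define w where "w x = indicator (cball 0 1) x *\<^sub>R u x" for x
  have wu: "w x = u x" if "x \<in> cball 0 1" for x using that by (simp add: w_def)
  have ae: "AE x in lebesgue. x \<in> B1 \<longrightarrow> g0 i x = g i x" "AE x in lebesgue. x \<in> B1 \<longrightarrow> H0 i j x = H i j x" for i j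
    by (rule eventually_mono[OF g(2)[of i]], simp) (rule eventually_mono[OF H(2)[of i j]], simp)
  have ug: "weak_partial B1 u i (g i)" for i
    by (rule weak_partial_cong_AE[OF g0(1) _ ae(1)]) simp
  have wg: "weak_partial B1 w i (g i)" for i
    by (rule weak_partial_cong_AE[OF g0(1) _ ae(1)]) (auto simp: wu)
  have gH: "weak_partial B1 (g i) j (H i j)" for i j
    by (rule weak_partial_cong_AE[OF H0(1) ae])
  show ?thesis
  proof (rule that[of w g H])
    show "w \<in> borel_measurable borel"
      unfolding w_def using u by (intro borel_measurable_continuous_on_indicator) (auto simp: Xsp_def)
    have "AE x in lebesgue. x \<in> B1 \<longrightarrow> wd B1 u i x = g i x" for i by (rule wd_AE_eq[OF open_ball ug])
    then have "AE x in lebesgue. \<forall>i\<in>UNIV. x \<in> B1 \<longrightarrow> wd B1 u i x = g i x" by (intro AE_finite_allI) auto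
    then have Dae: "AE x in lebesgue. x \<in> B1 \<longrightarrow> Du B1 u x = jac g x"
      by eventually_elim (simp add: Du_eq_jac jac_def)
    have "(\<integral>\<^sup>+x. ennreal (dist_sq g x) \<partial>lborel) = (\<integral>\<^sup>+x. ennreal (dist_sq g x) \<partial>lebesgue)"
      by (simp add: nn_integral_completion)
    also have "\<dots> = (\<integral>\<^sup>+x\<in>B1. ennreal ((infdist (Du B1 u x) O23)\<^sup>2) \<partial>lebesgue)"
      by (rule nn_integral_cong_AE) (use Dae in \<open>auto elim!: eventually_mono simp: dist_sq_def indicator_def\<close>)
    finally show "(\<integral>\<^sup>+x. ennreal (dist_sq g x) \<partial>lborel) = (\<integral>\<^sup>+x\<in>B1. ennreal ((infdist (Du B1 u x) O23)\<^sup>2) \<partial>lebesgue)" .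
    have "(\<integral>\<^sup>+x\<in>B1. ennreal (\<Sum>i\<in>UNIV. \<Sum>j\<in>UNIV. (norm (H i j x))\<^sup>2) \<partial>lborel)
      = (\<integral>\<^sup>+x\<in>B1. ennreal (\<Sum>i\<in>UNIV. \<Sum>j\<in>UNIV. (norm (H i j x))\<^sup>2) \<partial>lebesgue)"
      by (simp add: nn_integral_completion)
    also have "\<dots> = (\<integral>\<^sup>+x\<in>B1. ennreal (hess_sq B1 u x) \<partial>lebesgue)"
      by (rule nn_integral_cong_AE)
         (use hess_sq_AE_eq[OF open_ball ug gH] in \<open>auto elim!: eventually_mono simp: indicator_def\<close>)
    finally show "(\<integral>\<^sup>+x\<in>B1. ennreal (\<Sum>i\<in>UNIV. \<Sum>j\<in>UNIV. (norm (H i j x))\<^sup>2) \<partial>lborel) = (\<integral>\<^sup>+x\<in>B1. ennreal (hess_sq B1 u x) \<partial>lebesgue)" .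
  qed (use wu g H wg gH in auto)
qed

text \<open>Finiteness of the energy yields the regularity, and both terms of \<open>Eh\<close> are
  nonnegative, so each inherits the bound separately. Only the first is divided by h^2.\<close>

lemma Ebar_bounds:
  assumes E: "Ebar h u \<le> ennreal M" and h: "0 < h" "h < 1" and M: "M \<ge> 0"
  shows "u \<in> Xsp" "W2 2 B1 u"
    and "(\<integral>\<^sup>+x\<in>B1. ennreal (hess_sq B1 u x) \<partial>lebesgue) \<le> ennreal (M * \<bar>ln h\<bar>)"
    and "(\<integral>\<^sup>+x\<in>B1. ennreal ((infdist (Du B1 u x) O23)\<^sup>2) \<partial>lebesgue) \<le> ennreal (M * h\<^sup>2 * \<bar>ln h\<bar>)"
proof -
  have "Ebar h u \<noteq> \<infinity>" using E by (metis ennreal_less_top infinity_ennreal_def not_le)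
  then have uW: "u \<in> Xsp \<and> W2 2 B1 u" by (auto simp: Ebar_def split: if_splits)
  then show "u \<in> Xsp" "W2 2 B1 u" by auto
  have L: "\<bar>ln h\<bar> > 0" using h by simp
  define c where "c = h\<^sup>2 * \<bar>ln h\<bar>"
  have c: "c > 0" unfolding c_def using h L by (intro mult_pos_pos) simp_all
  define I where "I = (\<integral>\<^sup>+x\<in>B1. ennreal (hess_sq B1 u x) \<partial>lebesgue)"
  define D where "D = (\<integral>\<^sup>+x\<in>B1. ennreal ((infdist (Du B1 u x) O23)\<^sup>2) \<partial>lebesgue)"
  have "ennreal (1 / c) * (ennreal (h\<^sup>2) * I + D) \<le> ennreal M"
    using E uW by (simp add: Ebar_def Eh_def c_def I_def D_def)
  then have "ennreal c * (ennreal (1 / c) * (ennreal (h\<^sup>2) * I + D)) \<le> ennreal c * ennreal M" by (rule mult_left_mono) simp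
  then have sum: "ennreal (h\<^sup>2) * I + D \<le> ennreal (c * M)"
    using c M by (simp add: mult.assoc[symmetric] ennreal_mult[symmetric])
  have "D \<le> ennreal (c * M)" by (rule order_trans[OF _ sum]) (simp add: add_increasing)
  then show "(\<integral>\<^sup>+x\<in>B1. ennreal ((infdist (Du B1 u x) O23)\<^sup>2) \<partial>lebesgue) \<le> ennreal (M * h\<^sup>2 * \<bar>ln h\<bar>)"
    unfolding D_def[symmetric] c_def by (simp add: mult_ac)
  have "ennreal (h\<^sup>2) * I \<le> ennreal (c * M)" using sum by (rule order_trans[rotated]) (simp add: add_increasing2)
  then have "ennreal (1 / h\<^sup>2) * (ennreal (h\<^sup>2) * I) \<le> ennreal (1 / h\<^sup>2) * ennreal (c * M)" by (rule mult_left_mono) simp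
  moreover have "ennreal (1 / h\<^sup>2) * (ennreal (h\<^sup>2) * I) = I"
    using h by (simp add: mult.assoc[symmetric] ennreal_mult[symmetric])
  moreover have "ennreal (1 / h\<^sup>2) * ennreal (c * M) = ennreal (M * \<bar>ln h\<bar>)"
  proof -
    have "ennreal (1 / h\<^sup>2) * ennreal (c * M) = ennreal (1 / h\<^sup>2 * (c * M))"
      using c M by (intro ennreal_mult[symmetric]) auto
    also have "1 / h\<^sup>2 * (c * M) = M * \<bar>ln h\<bar>" using h by (simp add: c_def)
    finally show ?thesis .
  qed
  ultimately show "(\<integral>\<^sup>+x\<in>B1. ennreal (hess_sq B1 u x) \<partial>lebesgue) \<le> ennreal (M * \<bar>ln h\<bar>)"
    unfolding I_def[symmetric] by simp
qed

text \<open>For h at most 1/4 the logarithm has modulus at least 1, so all its lower powers are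
  absorbed in (ln h)^2. The constants add up as 10 = 8 + 2 for the area and 72 = 4 + 64 + 4 for
  \<open>M\<close>.\<close>

lemma dev_bound_le:
  assumes h: "0 < h" "h \<le> 1/4" and M: "M \<ge> 0"
  shows "dev_bound h (M * h\<^sup>2 * \<bar>ln h\<bar>) (M * \<bar>ln h\<bar>) \<le> (10 * measure lborel Ann + 72 * M) * (h * (ln h)\<^sup>2)"
proof -
  define \<kappa> where "\<kappa> = measure lborel Ann"
  have \<kappa>: "\<kappa> \<ge> 0" by (simp add: \<kappa>_def)
  define L where "L = \<bar>ln h\<bar>"
  have L_eq: "L = ln (1 / h)" using h by (simp add: L_def ln_div)
  have "exp 1 \<le> (4::real)" using exp_le by simp
  also have "4 \<le> 1 / h" using h by (simp add: field_simps)
  finally have "1 \<le> L" unfolding L_eq using h by (subst ln_ge_iff) auto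
  moreover from this have "L * 1 \<le> L * L" by (intro mult_left_mono) auto
  ultimately have LL: "1 \<le> L" "L \<le> L\<^sup>2" "1 \<le> L\<^sup>2" unfolding power2_eq_square by linarith+
  have "ln (2 / h) = ln 2 + L" using h by (simp add: ln_div L_eq)
  also have "ln 2 \<le> L" using \<open>1 \<le> L\<close> ln_le_minus_one[of "2::real"] by linarith
  finally have l2: "ln (2 / h) \<le> 2 * L" by simp
  have Lsq: "(ln h)\<^sup>2 = L\<^sup>2" by (simp add: L_def)
  have "dev_bound h (M * h\<^sup>2 * L) (M * L) = h * (8 * \<kappa> + 68 * (M * L)) + h * (2 * (M * L) + \<kappa>) * ln (2 / h)"
    unfolding dev_bound_def \<kappa>_def[symmetric] using h by (simp add: power2_eq_square field_simps)
  also have "\<dots> \<le> h * (8 * \<kappa> + 68 * (M * L)) + h * (2 * (M * L) + \<kappa>) * (2 * L)"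
    using h M \<kappa> LL by (intro add_left_mono mult_left_mono l2) auto
  also have "\<dots> = h * (8 * \<kappa> * 1 + 68 * M * L + 4 * M * L\<^sup>2 + 2 * \<kappa> * L)"
    by (simp add: power2_eq_square algebra_simps)
  also have "\<dots> \<le> h * (8 * \<kappa> * L\<^sup>2 + 68 * M * L\<^sup>2 + 4 * M * L\<^sup>2 + 2 * \<kappa> * L\<^sup>2)"
    using h M \<kappa> LL by (intro mult_left_mono add_mono) auto
  also have "\<dots> = (10 * \<kappa> + 72 * M) * (h * L\<^sup>2)" by (simp add: algebra_simps)
  finally show ?thesis unfolding Lsq L_def \<kappa>_def .
qed

lemma norm_add3_sq_le:
  fixes a b c :: "'b::real_inner"
  shows "(norm (a + b + c))\<^sup>2 \<le> 3 * ((norm a)\<^sup>2 + (norm b)\<^sup>2 + (norm c)\<^sup>2)"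
proof -
  have "norm (a + b + c) \<le> norm a + norm b + norm c" by (meson add_mono norm_triangle_ineq order_refl order_trans)
  then have "(norm (a + b + c))\<^sup>2 \<le> (norm a + norm b + norm c)\<^sup>2" by (intro power_mono) auto
  also have "\<dots> \<le> 3 * ((norm a)\<^sup>2 + (norm b)\<^sup>2 + (norm c)\<^sup>2)"
    using sum_squares_bound[of "norm a" "norm b"] sum_squares_bound[of "norm a" "norm c"] sum_squares_bound[of "norm b" "norm c"]
    by (simp add: power2_eq_square algebra_simps)
  finally show ?thesis .
qed

lemma norm_diff_sq_le: "(norm (a - b :: 'b::real_inner))\<^sup>2 \<le> 2 * (norm a)\<^sup>2 + 2 * (norm b)\<^sup>2"
  using norm_midpoint_sq[of a b] zero_le_power2[of "norm ((1/2) *\<^sub>R (a + b))"] by argo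

text \<open>\<open>conical_deviation\<close> is used at scale \<open>r\<close> and at scale 1. Both
  maps are compared with the same cone \<open>P\<close> over the boundary values, which drops out of
  the difference; 2/r + 2 is at most 4/r.\<close>

lemma rescaling_deviation:
  assumes E: "Ebar h u \<le> ennreal M" and h: "0 < h" "h \<le> 1/4" and M: "M \<ge> 0" and r: "0 < r" "r \<le> 1"
  shows "(\<integral>\<^sup>+x\<in>Ann. ennreal ((norm ((1 / r) *\<^sub>R u (r *\<^sub>R x) - u x))\<^sup>2) \<partial>lborel)
    \<le> ennreal (4 / r * ((10 * measure lborel Ann + 72 * M) * (h * (ln h)\<^sup>2)))"
proof -
  have h1: "h < 1" using h by simp
  note EB = Ebar_bounds[OF E h(1) h1 M]
  obtain w g H where rep: "w \<in> borel_measurable borel" "\<And>x. x \<in> cball 0 1 \<Longrightarrow> w x = u x"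
    "\<And>i. g i \<in> borel_measurable borel" "\<And>i j. H i j \<in> borel_measurable borel"
    "\<And>i. weak_partial B1 w i (g i)" "\<And>i j. weak_partial B1 (g i) j (H i j)"
    "(\<integral>\<^sup>+x. ennreal (dist_sq g x) \<partial>lborel) = (\<integral>\<^sup>+x\<in>B1. ennreal ((infdist (Du B1 u x) O23)\<^sup>2) \<partial>lebesgue)"
    "(\<integral>\<^sup>+x\<in>B1. ennreal (\<Sum>i\<in>UNIV. \<Sum>j\<in>UNIV. (norm (H i j x))\<^sup>2) \<partial>lborel) = (\<integral>\<^sup>+x\<in>B1. ennreal (hess_sq B1 u x) \<partial>lebesgue)"
    by (rule representatives[OF EB(1,2)]) blast
  define \<Delta> where "\<Delta> = M * h\<^sup>2 * \<bar>ln h\<bar>"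
  define E' where "E' = M * \<bar>ln h\<bar>"
  define Q where "Q = dev_bound h \<Delta> E'"
  have nonneg: "\<Delta> \<ge> 0" "E' \<ge> 0" using M by (auto simp: \<Delta>_def E'_def)
  have contw: "continuous_on (cball 0 1) w"
    using EB(1) rep(2) continuous_on_cong[of "cball 0 1" "cball 0 1" w u] by (simp add: Xsp_def)
  have w0: "w 0 = 0" using rep(2)[of 0] EB(1) by (simp add: Xsp_def)
  have w1: "norm (w x) = 1" if "norm x = 1" for x using rep(2)[of x] EB(1) that by (simp add: Xsp_def)
  define P where "P x = norm x *\<^sub>R w ((1 / norm x) *\<^sub>R x)" for x
  note [measurable] = rep(1)
  have Pm[measurable]: "P \<in> borel_measurable borel"
  proof -
    have "(\<lambda>x::real^2. w ((1 / norm x) *\<^sub>R x)) \<in> borel_measurable borel"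
      by (rule measurable_compose[OF _ rep(1)]) measurable
    then show ?thesis unfolding P_def by measurable
  qed
  have dev: "(\<integral>\<^sup>+x\<in>Ann. ennreal ((norm ((1 / s) *\<^sub>R w (s *\<^sub>R x) - P x))\<^sup>2) \<partial>lborel) \<le> ennreal ((1 / s) * Q)"
    if "0 < s" "s \<le> 1" for s
    unfolding P_def Q_def
    by (rule conical_deviation[OF rep(1) contw w0 w1 rep(3-6)])
       (use that EB(3,4) rep(7,8) nonneg h in \<open>simp_all add: \<Delta>_def E'_def\<close>)
  have "(\<integral>\<^sup>+x\<in>Ann. ennreal ((norm ((1 / r) *\<^sub>R u (r *\<^sub>R x) - u x))\<^sup>2) \<partial>lborel)
    \<le> (\<integral>\<^sup>+x. 2 * (ennreal ((norm ((1 / r) *\<^sub>R w (r *\<^sub>R x) - P x))\<^sup>2) * indicator Ann x)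
         + 2 * (ennreal ((norm ((1 / 1) *\<^sub>R w (1 *\<^sub>R x) - P x))\<^sup>2) * indicator Ann x) \<partial>lborel)"
  proof (rule nn_integral_mono)
    fix x :: "real^2"
    show "ennreal ((norm ((1 / r) *\<^sub>R u (r *\<^sub>R x) - u x))\<^sup>2) * indicator Ann x
      \<le> 2 * (ennreal ((norm ((1 / r) *\<^sub>R w (r *\<^sub>R x) - P x))\<^sup>2) * indicator Ann x)
         + 2 * (ennreal ((norm ((1 / 1) *\<^sub>R w (1 *\<^sub>R x) - P x))\<^sup>2) * indicator Ann x)"
    proof (cases "x \<in> Ann")
      case True
      then have n: "norm x \<le> 1" by simp
      have "r * norm x \<le> 1 * 1" using r n by (intro mult_mono) auto
      then have wu: "w x = u x" "w (r *\<^sub>R x) = u (r *\<^sub>R x)" using rep(2) n r by auto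
      have "(norm ((1 / r) *\<^sub>R u (r *\<^sub>R x) - u x))\<^sup>2
        = (norm (((1 / r) *\<^sub>R w (r *\<^sub>R x) - P x) - ((1 / 1) *\<^sub>R w (1 *\<^sub>R x) - P x)))\<^sup>2" by (simp add: wu)
      also have "\<dots> \<le> 2 * (norm ((1 / r) *\<^sub>R w (r *\<^sub>R x) - P x))\<^sup>2 + 2 * (norm ((1 / 1) *\<^sub>R w (1 *\<^sub>R x) - P x))\<^sup>2"
        by (rule norm_diff_sq_le)
      finally have "ennreal ((norm ((1 / r) *\<^sub>R u (r *\<^sub>R x) - u x))\<^sup>2)
        \<le> ennreal (2 * (norm ((1 / r) *\<^sub>R w (r *\<^sub>R x) - P x))\<^sup>2 + 2 * (norm ((1 / 1) *\<^sub>R w (1 *\<^sub>R x) - P x))\<^sup>2)"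
        by (rule ennreal_leI)
      then show ?thesis using True by (simp add: ennreal_plus ennreal_mult)
    qed simp
  qed
  also have "\<dots> = 2 * (\<integral>\<^sup>+x\<in>Ann. ennreal ((norm ((1 / r) *\<^sub>R w (r *\<^sub>R x) - P x))\<^sup>2) \<partial>lborel)
    + 2 * (\<integral>\<^sup>+x\<in>Ann. ennreal ((norm ((1 / 1) *\<^sub>R w (1 *\<^sub>R x) - P x))\<^sup>2) \<partial>lborel)"
    by (rule trans[OF nn_integral_add arg_cong2[of _ _ _ _ "(+)", OF nn_integral_cmult nn_integral_cmult]]) measurable
  also have "\<dots> \<le> 2 * ennreal ((1 / r) * Q) + 2 * ennreal ((1 / 1) * Q)"
    by (intro add_mono mult_left_mono dev r) auto
  also have "\<dots> \<le> ennreal (4 / r * ((10 * measure lborel Ann + 72 * M) * (h * (ln h)\<^sup>2)))"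
  proof -
    have Q0: "Q \<ge> 0" unfolding Q_def dev_bound_def using nonneg h by (intro add_nonneg_nonneg mult_nonneg_nonneg divide_nonneg_nonneg) auto
    have "2 * ennreal ((1 / r) * Q) + 2 * ennreal ((1 / 1) * Q) = ennreal (2 * ((1 / r) * Q) + 2 * Q)"
    proof -
      have "2 * ennreal a = ennreal (2 * a)" if "a \<ge> 0" for a :: real
        using that by (subst ennreal_mult) auto
      then show ?thesis using Q0 r by (simp add: ennreal_plus[symmetric] del: ennreal_plus)
    qed
    also have "2 * ((1 / r) * Q) + 2 * Q \<le> 4 / r * Q"
    proof -
      have "Q * 1 \<le> Q * (1 / r)" using Q0 r by (intro mult_left_mono) (auto simp: field_simps)
      moreover have "4 / r * Q = 4 * (Q * (1 / r))" "(1 / r) * Q = Q * (1 / r)" by simp_all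
      ultimately show ?thesis by argo
    qed
    also have "4 / r * Q \<le> 4 / r * ((10 * measure lborel Ann + 72 * M) * (h * (ln h)\<^sup>2))"
      unfolding Q_def \<Delta>_def E'_def using r by (intro mult_left_mono dev_bound_le h M) auto
    finally show ?thesis by (simp add: ennreal_leI)
  qed
  finally show ?thesis .
qed

section \<open>Dyadic annuli and blow-ups\<close>

lemma sum_dyadic_annuli_le:
  fixes f :: "real^2 \<Rightarrow> ennreal"
  assumes [measurable]: "f \<in> borel_measurable borel"
  shows "(\<Sum>j<N. \<integral>\<^sup>+x. f x * indicator Ann (2 ^ j *\<^sub>R x) \<partial>lborel) + (\<integral>\<^sup>+x. f x * indicator B1 (2 ^ N *\<^sub>R x) \<partial>lborel)
    \<le> (\<integral>\<^sup>+x\<in>B1. f x \<partial>lborel)"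
proof (induction N)
  case (Suc N)
  have "(\<integral>\<^sup>+x. f x * indicator Ann (2 ^ N *\<^sub>R x) \<partial>lborel) + (\<integral>\<^sup>+x. f x * indicator B1 (2 ^ Suc N *\<^sub>R x) \<partial>lborel)
    = (\<integral>\<^sup>+x. f x * indicator Ann (2 ^ N *\<^sub>R x) + f x * indicator B1 (2 ^ Suc N *\<^sub>R x) \<partial>lborel)"
    by (rule nn_integral_add[symmetric]) measurable
  \<comment> \<open>The disc left over after \<open>N\<close> annuli contains the next annulus and
    the next disc disjointly; carrying it along is what makes the induction work.\<close>
  also have "\<dots> \<le> (\<integral>\<^sup>+x. f x * indicator B1 (2 ^ N *\<^sub>R x) \<partial>lborel)"
  proof (rule nn_integral_mono)
    fix x :: "real^2"
    show "f x * indicator Ann (2 ^ N *\<^sub>R x) + f x * indicator B1 (2 ^ Suc N *\<^sub>R x) \<le> f x * indicator B1 (2 ^ N *\<^sub>R x)"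
      by (auto simp: indicator_def)
  qed
  finally have "(\<integral>\<^sup>+x. f x * indicator Ann (2 ^ N *\<^sub>R x) \<partial>lborel) + (\<integral>\<^sup>+x. f x * indicator B1 (2 ^ Suc N *\<^sub>R x) \<partial>lborel)
    \<le> (\<integral>\<^sup>+x. f x * indicator B1 (2 ^ N *\<^sub>R x) \<partial>lborel)" .
  then show ?case using Suc
    by (simp only: sum.lessThan_Suc add.assoc) (meson add_left_mono order_trans)
qed simp

lemma weak_partial_scaleR:
  fixes u :: "real^'n::finite \<Rightarrow> 'b::euclidean_space"
  assumes "weak_partial U u i g"
  shows "weak_partial U (\<lambda>x. c *\<^sub>R u x) i (\<lambda>x. c *\<^sub>R g x)"
  using weak_partial_mult_smooth[OF assms smooth_fn_const[of c]] by (simp add: pd_const)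

text \<open>The factor \<open>1 / r\<close> in front compensates the dilation for first derivatives:
  gradients are transported unchanged, second derivatives gain a factor \<open>r\<close>.\<close>

lemma weak_partial_blowup:
  fixes u :: "real^2 \<Rightarrow> real^3"
  assumes ug: "\<And>i. weak_partial U u i (g i)" and gH: "\<And>i j. weak_partial U (g i) j (H i j)"
    and r: "r > 0" and V: "\<And>x. x \<in> V \<Longrightarrow> r *\<^sub>R x \<in> U"
  shows "weak_partial V (\<lambda>x. (1 / r) *\<^sub>R u (r *\<^sub>R x)) i (\<lambda>x. g i (r *\<^sub>R x))"
    and "weak_partial V (\<lambda>x. g i (r *\<^sub>R x)) j (\<lambda>x. r *\<^sub>R H i j (r *\<^sub>R x))"
  using weak_partial_scaleR[OF weak_partial_scale[OF ug r V], where c="1 / r"] weak_partial_scale[OF gH r V] r by auto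

text \<open>Scale invariance of the Hessian energy in the plane: the factor r^2 from the squared
  second derivatives cancels the Jacobian 1/r^2.\<close>

lemma Ann_hessian_scale:
  fixes H :: "2 \<Rightarrow> 2 \<Rightarrow> real^2 \<Rightarrow> real^3"
  assumes [measurable]: "\<And>i j. H i j \<in> borel_measurable borel" and r: "r > 0" and [measurable]: "A \<in> sets borel"
  shows "(\<integral>\<^sup>+x\<in>A. ennreal (\<Sum>i\<in>UNIV. \<Sum>j\<in>UNIV. (norm (r *\<^sub>R H i j (r *\<^sub>R x)))\<^sup>2) \<partial>lborel)
    = (\<integral>\<^sup>+x. ennreal (\<Sum>i\<in>UNIV. \<Sum>j\<in>UNIV. (norm (H i j x))\<^sup>2) * indicator A ((1 / r) *\<^sub>R x) \<partial>lborel)"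
proof -
  define F where "F x = ennreal (\<Sum>i\<in>UNIV. \<Sum>j\<in>UNIV. (norm (H i j x))\<^sup>2) * indicator A ((1 / r) *\<^sub>R x)" for x
  have Fm: "F \<in> borel_measurable borel" unfolding F_def by measurable
  have "ennreal (\<Sum>i\<in>UNIV. \<Sum>j\<in>UNIV. (norm (r *\<^sub>R H i j (r *\<^sub>R x)))\<^sup>2) * indicator A x = ennreal (r\<^sup>2) * F (r *\<^sub>R x)" for x
  proof -
    have "(\<Sum>i\<in>UNIV. \<Sum>j\<in>UNIV. (norm (r *\<^sub>R H i j (r *\<^sub>R x)))\<^sup>2) = r\<^sup>2 * (\<Sum>i\<in>UNIV. \<Sum>j\<in>UNIV. (norm (H i j (r *\<^sub>R x)))\<^sup>2)"
      by (simp add: sum_distrib_left power_mult_distrib)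
    then show ?thesis using r by (simp add: F_def ennreal_mult sum_nonneg mult.assoc)
  qed
  then have "(\<integral>\<^sup>+x\<in>A. ennreal (\<Sum>i\<in>UNIV. \<Sum>j\<in>UNIV. (norm (r *\<^sub>R H i j (r *\<^sub>R x)))\<^sup>2) \<partial>lborel)
    = (\<integral>\<^sup>+x. ennreal (r\<^sup>2) * F (r *\<^sub>R x) \<partial>lborel)" by simp
  also have "\<dots> = ennreal (r\<^sup>2) * (\<integral>\<^sup>+x. F (r *\<^sub>R x) \<partial>lborel)"
    by (rule nn_integral_cmult, simp, rule measurable_compose[OF _ Fm], simp)
  also have "(\<integral>\<^sup>+x. F (r *\<^sub>R x) \<partial>lborel) = ennreal (1 / r ^ DIM(real^2)) * (\<integral>\<^sup>+x. F x \<partial>lborel)"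
    by (rule nn_integral_lborel_scale[OF Fm r])
  also have "ennreal (r\<^sup>2) * \<dots> = (ennreal (r\<^sup>2) * ennreal (1 / r\<^sup>2)) * (\<integral>\<^sup>+x. F x \<partial>lborel)"
    by (simp add: mult.assoc)
  also have "ennreal (r\<^sup>2) * ennreal (1 / r\<^sup>2) = 1" using r by (simp add: ennreal_mult[symmetric])
  finally show ?thesis by (simp add: F_def)
qed

text \<open>Pigeonhole: the cheapest of \<open>N\<close> disjoint annuli carries at most the average
  of the total Hessian energy, and by scale invariance the blow-up to \<open>Ann\<close> keeps this
  bound.\<close>

lemma dyadic_selection:
  assumes E: "Ebar h u \<le> ennreal M" and h: "0 < h" "h < 1" and M: "M \<ge> 0" and N: "N > 0"
  shows "\<exists>j<N. \<exists>G H. (\<forall>i. weak_partial Ann (\<lambda>x. 2 ^ j *\<^sub>R u ((1 / 2 ^ j) *\<^sub>R x)) i (G i)) \<and>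
     (\<forall>i l. weak_partial Ann (G i) l (H i l)) \<and> (\<forall>i l. H i l \<in> borel_measurable (lebesgue_on Ann)) \<and>
     (\<integral>\<^sup>+x\<in>Ann. ennreal (\<Sum>i\<in>UNIV. \<Sum>l\<in>UNIV. (norm (H i l x))\<^sup>2) \<partial>lebesgue) \<le> ennreal (M * \<bar>ln h\<bar> / N)"
proof -
  note EB = Ebar_bounds[OF E h M]
  obtain w g H where rep: "w \<in> borel_measurable borel" "\<And>x. x \<in> cball 0 1 \<Longrightarrow> w x = u x"
    "\<And>i. g i \<in> borel_measurable borel" "\<And>i j. H i j \<in> borel_measurable borel"
    "\<And>i. weak_partial B1 w i (g i)" "\<And>i j. weak_partial B1 (g i) j (H i j)"
    "(\<integral>\<^sup>+x. ennreal (dist_sq g x) \<partial>lborel) = (\<integral>\<^sup>+x\<in>B1. ennreal ((infdist (Du B1 u x) O23)\<^sup>2) \<partial>lebesgue)"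
    "(\<integral>\<^sup>+x\<in>B1. ennreal (\<Sum>i\<in>UNIV. \<Sum>j\<in>UNIV. (norm (H i j x))\<^sup>2) \<partial>lborel) = (\<integral>\<^sup>+x\<in>B1. ennreal (hess_sq B1 u x) \<partial>lebesgue)"
    by (rule representatives[OF EB(1,2)]) blast
  note [measurable] = rep(4)
  define F where "F x = ennreal (\<Sum>i\<in>UNIV. \<Sum>j\<in>UNIV. (norm (H i j x))\<^sup>2)" for x
  have Fm: "F \<in> borel_measurable borel" unfolding F_def by measurable
  define e where "e j = (\<integral>\<^sup>+x. F x * indicator Ann (2 ^ j *\<^sub>R x) \<partial>lborel)" for j :: nat
  have "(\<Sum>j<N. e j) \<le> (\<Sum>j<N. e j) + (\<integral>\<^sup>+x. F x * indicator B1 (2 ^ N *\<^sub>R x) \<partial>lborel)" by (simp add: add_increasing2)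
  also have "\<dots> \<le> (\<integral>\<^sup>+x\<in>B1. F x \<partial>lborel)" unfolding e_def by (rule sum_dyadic_annuli_le[OF Fm])
  also have "\<dots> \<le> ennreal (M * \<bar>ln h\<bar>)" using EB(3) rep(8) by (simp add: F_def)
  finally have sum: "(\<Sum>j<N. e j) \<le> ennreal (M * \<bar>ln h\<bar>)" .
  have "Min (e ` {..<N}) \<in> e ` {..<N}" using N by (intro Min_in) auto
  then obtain j where j: "j < N" "e j = Min (e ` {..<N})" by auto
  have "of_nat N * e j \<le> (\<Sum>j<N. e j)"
    using sum_bounded_below[of "{..<N}" "e j" e] j(2) by simp
  then have "ennreal (1 / N) * (ennreal N * e j) \<le> ennreal (1 / N) * ennreal (M * \<bar>ln h\<bar>)"
    using sum by (intro mult_left_mono) (auto simp: ennreal_of_nat_eq_real_of_nat)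
  then have ej: "e j \<le> ennreal (M * \<bar>ln h\<bar> / N)"
    using N M by (simp add: mult.assoc[symmetric] ennreal_mult[symmetric])
  define r where "r = 1 / (2::real) ^ j"
  have r: "0 < r" "r \<le> 1" by (auto simp: r_def)
  have V: "r *\<^sub>R x \<in> B1" if "x \<in> Ann" for x
    using that r mult_le_less_imp_less[of r 1 "norm x" 1] by auto
  note blow = weak_partial_blowup[OF rep(5,6) r(1) V]
  have wu: "w (r *\<^sub>R x) = u (r *\<^sub>R x)" if "x \<in> Ann" for x
    using rep(2)[of "r *\<^sub>R x"] V[OF that] by simp
  show ?thesis
  proof (intro exI conjI allI, rule j(1))
    fix i l
    show "weak_partial Ann (\<lambda>x. 2 ^ j *\<^sub>R u ((1 / 2 ^ j) *\<^sub>R x)) i (\<lambda>x. g i (r *\<^sub>R x))"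
      by (rule weak_partial_cong_AE[OF blow(1)]) (use wu in \<open>auto simp: r_def\<close>)
    show "weak_partial Ann (\<lambda>x. g i (r *\<^sub>R x)) l (\<lambda>x. r *\<^sub>R H i l (r *\<^sub>R x))" by (rule blow(2))
    have "(\<lambda>x. r *\<^sub>R H i l (r *\<^sub>R x)) \<in> borel_measurable lborel" by measurable
    then show "(\<lambda>x. r *\<^sub>R H i l (r *\<^sub>R x)) \<in> borel_measurable (lebesgue_on Ann)"
      by (intro measurable_restrict_space1 measurable_completion)
  next
    have "(\<integral>\<^sup>+x\<in>Ann. ennreal (\<Sum>i\<in>UNIV. \<Sum>l\<in>UNIV. (norm (r *\<^sub>R H i l (r *\<^sub>R x)))\<^sup>2) \<partial>lebesgue)
      = (\<integral>\<^sup>+x\<in>Ann. ennreal (\<Sum>i\<in>UNIV. \<Sum>l\<in>UNIV. (norm (r *\<^sub>R H i l (r *\<^sub>R x)))\<^sup>2) \<partial>lborel)"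
      by (simp add: nn_integral_completion)
    also have "\<dots> = e j"
      unfolding Ann_hessian_scale[OF rep(4) r(1) Ann_borel] e_def F_def by (simp add: r_def)
    finally show "(\<integral>\<^sup>+x\<in>Ann. ennreal (\<Sum>i\<in>UNIV. \<Sum>l\<in>UNIV. (norm (r *\<^sub>R H i l (r *\<^sub>R x)))\<^sup>2) \<partial>lebesgue) \<le> ennreal (M * \<bar>ln h\<bar> / N)"
      using ej by simp
  qed
qed

section \<open>Lower bound\<close>

text \<open>The inequality ln z \<le> z - 1 at the power z = h^(-e/4) bounds the squared logarithm
  by a multiple of h^(-e/2), so half of the exponent survives.\<close>

lemma powr_ln_square_tendsto_0:
  fixes h :: "nat \<Rightarrow> real"
  assumes e: "e > 0" and h: "\<And>k. 0 < h k" "\<And>k. h k < 1" "h \<longlonglongrightarrow> 0"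
  shows "(\<lambda>k. h k powr e * (ln (h k))\<^sup>2) \<longlonglongrightarrow> 0"
proof (rule tendsto_sandwich[of "\<lambda>_. 0::real"])
  have le: "h k powr e * (ln (h k))\<^sup>2 \<le> 16 / e\<^sup>2 * h k powr (e / 2)" for k
  proof -
    define y where "y = 1 / h k"
    have y: "y > 1" using h(1,2)[of k] by (simp add: y_def)
    have "ln y = 4 / e * ln (y powr (e / 4))" using y e by (simp add: ln_powr)
    also have "\<dots> \<le> 4 / e * (y powr (e / 4) - 1)" using y e by (intro mult_left_mono ln_le_minus_one) auto
    also have "\<dots> \<le> 4 / e * y powr (e / 4)" using e by (intro mult_left_mono) auto
    finally have "(ln y)\<^sup>2 \<le> (4 / e * y powr (e / 4))\<^sup>2" using y by (intro power_mono) auto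
    also have "\<dots> = 16 / e\<^sup>2 * y powr (e / 2)"
      using y by (simp add: power_mult_distrib power_divide powr_power)
    finally have "(ln y)\<^sup>2 \<le> 16 / e\<^sup>2 * y powr (e / 2)" .
    moreover have "(ln (h k))\<^sup>2 = (ln y)\<^sup>2" using h(1)[of k] by (simp add: y_def ln_div)
    ultimately have "h k powr e * (ln (h k))\<^sup>2 \<le> h k powr e * (16 / e\<^sup>2 * y powr (e / 2))"
      by (intro mult_left_mono) auto
    also have "y powr (e / 2) = h k powr (- (e / 2))"
      using h(1)[of k] by (simp add: y_def powr_divide powr_minus_divide)
    also have "h k powr e * (16 / e\<^sup>2 * h k powr (- (e / 2))) = 16 / e\<^sup>2 * h k powr (e / 2)"
      using h(1)[of k] by (simp add: powr_add[symmetric])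
    finally show ?thesis .
  qed
  show "\<forall>\<^sub>F k in sequentially. h k powr e * (ln (h k))\<^sup>2 \<le> 16 / e\<^sup>2 * h k powr (e / 2)"
    using le by simp
  have "(\<lambda>k. h k powr (e / 2)) \<longlonglongrightarrow> 0"
    by (rule tendsto_zero_powrI[OF h(3) tendsto_const]) (use h(1) e in \<open>auto intro!: always_eventually less_imp_le\<close>)
  then show "(\<lambda>k. 16 / e\<^sup>2 * h k powr (e / 2)) \<longlonglongrightarrow> 0" by (rule tendsto_mult_right_zero)
qed auto

lemma Xsp_measurable: "u \<in> Xsp \<Longrightarrow> u \<in> borel_measurable (lebesgue_on B1)"
  by (simp add: Xsp_def W1_def Lp_def)

text \<open>Fourth powers are squares of squares, so convergence in L4 passes to L2 by
  \<open>nn_integral_tendsto_0_if_square\<close> on the disc of finite measure.\<close>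

lemma W14_conv_L2:
  assumes us: "\<And>k. us k \<in> Xsp" and u: "u \<in> Xsp" and conv: "W14_conv us u"
  shows "(\<lambda>k. \<integral>\<^sup>+x\<in>B1. ennreal ((norm (us k x - u x))\<^sup>2) \<partial>lebesgue) \<longlonglongrightarrow> 0"
    and "(\<lambda>k. \<integral>\<^sup>+x\<in>B1. ennreal ((norm (Du B1 (us k) x - Du B1 u x))\<^sup>2) \<partial>lebesgue) \<longlonglongrightarrow> 0"
proof -
  have fin: "finite_measure (lebesgue_on B1)" by (rule finite_measure_lebesgue_on) simp
  have B1s: "B1 \<inter> space lebesgue \<in> sets lebesgue" by simp
  have gen: "(\<lambda>k. \<integral>\<^sup>+x\<in>B1. ennreal ((norm (f k x))\<^sup>2) \<partial>lebesgue) \<longlonglongrightarrow> 0"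
    if m: "\<And>k. f k \<in> borel_measurable (lebesgue_on B1)"
      and le: "\<And>k x. ennreal (norm (f k x) ^ 4) \<le> ennreal (norm (us k x - u x) ^ 4) + ennreal (norm (Du B1 (us k) x - Du B1 u x) ^ 4)"
    for f :: "nat \<Rightarrow> real^2 \<Rightarrow> 'c::euclidean_space"
  proof -
    have "(\<lambda>k. \<integral>\<^sup>+x. ennreal ((norm (f k x))\<^sup>2) \<partial>lebesgue_on B1) \<longlonglongrightarrow> 0"
    proof (rule nn_integral_tendsto_0_if_square[OF fin])
      show "(\<lambda>x. (norm (f k x))\<^sup>2) \<in> borel_measurable (lebesgue_on B1)" for k using m[of k] by measurable
      show "(\<lambda>k. \<integral>\<^sup>+x. ennreal (((norm (f k x))\<^sup>2)\<^sup>2) \<partial>lebesgue_on B1) \<longlonglongrightarrow> 0"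
      proof (rule tendsto_sandwich[of "\<lambda>_. 0::ennreal"])
        show "\<forall>\<^sub>F k in sequentially. (\<integral>\<^sup>+x. ennreal (((norm (f k x))\<^sup>2)\<^sup>2) \<partial>lebesgue_on B1)
          \<le> (\<integral>\<^sup>+x\<in>B1. ennreal (norm (us k x - u x) ^ 4) + ennreal (norm (Du B1 (us k) x - Du B1 u x) ^ 4) \<partial>lebesgue)"
          unfolding nn_integral_restrict_space[OF B1s]
          using le by (intro always_eventually allI nn_integral_mono mult_right_mono) (simp_all add: power_mult[symmetric])
        show "(\<lambda>k. \<integral>\<^sup>+x\<in>B1. ennreal (norm (us k x - u x) ^ 4) + ennreal (norm (Du B1 (us k) x - Du B1 u x) ^ 4) \<partial>lebesgue) \<longlonglongrightarrow> 0"
          using conv by (simp only: W14_conv_def)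
      qed auto
    qed auto
    then show ?thesis by (simp only: nn_integral_restrict_space[OF B1s])
  qed
  show "(\<lambda>k. \<integral>\<^sup>+x\<in>B1. ennreal ((norm (us k x - u x))\<^sup>2) \<partial>lebesgue) \<longlonglongrightarrow> 0"
    by (rule gen[of "\<lambda>k x. us k x - u x"])
       (auto intro!: borel_measurable_diff[OF Xsp_measurable[OF us] Xsp_measurable[OF u]])
  show "(\<lambda>k. \<integral>\<^sup>+x\<in>B1. ennreal ((norm (Du B1 (us k) x - Du B1 u x))\<^sup>2) \<partial>lebesgue) \<longlonglongrightarrow> 0"
    by (rule gen[of "\<lambda>k x. Du B1 (us k) x - Du B1 u x"])
       (auto intro!: borel_measurable_diff[OF Xsp_Du_measurable[OF us] Xsp_Du_measurable[OF u]])
qed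

lemma ennreal_eq_0_if_le_tendsto_0:
  fixes a :: ennreal
  assumes "\<And>k. a \<le> b k" "b \<longlonglongrightarrow> 0"
  shows "a = 0"
proof -
  have "a \<le> 0" by (rule LIMSEQ_le_const[OF assms(2)]) (use assms(1) in auto)
  then show ?thesis by simp
qed

text \<open>The distance to \<open>O23\<close> is 1-Lipschitz, so for the limit its square is at
  most twice the square for \<open>us k\<close> plus twice the squared gradient error, both of which
  vanish. \<open>O23\<close> is closed, hence distance 0 means membership.\<close>

lemma limit_isometry:
  assumes us: "\<And>k. us k \<in> Xsp" and u: "u \<in> Xsp" and conv: "W14_conv us u"
    and D: "(\<lambda>k. \<integral>\<^sup>+x\<in>B1. ennreal ((infdist (Du B1 (us k) x) O23)\<^sup>2) \<partial>lebesgue) \<longlonglongrightarrow> 0"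
  shows "AE x in lebesgue_on B1. Du B1 u x \<in> O23"
proof -
  have B1s: "B1 \<inter> space lebesgue \<in> sets lebesgue" by simp
  have im: "(\<lambda>x. infdist (f x) O23) \<in> borel_measurable (lebesgue_on B1)" if "f \<in> borel_measurable (lebesgue_on B1)" for f
    by (rule measurable_compose[OF that borel_measurable_continuous_onI]) (intro continuous_intros)
  note m[measurable] = Xsp_Du_measurable[OF us] Xsp_Du_measurable[OF u] im[OF Xsp_Du_measurable[OF us]] im[OF Xsp_Du_measurable[OF u]]
  have "(\<integral>\<^sup>+x. ennreal ((infdist (Du B1 u x) O23)\<^sup>2) \<partial>lebesgue_on B1) = 0"
  proof (rule ennreal_eq_0_if_le_tendsto_0)
    fix k
    have "(\<integral>\<^sup>+x. ennreal ((infdist (Du B1 u x) O23)\<^sup>2) \<partial>lebesgue_on B1)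
      \<le> (\<integral>\<^sup>+x. 2 * ennreal ((infdist (Du B1 (us k) x) O23)\<^sup>2) + 2 * ennreal ((norm (Du B1 (us k) x - Du B1 u x))\<^sup>2) \<partial>lebesgue_on B1)"
    proof (rule nn_integral_mono)
      fix x
      have "infdist (Du B1 u x) O23 \<le> infdist (Du B1 (us k) x) O23 + dist (Du B1 u x) (Du B1 (us k) x)"
        by (rule infdist_triangle)
      then have "(infdist (Du B1 u x) O23)\<^sup>2 \<le> (infdist (Du B1 (us k) x) O23 + norm (Du B1 (us k) x - Du B1 u x))\<^sup>2"
        by (intro power_mono) (auto simp: dist_norm norm_minus_commute infdist_nonneg)
      also have "\<dots> \<le> 2 * (infdist (Du B1 (us k) x) O23)\<^sup>2 + 2 * (norm (Du B1 (us k) x - Du B1 u x))\<^sup>2"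
        using sum_squares_bound[of "infdist (Du B1 (us k) x) O23" "norm (Du B1 (us k) x - Du B1 u x)"] by (simp add: power2_sum)
      finally have "ennreal ((infdist (Du B1 u x) O23)\<^sup>2) \<le> ennreal (2 * (infdist (Du B1 (us k) x) O23)\<^sup>2 + 2 * (norm (Du B1 (us k) x - Du B1 u x))\<^sup>2)"
        by (rule ennreal_leI)
      then show "ennreal ((infdist (Du B1 u x) O23)\<^sup>2) \<le> 2 * ennreal ((infdist (Du B1 (us k) x) O23)\<^sup>2) + 2 * ennreal ((norm (Du B1 (us k) x - Du B1 u x))\<^sup>2)"
        by (simp add: ennreal_plus ennreal_mult)
    qed
    also have "\<dots> = 2 * (\<integral>\<^sup>+x. ennreal ((infdist (Du B1 (us k) x) O23)\<^sup>2) \<partial>lebesgue_on B1)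
        + 2 * (\<integral>\<^sup>+x. ennreal ((norm (Du B1 (us k) x - Du B1 u x))\<^sup>2) \<partial>lebesgue_on B1)"
      by (rule trans[OF nn_integral_add arg_cong2[of _ _ _ _ "(+)", OF nn_integral_cmult nn_integral_cmult]]) measurable
    finally show "(\<integral>\<^sup>+x. ennreal ((infdist (Du B1 u x) O23)\<^sup>2) \<partial>lebesgue_on B1)
      \<le> 2 * (\<integral>\<^sup>+x\<in>B1. ennreal ((infdist (Du B1 (us k) x) O23)\<^sup>2) \<partial>lebesgue)
        + 2 * (\<integral>\<^sup>+x\<in>B1. ennreal ((norm (Du B1 (us k) x - Du B1 u x))\<^sup>2) \<partial>lebesgue)"
      by (simp only: nn_integral_restrict_space[OF B1s])
  next
    have "(\<lambda>k. 2 * (\<integral>\<^sup>+x\<in>B1. ennreal ((infdist (Du B1 (us k) x) O23)\<^sup>2) \<partial>lebesgue)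
        + 2 * (\<integral>\<^sup>+x\<in>B1. ennreal ((norm (Du B1 (us k) x - Du B1 u x))\<^sup>2) \<partial>lebesgue)) \<longlonglongrightarrow> 2 * 0 + 2 * 0"
      by (intro tendsto_add tendsto_mult_ennreal tendsto_const D W14_conv_L2(2)[OF us u conv]) auto
    then show "(\<lambda>k. 2 * (\<integral>\<^sup>+x\<in>B1. ennreal ((infdist (Du B1 (us k) x) O23)\<^sup>2) \<partial>lebesgue)
        + 2 * (\<integral>\<^sup>+x\<in>B1. ennreal ((norm (Du B1 (us k) x - Du B1 u x))\<^sup>2) \<partial>lebesgue)) \<longlonglongrightarrow> 0" by simp
  qed
  then have "AE x in lebesgue_on B1. ennreal ((infdist (Du B1 u x) O23)\<^sup>2) = 0"
    by (subst (asm) nn_integral_0_iff_AE) measurable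
  then show ?thesis
    by eventually_elim (auto simp: in_closed_iff_infdist_zero[OF closed_O23 O23_nonempty] ennreal_eq_0_iff)
qed

text \<open>Membership in \<open>Xsp\<close> says nothing about values outside the closed disc;
  extension by 0 gives a Borel function on the plane.\<close>

definition clip :: "(real^2 \<Rightarrow> real^3) \<Rightarrow> real^2 \<Rightarrow> real^3" where
  "clip u x = indicator (cball 0 1) x *\<^sub>R u x"

lemma clip_eq: "x \<in> cball 0 1 \<Longrightarrow> clip u x = u x"
  by (simp add: clip_def)

lemma clip_measurable: "u \<in> Xsp \<Longrightarrow> clip u \<in> borel_measurable borel"
  unfolding clip_def[abs_def] by (intro borel_measurable_continuous_on_indicator) (auto simp: Xsp_def)

lemma clip_scale_measurable: "u \<in> Xsp \<Longrightarrow> (\<lambda>x. clip u (r *\<^sub>R x)) \<in> borel_measurable borel"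
  by (rule measurable_compose[OF _ clip_measurable]) simp

lemma nn_integral_clip_diff:
  "(\<integral>\<^sup>+x\<in>B1. ennreal ((norm (clip v x - clip u x))\<^sup>2) \<partial>lborel) = (\<integral>\<^sup>+x\<in>B1. ennreal ((norm (v x - u x))\<^sup>2) \<partial>lebesgue)"
  unfolding nn_integral_completion by (rule nn_integral_cong) (auto simp: clip_def indicator_def)

lemma Ann_scale_cball: "x \<in> Ann \<Longrightarrow> 0 \<le> r \<Longrightarrow> r \<le> 1 \<Longrightarrow> r *\<^sub>R x \<in> cball 0 1"
  using mult_mono[of r 1 "norm x" 1] by auto

lemma rescaling_deviation_clip:
  assumes E: "Ebar h u \<le> ennreal M" and h: "0 < h" "h \<le> 1/4" and M: "M \<ge> 0" and r: "0 < r" "r \<le> 1"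
  shows "(\<integral>\<^sup>+x\<in>Ann. ennreal ((norm ((1 / r) *\<^sub>R clip u (r *\<^sub>R x) - clip u x))\<^sup>2) \<partial>lborel)
    \<le> ennreal (4 / r * ((10 * measure lborel Ann + 72 * M) * (h * (ln h)\<^sup>2)))"
proof -
  have "(\<integral>\<^sup>+x\<in>Ann. ennreal ((norm ((1 / r) *\<^sub>R clip u (r *\<^sub>R x) - clip u x))\<^sup>2) \<partial>lborel)
    = (\<integral>\<^sup>+x\<in>Ann. ennreal ((norm ((1 / r) *\<^sub>R u (r *\<^sub>R x) - u x))\<^sup>2) \<partial>lborel)"
  proof (rule nn_integral_cong)
    fix x :: "real^2"
    show "ennreal ((norm ((1 / r) *\<^sub>R clip u (r *\<^sub>R x) - clip u x))\<^sup>2) * indicator Ann x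
      = ennreal ((norm ((1 / r) *\<^sub>R u (r *\<^sub>R x) - u x))\<^sup>2) * indicator Ann x"
      using Ann_scale_cball[of x r] Ann_scale_cball[of x 1] r by (cases "x \<in> Ann") (auto simp: clip_eq)
  qed
  then show ?thesis using rescaling_deviation[OF assms] by simp
qed

text \<open>For fixed \<open>r\<close> the deviation between \<open>us k\<close> and its rescaling
  is a multiple of h (ln h)^2 and tends to 0, while both maps converge in L2. The limit is thus
  homogeneous almost everywhere on the annulus, and continuity removes the exception.\<close>

lemma limit_homogeneous_Ann:
  assumes us: "\<And>k. us k \<in> Xsp" and u: "u \<in> Xsp" and conv: "W14_conv us u"
    and E: "\<And>k. Ebar (h k) (us k) \<le> ennreal M" and h: "\<And>k. 0 < h k" "\<And>k. h k \<le> 1/4" "h \<longlonglongrightarrow> 0" and M: "M \<ge> 0"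
    and r: "0 < r" "r \<le> 1" and x: "x \<in> Ann"
  shows "u (r *\<^sub>R x) = r *\<^sub>R u x"
proof -
  note [measurable] = clip_measurable[OF us] clip_measurable[OF u] clip_scale_measurable[OF us] clip_scale_measurable[OF u]
  have h1: "h k < 1" for k using h(2)[of k] by simp
  define C where "C = 10 * measure lborel Ann + 72 * M"
  define b where "b k = (\<integral>\<^sup>+x\<in>B1. ennreal ((norm (clip (us k) x - clip u x))\<^sup>2) \<partial>lborel)" for k
  have b0: "b \<longlonglongrightarrow> 0" unfolding b_def nn_integral_clip_diff by (rule W14_conv_L2(1)[OF us u conv])
  have "(\<integral>\<^sup>+x\<in>Ann. ennreal ((norm ((1 / r) *\<^sub>R clip u (r *\<^sub>R x) - clip u x))\<^sup>2) \<partial>lborel) = 0"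
  proof (rule ennreal_eq_0_if_le_tendsto_0)
    fix k
    let ?a = "\<lambda>x. ennreal ((norm (clip (us k) (r *\<^sub>R x) - clip u (r *\<^sub>R x)))\<^sup>2) * indicator Ann x"
    let ?b = "\<lambda>x. ennreal ((norm ((1 / r) *\<^sub>R clip (us k) (r *\<^sub>R x) - clip (us k) x))\<^sup>2) * indicator Ann x"
    let ?c = "\<lambda>x. ennreal ((norm (clip (us k) x - clip u x))\<^sup>2) * indicator B1 x"
    have "(\<integral>\<^sup>+x\<in>Ann. ennreal ((norm ((1 / r) *\<^sub>R clip u (r *\<^sub>R x) - clip u x))\<^sup>2) \<partial>lborel)
      \<le> (\<integral>\<^sup>+x. ennreal (3 / r\<^sup>2) * ?a x + (3 * ?b x + 3 * ?c x) \<partial>lborel)"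
    proof (rule nn_integral_mono)
      fix x :: "real^2"
      show "ennreal ((norm ((1 / r) *\<^sub>R clip u (r *\<^sub>R x) - clip u x))\<^sup>2) * indicator Ann x \<le> ennreal (3 / r\<^sup>2) * ?a x + (3 * ?b x + 3 * ?c x)"
      proof (cases "x \<in> Ann")
        case True
        then have xB: "x \<in> B1" by simp
        have "(1 / r) *\<^sub>R clip u (r *\<^sub>R x) - clip u x = (- (1 / r)) *\<^sub>R (clip (us k) (r *\<^sub>R x) - clip u (r *\<^sub>R x))
          + ((1 / r) *\<^sub>R clip (us k) (r *\<^sub>R x) - clip (us k) x) + (clip (us k) x - clip u x)"
          by (simp add: algebra_simps)
        then have "(norm ((1 / r) *\<^sub>R clip u (r *\<^sub>R x) - clip u x))\<^sup>2 \<le>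
          3 * ((norm ((- (1 / r)) *\<^sub>R (clip (us k) (r *\<^sub>R x) - clip u (r *\<^sub>R x))))\<^sup>2
          + (norm ((1 / r) *\<^sub>R clip (us k) (r *\<^sub>R x) - clip (us k) x))\<^sup>2 + (norm (clip (us k) x - clip u x))\<^sup>2)"
          by (simp only: norm_add3_sq_le)
        also have "\<dots> = 3 / r\<^sup>2 * (norm (clip (us k) (r *\<^sub>R x) - clip u (r *\<^sub>R x)))\<^sup>2
          + (3 * (norm ((1 / r) *\<^sub>R clip (us k) (r *\<^sub>R x) - clip (us k) x))\<^sup>2 + 3 * (norm (clip (us k) x - clip u x))\<^sup>2)"
          by (simp only: norm_scaleR power_mult_distrib) (simp add: power_divide)
        finally have "ennreal ((norm ((1 / r) *\<^sub>R clip u (r *\<^sub>R x) - clip u x))\<^sup>2) \<le> ennreal (3 / r\<^sup>2 * (norm (clip (us k) (r *\<^sub>R x) - clip u (r *\<^sub>R x)))\<^sup>2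
          + (3 * (norm ((1 / r) *\<^sub>R clip (us k) (r *\<^sub>R x) - clip (us k) x))\<^sup>2 + 3 * (norm (clip (us k) x - clip u x))\<^sup>2))"
          by (rule ennreal_leI)
        also have "\<dots> = ennreal (3 / r\<^sup>2) * ennreal ((norm (clip (us k) (r *\<^sub>R x) - clip u (r *\<^sub>R x)))\<^sup>2)
          + (ennreal 3 * ennreal ((norm ((1 / r) *\<^sub>R clip (us k) (r *\<^sub>R x) - clip (us k) x))\<^sup>2) + ennreal 3 * ennreal ((norm (clip (us k) x - clip u x))\<^sup>2))"
          by (simp only: ennreal_mult[symmetric] ennreal_plus[symmetric] zero_le_power2 zero_le_divide_iff zero_le_mult_iff zero_le_numeral add_nonneg_nonneg simp_thms)
        finally show ?thesis using True xB by simp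
      qed simp
    qed
    also have "\<dots> = ennreal (3 / r\<^sup>2) * (\<integral>\<^sup>+x. ?a x \<partial>lborel) + (3 * (\<integral>\<^sup>+x. ?b x \<partial>lborel) + 3 * (\<integral>\<^sup>+x. ?c x \<partial>lborel))"
      by (rule trans[OF nn_integral_add arg_cong2[of _ _ _ _ "(+)", OF nn_integral_cmult
            trans[OF nn_integral_add arg_cong2[of _ _ _ _ "(+)", OF nn_integral_cmult nn_integral_cmult]]]]) measurable
    also have "\<dots> \<le> ennreal (3 / r\<^sup>2) * (ennreal (1 / r\<^sup>2) * b k) + (3 * ennreal (4 / r * (C * (h k * (ln (h k))\<^sup>2))) + 3 * b k)"
    proof (intro add_mono mult_left_mono)
      show "(\<integral>\<^sup>+x. ?a x \<partial>lborel) \<le> ennreal (1 / r\<^sup>2) * b k"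
        unfolding b_def by (rule nn_integral_Ann_scale_le[where f="\<lambda>y. ennreal ((norm (clip (us k) y - clip u y))\<^sup>2)", OF _ r]) measurable
      show "(\<integral>\<^sup>+x. ?b x \<partial>lborel) \<le> ennreal (4 / r * (C * (h k * (ln (h k))\<^sup>2)))"
        unfolding C_def by (rule rescaling_deviation_clip[OF E h(1,2) M r])
    qed (auto simp: b_def)
    finally show "(\<integral>\<^sup>+x\<in>Ann. ennreal ((norm ((1 / r) *\<^sub>R clip u (r *\<^sub>R x) - clip u x))\<^sup>2) \<partial>lborel)
      \<le> ennreal (3 / r\<^sup>2) * (ennreal (1 / r\<^sup>2) * b k) + (3 * ennreal (4 / r * (C * (h k * (ln (h k))\<^sup>2))) + 3 * b k)" .
  next
    have "(\<lambda>k. h k powr 1 * (ln (h k))\<^sup>2) \<longlonglongrightarrow> 0"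
      by (rule powr_ln_square_tendsto_0) (use h h1 in auto)
    then have "(\<lambda>k. h k * (ln (h k))\<^sup>2) \<longlonglongrightarrow> 0" using h(1) by (simp add: less_imp_le)
    then have "(\<lambda>k. 4 / r * (C * (h k * (ln (h k))\<^sup>2))) \<longlonglongrightarrow> 0" by (intro tendsto_mult_right_zero)
    then have "(\<lambda>k. ennreal (4 / r * (C * (h k * (ln (h k))\<^sup>2)))) \<longlonglongrightarrow> ennreal 0" by (rule tendsto_ennrealI)
    then have "(\<lambda>k. ennreal (3 / r\<^sup>2) * (ennreal (1 / r\<^sup>2) * b k) + (3 * ennreal (4 / r * (C * (h k * (ln (h k))\<^sup>2))) + 3 * b k))
      \<longlonglongrightarrow> ennreal (3 / r\<^sup>2) * (ennreal (1 / r\<^sup>2) * 0) + (3 * ennreal 0 + 3 * 0)"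
      by (intro tendsto_add tendsto_mult_ennreal tendsto_const b0) auto
    then show "(\<lambda>k. ennreal (3 / r\<^sup>2) * (ennreal (1 / r\<^sup>2) * b k) + (3 * ennreal (4 / r * (C * (h k * (ln (h k))\<^sup>2))) + 3 * b k)) \<longlonglongrightarrow> 0"
      by simp
  qed
  then have ae: "AE x in lborel. ennreal ((norm ((1 / r) *\<^sub>R clip u (r *\<^sub>R x) - clip u x))\<^sup>2) * indicator Ann x = 0"
    by (subst (asm) nn_integral_0_iff_AE) measurable
  define d where "d x = u (r *\<^sub>R x) - r *\<^sub>R u x" for x
  have contu: "continuous_on (cball 0 1) u" using u by (simp add: Xsp_def)
  have contd: "continuous_on Ann d"
    unfolding d_def
  proof (intro continuous_on_diff continuous_on_scaleR continuous_on_const)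
    show "continuous_on Ann (\<lambda>x. u (r *\<^sub>R x))"
      by (rule continuous_on_compose2[OF contu]) (use Ann_scale_cball r in \<open>auto intro!: continuous_intros simp del: mem_cball\<close>)
    show "continuous_on Ann u" by (rule continuous_on_subset[OF contu]) auto
  qed
  \<comment> \<open>The set where homogeneity fails is open by continuity and negligible, hence
    empty.\<close>
  have "open (Ann \<inter> d -` (- {0}))"
    by (rule continuous_open_preimage[OF contd]) auto
  moreover have "negligible (Ann \<inter> d -` (- {0}))"
  proof -
    have "AE x in lborel. x \<notin> Ann \<inter> d -` (- {0})"
      using ae
    proof eventually_elim
      fix x assume a: "ennreal ((norm ((1 / r) *\<^sub>R clip u (r *\<^sub>R x) - clip u x))\<^sup>2) * indicator Ann x = 0"
      show "x \<notin> Ann \<inter> d -` (- {0})"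
      proof
        assume x: "x \<in> Ann \<inter> d -` (- {0})"
        then have xA: "x \<in> Ann" by blast
        have "(1 / r) *\<^sub>R u (r *\<^sub>R x) - u x = 0"
          using a xA Ann_scale_cball[OF xA, of r] Ann_scale_cball[OF xA, of 1] r by (simp add: clip_eq ennreal_eq_0_iff)
        then have "r *\<^sub>R ((1 / r) *\<^sub>R u (r *\<^sub>R x) - u x) = 0" by simp
        then have "d x = 0" using r by (simp add: d_def scaleR_diff_right)
        then show False using x by simp
      qed
    qed
    then have "AE x in lebesgue. x \<notin> Ann \<inter> d -` (- {0})" by (rule AE_completion)
    then show ?thesis unfolding negligible_iff_null_sets by (simp add: completion.null_sets_iff_AE)
  qed
  ultimately have "Ann \<inter> d -` (- {0}) = {}" using open_not_negligible by blast
  then show ?thesis using x by (auto simp: d_def)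
qed

text \<open>\<open>u\<close> itself serves as \<open>\<gamma>\<close>. Approaching the circle
  radially from inside \<open>Ann\<close> extends homogeneity to unit vectors, and every nonzero
  point of the disc is a multiple of one.\<close>

lemma limit_one_homogeneous:
  assumes u: "u \<in> Xsp" and hom: "\<And>r x. 0 < r \<Longrightarrow> r \<le> 1 \<Longrightarrow> x \<in> Ann \<Longrightarrow> u (r *\<^sub>R x) = r *\<^sub>R u x"
  shows "\<exists>\<gamma>. \<forall>x\<in>B1. x \<noteq> 0 \<longrightarrow> u x = norm x *\<^sub>R \<gamma> (x /\<^sub>R norm x)"
proof (intro exI[of _ u] ballI impI)
  fix x :: "real^2" assume x: "x \<in> B1" "x \<noteq> 0"
  define \<omega> where "\<omega> = x /\<^sub>R norm x"
  define r where "r = norm x"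
  have r: "0 < r" "r \<le> 1" "x = r *\<^sub>R \<omega>" "norm \<omega> = 1" using x by (auto simp: r_def \<omega>_def)
  have contu: "continuous_on (cball 0 1) u" using u by (simp add: Xsp_def)
  define a where "a n = 1 - 1 / (real n + 3)" for n
  have a: "1/2 < a n" "a n < 1" for n by (auto simp: a_def field_simps)
  have alim: "a \<longlonglongrightarrow> 1"
  proof -
    have "(\<lambda>n. 1 - inverse (real (Suc (n + 2)))) \<longlonglongrightarrow> 1 - 0"
      by (intro tendsto_diff tendsto_const LIMSEQ_ignore_initial_segment[OF LIMSEQ_inverse_real_of_nat])
    moreover have "a = (\<lambda>n. 1 - inverse (real (Suc (n + 2))))"
      by (auto simp: a_def fun_eq_iff divide_inverse add.commute)
    ultimately show ?thesis by simp
  qed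
  have "u (r *\<^sub>R (a n *\<^sub>R \<omega>)) = r *\<^sub>R u (a n *\<^sub>R \<omega>)" for n
    by (rule hom) (use r a[of n] in auto)
  moreover have "(\<lambda>n. u (r *\<^sub>R (a n *\<^sub>R \<omega>))) \<longlonglongrightarrow> u (r *\<^sub>R (1 *\<^sub>R \<omega>))"
  proof (rule continuous_on_tendsto_compose[OF contu])
    show "(\<lambda>n. r *\<^sub>R (a n *\<^sub>R \<omega>)) \<longlonglongrightarrow> r *\<^sub>R (1 *\<^sub>R \<omega>)" by (intro tendsto_scaleR tendsto_const alim)
    have "r *\<^sub>R (a n *\<^sub>R \<omega>) \<in> cball 0 1" for n
    proof -
      have "r * a n \<le> 1 * 1" using r a[of n] by (intro mult_mono) auto
      then show ?thesis using r a(1)[of n] by (simp add: abs_mult)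
    qed
    then show "\<forall>\<^sub>F n in sequentially. r *\<^sub>R (a n *\<^sub>R \<omega>) \<in> cball 0 1" by simp
  qed (use r in auto)
  moreover have "(\<lambda>n. r *\<^sub>R u (a n *\<^sub>R \<omega>)) \<longlonglongrightarrow> r *\<^sub>R u (1 *\<^sub>R \<omega>)"
  proof (intro tendsto_scaleR tendsto_const continuous_on_tendsto_compose[OF contu] alim)
    have "a n *\<^sub>R \<omega> \<in> cball 0 1" for n using r(4) a[of n] by simp
    then show "\<forall>\<^sub>F n in sequentially. a n *\<^sub>R \<omega> \<in> cball 0 1" by simp
  qed (use r in auto)
  ultimately have "u (r *\<^sub>R (1 *\<^sub>R \<omega>)) = r *\<^sub>R u (1 *\<^sub>R \<omega>)" using LIMSEQ_unique by simp
  then show "u x = norm x *\<^sub>R u (x /\<^sub>R norm x)" using r by (simp add: \<omega>_def[symmetric] r_def[symmetric])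
qed

lemma Xsp_Ann:
  assumes u: "u \<in> Xsp"
  shows "Lp 2 Ann u" "weak_partial Ann u i (wd B1 u i)" "Lp 2 Ann (wd B1 u i)"
proof -
  have sub: "Ann \<subseteq> B1" "Ann \<in> sets lebesgue" by auto
  have "Lp 4 B1 u" using u by (simp add: Xsp_def W1_def)
  then show "Lp 2 Ann u" by (intro Lp_mono[OF Lp_4_imp_2 sub]) auto
  show "weak_partial Ann u i (wd B1 u i)" by (rule weak_partial_mono[OF Xsp_wd(1)[OF u] sub(1)])
  show "Lp 2 Ann (wd B1 u i)" by (intro Lp_mono[OF Lp_4_imp_2 sub] Xsp_wd(2)[OF u]) auto
qed

text \<open>At scale 2^(-j) the deviation is 2^j h (ln h)^2 up to a constant. The bound on 2^j turns
  this into h^e (ln h)^2, which still tends to 0; this is why the admissible scales end at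
  h^(1-e).\<close>

lemma blowup_L2_limit:
  assumes us: "\<And>k. us k \<in> Xsp" and u: "u \<in> Xsp" and conv: "W14_conv us u"
    and E: "\<And>k. Ebar (h k) (us k) \<le> ennreal M" and h: "\<And>k. 0 < h k" "\<And>k. h k \<le> 1/4" "h \<longlonglongrightarrow> 0" and M: "M \<ge> 0"
    and e: "e > 0" and j: "\<And>k. (2::real) ^ j k \<le> h k powr (e - 1)"
  shows "(\<lambda>k. \<integral>\<^sup>+x\<in>Ann. ennreal ((norm (2 ^ j k *\<^sub>R clip (us k) ((1 / 2 ^ j k) *\<^sub>R x) - clip u x))\<^sup>2) \<partial>lborel) \<longlonglongrightarrow> 0"
proof -
  note [measurable] = clip_measurable[OF us] clip_measurable[OF u] clip_scale_measurable[OF us] clip_scale_measurable[OF u]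
  define C where "C = 10 * measure lborel Ann + 72 * M"
  have C: "C \<ge> 0" using M by (simp add: C_def)
  define b where "b k = (\<integral>\<^sup>+x\<in>B1. ennreal ((norm (clip (us k) x - clip u x))\<^sup>2) \<partial>lborel)" for k
  have b0: "b \<longlonglongrightarrow> 0" unfolding b_def nn_integral_clip_diff by (rule W14_conv_L2(1)[OF us u conv])
  have h1: "h k < 1" for k using h(2)[of k] by simp
  show ?thesis
  proof (rule tendsto_sandwich[of "\<lambda>_. 0::ennreal"])
    have "(\<integral>\<^sup>+x\<in>Ann. ennreal ((norm (2 ^ j k *\<^sub>R clip (us k) ((1 / 2 ^ j k) *\<^sub>R x) - clip u x))\<^sup>2) \<partial>lborel)
      \<le> 2 * ennreal (4 * C * (h k powr e * (ln (h k))\<^sup>2)) + 2 * b k" for k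
    proof -
      define r where "r = 1 / (2::real) ^ j k"
      have r: "0 < r" "r \<le> 1" "1 / r = 2 ^ j k" by (auto simp: r_def)
      let ?b = "\<lambda>x. ennreal ((norm ((1 / r) *\<^sub>R clip (us k) (r *\<^sub>R x) - clip (us k) x))\<^sup>2) * indicator Ann x"
      let ?c = "\<lambda>x. ennreal ((norm (clip (us k) x - clip u x))\<^sup>2) * indicator B1 x"
      have "(\<integral>\<^sup>+x\<in>Ann. ennreal ((norm ((1 / r) *\<^sub>R clip (us k) (r *\<^sub>R x) - clip u x))\<^sup>2) \<partial>lborel) \<le> (\<integral>\<^sup>+x. 2 * ?b x + 2 * ?c x \<partial>lborel)"
      proof (rule nn_integral_mono)
        fix x :: "real^2"
        show "ennreal ((norm ((1 / r) *\<^sub>R clip (us k) (r *\<^sub>R x) - clip u x))\<^sup>2) * indicator Ann x \<le> 2 * ?b x + 2 * ?c x"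
        proof (cases "x \<in> Ann")
          case True
          then have xB: "x \<in> B1" by simp
          have "(1 / r) *\<^sub>R clip (us k) (r *\<^sub>R x) - clip u x
            = ((1 / r) *\<^sub>R clip (us k) (r *\<^sub>R x) - clip (us k) x) - (clip u x - clip (us k) x)" by simp
          then have "(norm ((1 / r) *\<^sub>R clip (us k) (r *\<^sub>R x) - clip u x))\<^sup>2
            \<le> 2 * (norm ((1 / r) *\<^sub>R clip (us k) (r *\<^sub>R x) - clip (us k) x))\<^sup>2 + 2 * (norm (clip u x - clip (us k) x))\<^sup>2"
            by (simp only: norm_diff_sq_le)
          then have "ennreal ((norm ((1 / r) *\<^sub>R clip (us k) (r *\<^sub>R x) - clip u x))\<^sup>2)
            \<le> ennreal (2 * (norm ((1 / r) *\<^sub>R clip (us k) (r *\<^sub>R x) - clip (us k) x))\<^sup>2 + 2 * (norm (clip (us k) x - clip u x))\<^sup>2)"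
            by (intro ennreal_leI) (simp add: norm_minus_commute)
          then show ?thesis using True xB by (simp add: ennreal_plus ennreal_mult)
        qed simp
      qed
      also have "\<dots> = 2 * (\<integral>\<^sup>+x. ?b x \<partial>lborel) + 2 * (\<integral>\<^sup>+x. ?c x \<partial>lborel)"
        by (rule trans[OF nn_integral_add arg_cong2[of _ _ _ _ "(+)", OF nn_integral_cmult nn_integral_cmult]]) measurable
      also have "\<dots> \<le> 2 * ennreal (4 * C * (h k powr e * (ln (h k))\<^sup>2)) + 2 * b k"
      proof (intro add_mono mult_left_mono)
        have "(\<integral>\<^sup>+x. ?b x \<partial>lborel) \<le> ennreal (4 / r * (C * (h k * (ln (h k))\<^sup>2)))"
          unfolding C_def by (rule rescaling_deviation_clip[OF E h(1,2) M r(1,2)])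
        also have "4 / r * (C * (h k * (ln (h k))\<^sup>2)) \<le> 4 * h k powr (e - 1) * (C * (h k * (ln (h k))\<^sup>2))"
        proof (rule mult_right_mono)
          have "4 / r = 4 * 2 ^ j k" by (simp add: r_def)
          then show "4 / r \<le> 4 * h k powr (e - 1)" using j[of k] by simp
          show "0 \<le> C * (h k * (ln (h k))\<^sup>2)" using C h(1)[of k] by simp
        qed
        also have "4 * h k powr (e - 1) * (C * (h k * (ln (h k))\<^sup>2)) = 4 * C * (h k powr e * (ln (h k))\<^sup>2)"
          using h(1)[of k] by (simp add: powr_diff)
        finally show "(\<integral>\<^sup>+x. ?b x \<partial>lborel) \<le> ennreal (4 * C * (h k powr e * (ln (h k))\<^sup>2))" by (simp add: ennreal_leI)
      qed (auto simp: b_def)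
      finally show ?thesis by (simp only: r(3)) (simp only: r_def)
    qed
    then show "\<forall>\<^sub>F k in sequentially. (\<integral>\<^sup>+x\<in>Ann. ennreal ((norm (2 ^ j k *\<^sub>R clip (us k) ((1 / 2 ^ j k) *\<^sub>R x) - clip u x))\<^sup>2) \<partial>lborel)
      \<le> 2 * ennreal (4 * C * (h k powr e * (ln (h k))\<^sup>2)) + 2 * b k" by simp
    have "(\<lambda>k. 4 * C * (h k powr e * (ln (h k))\<^sup>2)) \<longlonglongrightarrow> 0"
      by (intro tendsto_mult_right_zero powr_ln_square_tendsto_0 e h h1)
    then have "(\<lambda>k. ennreal (4 * C * (h k powr e * (ln (h k))\<^sup>2))) \<longlonglongrightarrow> ennreal 0" by (rule tendsto_ennrealI)
    then have "(\<lambda>k. 2 * ennreal (4 * C * (h k powr e * (ln (h k))\<^sup>2)) + 2 * b k) \<longlonglongrightarrow> 2 * ennreal 0 + 2 * 0"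
      by (intro tendsto_add tendsto_mult_ennreal tendsto_const b0) auto
    then show "(\<lambda>k. 2 * ennreal (4 * C * (h k powr e * (ln (h k))\<^sup>2)) + 2 * b k) \<longlonglongrightarrow> 0" by simp
  qed auto
qed

text \<open>On the selected annuli the blow-ups converge to \<open>u\<close> and have Hessian energy
  at most \<open>M\<close> |ln h| / \<open>N\<close>, so lower semicontinuity applies. The
  assumption \<open>big\<close> says that rounding the number of annuli down loses at most e |ln h|
  / ln 2, whence the factor 1 - 2 e.\<close>

lemma limit_hessian_bound:
  assumes us: "\<And>k. us k \<in> Xsp" and u: "u \<in> Xsp" and conv: "W14_conv us u"
    and E: "\<And>k. Ebar (h k) (us k) \<le> ennreal M" and h: "\<And>k. 0 < h k" "\<And>k. h k \<le> 1/4" "h \<longlonglongrightarrow> 0" and M: "M \<ge> 0"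
    and e: "0 < e" "e < 1/2" and big: "\<And>k. e * \<bar>ln (h k)\<bar> \<ge> ln 2"
  shows "W2 2 Ann u \<and> (\<integral>\<^sup>+x\<in>Ann. ennreal (hess_sq Ann u x) \<partial>lebesgue) \<le> ennreal (M * ln 2 / (1 - 2 * e))"
proof -
  note cm = clip_measurable[OF us] clip_measurable[OF u] clip_scale_measurable[OF us]
  have l2: "ln 2 > (0::real)" by simp
  define L where "L k = \<bar>ln (h k)\<bar>" for k
  have L: "L k = - ln (h k)" for k using h(1,2)[of k] by (simp add: L_def)
  \<comment> \<open>The number of dyadic steps that keep 2^j at most h^(e-1), as needed for
    \<open>blowup_L2_limit\<close>.\<close>
  define N where "N k = nat \<lfloor>(1 - e) * L k / ln 2\<rfloor>" for k
  have N_le: "real (N k) \<le> (1 - e) * L k / ln 2" for k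
  proof -
    have "0 \<le> (1 - e) * L k / ln 2" using e l2 by (simp add: L_def)
    then show ?thesis unfolding N_def by (simp add: of_nat_floor)
  qed
  have N_ge: "real (N k) \<ge> (1 - 2 * e) * L k / ln 2" for k
  proof -
    have "(1 - e) * L k / ln 2 - 1 \<le> real (N k)" unfolding N_def by linarith
    moreover have "1 \<le> e * L k / ln 2" using big[of k] l2 by (simp add: L_def pos_le_divide_eq)
    moreover have "(1 - 2 * e) * L k / ln 2 = (1 - e) * L k / ln 2 - e * L k / ln 2"
      by (simp add: diff_divide_distrib[symmetric] algebra_simps)
    ultimately show ?thesis by linarith
  qed
  have Lpos: "L k > 0" for k
  proof -
    have "0 < e * L k" using big[of k] l2 unfolding L_def by linarith
    then show ?thesis using e by (simp add: zero_less_mult_iff)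
  qed
  have Npos: "N k > 0" for k
  proof -
    have "0 < (1 - 2 * e) * L k / ln 2" using e Lpos[of k] l2 by simp
    then have "0 < real (N k)" using N_ge[of k] by linarith
    then show ?thesis by simp
  qed
  have h1: "h k < 1" for k using h(2)[of k] by simp
  \<comment> \<open>Bundled into one predicate so that the annulus and its derivatives can be chosen
    for all \<open>k\<close> one after another.\<close>
  define Q where "Q k j G H \<longleftrightarrow> j < N k \<and> (\<forall>i. weak_partial Ann (\<lambda>x. 2 ^ j *\<^sub>R us k ((1 / 2 ^ j) *\<^sub>R x)) i (G i)) \<and>
     (\<forall>i l. weak_partial Ann (G i) l (H i l)) \<and> (\<forall>i l. H i l \<in> borel_measurable (lebesgue_on Ann)) \<and>
     (\<integral>\<^sup>+x\<in>Ann. ennreal (\<Sum>i\<in>UNIV. \<Sum>l\<in>UNIV. (norm (H i l x))\<^sup>2) \<partial>lebesgue) \<le> ennreal (M * \<bar>ln (h k)\<bar> / N k)" for k j G H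
  have "\<forall>k. \<exists>j G H. Q k j G H"
    using dyadic_selection[OF E h(1) h1 M Npos] unfolding Q_def by blast
  from choice[OF this] obtain j where "\<forall>k. \<exists>G H. Q k (j k) G H" ..
  from choice[OF this] obtain G where "\<forall>k. \<exists>H. Q k (j k) (G k) H" ..
  from choice[OF this] obtain H where "\<forall>k. Q k (j k) (G k) (H k)" ..
  then have sel: "j k < N k" "weak_partial Ann (\<lambda>x. 2 ^ j k *\<^sub>R us k ((1 / 2 ^ j k) *\<^sub>R x)) i (G k i)"
    "weak_partial Ann (G k i) l (H k i l)" "H k i l \<in> borel_measurable (lebesgue_on Ann)"
    "(\<integral>\<^sup>+x\<in>Ann. ennreal (\<Sum>i\<in>UNIV. \<Sum>l\<in>UNIV. (norm (H k i l x))\<^sup>2) \<partial>lebesgue) \<le> ennreal (M * \<bar>ln (h k)\<bar> / N k)" for k i l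
    unfolding Q_def by blast+
  define v where "v k x = 2 ^ j k *\<^sub>R us k ((1 / 2 ^ j k) *\<^sub>R x)" for k x
  define f where "f k x = norm (2 ^ j k *\<^sub>R clip (us k) ((1 / 2 ^ j k) *\<^sub>R x) - clip u x)" for k x
  have fv: "f k x = norm (v k x - u x)" if "x \<in> Ann" for k x
    using Ann_scale_cball[OF that, of "1 / 2 ^ j k"] Ann_scale_cball[OF that, of 1] by (simp add: f_def v_def clip_eq)
  have fm: "f k \<in> borel_measurable borel" for k
    unfolding f_def using cm by measurable
  have Anns: "Ann \<inter> space lebesgue \<in> sets lebesgue" by auto
  have AnnL: "Ann \<in> lmeasurable" by (intro fmeasurable.Diff) auto
  have "(\<lambda>k. \<integral>\<^sup>+x. ennreal ((f k x)\<^sup>2) \<partial>lebesgue_on Ann) \<longlonglongrightarrow> 0"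
  proof -
    have "(2::real) ^ j k \<le> h k powr (e - 1)" for k
    proof -
      have "real (j k) \<le> (1 - e) * L k / ln 2" using sel(1)[of k] N_le[of k] by linarith
      then have "real (j k) * ln 2 \<le> (1 - e) * L k" using l2 by (simp add: pos_le_divide_eq)
      then have "exp (real (j k) * ln 2) \<le> exp ((e - 1) * ln (h k))" by (simp add: L algebra_simps)
      moreover have "exp (real (j k) * ln 2) = (2::real) ^ j k" by (simp add: exp_of_nat_mult)
      ultimately show ?thesis using h(1)[of k] by (simp add: powr_def)
    qed
    from blowup_L2_limit[OF us u conv E h M e(1) this]
    show ?thesis unfolding nn_integral_restrict_space[OF Anns] nn_integral_completion f_def .
  qed
  then have f0: "(\<lambda>k. \<integral>\<^sup>+x. ennreal (f k x) \<partial>lebesgue_on Ann) \<longlonglongrightarrow> 0"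
  proof (rule nn_integral_tendsto_0_if_square[OF finite_measure_lebesgue_on[OF AnnL], rotated 2])
    show "f k \<in> borel_measurable (lebesgue_on Ann)" for k
      by (rule measurable_restrict_space1, rule measurable_completion) (simp add: fm)
    show "0 \<le> f k x" for k x by (simp add: f_def)
  qed
  \<comment> \<open>Smallness in L1 on the annulus against a bounded test function gives the
    distributional convergence required for lower semicontinuity.\<close>
  have conv': "(\<lambda>k. LINT x|lebesgue. \<phi> x *\<^sub>R v k x) \<longlonglongrightarrow> (LINT x|lebesgue. \<phi> x *\<^sub>R u x)" if \<phi>: "test_fn Ann \<phi>" for \<phi>
  proof (rule tendsto_L1_int)
    show "integrable lebesgue (\<lambda>x. \<phi> x *\<^sub>R v k x)" for k
      using test_fn_integrable[OF \<phi>] sel(2)[of k] unfolding weak_partial_def v_def by blast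
    show "integrable lebesgue (\<lambda>x. \<phi> x *\<^sub>R u x)"
      by (rule test_fn_integrable[OF \<phi> Lp2_loc_int[OF Xsp_Ann(1)[OF u] AnnL]])
    obtain B where B: "\<And>x. \<bar>\<phi> x\<bar> \<le> B" using test_fn_bounded[OF \<phi>] by auto
    have B0: "B \<ge> 0" using B abs_ge_zero order_trans by blast
    obtain K where K: "K \<subseteq> Ann" "\<And>x. x \<notin> K \<Longrightarrow> \<phi> x = 0" using test_fnE[OF \<phi>] by metis
    show "(\<lambda>k. \<integral>\<^sup>+x. ennreal (norm (\<phi> x *\<^sub>R v k x - \<phi> x *\<^sub>R u x)) \<partial>lebesgue) \<longlonglongrightarrow> 0"
    proof (rule tendsto_sandwich[of "\<lambda>_. 0::ennreal"])
      have "(\<integral>\<^sup>+x. ennreal (norm (\<phi> x *\<^sub>R v k x - \<phi> x *\<^sub>R u x)) \<partial>lebesgue) \<le> ennreal B * (\<integral>\<^sup>+x. ennreal (f k x) \<partial>lebesgue_on Ann)" for k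
      proof -
        have "(\<integral>\<^sup>+x. ennreal (norm (\<phi> x *\<^sub>R v k x - \<phi> x *\<^sub>R u x)) \<partial>lebesgue) \<le> (\<integral>\<^sup>+x. ennreal B * (ennreal (f k x) * indicator Ann x) \<partial>lebesgue)"
        proof (rule nn_integral_mono)
          fix x
          show "ennreal (norm (\<phi> x *\<^sub>R v k x - \<phi> x *\<^sub>R u x)) \<le> ennreal B * (ennreal (f k x) * indicator Ann x)"
          proof (cases "x \<in> Ann")
            case True
            have "norm (\<phi> x *\<^sub>R v k x - \<phi> x *\<^sub>R u x) = \<bar>\<phi> x\<bar> * f k x"
              unfolding fv[OF True] scaleR_diff_right[symmetric] by simp
            also have "\<dots> \<le> B * f k x" by (intro mult_right_mono B) (simp add: f_def)
            finally show ?thesis using True B0 by (simp add: ennreal_mult'[symmetric] ennreal_leI)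
          next
            case False
            then have "\<phi> x = 0" using K by blast
            then show ?thesis by simp
          qed
        qed
        also have "\<dots> = ennreal B * (\<integral>\<^sup>+x. ennreal (f k x) * indicator Ann x \<partial>lebesgue)"
          by (rule nn_integral_cmult, rule measurable_completion) (use fm[of k] in measurable)
        finally show ?thesis unfolding nn_integral_restrict_space[OF Anns] .
      qed
      then show "\<forall>\<^sub>F k in sequentially. (\<integral>\<^sup>+x. ennreal (norm (\<phi> x *\<^sub>R v k x - \<phi> x *\<^sub>R u x)) \<partial>lebesgue) \<le> ennreal B * (\<integral>\<^sup>+x. ennreal (f k x) \<partial>lebesgue_on Ann)"
        by simp
      have "(\<lambda>k. ennreal B * (\<integral>\<^sup>+x. ennreal (f k x) \<partial>lebesgue_on Ann)) \<longlonglongrightarrow> ennreal B * 0"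
        by (intro tendsto_mult_ennreal tendsto_const f0) auto
      then show "(\<lambda>k. ennreal B * (\<integral>\<^sup>+x. ennreal (f k x) \<partial>lebesgue_on Ann)) \<longlonglongrightarrow> 0" by simp
    qed auto
  qed
  show ?thesis
  proof (rule W2_lower_semicontinuity[OF _ AnnL Xsp_Ann[OF u] sel(2)[folded v_def] sel(3,4) _ _ conv'])
    show "open Ann" by (intro open_Diff) auto
    show "0 \<le> M * ln 2 / (1 - 2 * e)" using M e l2 by simp
    fix k
    have "M * \<bar>ln (h k)\<bar> / N k \<le> M * ln 2 / (1 - 2 * e)"
    proof -
      have "(1 - 2 * e) * L k \<le> real (N k) * ln 2" using N_ge[of k] l2 by (simp add: pos_divide_le_eq)
      then have "M * ((1 - 2 * e) * L k) \<le> M * (real (N k) * ln 2)" using M by (rule mult_left_mono)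
      then show ?thesis using Npos[of k] e unfolding L_def by (simp add: divide_simps mult_ac)
    qed
    then show "(\<integral>\<^sup>+x\<in>Ann. ennreal (\<Sum>i\<in>UNIV. \<Sum>l\<in>UNIV. (norm (H k i l x))\<^sup>2) \<partial>lebesgue) \<le> ennreal (M * ln 2 / (1 - 2 * e))"
      using sel(5)[of k] ennreal_leI order_trans by blast
  qed
qed

text \<open>Bounded energy forces the limit to be a one-homogeneous isometry, and the Hessian bound
  holds for each e below 1/2. The conclusion follows as e tends to 0.\<close>

lemma Ebar_limit_bound:
  assumes us: "\<And>k. us k \<in> Xsp" and u: "u \<in> Xsp" and conv: "W14_conv us u"
    and E: "\<And>k. Ebar (h k) (us k) \<le> ennreal M" and h: "\<And>k. 0 < h k" "\<And>k. h k \<le> 1/4" "h \<longlonglongrightarrow> 0" and M: "M \<ge> 0"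
  shows "E0 u \<le> ennreal M"
proof -
  have h1: "h k < 1" for k using h(2)[of k] by simp
  have D: "(\<lambda>k. \<integral>\<^sup>+x\<in>B1. ennreal ((infdist (Du B1 (us k) x) O23)\<^sup>2) \<partial>lebesgue) \<longlonglongrightarrow> 0"
  proof (rule tendsto_sandwich[of "\<lambda>_. 0::ennreal"])
    \<comment> \<open>The defect is compared with h (ln h)^2, whose limit is known; this uses |ln h|
      \<ge> 1 and h < 1.\<close>
    have "M * (h k)\<^sup>2 * \<bar>ln (h k)\<bar> \<le> M * (h k powr 1 * (ln (h k))\<^sup>2)" for k
    proof -
      have "exp 1 \<le> (4::real)" using exp_le by simp
      also have "4 \<le> 1 / h k" using h(1,2)[of k] by (simp add: field_simps)
      finally have "1 \<le> ln (1 / h k)" using h(1)[of k] by (subst ln_ge_iff) auto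
      then have l: "1 \<le> \<bar>ln (h k)\<bar>" using h(1)[of k] by (simp add: ln_div)
      have "h k * \<bar>ln (h k)\<bar> \<le> 1 * (\<bar>ln (h k)\<bar> * \<bar>ln (h k)\<bar>)"
      proof -
        have "h k * \<bar>ln (h k)\<bar> \<le> 1 * \<bar>ln (h k)\<bar>" using h1[of k] by (intro mult_right_mono) auto
        moreover have "\<bar>ln (h k)\<bar> * 1 \<le> \<bar>ln (h k)\<bar> * \<bar>ln (h k)\<bar>" by (rule mult_left_mono[OF l]) simp
        ultimately show ?thesis by linarith
      qed
      then have "(M * h k) * (h k * \<bar>ln (h k)\<bar>) \<le> (M * h k) * (1 * (\<bar>ln (h k)\<bar> * \<bar>ln (h k)\<bar>))"
        using M h(1)[of k] by (intro mult_left_mono) auto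
      then show ?thesis using h(1)[of k] by (simp add: power2_eq_square mult_ac)
    qed
    then show "\<forall>\<^sub>F k in sequentially. (\<integral>\<^sup>+x\<in>B1. ennreal ((infdist (Du B1 (us k) x) O23)\<^sup>2) \<partial>lebesgue) \<le> ennreal (M * (h k powr 1 * (ln (h k))\<^sup>2))"
      using Ebar_bounds(4)[OF E h(1) h1 M] by (intro always_eventually allI) (meson ennreal_leI order_trans)
    have "(\<lambda>k. M * (h k powr 1 * (ln (h k))\<^sup>2)) \<longlonglongrightarrow> 0"
      by (intro tendsto_mult_right_zero powr_ln_square_tendsto_0 h h1) simp
    then have "(\<lambda>k. ennreal (M * (h k powr 1 * (ln (h k))\<^sup>2))) \<longlonglongrightarrow> ennreal 0" by (rule tendsto_ennrealI)
    then show "(\<lambda>k. ennreal (M * (h k powr 1 * (ln (h k))\<^sup>2))) \<longlonglongrightarrow> 0" by simp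
  qed auto
  have iso: "one_hom_isometry u"
    unfolding one_hom_isometry_def
    by (intro conjI limit_one_homogeneous[OF u] limit_homogeneous_Ann[OF us u conv E h M] limit_isometry[OF us u conv D])
  have hb: "W2 2 Ann u \<and> (\<integral>\<^sup>+x\<in>Ann. ennreal (hess_sq Ann u x) \<partial>lebesgue) \<le> ennreal (M * ln 2 / (1 - 2 * e))"
    if e: "0 < e" "e < 1/2" for e
  proof -
    have "(\<lambda>k. h k) \<longlonglongrightarrow> 0" by (rule h(3))
    then have "\<forall>\<^sub>F k in sequentially. h k < exp (- (ln 2 / e))" by (rule order_tendstoD(2)) simp
    \<comment> \<open>Dropping the first \<open>K\<close> members makes h so small that e |ln h|
      \<ge> ln 2 holds along the whole remaining sequence.\<close>
    then obtain K where K: "\<And>k. k \<ge> K \<Longrightarrow> h k < exp (- (ln 2 / e))" by (auto simp: eventually_sequentially)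
    show ?thesis
    proof (rule limit_hessian_bound[of "\<lambda>k. us (k + K)" u "\<lambda>k. h (k + K)" M e])
      show "W14_conv (\<lambda>k. us (k + K)) u"
        using conv unfolding W14_conv_def by (rule LIMSEQ_ignore_initial_segment)
      show "(\<lambda>k. h (k + K)) \<longlonglongrightarrow> 0" by (rule LIMSEQ_ignore_initial_segment[OF h(3)])
      fix k
      have "ln (h (k + K)) < - (ln 2 / e)" using K[of "k + K"] h(1)[of "k + K"] ln_less_cancel_iff[of "h (k + K)" "exp (- (ln 2 / e))"] by simp
      then have "ln 2 / e \<le> \<bar>ln (h (k + K))\<bar>" by linarith
      then show "ln 2 \<le> e * \<bar>ln (h (k + K))\<bar>" using e by (simp add: pos_divide_le_eq mult.commute)
    qed (use us u E h M e in auto)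
  qed
  have W: "W2 2 Ann u" using hb[of "1/4"] by simp
  have l2: "ln 2 > (0::real)" by simp
  have "E0 u = ennreal (1 / ln 2) * (\<integral>\<^sup>+x\<in>Ann. ennreal (hess_sq Ann u x) \<partial>lebesgue)"
    using u W iso by (simp add: E0_def)
  also have "\<dots> \<le> ennreal M"
  proof (rule ennreal_le_epsilon)
    fix d :: real assume d: "d > 0"
    \<comment> \<open>Solves M / (1 - 2 e) \<le> M + d for e; the minimum with 1/4 keeps e below
      1/2.\<close>
    define e where "e = min (1/4) (d / (2 * (M + d)))"
    have e: "0 < e" "e < 1/2" using d M by (auto simp: e_def)
    have "e * (2 * (M + d)) \<le> d"
      using d M by (simp add: e_def min_def divide_simps split: if_splits)
    then have "M \<le> (M + d) * (1 - 2 * e)" by (simp add: algebra_simps)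
    then have Md: "M / (1 - 2 * e) \<le> M + d" using e by (simp add: pos_divide_le_eq)
    have "ennreal (1 / ln 2) * (\<integral>\<^sup>+x\<in>Ann. ennreal (hess_sq Ann u x) \<partial>lebesgue) \<le> ennreal (1 / ln 2) * ennreal (M * ln 2 / (1 - 2 * e))"
      using hb[OF e] by (intro mult_left_mono) auto
    also have "\<dots> = ennreal (M / (1 - 2 * e))" using l2 M e by (subst ennreal_mult[symmetric]) auto
    also have "\<dots> \<le> ennreal (M + d)" by (rule ennreal_leI[OF Md])
    finally show "ennreal (1 / ln 2) * (\<integral>\<^sup>+x\<in>Ann. ennreal (hess_sq Ann u x) \<partial>lebesgue) \<le> ennreal M + ennreal d"
      using M d by (simp add: ennreal_plus)
  qed
  finally show ?thesis .
qed

text \<open>Reduction to uniformly bounded energies. An infinite lower limit is trivial; otherwise,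
  along a subsequence attaining it, the energies are eventually below the lower limit plus
  \<open>d\<close>, and h is below 1/4.\<close>

theorem gamma_liminf:
  assumes hs: "\<And>k. 0 < hs k" "\<And>k. hs k < 1" "hs \<longlonglongrightarrow> 0"
    and us: "\<And>k. us k \<in> Xsp" and u: "u \<in> Xsp" and conv: "W14_conv us u"
  shows "E0 u \<le> liminf (\<lambda>k. Ebar (hs k) (us k))"
proof (rule ennreal_le_epsilon)
  define L where "L = liminf (\<lambda>k. Ebar (hs k) (us k))"
  fix d :: real assume L: "liminf (\<lambda>k. Ebar (hs k) (us k)) < top" and d: "d > 0"
  obtain r where r: "strict_mono r" "((\<lambda>k. Ebar (hs k) (us k)) \<circ> r) \<longlonglongrightarrow> L"
    using liminf_subseq_lim unfolding L_def by blast
  define M where "M = enn2real L + d"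
  have M: "M \<ge> 0" "ennreal M = L + ennreal d" "L < ennreal M"
  proof -
    show "M \<ge> 0" using d by (simp add: M_def)
    show "ennreal M = L + ennreal d" using L d by (simp add: M_def L_def ennreal_plus)
    then show "L < ennreal M" using L d unfolding L_def
      by (metis M_def L_def ennreal_enn2real_if ennreal_lessI enn2real_nonneg less_add_same_cancel1 add_pos_nonneg add.commute infinity_ennreal_def less_irrefl)
  qed
  have "\<forall>\<^sub>F k in sequentially. ((\<lambda>k. Ebar (hs k) (us k)) \<circ> r) k < ennreal M"
    by (rule order_tendstoD(2)[OF r(2) M(3)])
  moreover have hr: "(\<lambda>k. hs (r k)) \<longlonglongrightarrow> 0"
    using LIMSEQ_subseq_LIMSEQ[OF hs(3) r(1)] by (simp add: o_def)
  moreover have "\<forall>\<^sub>F k in sequentially. hs (r k) < 1/4" by (rule order_tendstoD(2)[OF hr]) simp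
  ultimately have "\<forall>\<^sub>F k in sequentially. Ebar (hs (r k)) (us (r k)) < ennreal M \<and> hs (r k) < 1/4"
    by (simp add: eventually_conj)
  then obtain K where K: "\<And>k. k \<ge> K \<Longrightarrow> Ebar (hs (r k)) (us (r k)) < ennreal M \<and> hs (r k) < 1/4"
    by (auto simp: eventually_sequentially)
  have "E0 u \<le> ennreal M"
  proof (rule Ebar_limit_bound[of "\<lambda>k. us (r (k + K))" u "\<lambda>k. hs (r (k + K))"])
    have "W14_conv (\<lambda>k. us (r k)) u"
      using LIMSEQ_subseq_LIMSEQ[OF conv[unfolded W14_conv_def] r(1)] by (simp add: W14_conv_def o_def)
    then show "W14_conv (\<lambda>k. us (r (k + K))) u"
      unfolding W14_conv_def by (rule LIMSEQ_ignore_initial_segment)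
    show "(\<lambda>k. hs (r (k + K))) \<longlonglongrightarrow> 0" by (rule LIMSEQ_ignore_initial_segment[OF hr])
    fix k
    show "Ebar (hs (r (k + K))) (us (r (k + K))) \<le> ennreal M" "hs (r (k + K)) \<le> 1/4"
      using K[of "k + K"] by auto
  qed (use us u hs M in auto)
  then show "E0 u \<le> liminf (\<lambda>k. Ebar (hs k) (us k)) + ennreal d" using M(2) by (simp add: L_def)
qed

section \<open>Recovery sequence\<close>

text \<open>Radii enter squared because the squared norm is smooth also at the origin: cutoffs
  between shells are then \<open>sstep\<close> of affine functions of it.\<close>

definition shell :: "real \<Rightarrow> real \<Rightarrow> (real^2) set" where
  "shell a b = {x. a < (norm x)\<^sup>2 \<and> (norm x)\<^sup>2 < b}"

lemma open_shell: "open (shell a b)"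
  unfolding shell_def by (intro open_Collect_conj open_Collect_less continuous_intros)

lemma Ann_eq_shell: "Ann = shell (1/4) 1"
proof -
  have "norm x < 1 \<longleftrightarrow> (norm x)\<^sup>2 < 1" "1/2 < norm x \<longleftrightarrow> 1/4 < (norm x)\<^sup>2" for x :: "real^2"
    using power2_less_imp_less[of "norm x" 1] power_strict_mono[of "norm x" 1 2]
      power2_less_imp_less[of "1/2" "norm x"] power_strict_mono[of "1/2" "norm x" 2]
    by (auto simp: power2_eq_square)
  moreover have "x \<in> Ann \<longleftrightarrow> norm x < 1 \<and> 1/2 < norm x" for x :: "real^2" by auto
  ultimately show ?thesis unfolding shell_def by blast
qed

lemma compact_norm_sq_ge: "compact K \<Longrightarrow> compact (K \<inter> {x::real^2. c \<le> (norm x)\<^sup>2})"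
  and compact_norm_sq_le: "compact K \<Longrightarrow> compact (K \<inter> {x::real^2. (norm x)\<^sup>2 \<le> c})"
  by (intro compact_Int_closed closed_Collect_le continuous_intros; assumption)+

lemma smooth_radial: "smooth_fn (\<lambda>x::real^2. sstep (a * (norm x)\<^sup>2 + b))"
  by (intro smooth_fn_sstep smooth_fn_add smooth_fn_mult smooth_fn_const smooth_fn_norm_sq)

text \<open>A partition of unity subordinate to the two overlapping shells splits each test function
  into one supported in either shell, and the identities add up.\<close>

lemma weak_partial_glue_shells:
  fixes u :: "real^2 \<Rightarrow> 'b::euclidean_space"
  assumes 1: "weak_partial (shell a c) u i g" and 2: "weak_partial (shell b d) u i g" and bc: "a \<le> b" "b < c" "c \<le> d"
  shows "weak_partial (shell a d) u i g"
proof -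
  \<comment> \<open>\<open>\<beta>\<close> and \<open>\<gamma>\<close> cut the overlap into thirds;
    the cutoff rises in the middle one, which leaves room on both sides for compact
    supports.\<close>
  define \<beta> where "\<beta> = b + (c - b) / 3"
  define \<gamma> where "\<gamma> = b + 2 * (c - b) / 3"
  have bg: "b < \<beta>" "\<beta> < \<gamma>" "\<gamma> < c" using bc by (auto simp: \<beta>_def \<gamma>_def field_simps)
  define \<theta> where "\<theta> x = sstep (1 / (\<gamma> - \<beta>) * (norm x)\<^sup>2 + - \<beta> / (\<gamma> - \<beta>))" for x :: "real^2"
  have arg: "1 / (\<gamma> - \<beta>) * s + - \<beta> / (\<gamma> - \<beta>) = (s - \<beta>) / (\<gamma> - \<beta>)" for s
    by (simp add: diff_divide_distrib)
  have \<theta>0: "\<theta> x = 0" if "(norm x)\<^sup>2 \<le> \<beta>" for x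
    unfolding \<theta>_def arg using that bg by (intro sstep_eq_0) (simp add: divide_nonpos_pos)
  have \<theta>1: "\<theta> x = 1" if "\<gamma> \<le> (norm x)\<^sup>2" for x
    unfolding \<theta>_def arg using that bg by (intro sstep_eq_1) simp
  have \<theta>s: "smooth_fn \<theta>" unfolding \<theta>_def by (rule smooth_radial)
  have split: "\<exists>\<phi>1 \<phi>2. test_fn (shell a c) \<phi>1 \<and> test_fn (shell b d) \<phi>2 \<and> (\<forall>x. \<phi> x = \<phi>1 x + \<phi>2 x)" if \<phi>: "test_fn (shell a d) \<phi>" for \<phi>
  proof (intro exI conjI allI)
    obtain K where K: "compact K" "K \<subseteq> shell a d" "\<And>x. x \<notin> K \<Longrightarrow> \<phi> x = 0" using test_fnE[OF \<phi>] by metis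
    note s = test_fn_smooth[OF \<phi>]
    show "test_fn (shell a c) (\<lambda>x. (1 - \<theta> x) * \<phi> x)"
    proof (rule test_fnI[of _ "K \<inter> {x. (norm x)\<^sup>2 \<le> \<gamma>}"])
      show "(1 - \<theta> x) * \<phi> x = 0" if "x \<notin> K \<inter> {x. (norm x)\<^sup>2 \<le> \<gamma>}" for x
        using that K(3)[of x] \<theta>1[of x] by force
    qed (use K bg s \<theta>s compact_norm_sq_le in \<open>auto intro!: smooth_fn_mult smooth_fn_diff smooth_fn_const simp: shell_def\<close>)
    show "test_fn (shell b d) (\<lambda>x. \<theta> x * \<phi> x)"
    proof (rule test_fnI[of _ "K \<inter> {x. \<beta> \<le> (norm x)\<^sup>2}"])
      show "\<theta> x * \<phi> x = 0" if "x \<notin> K \<inter> {x. \<beta> \<le> (norm x)\<^sup>2}" for x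
        using that K(3)[of x] \<theta>0[of x] by force
    qed (use K bg s \<theta>s compact_norm_sq_ge in \<open>auto intro!: smooth_fn_mult simp: shell_def\<close>)
    show "\<phi> x = (1 - \<theta> x) * \<phi> x + \<theta> x * \<phi> x" for x by (simp add: algebra_simps)
  qed
  have loc: "loc_int (shell a d) f" if f: "loc_int (shell a c) f" "loc_int (shell b d) f" for f :: "real^2 \<Rightarrow> 'b"
    unfolding loc_int_def
  proof (intro allI impI)
    fix K assume K: "compact K \<and> K \<subseteq> shell a d"
    define K1 where "K1 = K \<inter> {x. (norm x)\<^sup>2 \<le> \<beta>}"
    define K2 where "K2 = K \<inter> {x. \<beta> \<le> (norm x)\<^sup>2}"
    have "compact K1" "K1 \<subseteq> shell a c" "compact K2" "K2 \<subseteq> shell b d"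
      using K bg compact_norm_sq_le compact_norm_sq_ge by (auto simp: K1_def K2_def shell_def)
    then have "set_integrable lebesgue (K1 \<union> K2) f"
      using f by (intro set_integrable_Un) (auto simp: loc_int_def borel_compact)
    also have "K1 \<union> K2 = K" by (auto simp: K1_def K2_def)
    finally show "set_integrable lebesgue K f" .
  qed
  have l1: "loc_int (shell a c) u" "loc_int (shell a c) g" and l2: "loc_int (shell b d) u" "loc_int (shell b d) g"
    using 1 2 by (auto simp: weak_partial_def)
  show ?thesis
    unfolding weak_partial_iff
  proof (intro conjI allI impI loc l1 l2)
    fix \<phi> :: "real^2 \<Rightarrow> real" assume "test_fn (shell a d) \<phi>"
    then obtain \<phi>1 \<phi>2 where t: "test_fn (shell a c) \<phi>1" "test_fn (shell b d) \<phi>2" and sum: "\<And>x. \<phi> x = \<phi>1 x + \<phi>2 x"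
      using split by metis
    have \<phi>: "\<phi> = (\<lambda>x. \<phi>1 x + \<phi>2 x)" using sum by auto
    have pd: "pd i \<phi> x = pd i \<phi>1 x + pd i \<phi>2 x" for x
      unfolding \<phi> by (intro pd_add smooth_fn_differentiable test_fn_smooth[OF t(1)] test_fn_smooth[OF t(2)])
    have "(LINT x|lebesgue. pd i \<phi> x *\<^sub>R u x) = (LINT x|lebesgue. pd i \<phi>1 x *\<^sub>R u x) + (LINT x|lebesgue. pd i \<phi>2 x *\<^sub>R u x)"
      unfolding pd scaleR_add_left
      by (rule Bochner_Integration.integral_add[OF test_fn_integrable[OF test_fn_pd[OF t(1)] l1(1)] test_fn_integrable[OF test_fn_pd[OF t(2)] l2(1)]])
    also have "\<dots> = - (LINT x|lebesgue. \<phi>1 x *\<^sub>R g x) + - (LINT x|lebesgue. \<phi>2 x *\<^sub>R g x)"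
      using 1 2 t by (simp add: weak_partial_iff)
    also have "\<dots> = - (LINT x|lebesgue. \<phi> x *\<^sub>R g x)"
      unfolding sum scaleR_add_left
      by (subst Bochner_Integration.integral_add[OF test_fn_integrable[OF t(1) l1(2)] test_fn_integrable[OF t(2) l2(2)]]) simp
    finally show "(LINT x|lebesgue. pd i \<phi> x *\<^sub>R u x) = - (LINT x|lebesgue. \<phi> x *\<^sub>R g x)" .
  qed
qed

text \<open>Each shell spans a factor 4 in squared radius while consecutive ones are shifted by a
  factor 2, so neighbours overlap and can be glued inductively. A compact subset of the punctured
  disc stays away from 0 and meets only finitely many of them.\<close>

lemma weak_partial_punctured:
  fixes u :: "real^2 \<Rightarrow> 'b::euclidean_space"
  assumes w: "\<And>m::nat. weak_partial (shell ((1/2) ^ m / 4) ((1/2) ^ m)) u i g"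
  shows "weak_partial (B1 - {0}) u i g"
proof -
  have W: "weak_partial (shell ((1/2) ^ m / 4) 1) u i g" for m :: nat
  proof (induction m)
    case 0 then show ?case using w[of 0] by simp
  next
    case (Suc m)
    have p: "0 < (1/2::real) ^ m" "(1/2::real) ^ m \<le> 1" by (simp_all add: power_le_one)
    show ?case
      by (rule weak_partial_glue_shells[OF w[of "Suc m"] Suc]; unfold power_Suc; use p in linarith)
  qed
  have ex: "\<exists>m. K \<subseteq> shell ((1/2) ^ m / 4) 1" if K: "compact K" "K \<subseteq> B1 - {0}" for K
  proof (cases "K = {}")
    case False
    obtain y where y: "y \<in> K" "\<And>x. x \<in> K \<Longrightarrow> norm y \<le> norm x"
      using continuous_attains_inf[OF K(1) False, of norm] by (auto intro: continuous_intros)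
    then have "norm y > 0" using K by auto
    then obtain m where m: "(1/2::real) ^ m < (norm y)\<^sup>2" using real_arch_pow_inv[of "(norm y)\<^sup>2" "1/2"] by auto
    have "x \<in> shell ((1/2) ^ m / 4) 1" if "x \<in> K" for x
    proof -
      have "(norm y)\<^sup>2 \<le> (norm x)\<^sup>2" using y(2)[OF that] by (intro power_mono) auto
      moreover have "0 < (1/2::real) ^ m" by simp
      ultimately have "(1/2) ^ m / 4 < (norm x)\<^sup>2" using m by linarith
      moreover have "norm x < 1" using K that by auto
      then have "(norm x)\<^sup>2 < 1\<^sup>2" by (intro power_strict_mono) auto
      ultimately show ?thesis by (simp add: shell_def del: power_one_over)
    qed
    then show ?thesis by blast
  qed auto
  have l: "loc_int (B1 - {0}) f" if "\<And>m::nat. loc_int (shell ((1/2) ^ m / 4) 1) f" for f :: "real^2 \<Rightarrow> 'b"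
    unfolding loc_int_def using ex that unfolding loc_int_def by meson
  show ?thesis
    unfolding weak_partial_iff
  proof (intro conjI allI impI)
    show "loc_int (B1 - {0}) u" "loc_int (B1 - {0}) g" using W by (auto intro!: l simp: weak_partial_def)
    fix \<phi> :: "real^2 \<Rightarrow> real" assume \<phi>: "test_fn (B1 - {0}) \<phi>"
    then obtain K where K: "compact K" "K \<subseteq> B1 - {0}" "\<And>x. x \<notin> K \<Longrightarrow> \<phi> x = 0" using test_fnE by metis
    obtain m where m: "K \<subseteq> shell ((1/2) ^ m / 4) 1" using ex[OF K(1,2)] by auto
    have "test_fn (shell ((1/2) ^ m / 4) 1) \<phi>" by (rule test_fnI[OF test_fn_smooth[OF \<phi>] K(1) m K(3)])
    then show "(LINT x|lebesgue. pd i \<phi> x *\<^sub>R u x) = - (LINT x|lebesgue. \<phi> x *\<^sub>R g x)"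
      using W[of m] by (simp add: weak_partial_iff)
  qed
qed

text \<open>Since \<open>u\<close> and \<open>g\<close> vanish near the origin, a test function on
  the disc may be multiplied by a function vanishing near the origin without changing either
  integral.\<close>

lemma weak_partial_fill_puncture:
  fixes u :: "real^2 \<Rightarrow> 'b::euclidean_space"
  assumes w: "weak_partial (B1 - {0}) u i g" and d: "d > 0"
    and 0: "\<And>x. norm x < d \<Longrightarrow> u x = 0" "\<And>x. norm x < d \<Longrightarrow> g x = 0"
  shows "weak_partial B1 u i g"
proof -
  \<comment> \<open>Vanishes where (norm x)^2 is at most d^2/8 and equals 1 from d^2/4 on, so it
    leaves test functions unchanged beyond norm d/2.\<close>
  define \<theta> where "\<theta> x = sstep (8 / d\<^sup>2 * (norm x)\<^sup>2 + - 1)" for x :: "real^2"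
  have \<theta>s: "smooth_fn \<theta>" unfolding \<theta>_def by (rule smooth_radial)
  have \<theta>1: "\<theta> x = 1" if "d / 2 \<le> norm x" for x
  proof -
    have "(d / 2)\<^sup>2 \<le> (norm x)\<^sup>2" using that d by (intro power_mono) auto
    then show ?thesis unfolding \<theta>_def using d by (intro sstep_eq_1) (simp add: field_simps power2_eq_square)
  qed
  have \<theta>0: "\<theta> x = 0" if "norm x \<le> d / 4" for x
  proof -
    have "(norm x)\<^sup>2 \<le> (d / 4)\<^sup>2" using that d by (intro power_mono) auto
    then have "(norm x)\<^sup>2 \<le> d\<^sup>2 / 16" by (simp add: power_divide)
    then have "8 * (norm x)\<^sup>2 \<le> d\<^sup>2" using zero_le_power2[of "norm x"] by linarith
    then show ?thesis unfolding \<theta>_def using d by (intro sstep_eq_0) (simp add: field_simps)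
  qed
  have pd\<theta>: "pd i \<theta> x = 0" if "d \<le> norm x" for x
  proof -
    \<comment> \<open>The derivative of \<open>\<theta>\<close> is read off from 1 - \<theta>, which
      vanishes outside a closed ball.\<close>
    have "pd i (\<lambda>x. 1 + (-1) * \<theta> x) x = pd i (\<lambda>_. 1) x + pd i (\<lambda>x. (-1) * \<theta> x) x"
      by (intro pd_add smooth_fn_differentiable smooth_fn_const smooth_fn_mult \<theta>s)
    moreover have "pd i (\<lambda>x. (-1) * \<theta> x) x = (-1) * pd i \<theta> x + pd i (\<lambda>_. -1) x * \<theta> x"
      by (intro pd_mult smooth_fn_differentiable smooth_fn_const \<theta>s)
    moreover have "pd i (\<lambda>x. 1 + (-1) * \<theta> x) x = 0"
      by (rule pd_eq_0_outside[of "cball 0 (d / 2)"]) (use \<theta>1 that d in \<open>auto simp: not_le\<close>)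
    ultimately show ?thesis unfolding pd_const by linarith
  qed
  have loc: "loc_int B1 f" if f: "loc_int (B1 - {0}) f" "\<And>x. norm x < d \<Longrightarrow> f x = 0" for f :: "real^2 \<Rightarrow> 'b"
    unfolding loc_int_def
  proof (intro allI impI)
    fix K assume K: "compact K \<and> K \<subseteq> B1"
    have c: "compact (K - ball 0 d)" using K by (intro compact_diff) auto
    moreover have "K - ball 0 d \<subseteq> B1 - {0}" using K d by auto
    ultimately have "set_integrable lebesgue (K - ball 0 d) f" using f by (simp add: loc_int_def)
    moreover have "(\<lambda>x. indicator (K - ball 0 d) x *\<^sub>R f x) = (\<lambda>x. indicator K x *\<^sub>R f x)"
      using f(2) by (auto simp: indicator_def fun_eq_iff)
    ultimately show "set_integrable lebesgue K f" by (simp add: set_integrable_def)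
  qed
  show ?thesis
    unfolding weak_partial_iff
  proof (intro conjI allI impI)
    show "loc_int B1 u" "loc_int B1 g" using w 0 by (auto intro!: loc simp: weak_partial_def)
    fix \<phi> :: "real^2 \<Rightarrow> real" assume \<phi>: "test_fn B1 \<phi>"
    obtain K where K: "compact K" "K \<subseteq> B1" "\<And>x. x \<notin> K \<Longrightarrow> \<phi> x = 0" using test_fnE[OF \<phi>] by metis
    have t: "test_fn (B1 - {0}) (\<lambda>x. \<theta> x * \<phi> x)"
    proof (rule test_fnI[of _ "K - ball 0 (d / 4)"])
      show "compact (K - ball 0 (d / 4))" using K by (intro compact_diff) auto
      show "\<theta> x * \<phi> x = 0" if "x \<notin> K - ball 0 (d / 4)" for x
        using that K(3)[of x] \<theta>0[of x] by (auto simp: less_imp_le)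
    qed (use \<theta>s test_fn_smooth[OF \<phi>] K d in \<open>auto intro: smooth_fn_mult\<close>)
    have e1: "pd i (\<lambda>x. \<theta> x * \<phi> x) x *\<^sub>R u x = pd i \<phi> x *\<^sub>R u x" for x
    proof (cases "norm x < d")
      case False
      have "pd i (\<lambda>x. \<theta> x * \<phi> x) x = \<theta> x * pd i \<phi> x + pd i \<theta> x * \<phi> x"
        by (intro pd_mult smooth_fn_differentiable \<theta>s test_fn_smooth[OF \<phi>])
      then show ?thesis using False \<theta>1[of x] pd\<theta>[of x] d by simp
    qed (simp add: 0)
    have e2: "(\<theta> x * \<phi> x) *\<^sub>R g x = \<phi> x *\<^sub>R g x" for x
      using 0(2)[of x] \<theta>1[of x] d by (cases "norm x < d") auto
    moreover have "(LINT x|lebesgue. pd i (\<lambda>x. \<theta> x * \<phi> x) x *\<^sub>R u x) = - (LINT x|lebesgue. (\<theta> x * \<phi> x) *\<^sub>R g x)"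
      using w t unfolding weak_partial_iff by blast
    have "(LINT x|lebesgue. pd i (\<lambda>x. \<theta> x * \<phi> x) x *\<^sub>R u x) = - (LINT x|lebesgue. (\<theta> x * \<phi> x) *\<^sub>R g x)"
      using w t unfolding weak_partial_iff by blast
    then show "(LINT x|lebesgue. pd i \<phi> x *\<^sub>R u x) = - (LINT x|lebesgue. \<phi> x *\<^sub>R g x)"
      unfolding e1 e2 .
  qed
qed

section \<open>One-homogeneous isometries on the punctured disc\<close>

lemma one_homogeneous_facts:
  assumes u: "u \<in> Xsp" and \<gamma>: "\<And>x. x \<in> B1 \<Longrightarrow> x \<noteq> 0 \<Longrightarrow> u x = norm x *\<^sub>R \<gamma> (x /\<^sub>R norm x)"
  shows "\<And>x c. c > 0 \<Longrightarrow> x \<in> B1 \<Longrightarrow> c *\<^sub>R x \<in> B1 \<Longrightarrow> u (c *\<^sub>R x) = c *\<^sub>R u x"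
    and "\<And>x. x \<in> B1 \<Longrightarrow> norm (u x) = norm x"
proof -
  have u0: "u 0 = 0" and contu: "continuous_on (cball 0 1) u" and u1: "\<And>x. norm x = 1 \<Longrightarrow> norm (u x) = 1"
    using u by (auto simp: Xsp_def)
  show "u (c *\<^sub>R x) = c *\<^sub>R u x" if "c > 0" "x \<in> B1" "c *\<^sub>R x \<in> B1" for x c
  proof (cases "x = 0")
    case False
    then have "inverse (c * norm x) * c = inverse (norm x)" using that by (simp add: field_simps)
    then have "inverse (norm (c *\<^sub>R x)) * c = inverse (norm x)" using that by simp
    then have e: "(c *\<^sub>R x) /\<^sub>R norm (c *\<^sub>R x) = x /\<^sub>R norm x" by (simp only: scaleR_scaleR)
    have "u (c *\<^sub>R x) = norm (c *\<^sub>R x) *\<^sub>R \<gamma> ((c *\<^sub>R x) /\<^sub>R norm (c *\<^sub>R x))"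
      by (rule \<gamma>) (use that False in auto)
    also have "\<dots> = (c * norm x) *\<^sub>R \<gamma> (x /\<^sub>R norm x)" unfolding e using that by simp
    also have "\<dots> = c *\<^sub>R u x" using \<gamma>[of x] that False by simp
    finally show ?thesis .
  qed (simp add: u0)
  show "norm (u x) = norm x" if x: "x \<in> B1" for x
  proof (cases "x = 0")
    case False
    define \<omega> where "\<omega> = x /\<^sub>R norm x"
    have \<omega>: "norm \<omega> = 1" using False by (simp add: \<omega>_def)
    \<comment> \<open>\<open>\<gamma>\<close> is tied to \<open>u\<close> only inside the open disc.
      Radii tending to 1 carry the unit length of the boundary values over to it.\<close>
    define a where "a n = 1 - inverse (real (Suc (Suc n)))" for n
    have a: "0 < a n" "a n < 1" for n by (auto simp: a_def field_simps)
    have alim: "a \<longlonglongrightarrow> 1"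
    proof -
      have "(\<lambda>n. 1 - inverse (real (Suc (n + 1)))) \<longlonglongrightarrow> 1 - 0"
        by (intro tendsto_diff tendsto_const LIMSEQ_ignore_initial_segment[OF LIMSEQ_inverse_real_of_nat])
      then show ?thesis by (simp add: a_def[abs_def])
    qed
    have "u (a n *\<^sub>R \<omega>) = a n *\<^sub>R \<gamma> \<omega>" for n
    proof -
      have "a n *\<^sub>R \<omega> \<in> B1" "a n *\<^sub>R \<omega> \<noteq> 0" using a[of n] \<omega> by auto
      then show ?thesis using \<gamma>[of "a n *\<^sub>R \<omega>"] a[of n] \<omega> by simp
    qed
    moreover have "(\<lambda>n. u (a n *\<^sub>R \<omega>)) \<longlonglongrightarrow> u (1 *\<^sub>R \<omega>)"
    proof (rule continuous_on_tendsto_compose[OF contu])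
      show "(\<lambda>n. a n *\<^sub>R \<omega>) \<longlonglongrightarrow> 1 *\<^sub>R \<omega>" by (intro tendsto_scaleR tendsto_const alim)
      have "a n *\<^sub>R \<omega> \<in> cball 0 1" for n using a[of n] \<omega> by simp
      then show "\<forall>\<^sub>F n in sequentially. a n *\<^sub>R \<omega> \<in> cball 0 1" by simp
    qed (use \<omega> in simp)
    moreover have "(\<lambda>n. a n *\<^sub>R \<gamma> \<omega>) \<longlonglongrightarrow> 1 *\<^sub>R \<gamma> \<omega>" by (intro tendsto_scaleR tendsto_const alim)
    ultimately have "u \<omega> = \<gamma> \<omega>" using LIMSEQ_unique by simp
    then have "norm (\<gamma> \<omega>) = 1" using u1[OF \<omega>] by simp
    then show ?thesis using \<gamma>[OF x False] by (simp add: \<omega>_def)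
  qed (simp add: u0)
qed

text \<open>Index of the dyadic annulus that contains \<open>x\<close>; through it a function given
  on \<open>Ann\<close> is dilated to all annuli by one Borel formula.\<close>

definition dyad :: "real^2 \<Rightarrow> nat" where
  "dyad x = (LEAST i. 1/2 < norm (2 ^ i *\<^sub>R x))"

lemma dyad_eq:
  assumes "2 ^ i *\<^sub>R x \<in> Ann"
  shows "dyad x = i"
  unfolding dyad_def
proof (rule Least_equality)
  show "1/2 < norm (2 ^ i *\<^sub>R x)" using assms by simp
  fix k assume k: "1/2 < norm (2 ^ k *\<^sub>R x)"
  show "i \<le> k"
  proof (rule ccontr)
    assume "\<not> i \<le> k"
    then have "(2::real) ^ Suc k \<le> 2 ^ i" by (intro power_increasing) auto
    then have "2 ^ Suc k * norm x \<le> 2 ^ i * norm x" by (intro mult_right_mono) auto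
    moreover have "2 ^ i * norm x < 1" using assms by simp
    ultimately show False using k by simp
  qed
qed

text \<open>Second derivatives are given only on \<open>Ann\<close>. Dilating by powers of 2 reaches
  every dyadic annulus but leaves out the circles between them, across which a distributional
  derivative could have a singular part. Shells dilated by sqrt 2 times a power of 2 straddle these
  circles and exclude this; gluing both families gives the punctured disc.\<close>

lemma homogeneous_derivatives:
  fixes u :: "real^2 \<Rightarrow> real^3"
  assumes u: "u \<in> Xsp" and W: "W2 2 Ann u" and iso: "one_hom_isometry u"
  obtains g :: "2 \<Rightarrow> real^2 \<Rightarrow> real^3" and G :: "2 \<Rightarrow> 2 \<Rightarrow> real^2 \<Rightarrow> real^3"
  where "\<And>l. g l \<in> borel_measurable borel" "\<And>l j. G l j \<in> borel_measurable borel"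
    "\<And>l. weak_partial B1 u l (g l)" "\<And>l j. weak_partial (B1 - {0}) (g l) j (G l j)"
    "AE x in lebesgue. x \<in> B1 \<longrightarrow> jac g x \<in> O23"
    "\<And>i. (\<integral>\<^sup>+x. ennreal (\<Sum>l\<in>UNIV. \<Sum>j\<in>UNIV. (norm (G l j x))\<^sup>2) * indicator Ann (2 ^ i *\<^sub>R x) \<partial>lborel)
      = (\<integral>\<^sup>+x\<in>Ann. ennreal (hess_sq Ann u x) \<partial>lebesgue)"
proof -
  obtain \<gamma> where \<gamma>: "\<And>x. x \<in> B1 \<Longrightarrow> x \<noteq> 0 \<Longrightarrow> u x = norm x *\<^sub>R \<gamma> (x /\<^sub>R norm x)"
    using iso unfolding one_hom_isometry_def by blast
  note hom = one_homogeneous_facts(1)[OF u \<gamma>]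
  have rep: "\<exists>f'. f' \<in> borel_measurable borel \<and> (AE x in lebesgue. x \<in> U \<longrightarrow> f' x = f x)"
    if "f \<in> borel_measurable (lebesgue_on U)" "U \<in> sets borel" for f :: "real^2 \<Rightarrow> real^3" and U
    by (rule borel_representative[OF that(2,1)]) blast
  have openA: "open Ann" by (intro open_Diff) auto
  have mg: "wd B1 u l \<in> borel_measurable (lebesgue_on B1)" for l using Xsp_wd(2)[OF u, of l] by (simp add: Lp_def)
  define g where "g l = (SOME f'. f' \<in> borel_measurable borel \<and> (AE x in lebesgue. x \<in> B1 \<longrightarrow> f' x = wd B1 u l x))" for l
  have g: "g l \<in> borel_measurable borel" "AE x in lebesgue. x \<in> B1 \<longrightarrow> g l x = wd B1 u l x" for l
    using someI_ex[OF rep[OF mg B1_borel], of l] unfolding g_def by blast+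
  have ug: "weak_partial B1 u l (g l)" for l
    by (rule weak_partial_cong_AE[OF Xsp_wd(1)[OF u]]) (use g(2)[of l] in \<open>auto elim!: eventually_mono\<close>)
  have AnnB1: "Ann \<subseteq> B1" by auto
  obtain g0 where g0: "\<And>l. weak_partial Ann u l (g0 l)" "\<And>l. \<forall>j. \<exists>g2. weak_partial Ann (g0 l) j g2 \<and> Lp 2 Ann g2"
    using W unfolding W2_def by metis
  have g0g: "AE x in lebesgue. x \<in> Ann \<longrightarrow> g0 l x = g l x" for l
    by (rule weak_partial_unique[OF openA g0(1) weak_partial_mono[OF ug AnnB1]])
  have ex: "\<exists>f'. f' \<in> borel_measurable borel \<and> weak_partial Ann (g l) j f'" for l j
  proof -
    obtain g2 where g2: "weak_partial Ann (g0 l) j g2" "Lp 2 Ann g2" using g0(2) by blast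
    then have "g2 \<in> borel_measurable (lebesgue_on Ann)" by (simp add: Lp_def)
    from rep[OF this Ann_borel] obtain f' where f': "f' \<in> borel_measurable borel" "AE x in lebesgue. x \<in> Ann \<longrightarrow> f' x = g2 x" by blast
    have "AE x in lebesgue. x \<in> Ann \<longrightarrow> g2 x = f' x" by (rule eventually_mono[OF f'(2)]) simp
    from weak_partial_cong_AE[OF g2(1) g0g this] f'(1) show ?thesis by blast
  qed
  define G0 where "G0 l j = (SOME f'. f' \<in> borel_measurable borel \<and> weak_partial Ann (g l) j f')" for l j
  have G0: "G0 l j \<in> borel_measurable borel" "weak_partial Ann (g l) j (G0 l j)" for l j
    using someI_ex[OF ex[of l j]] unfolding G0_def by blast+
  \<comment> \<open>The derivative of a 0-homogeneous function is homogeneous of degree -1, hence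
    the factor in front.\<close>
  define G where "G l j x = 2 ^ dyad x *\<^sub>R G0 l j (2 ^ dyad x *\<^sub>R x)" for l j x
  have dyad_m: "dyad \<in> measurable borel (count_space UNIV)"
    unfolding dyad_def by measurable
  have Gm: "G l j \<in> borel_measurable borel" for l j
    unfolding G_def
  proof (rule measurable_compose_countable[OF _ dyad_m])
    fix i :: nat
    have "(\<lambda>x. G0 l j (2 ^ i *\<^sub>R x)) \<in> borel_measurable borel" by (rule measurable_compose[OF _ G0(1)]) simp
    then show "(\<lambda>x. 2 ^ i *\<^sub>R G0 l j (2 ^ i *\<^sub>R x)) \<in> borel_measurable borel" by simp
  qed
  text \<open>The gradient is 0-homogeneous, hence dilating \<open>Ann\<close> transports its second derivatives.\<close>
  have dil: "weak_partial (shell (1 / (4 * c\<^sup>2)) (1 / c\<^sup>2)) (g l) j (\<lambda>x. c *\<^sub>R G0 l j (c *\<^sub>R x))" if c: "c \<ge> 1" for c l j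
  proof -
    define V where "V = shell (1 / (4 * c\<^sup>2)) (1 / c\<^sup>2)"
    have V: "c *\<^sub>R x \<in> Ann" if "x \<in> V" for x
      using that c unfolding Ann_eq_shell V_def shell_def by (simp add: power_mult_distrib divide_less_eq less_divide_eq mult_ac)
    have VB: "x \<in> B1" if "x \<in> V" for x
    proof -
      have "1 * norm x \<le> c * norm x" using c by (intro mult_right_mono) auto
      then show ?thesis using V[OF that] c by simp
    qed
    have w1: "weak_partial V (\<lambda>x. u (c *\<^sub>R x)) l (\<lambda>x. c *\<^sub>R g l (c *\<^sub>R x))"
      by (rule weak_partial_scale[OF ug]) (use c V in auto)
    have "weak_partial V (\<lambda>x. c *\<^sub>R u x) l (\<lambda>x. c *\<^sub>R g l x)"
      by (intro weak_partial_scaleR weak_partial_mono[OF ug]) (use VB in blast)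
    then have w2: "weak_partial V (\<lambda>x. u (c *\<^sub>R x)) l (\<lambda>x. c *\<^sub>R g l x)"
    proof (rule weak_partial_cong_AE)
      have "c *\<^sub>R u x = u (c *\<^sub>R x)" if "x \<in> V" for x
        using hom[of c x] VB[OF that] V[OF that] c by (simp add: Diff_iff)
      then show "AE x in lebesgue. x \<in> V \<longrightarrow> c *\<^sub>R u x = u (c *\<^sub>R x)" by simp
    qed simp
    have "AE x in lebesgue. x \<in> V \<longrightarrow> c *\<^sub>R g l (c *\<^sub>R x) = c *\<^sub>R g l x"
      by (rule weak_partial_unique[OF _ w1 w2]) (simp add: V_def open_shell)
    then have "AE x in lebesgue. x \<in> V \<longrightarrow> g l (c *\<^sub>R x) = g l x" by (rule eventually_mono) (use c in auto)
    from weak_partial_cong_AE[OF weak_partial_scale[OF G0(2)] this] show ?thesis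
      using c V unfolding V_def[symmetric] by simp
  qed
  have even: "weak_partial (shell ((1/4) ^ i / 4) ((1/4) ^ i)) (g l) j (G l j)" for i l j
  proof -
    have e: "1 / (4 * (2 ^ i)\<^sup>2) = (1/4) ^ i / (4::real)" "1 / (2 ^ i)\<^sup>2 = (1/4::real) ^ i"
      by (simp_all add: power_mult[symmetric] power_one_over power_mult[of 2 2] mult.commute[of i 2])
    have "weak_partial (shell ((1/4) ^ i / 4) ((1/4) ^ i)) (g l) j (\<lambda>x. 2 ^ i *\<^sub>R G0 l j (2 ^ i *\<^sub>R x))"
      using dil[of "2 ^ i" l j] unfolding e by simp
    then show ?thesis
    proof (rule weak_partial_cong_AE)
      have "2 ^ i *\<^sub>R x \<in> Ann" if "x \<in> shell ((1/4) ^ i / 4) ((1/4) ^ i)" for x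
        using that unfolding e[symmetric] Ann_eq_shell shell_def
        by (simp add: power_mult_distrib divide_less_eq less_divide_eq mult_ac)
      then show "AE x in lebesgue. x \<in> shell ((1/4) ^ i / 4) ((1/4) ^ i) \<longrightarrow> 2 ^ i *\<^sub>R G0 l j (2 ^ i *\<^sub>R x) = G l j x"
        unfolding G_def by (intro AE_I2 impI) (simp only: dyad_eq[of i])
    qed simp
  qed
  have odd: "weak_partial (shell ((1/4) ^ i / 8) ((1/4) ^ i / 2)) (g l) j (G l j)" for i l j
  proof -
    \<comment> \<open>Half a dyadic step further: the dilated shell has squared radii between
      4^(-i)/8 and 4^(-i)/2 and contains the circle of squared radius 4^(-i)/4 separating two
      neighbouring annuli.\<close>
    define c where "c = sqrt 2 * 2 ^ i"
    have c1: "c \<ge> 1"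
    proof -
      have "1 * 1 \<le> sqrt 2 * (2::real) ^ i" by (intro mult_mono) auto
      then show ?thesis by (simp add: c_def)
    qed
    have e: "1 / (4 * c\<^sup>2) = (1/4) ^ i / (8::real)" "1 / c\<^sup>2 = (1/4::real) ^ i / 2"
      by (simp_all add: c_def power_mult_distrib power_mult[symmetric] power_one_over power_mult[of 2 2] mult.commute[of i 2])
    define V where "V = shell ((1/4::real) ^ i / 8) ((1/4) ^ i / 2)"
    have w: "weak_partial V (g l) j (\<lambda>x. c *\<^sub>R G0 l j (c *\<^sub>R x))" using dil[OF c1, of l j] unfolding e V_def .
    have "AE x in lebesgue. x \<in> V \<inter> S \<longrightarrow> c *\<^sub>R G0 l j (c *\<^sub>R x) = G l j x" if "weak_partial S (g l) j (G l j)" "open S" for S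
      by (rule weak_partial_unique[OF _ weak_partial_mono[OF w] weak_partial_mono[OF that(1)]])
         (use that(2) open_shell in \<open>auto simp: V_def intro: open_Int\<close>)
    from this[OF even[of i] open_shell] this[OF even[of "Suc i"] open_shell]
    \<comment> \<open>The two neighbouring annuli cover the shell up to this circle, so uniqueness
      on each of them identifies the derivative with \<open>G\<close> almost everywhere.\<close>
    moreover have "AE x in lebesgue. x \<notin> sphere (0::real^2) (sqrt ((1/4) ^ i / 4))"
      using negligible_sphere by (intro AE_not_in) (simp add: negligible_iff_null_sets)
    ultimately have "AE x in lebesgue. x \<in> V \<longrightarrow> c *\<^sub>R G0 l j (c *\<^sub>R x) = G l j x"
    proof (eventually_elim, intro impI)
      fix x
      assume a: "x \<in> V \<inter> shell ((1/4) ^ i / 4) ((1/4) ^ i) \<longrightarrow> c *\<^sub>R G0 l j (c *\<^sub>R x) = G l j x"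
        and b: "x \<in> V \<inter> shell ((1/4) ^ Suc i / 4) ((1/4) ^ Suc i) \<longrightarrow> c *\<^sub>R G0 l j (c *\<^sub>R x) = G l j x"
        and s: "x \<notin> sphere (0::real^2) (sqrt ((1/4) ^ i / 4))" and x: "x \<in> V"
      have "(norm x)\<^sup>2 \<noteq> (1/4) ^ i / 4" using s by (metis mem_sphere_0 norm_ge_zero real_sqrt_unique)
      then have "x \<in> shell ((1/4) ^ i / 4) ((1/4) ^ i) \<or> x \<in> shell ((1/4) ^ Suc i / 4) ((1/4) ^ Suc i)"
        using x by (auto simp: V_def shell_def)
      then show "c *\<^sub>R G0 l j (c *\<^sub>R x) = G l j x" using a b x by blast
    qed
    from weak_partial_cong_AE[OF w _ this] show ?thesis unfolding V_def by simp
  qed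
  show ?thesis
  proof (rule that[OF g(1) Gm ug])
    show "weak_partial (B1 - {0}) (g l) j (G l j)" for l j
    proof (rule weak_partial_punctured)
      fix m :: nat
      obtain i where "m = 2 * i \<or> m = 2 * i + 1" by (metis evenE oddE)
      then show "weak_partial (shell ((1/2) ^ m / 4) ((1/2) ^ m)) (g l) j (G l j)"
      proof
        assume "m = 2 * i"
        then have "(1/2::real) ^ m = (1/4) ^ i" by (simp add: power_mult power2_eq_square)
        then show ?thesis using even[of i l j] by simp
      next
        assume "m = 2 * i + 1"
        then have "(1/2::real) ^ m = (1/4) ^ i / 2" "(1/2::real) ^ m / 4 = (1/4) ^ i / 8" by (simp_all add: power_mult power2_eq_square)
        then show ?thesis using odd[of i l j] by (simp only:)
      qed
    qed
    have B1s: "B1 \<in> sets lebesgue" by simp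
    have ae: "AE x in lebesgue. x \<in> B1 \<longrightarrow> Du B1 u x \<in> O23"
      using iso B1s unfolding one_hom_isometry_def by (simp add: AE_restrict_space_iff)
    have "AE x in lebesgue. \<forall>l\<in>UNIV. x \<in> B1 \<longrightarrow> g l x = wd B1 u l x" using g(2) by (intro AE_finite_allI) auto
    with ae show "AE x in lebesgue. x \<in> B1 \<longrightarrow> jac g x \<in> O23"
    proof eventually_elim
      fix x assume a: "x \<in> B1 \<longrightarrow> Du B1 u x \<in> O23" "\<forall>l\<in>UNIV. x \<in> B1 \<longrightarrow> g l x = wd B1 u l x"
      show "x \<in> B1 \<longrightarrow> jac g x \<in> O23"
      proof
        assume x: "x \<in> B1"
        then have "jac g x = Du B1 u x" using a(2) by (simp add: Du_eq_jac jac_def)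
        then show "jac g x \<in> O23" using a(1) x by simp
      qed
    qed
    fix i :: nat
    define A where "A = {x::real^2. 2 ^ i *\<^sub>R x \<in> Ann}"
    have A: "A \<in> sets borel"
    proof -
      have "(\<lambda>x::real^2. 2 ^ i *\<^sub>R x) -` Ann \<inter> space borel \<in> sets borel" by (rule measurable_sets[OF _ Ann_borel]) simp
      then show ?thesis by (simp add: A_def vimage_def)
    qed
    have "(\<integral>\<^sup>+x. ennreal (\<Sum>l\<in>UNIV. \<Sum>j\<in>UNIV. (norm (G l j x))\<^sup>2) * indicator Ann (2 ^ i *\<^sub>R x) \<partial>lborel)
      = (\<integral>\<^sup>+x\<in>A. ennreal (\<Sum>l\<in>UNIV. \<Sum>j\<in>UNIV. (norm (2 ^ i *\<^sub>R G0 l j (2 ^ i *\<^sub>R x)))\<^sup>2) \<partial>lborel)"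
    proof (rule nn_integral_cong)
      fix x :: "real^2"
      show "ennreal (\<Sum>l\<in>UNIV. \<Sum>j\<in>UNIV. (norm (G l j x))\<^sup>2) * indicator Ann (2 ^ i *\<^sub>R x)
        = ennreal (\<Sum>l\<in>UNIV. \<Sum>j\<in>UNIV. (norm (2 ^ i *\<^sub>R G0 l j (2 ^ i *\<^sub>R x)))\<^sup>2) * indicator A x"
      proof (cases "2 ^ i *\<^sub>R x \<in> Ann")
        case True
        then show ?thesis by (simp only: G_def dyad_eq[OF True] A_def mem_Collect_eq indicator_simps)
      next
        case False
        then have "x \<notin> A" by (simp only: A_def mem_Collect_eq not_False_eq_True)
        then show ?thesis using False by (simp only: indicator_simps mult_zero_right not_False_eq_True)
      qed
    qed
    also have "\<dots> = (\<integral>\<^sup>+x. ennreal (\<Sum>l\<in>UNIV. \<Sum>j\<in>UNIV. (norm (G0 l j x))\<^sup>2) * indicator A ((1 / 2 ^ i) *\<^sub>R x) \<partial>lborel)"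
      by (rule Ann_hessian_scale[OF G0(1) _ A]) simp
    also have "\<dots> = (\<integral>\<^sup>+x\<in>Ann. ennreal (\<Sum>l\<in>UNIV. \<Sum>j\<in>UNIV. (norm (G0 l j x))\<^sup>2) \<partial>lborel)"
      by (simp add: A_def indicator_def)
    also have "\<dots> = (\<integral>\<^sup>+x\<in>Ann. ennreal (\<Sum>l\<in>UNIV. \<Sum>j\<in>UNIV. (norm (G0 l j x))\<^sup>2) \<partial>lebesgue)"
      by (simp add: nn_integral_completion)
    also have "\<dots> = (\<integral>\<^sup>+x\<in>Ann. ennreal (hess_sq Ann u x) \<partial>lebesgue)"
      by (rule nn_integral_cong_AE)
         (use hess_sq_AE_eq[OF openA weak_partial_mono[OF ug AnnB1] G0(2)] in \<open>auto elim!: eventually_mono simp: indicator_def\<close>)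
    finally show "(\<integral>\<^sup>+x. ennreal (\<Sum>l\<in>UNIV. \<Sum>j\<in>UNIV. (norm (G l j x))\<^sup>2) * indicator Ann (2 ^ i *\<^sub>R x) \<partial>lborel)
      = (\<integral>\<^sup>+x\<in>Ann. ennreal (hess_sq Ann u x) \<partial>lebesgue)" .
  qed
qed

section \<open>Cutting off near the origin\<close>

lemma weak_partial_add:
  fixes u v :: "real^'n::finite \<Rightarrow> 'b::euclidean_space"
  assumes u: "weak_partial U u i g" and v: "weak_partial U v i h"
  shows "weak_partial U (\<lambda>x. u x + v x) i (\<lambda>x. g x + h x)"
  unfolding weak_partial_iff
proof (intro conjI allI impI)
  have l: "loc_int U u" "loc_int U g" "loc_int U v" "loc_int U h" using u v by (auto simp: weak_partial_def)
  then show "loc_int U (\<lambda>x. u x + v x)" "loc_int U (\<lambda>x. g x + h x)" by (simp_all add: loc_int_add)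
  fix \<phi> :: "real^'n \<Rightarrow> real" assume \<phi>: "test_fn U \<phi>"
  have "(LINT x|lebesgue. pd i \<phi> x *\<^sub>R (u x + v x)) = (LINT x|lebesgue. pd i \<phi> x *\<^sub>R u x) + (LINT x|lebesgue. pd i \<phi> x *\<^sub>R v x)"
    unfolding scaleR_add_right
    by (rule Bochner_Integration.integral_add[OF test_fn_integrable[OF test_fn_pd[OF \<phi>] l(1)] test_fn_integrable[OF test_fn_pd[OF \<phi>] l(3)]])
  also have "\<dots> = - (LINT x|lebesgue. \<phi> x *\<^sub>R g x) + - (LINT x|lebesgue. \<phi> x *\<^sub>R h x)"
    using u v \<phi> by (simp add: weak_partial_iff)
  also have "\<dots> = - (LINT x|lebesgue. \<phi> x *\<^sub>R (g x + h x))"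
    unfolding scaleR_add_right
    by (subst Bochner_Integration.integral_add[OF test_fn_integrable[OF \<phi> l(2)] test_fn_integrable[OF \<phi> l(4)]]) simp
  finally show "(LINT x|lebesgue. pd i \<phi> x *\<^sub>R (u x + v x)) = - (LINT x|lebesgue. \<phi> x *\<^sub>R (g x + h x))" .
qed

text \<open>The affine argument is 0 at squared norm 1/8 and 1 at squared norm 1/4, so the
  transition lies between the norms 1/4 and 1/2 and fits into a single dyadic annulus.\<close>

definition cutoff :: "real^2 \<Rightarrow> real" where
  "cutoff x = sstep (8 * (norm x)\<^sup>2 + - 1)"

lemma smooth_cutoff: "smooth_fn cutoff"
  using smooth_radial[of 8 "-1"] by (simp add: cutoff_def[abs_def])

lemma cutoff_bounds: "0 \<le> cutoff x" "cutoff x \<le> 1"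
  by (simp_all add: cutoff_def sstep_bounds)

lemma cutoff_eq_0: "norm x \<le> 1/4 \<Longrightarrow> cutoff x = 0"
  and cutoff_eq_1: "1/2 \<le> norm x \<Longrightarrow> cutoff x = 1"
proof -
  assume "norm x \<le> 1/4"
  then have "(norm x)\<^sup>2 \<le> (1/4)\<^sup>2" by (intro power_mono) auto
  then show "cutoff x = 0" unfolding cutoff_def by (intro sstep_eq_0) (simp add: power2_eq_square)
next
  assume "1/2 \<le> norm x"
  then have "(1/2)\<^sup>2 \<le> (norm x)\<^sup>2" by (intro power_mono) auto
  then show "cutoff x = 1" unfolding cutoff_def by (intro sstep_eq_1) (simp add: power2_eq_square)
qed

lemma pd_cutoff_eq_0:
  assumes "norm x < 1/4 \<or> 1/2 < norm x"
  shows "pd l cutoff x = 0" "pd j (pd l cutoff) x = 0"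
    and test_fn_pd_cutoff: "test_fn B1 (pd l cutoff)"
proof -
  \<comment> \<open>The cutoff has no compact support, but after subtracting 1 it has, and the
    partial derivatives are the same.\<close>
  define T where "T x = cutoff x + -1" for x
  have sT: "smooth_fn T" unfolding T_def by (intro smooth_fn_add smooth_cutoff smooth_fn_const)
  have pT: "pd l cutoff = pd l T" for l
  proof
    fix x
    have "pd l T x = pd l cutoff x + pd l (\<lambda>_. -1) x"
      unfolding T_def[abs_def] by (intro pd_add smooth_fn_differentiable smooth_cutoff smooth_fn_const)
    then show "pd l cutoff x = pd l T x" by (simp add: pd_const)
  qed
  have T0: "T x = 0" if "x \<notin> cball 0 (1/2)" for x using that cutoff_eq_1[of x] by (simp add: T_def)
  have "test_fn B1 T" by (rule test_fnI[OF sT, of "cball 0 (1/2)"]) (use T0 in auto)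
  then show "test_fn B1 (pd l cutoff)" unfolding pT by (rule test_fn_pd)
  have c0: "cutoff x = 0" if "x \<notin> - ball 0 (1/4)" for x using that by (intro cutoff_eq_0) simp
  have in1: "pd l cutoff x = 0" if "x \<notin> - ball 0 (1/4)" for x l by (rule pd_eq_0_outside[OF _ c0 that]) auto
  have in2: "pd j (pd l cutoff) x = 0" if "x \<notin> - ball 0 (1/4)" for x j l by (rule pd_eq_0_outside[OF _ in1 that]) auto
  have out1: "pd l cutoff x = 0" if "x \<notin> cball 0 (1/2)" for x l unfolding pT by (rule pd_eq_0_outside[OF _ T0 that]) auto
  have out2: "pd j (pd l cutoff) x = 0" if "x \<notin> cball 0 (1/2)" for x j l by (rule pd_eq_0_outside[OF _ out1 that]) auto
  show "pd l cutoff x = 0" "pd j (pd l cutoff) x = 0"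
    using assms in1[of x l] out1[of x l] in2[of x j l] out2[of x j l] by auto
qed

lemma pd_cutoff_bounded:
  obtains B where "B \<ge> 1" "\<And>l x. \<bar>pd l cutoff x\<bar> \<le> B" "\<And>l j x. \<bar>pd j (pd l cutoff) x\<bar> \<le> B"
proof -
  have t: "test_fn B1 (pd l cutoff)" for l by (rule test_fn_pd_cutoff[of 0]) simp
  have "\<forall>l. \<exists>b. \<forall>x. \<bar>pd l cutoff x\<bar> \<le> b" using test_fn_bounded[OF t] by blast
  then obtain b where b: "\<And>l x. \<bar>pd l cutoff x\<bar> \<le> b l" by metis
  have "\<forall>p. \<exists>b. \<forall>x. \<bar>pd (fst p) (pd (snd p) cutoff) x\<bar> \<le> b" using test_fn_bounded[OF test_fn_pd[OF t]] by blast
  then obtain d where d: "\<And>p x. \<bar>pd (fst p) (pd (snd p) cutoff) x\<bar> \<le> d p" by metis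
  define B where "B = 1 + (\<Sum>l\<in>UNIV. b l) + (\<Sum>p\<in>UNIV. d p)"
  have b0: "b l \<ge> 0" and d0: "d p \<ge> 0" for l p
    using b[where l = l and x = 0] d[where p = p and x = 0] by linarith+
  have "b l \<le> (\<Sum>l\<in>UNIV. b l)" "d p \<le> (\<Sum>p\<in>UNIV. d p)" for l p
    using b0 d0 by (auto intro!: member_le_sum)
  moreover have "0 \<le> (\<Sum>l\<in>UNIV. b l)" "0 \<le> (\<Sum>p\<in>UNIV. d p)" using b0 d0 by (simp_all add: sum_nonneg)
  ultimately have B: "b l \<le> B" "d p \<le> B" "1 \<le> B" for l p unfolding B_def by (smt (verit))+
  show ?thesis
  proof (rule that[OF B(3)])
    show "\<bar>pd l cutoff x\<bar> \<le> B" for l x using b[where l = l and x = x] B(1)[of l] by linarith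
    show "\<bar>pd j (pd l cutoff) x\<bar> \<le> B" for l j x using d[where p = "(j, l)" and x = x] B(2)[of "(j, l)"] by simp
  qed
qed

lemma Du_AE_eq_jac:
  assumes "\<And>l. weak_partial B1 v l (g l)"
  shows "AE x in lebesgue. x \<in> B1 \<longrightarrow> Du B1 v x = jac g x"
proof -
  have "AE x in lebesgue. \<forall>l\<in>UNIV. x \<in> B1 \<longrightarrow> wd B1 v l x = g l x"
    by (intro AE_finite_allI wd_AE_eq assms) auto
  then show ?thesis by eventually_elim (simp add: Du_eq_jac jac_def)
qed

lemma norm_jac_diff: "(norm (jac a x - jac b x))\<^sup>2 = (\<Sum>j\<in>UNIV. (norm (a j x - b j x))\<^sup>2)"
proof -
  have "jac a x - jac b x = jac (\<lambda>j x. a j x - b j x) x" by (simp add: jac_def vec_eq_iff)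
  then show ?thesis by (simp add: norm_jac)
qed

lemma finite_emeasure_B1: "emeasure lborel B1 = ennreal (measure lborel B1)"
  using emeasure_lborel_ball_finite[of "0::real^2" 1] by (intro emeasure_eq_ennreal_measure) (simp add: less_top)

lemma nn_integral_scaled_disc:
  assumes "K \<ge> 0" "c > 0"
  shows "(\<integral>\<^sup>+x. ennreal K * indicator B1 (c *\<^sub>R x) \<partial>lebesgue) = ennreal (K * measure lborel B1 / c\<^sup>2)"
proof -
  have "(\<integral>\<^sup>+x. ennreal K * indicator B1 (c *\<^sub>R x) \<partial>lebesgue) = (\<integral>\<^sup>+x. ennreal K * indicator B1 (c *\<^sub>R (x::real^2)) \<partial>lborel)"
    by (rule nn_integral_completion)
  also have "\<dots> = ennreal (1 / c ^ DIM(real^2)) * (\<integral>\<^sup>+x. ennreal K * indicator B1 x \<partial>lborel)"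
    by (rule nn_integral_lborel_scale[OF _ assms(2)]) measurable
  also have "(\<integral>\<^sup>+x. ennreal K * indicator B1 x \<partial>lborel) = ennreal K * ennreal (measure lborel B1)"
    by (subst nn_integral_cmult_indicator) (simp_all add: finite_emeasure_B1)
  also have "ennreal (1 / c ^ DIM(real^2)) * (ennreal K * ennreal (measure lborel B1)) = ennreal (K * measure lborel B1 / c\<^sup>2)"
    using assms by (simp add: ennreal_mult[symmetric])
  finally show ?thesis .
qed

lemma Lp_B1_bounded:
  fixes f :: "real^2 \<Rightarrow> real^3"
  assumes f: "f \<in> borel_measurable borel" and b: "AE x in lebesgue. x \<in> B1 \<longrightarrow> norm (f x) \<le> K"
  shows "Lp p B1 f"
  unfolding Lp_def
proof
  show "f \<in> borel_measurable (lebesgue_on B1)" by (rule measurable_restrict_space1[OF measurable_completion]) (simp add: f)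
  have "(\<integral>\<^sup>+x\<in>B1. ennreal (norm (f x) ^ p) \<partial>lebesgue) \<le> (\<integral>\<^sup>+x. ennreal (K ^ p) * indicator B1 (1 *\<^sub>R x) \<partial>lebesgue)"
    by (rule nn_integral_mono_AE, rule eventually_mono[OF b]) (auto simp: indicator_def intro!: ennreal_leI power_mono)
  also have "\<dots> < \<infinity>"
  proof (cases "K \<ge> 0")
    case True
    then show ?thesis by (subst nn_integral_scaled_disc) auto
  next
    case False
    have "(\<integral>\<^sup>+x. ennreal (K ^ p) * indicator B1 (1 *\<^sub>R x) \<partial>lebesgue) \<le> (\<integral>\<^sup>+x. ennreal (\<bar>K\<bar> ^ p) * indicator B1 (1 *\<^sub>R x) \<partial>lebesgue)"
      by (intro nn_integral_mono mult_right_mono ennreal_leI) (auto simp: power_abs[symmetric])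
    also have "\<dots> < \<infinity>" by (subst nn_integral_scaled_disc) auto
    finally show ?thesis .
  qed
  finally show "(\<integral>\<^sup>+x\<in>B1. ennreal (norm (f x) ^ p) \<partial>lebesgue) < \<infinity>" .
qed

lemma dyadic_annulus_exists:
  fixes x :: "real^2"
  assumes "norm x < 1" "1 < 2 ^ N * norm x" "\<And>i. 2 ^ i * norm x \<noteq> 1"
  shows "\<exists>i<N. 2 ^ i *\<^sub>R x \<in> Ann"
  using assms(2)
proof (induction N)
  case (Suc N)
  show ?case
  proof (cases "1 < 2 ^ N * norm x")
    case True
    then show ?thesis using Suc.IH less_Suc_eq by blast
  next
    case False
    then have "2 ^ N * norm x < 1" using assms(3)[of N] by linarith
    then have "2 ^ N *\<^sub>R x \<in> Ann" using Suc.prems by simp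
    then show ?thesis by blast
  qed
qed (use assms(1) in simp)

lemma AE_dyadic_spheres: "AE x in lebesgue. \<forall>i. 2 ^ i * norm (x::real^2) \<noteq> 1"
  unfolding AE_all_countable
proof
  fix i :: nat
  have "AE x in lebesgue. x \<notin> sphere (0::real^2) (1 / 2 ^ i)"
    using negligible_sphere by (intro AE_not_in) (simp add: negligible_iff_null_sets)
  then show "AE x in lebesgue. 2 ^ i * norm (x::real^2) \<noteq> 1"
    by (rule eventually_mono) (auto simp: field_simps)
qed


text \<open>Where the cutoff varies, \<open>U\<close> has norm at most 1/c, so the factor c^2 from
  second derivatives of the cutoff leaves only order c. The terms of the product rule add up to c B
  + 2 c B + 2 c B plus the norm of \<open>G\<close>, and twice the square of 5 c B gives the
  50.\<close>

lemma cutoff_second_derivative_bound: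
  fixes U :: "'b::euclidean_space"
  assumes bd: "\<bar>p\<bar> \<le> c * B" "\<bar>p'\<bar> \<le> c * B" "\<bar>q\<bar> \<le> c\<^sup>2 * B" and c: "c \<ge> 1" "B \<ge> 1" "0 \<le> s" "s \<le> 1"
    and U: "c * norm U \<le> 1" and g: "norm g \<le> 2" "norm g' \<le> 2"
  shows "(norm ((q *\<^sub>R U + p *\<^sub>R g') + (p' *\<^sub>R g + s *\<^sub>R G)))\<^sup>2 \<le> 50 * B\<^sup>2 * c\<^sup>2 + 2 * (norm G)\<^sup>2"
proof -
  have "\<bar>q\<bar> * norm U \<le> (c\<^sup>2 * B) * norm U" by (intro mult_right_mono bd) simp
  also have "\<dots> = c * B * (c * norm U)" by (simp add: power2_eq_square)
  also have "\<dots> \<le> c * B * 1" using c by (intro mult_left_mono U) simp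
  finally have 1: "\<bar>q\<bar> * norm U \<le> c * B" by simp
  have cB: "0 \<le> c * B" using c by simp
  have 2: "\<bar>p\<bar> * norm g' \<le> (c * B) * 2" by (intro mult_mono bd g cB) simp
  have 3: "\<bar>p'\<bar> * norm g \<le> (c * B) * 2" by (intro mult_mono bd g cB) simp
  have 4: "s * norm G \<le> 1 * norm G" using c by (intro mult_right_mono) auto
  have "norm ((q *\<^sub>R U + p *\<^sub>R g') + (p' *\<^sub>R g + s *\<^sub>R G)) \<le> (\<bar>q\<bar> * norm U + \<bar>p\<bar> * norm g') + (\<bar>p'\<bar> * norm g + s * norm G)"
    using norm_triangle_ineq[of "q *\<^sub>R U + p *\<^sub>R g'" "p' *\<^sub>R g + s *\<^sub>R G"] norm_triangle_ineq[of "q *\<^sub>R U" "p *\<^sub>R g'"]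
      norm_triangle_ineq[of "p' *\<^sub>R g" "s *\<^sub>R G"] c by simp
  then have "norm ((q *\<^sub>R U + p *\<^sub>R g') + (p' *\<^sub>R g + s *\<^sub>R G)) \<le> 5 * (c * B) + norm G" using 1 2 3 4 by linarith
  then have "(norm ((q *\<^sub>R U + p *\<^sub>R g') + (p' *\<^sub>R g + s *\<^sub>R G)))\<^sup>2 \<le> (5 * (c * B) + norm G)\<^sup>2"
    by (intro power_mono) auto
  also have "\<dots> \<le> 2 * (5 * (c * B))\<^sup>2 + 2 * (norm G)\<^sup>2"
    using zero_le_power2[of "5 * (c * B) - norm G"] by (simp add: power2_sum power2_diff)
  finally show ?thesis by (simp add: power_mult_distrib mult_ac)
qed

text \<open>The factor c from differentiating the cutoff is compensated by the norm of
  \<open>U\<close>, so the gradient changes by a bounded amount at every scale.\<close>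

lemma cutoff_gradient_bound:
  fixes U :: "'b::euclidean_space"
  assumes p: "\<bar>p\<bar> \<le> c * B" and c: "B \<ge> 1" "0 \<le> s" "s \<le> 1" and U: "c * norm U \<le> 1" and g: "norm g \<le> 2"
  shows "norm ((p *\<^sub>R U + s *\<^sub>R g) - g) \<le> B + 2"
proof -
  have "\<bar>p\<bar> * norm U \<le> (c * B) * norm U" by (intro mult_right_mono p) simp
  also have "\<dots> = B * (c * norm U)" by simp
  also have "\<dots> \<le> B * 1" using c by (intro mult_left_mono U) simp
  finally have 1: "norm (p *\<^sub>R U) \<le> B" by simp
  have "norm ((s - 1) *\<^sub>R g) \<le> 1 * 2" unfolding norm_scaleR by (intro mult_mono g) (use c in auto)
  then show ?thesis using 1 norm_triangle_ineq[of "p *\<^sub>R U" "(s - 1) *\<^sub>R g"] by (simp add: algebra_simps)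
qed

lemma W2_hessian_finite:
  assumes U: "open U" "U \<in> sets lebesgue" and W: "W2 2 U u"
  shows "(\<integral>\<^sup>+x\<in>U. ennreal (hess_sq U u x) \<partial>lebesgue) < \<infinity>"
proof -
  have "\<forall>l. \<exists>g. weak_partial U u l g \<and> (\<forall>j. \<exists>g2. weak_partial U g j g2 \<and> Lp 2 U g2)"
    using W unfolding W2_def by blast
  then obtain g where g: "\<And>l. weak_partial U u l (g l)" "\<And>l. \<forall>j. \<exists>g2. weak_partial U (g l) j g2 \<and> Lp 2 U g2"
    by metis
  define H where "H l j = (SOME g2. weak_partial U (g l) j g2 \<and> Lp 2 U g2)" for l j
  have H: "weak_partial U (g l) j (H l j)" "Lp 2 U (H l j)" for l j
    using someI_ex[OF g(2)[rule_format, of l j]] unfolding H_def by blast+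
  have [measurable]: "H l j \<in> borel_measurable (lebesgue_on U)" for l j using H(2)[of l j] by (simp add: Lp_def)
  have fin: "(\<integral>\<^sup>+x. ennreal ((norm (H l j x))\<^sup>2) \<partial>lebesgue_on U) < \<infinity>" for l j
    using H(2)[of l j] U(2) by (simp add: Lp_def nn_integral_restrict_space)
  have "(\<integral>\<^sup>+x\<in>U. ennreal (hess_sq U u x) \<partial>lebesgue) = (\<integral>\<^sup>+x\<in>U. ennreal (\<Sum>l\<in>UNIV. \<Sum>j\<in>UNIV. (norm (H l j x))\<^sup>2) \<partial>lebesgue)"
    by (rule nn_integral_cong_AE, rule eventually_mono[OF hess_sq_AE_eq[OF U(1) g(1) H(1)]]) (auto simp: indicator_def)
  also have "\<dots> = (\<integral>\<^sup>+x. (\<Sum>l\<in>UNIV. \<Sum>j\<in>UNIV. ennreal ((norm (H l j x))\<^sup>2)) \<partial>lebesgue_on U)"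
    using U(2) by (simp add: nn_integral_restrict_space sum_ennreal sum_nonneg)
  also have "\<dots> = (\<Sum>l\<in>UNIV. \<Sum>j\<in>UNIV. \<integral>\<^sup>+x. ennreal ((norm (H l j x))\<^sup>2) \<partial>lebesgue_on U)"
    by (simp add: nn_integral_sum del: sum_ennreal)
  also have "\<dots> < \<infinity>" using fin by (simp add: sum_2)
  finally show ?thesis .
qed

text \<open>The map is \<open>u\<close> multiplied by the cutoff at scale 2^(-N). \<open>C\<close>
  does not depend on \<open>N\<close>: gradient errors are bounded and live on a disc of area
  proportional to 4^(-N), while the Hessian error of order c^2 = 4^N on that disc integrates to a
  constant.\<close>

lemma recovery_map:
  assumes u: "u \<in> Xsp" and W: "W2 2 Ann u" and iso: "one_hom_isometry u"
  obtains C where "C \<ge> 0"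
    "\<And>N. \<exists>v. v \<in> Xsp \<and> W2 2 B1 v \<and>
      (\<integral>\<^sup>+x\<in>B1. ennreal (hess_sq B1 v x) \<partial>lebesgue) \<le> of_nat (N + 4) * (\<integral>\<^sup>+x\<in>Ann. ennreal (hess_sq Ann u x) \<partial>lebesgue) + ennreal C \<and>
      (\<integral>\<^sup>+x\<in>B1. ennreal ((infdist (Du B1 v x) O23)\<^sup>2) \<partial>lebesgue) \<le> ennreal (C / 4 ^ N) \<and>
      (\<integral>\<^sup>+x\<in>B1. ennreal (norm (v x - u x) ^ 4) + ennreal (norm (Du B1 v x - Du B1 u x) ^ 4) \<partial>lebesgue) \<le> ennreal (C / 4 ^ N)"
proof -
  obtain \<gamma> where \<gamma>: "\<And>x. x \<in> B1 \<Longrightarrow> x \<noteq> 0 \<Longrightarrow> u x = norm x *\<^sub>R \<gamma> (x /\<^sub>R norm x)"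
    using iso unfolding one_hom_isometry_def by blast
  have nu: "norm (u x) = norm x" if "x \<in> B1" for x
    by (rule one_homogeneous_facts(2)[OF u _ that]) (rule \<gamma>)
  define U where "U = clip u"
  have Uu: "U x = u x" if "x \<in> cball 0 1" for x using that by (simp add: U_def clip_eq)
  have U[measurable]: "U \<in> borel_measurable borel" unfolding U_def by (rule clip_measurable[OF u])
  have nU: "norm (U x) = norm x" if "x \<in> B1" for x using that nu[OF that] Uu[of x] by simp
  have g0: thesis if main: "\<And>g G. (\<And>l. g l \<in> borel_measurable borel) \<Longrightarrow> (\<And>l j. G l j \<in> borel_measurable borel) \<Longrightarrow>
    (\<And>l. weak_partial B1 u l (g l)) \<Longrightarrow> (\<And>l j. weak_partial (B1 - {0}) (g l) j (G l j)) \<Longrightarrow>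
    (AE x in lebesgue. x \<in> B1 \<longrightarrow> jac g x \<in> O23) \<Longrightarrow>
    (\<And>i. (\<integral>\<^sup>+x. ennreal (\<Sum>l\<in>UNIV. \<Sum>j\<in>UNIV. (norm (G l j x))\<^sup>2) * indicator Ann (2 ^ i *\<^sub>R x) \<partial>lborel)
      = (\<integral>\<^sup>+x\<in>Ann. ennreal (hess_sq Ann u x) \<partial>lebesgue)) \<Longrightarrow> thesis"
    by (rule homogeneous_derivatives[OF u W iso]) (rule main)
  show ?thesis
  proof (rule g0)
    fix g :: "2 \<Rightarrow> real^2 \<Rightarrow> real^3" and G :: "2 \<Rightarrow> 2 \<Rightarrow> real^2 \<Rightarrow> real^3"
    assume g[measurable]: "\<And>l. g l \<in> borel_measurable borel" and G[measurable]: "\<And>l j. G l j \<in> borel_measurable borel"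
      and ug: "\<And>l. weak_partial B1 u l (g l)" and gG: "\<And>l j. weak_partial (B1 - {0}) (g l) j (G l j)"
      and O: "AE x in lebesgue. x \<in> B1 \<longrightarrow> jac g x \<in> O23"
      and I: "\<And>i. (\<integral>\<^sup>+x. ennreal (\<Sum>l\<in>UNIV. \<Sum>j\<in>UNIV. (norm (G l j x))\<^sup>2) * indicator Ann (2 ^ i *\<^sub>R x) \<partial>lborel)
      = (\<integral>\<^sup>+x\<in>Ann. ennreal (hess_sq Ann u x) \<partial>lebesgue)"
    obtain B where B: "B \<ge> 1" "\<And>l x. \<bar>pd l cutoff x\<bar> \<le> B" "\<And>l j x. \<bar>pd j (pd l cutoff) x\<bar> \<le> B"
      using pd_cutoff_bounded by metis
    \<comment> \<open>Bounds the squared change of the gradient: two columns, each changed by at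
      most \<open>B + 2\<close>. In \<open>C\<close> below, 200 is four second derivatives times 50,
      the second summand serves the distance to isometries and the third the fourth powers of the
      error.\<close>
    define K where "K = 2 * (B + 2)\<^sup>2"
    define m where "m = measure lborel B1"
    define C where "C = 200 * B\<^sup>2 * m + K * m + (1 + K\<^sup>2) * m"
    define SG where "SG x = (\<Sum>l\<in>UNIV. \<Sum>j\<in>UNIV. (norm (G l j x))\<^sup>2)" for x
    have SG[measurable]: "SG \<in> borel_measurable borel" unfolding SG_def by measurable
    have SG0: "SG x \<ge> 0" for x by (auto simp: SG_def intro!: sum_nonneg)
    have K0: "K \<ge> 0" "m \<ge> 0" by (simp_all add: K_def m_def)
    have C0: "200 * B\<^sup>2 * m \<le> C" "K * m \<le> C" "(1 + K\<^sup>2) * m \<le> C" "C \<ge> 0" using K0 by (simp_all add: C_def)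
    have gb: "norm (g l x) \<le> 2" if "jac g x \<in> O23" for x l
    proof -
      have "(norm (g l x))\<^sup>2 \<le> (norm (jac g x))\<^sup>2" unfolding norm_jac by (intro member_le_sum) auto
      also have "\<dots> \<le> 2\<^sup>2" using norm_O23[OF that] by simp
      finally show ?thesis by (rule power2_le_imp_le) simp
    qed
    have Ug: "weak_partial (B1 - {0}) U l (g l)" for l
      by (rule weak_partial_mono[OF weak_partial_cong_AE[OF ug]]) (auto simp: Uu)
    show thesis
    proof (rule that[OF C0(4)])
      fix N :: nat
      define c where "c = (2::real) ^ N"
      have c1: "c \<ge> 1" and c2: "c\<^sup>2 = 4 ^ N" by (simp_all add: c_def power_mult[symmetric] power_mult[of 2 2] mult.commute[of N 2])
      then have c0: "c > 0" by linarith
      define s where "s x = cutoff (c *\<^sub>R x)" for x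
      have ss: "smooth_fn s" unfolding s_def by (rule smooth_fn_scale[OF smooth_cutoff])
      have ps: "pd l s = (\<lambda>x. c * pd l cutoff (c *\<^sub>R x))" for l
        unfolding s_def by (intro ext pd_scale smooth_fn_differentiable smooth_cutoff)
      have pps: "pd j (pd l s) x = c\<^sup>2 * pd j (pd l cutoff) (c *\<^sub>R x)" for j l x
      proof -
        have "pd j (\<lambda>x. c * pd l cutoff (c *\<^sub>R x)) x
          = c * pd j (\<lambda>x. pd l cutoff (c *\<^sub>R x)) x + pd j (\<lambda>_. c) x * pd l cutoff (c *\<^sub>R x)"
          by (intro pd_mult smooth_fn_differentiable smooth_fn_const smooth_fn_scale smooth_fn_pd smooth_cutoff)
        also have "pd j (\<lambda>x. pd l cutoff (c *\<^sub>R x)) x = c * pd j (pd l cutoff) (c *\<^sub>R x)"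
          by (intro pd_scale smooth_fn_differentiable smooth_fn_pd smooth_cutoff)
        finally show ?thesis unfolding ps by (simp add: pd_const power2_eq_square)
      qed
      have ps': "pd l s x = c * pd l cutoff (c *\<^sub>R x)" for l x by (simp add: ps)
      have s01: "0 \<le> s x" "s x \<le> 1" for x by (simp_all add: s_def cutoff_bounds)
      have psb: "\<bar>pd l s x\<bar> \<le> c * B" "\<bar>pd j (pd l s) x\<bar> \<le> c\<^sup>2 * B" for l j x
        using B c0 by (simp_all add: pps ps' abs_mult)
      have inner: "s x = 0" "pd l s x = 0" "pd j (pd l s) x = 0" if "c * norm x < 1/4" for x l j
        using that c0 cutoff_eq_0[of "c *\<^sub>R x"] pd_cutoff_eq_0[of "c *\<^sub>R x"] by (simp_all add: s_def pps ps')
      have outer: "s x = 1" "pd l s x = 0" "pd j (pd l s) x = 0" if "1/2 < c * norm x" for x l j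
        using that c0 cutoff_eq_1[of "c *\<^sub>R x"] pd_cutoff_eq_0[of "c *\<^sub>R x"] by (simp_all add: s_def pps ps')
      have sm[measurable]: "s \<in> borel_measurable borel" "pd l s \<in> borel_measurable borel" "pd j (pd l s) \<in> borel_measurable borel" for l j
        by (intro smooth_fn_borel smooth_fn_pd ss)+
      define v where "v x = s x *\<^sub>R U x" for x
      define gv where "gv l x = pd l s x *\<^sub>R U x + s x *\<^sub>R g l x" for l x
      define H where "H l j x = (pd j (pd l s) x *\<^sub>R U x + pd l s x *\<^sub>R g j x) + (pd j s x *\<^sub>R g l x + s x *\<^sub>R G l j x)" for l j x
      have vm: "v \<in> borel_measurable borel" and gm: "gv l \<in> borel_measurable borel" and Hm: "H l j \<in> borel_measurable borel" for l j
        unfolding v_def gv_def H_def by measurable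
      have small: "c * norm x < 1/4" if "norm x < 1 / (4 * c)" for x :: "real^2" using that c0 by (simp add: field_simps)
      have d0: "1 / (4 * c) > 0" using c0 by simp
      \<comment> \<open>The product rule holds on the punctured disc; the cutoff vanishes for norm x
        < 1/(4 c), so \<open>v\<close> and \<open>gv\<close> are 0 near the origin and the puncture
        can be filled.\<close>
      have vg: "weak_partial B1 v l (gv l)" for l
        by (rule weak_partial_fill_puncture[OF weak_partial_mult_smooth[OF Ug ss, folded v_def gv_def] d0])
           (simp_all add: v_def gv_def inner[OF small])
      have "weak_partial (B1 - {0}) (gv l) j (H l j)" for l j
        unfolding gv_def H_def
        by (intro weak_partial_add weak_partial_mult_smooth[OF Ug smooth_fn_pd[OF ss]] weak_partial_mult_smooth[OF gG ss])
      then have gH: "weak_partial B1 (gv l) j (H l j)" for l j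
        by (rule weak_partial_fill_puncture[OF _ d0]) (simp_all add: gv_def H_def inner[OF small])
      define SH where "SH x = (\<Sum>l\<in>UNIV. \<Sum>j\<in>UNIV. (norm (H l j x))\<^sup>2)" for x
      have outer_eq: "v x = U x" "gv l x = g l x" "SH x = SG x" if "1/2 < c * norm x" for x l
        unfolding v_def gv_def SH_def SG_def H_def using outer[OF that] by simp_all
      have cU: "c * norm (U x) \<le> 1" if "x \<in> B1" "c * norm x \<le> 1" for x using that nU by simp
      have gdiff: "norm (gv l x - g l x) \<le> (B + 2) * indicator B1 (c *\<^sub>R x)" if "x \<in> B1" "jac g x \<in> O23" for x l
      proof (cases "1/2 < c * norm x")
        case False
        then have "c *\<^sub>R x \<in> B1" using c0 by simp
        then show ?thesis unfolding gv_def
          using cutoff_gradient_bound[OF psb(1)[of l x] B(1) s01 cU[OF that(1)] gb[OF that(2)]] False by simp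
      qed (use B(1) outer_eq in \<open>simp add: indicator_def\<close>)
      have jdiff: "(norm (jac gv x - jac g x))\<^sup>2 \<le> K * indicator B1 (c *\<^sub>R x)" if "x \<in> B1" "jac g x \<in> O23" for x
      proof -
        have "(\<Sum>j\<in>UNIV. (norm (gv j x - g j x))\<^sup>2) \<le> of_nat (card (UNIV::2 set)) * ((B + 2) * indicator B1 (c *\<^sub>R x))\<^sup>2"
          by (intro sum_bounded_above power_mono gdiff that) simp
        then show ?thesis unfolding norm_jac_diff by (cases "\<bar>c\<bar> * norm x < 1") (simp_all add: K_def)
      qed
      have Du: "AE x in lebesgue. x \<in> B1 \<longrightarrow> Du B1 v x = jac gv x" "AE x in lebesgue. x \<in> B1 \<longrightarrow> Du B1 u x = jac g x"
        by (rule Du_AE_eq_jac, rule vg) (rule Du_AE_eq_jac, rule ug)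
      have gvb: "AE x in lebesgue. x \<in> B1 \<longrightarrow> norm (gv l x) \<le> B + 4" for l
        using O
      proof eventually_elim
        fix x assume a: "x \<in> B1 \<longrightarrow> jac g x \<in> O23"
        show "x \<in> B1 \<longrightarrow> norm (gv l x) \<le> B + 4"
        proof
          assume x: "x \<in> B1"
          have "norm (gv l x - g l x) \<le> B + 2" using gdiff[of x l] a x B(1) by (cases "\<bar>c\<bar> * norm x < 1") auto
          then show "norm (gv l x) \<le> B + 4" using gb[of x l] a x norm_triangle_sub[of "gv l x" "g l x"] by simp
        qed
      qed
      have vb: "AE x in lebesgue. x \<in> B1 \<longrightarrow> norm (v x) \<le> 1"
      proof (intro AE_I2 impI)
        fix x assume x: "x \<in> B1"
        have "s x * norm (U x) \<le> 1 * 1" using s01[of x] nU[OF x] x by (intro mult_mono) auto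
        then show "norm (v x) \<le> 1" using s01[of x] by (simp add: v_def)
      qed
      have Lpv: "Lp p B1 v" "Lp p B1 (gv l)" for p l
        by (rule Lp_B1_bounded[OF vm vb]) (rule Lp_B1_bounded[OF gm gvb])
      have vX: "v \<in> Xsp"
        unfolding Xsp_def
      proof (intro CollectI conjI allI impI)
        have "continuous_on (cball 0 1) (\<lambda>x. s x *\<^sub>R u x)"
          using u by (intro continuous_on_scaleR smooth_fn_continuous ss) (simp add: Xsp_def)
        then show "continuous_on (cball 0 1) v"
          by (rule continuous_on_eq) (simp add: v_def Uu)
        show "W1 4 B1 v" unfolding W1_def using Lpv vg by blast
        show "v 0 = 0" using inner(1)[of 0] by (simp add: v_def)
        fix x :: "real^2" assume x: "norm x = 1"
        then have "v x = u x" using outer_eq(1)[of x] c1 Uu[of x] by simp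
        then show "v x \<in> sphere 0 1" using u x by (simp add: Xsp_def)
      qed
      have hess: "AE x in lebesgue. x \<in> B1 \<longrightarrow> hess_sq B1 v x = SH x"
        unfolding SH_def by (rule hess_sq_AE_eq[OF _ vg gH]) simp
      \<comment> \<open>For c norm x > 1 nothing has changed and \<open>x\<close> lies in one of the
        first \<open>N\<close> annuli. Between 1/4 and 1 the cutoff bound applies and
        \<open>x\<close> lies in annulus \<open>N\<close> or \<open>Suc N\<close>; below 1/4
        everything vanishes. The separating circles are null.\<close>
      have pt: "AE x in lebesgue. ennreal (SH x) * indicator B1 x \<le>
        (\<Sum>i<N. ennreal (SG x) * indicator Ann (2 ^ i *\<^sub>R x))
          + (ennreal (200 * B\<^sup>2 * c\<^sup>2) * indicator B1 (c *\<^sub>R x)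
          + (2 * (ennreal (SG x) * indicator Ann (2 ^ N *\<^sub>R x)) + 2 * (ennreal (SG x) * indicator Ann (2 ^ Suc N *\<^sub>R x))))"
        (is "AE x in _. _ \<le> ?S x + (?P x + (?Q x + ?R x))")
        using O AE_dyadic_spheres
      proof eventually_elim
        fix x :: "real^2" assume O: "x \<in> B1 \<longrightarrow> jac g x \<in> O23" and sph: "\<forall>i. 2 ^ i * norm x \<noteq> 1"
        show "ennreal (SH x) * indicator B1 x \<le> ?S x + (?P x + (?Q x + ?R x))"
        proof (cases "x \<in> B1")
          case x: True
          show ?thesis
          proof (cases "1 < c * norm x")
            case True
            have "norm x < 1" using x by simp
            then obtain i where i: "i < N" "2 ^ i *\<^sub>R x \<in> Ann"
              using dyadic_annulus_exists[of x N] True sph unfolding c_def by blast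
            have "SH x = SG x" using outer_eq(3)[of x] True by simp
            then have "ennreal (SH x) * indicator B1 x = ennreal (SG x) * indicator Ann (2 ^ i *\<^sub>R x)"
              using x i(2) by (simp only: indicator_simps)
            also have "\<dots> \<le> ?S x" using i(1) by (intro member_le_sum) auto
            also have "\<dots> \<le> ?S x + (?P x + (?Q x + ?R x))" by (rule add_increasing2) auto
            finally show ?thesis .
          next
            case F1: False
            then have cx: "c * norm x < 1" using sph unfolding c_def by (meson linorder_neqE)
            have P: "?P x = ennreal (200 * B\<^sup>2 * c\<^sup>2)" using cx c0 by simp
            show ?thesis
            proof (cases "c * norm x < 1/4")
              case True
              then have "SH x = 0" by (simp add: SH_def H_def inner[OF True])
              then show ?thesis by simp
            next
              case F2: False
              have n1: "c * norm x \<noteq> 1/4" "c * norm x \<noteq> 1/2"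
                using sph[rule_format, of "Suc (Suc N)"] sph[rule_format, of "Suc N"] unfolding c_def by simp_all
              have "SH x \<le> 200 * B\<^sup>2 * c\<^sup>2 + 2 * SG x"
              proof -
                have "(norm (H l j x))\<^sup>2 \<le> 50 * B\<^sup>2 * c\<^sup>2 + 2 * (norm (G l j x))\<^sup>2" for l j
                  unfolding H_def using cx O x
                  by (intro cutoff_second_derivative_bound psb c1 B s01 cU gb) auto
                then have "SH x \<le> (\<Sum>l\<in>UNIV. \<Sum>j\<in>UNIV. 50 * B\<^sup>2 * c\<^sup>2 + 2 * (norm (G l j x))\<^sup>2)"
                  unfolding SH_def by (intro sum_mono)
                also have "\<dots> = 200 * B\<^sup>2 * c\<^sup>2 + 2 * SG x"
                  by (simp add: SG_def sum.distrib sum_distrib_left)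
                finally show ?thesis .
              qed
              then have "ennreal (SH x) \<le> ennreal (200 * B\<^sup>2 * c\<^sup>2) + 2 * ennreal (SG x)"
                using SG0[of x] by (simp add: ennreal_plus[symmetric] ennreal_mult'[symmetric] ennreal_leI del: ennreal_plus
                    flip: ennreal_numeral)
              also have "2 * ennreal (SG x) \<le> ?Q x + ?R x"
              proof (cases "1/2 < c * norm x")
                case True
                then have "2 ^ N *\<^sub>R x \<in> Ann" using cx by (simp add: c_def)
                then have "?Q x = 2 * ennreal (SG x)" by (simp only: indicator_simps mult_1_right)
                then show ?thesis by simp
              next
                case False
                then have "2 ^ Suc N *\<^sub>R x \<in> Ann" using F2 n1 by (simp add: c_def)
                then have "?R x = 2 * ennreal (SG x)" by (simp only: indicator_simps mult_1_right)
                then show ?thesis by simp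
              qed
              finally have "ennreal (SH x) \<le> ?P x + (?Q x + ?R x)" unfolding P by (simp add: add_left_mono)
              then have "ennreal (SH x) * indicator B1 x \<le> ?P x + (?Q x + ?R x)" using x by simp
              then show ?thesis by (rule add_increasing[rotated]) simp
            qed
          qed
        qed simp
      qed
      have hb: "(\<integral>\<^sup>+x\<in>B1. ennreal (SH x) \<partial>lebesgue) \<le> of_nat (N + 4) * (\<integral>\<^sup>+x\<in>Ann. ennreal (hess_sq Ann u x) \<partial>lebesgue) + ennreal C"
        (is "_ \<le> of_nat (N + 4) * ?I + _")
      proof -
        have sc: "(\<lambda>x::real^2. a *\<^sub>R x) \<in> borel_measurable borel" for a
          by (intro borel_measurable_continuous_onI continuous_intros)
        have gen: "(\<integral>\<^sup>+x. (\<Sum>i<N. f i x) + (p x + (2 * q x + 2 * r x)) \<partial>lborel)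
          = (\<Sum>i<N. \<integral>\<^sup>+x. f i x \<partial>lborel) + ((\<integral>\<^sup>+x. p x \<partial>lborel) + (2 * (\<integral>\<^sup>+x. q x \<partial>lborel) + 2 * (\<integral>\<^sup>+x. r x \<partial>lborel)))"
          if "\<And>i. f i \<in> borel_measurable lborel" "p \<in> borel_measurable lborel" "q \<in> borel_measurable lborel" "r \<in> borel_measurable lborel"
          for f :: "nat \<Rightarrow> real^2 \<Rightarrow> ennreal" and p q r
          using that by (simp add: nn_integral_add nn_integral_sum nn_integral_cmult)
        have mA: "(\<lambda>x. indicator Ann (a *\<^sub>R x) :: ennreal) \<in> borel_measurable borel" for a
          by (rule measurable_compose[OF sc borel_measurable_indicator[OF Ann_borel]])
        have mB: "(\<lambda>x. indicator B1 (a *\<^sub>R x) :: ennreal) \<in> borel_measurable borel" for a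
          by (rule measurable_compose[OF sc borel_measurable_indicator[OF B1_borel]])
        have mf: "(\<lambda>x. ennreal (SG x) * indicator Ann (a *\<^sub>R x)) \<in> borel_measurable lborel" for a
          unfolding measurable_lborel2 by (intro borel_measurable_times_ennreal measurable_compose[OF SG measurable_ennreal] mA)
        have mp: "(\<lambda>x. ennreal a * indicator B1 (c *\<^sub>R x)) \<in> borel_measurable lborel" for a
          unfolding measurable_lborel2 by (intro borel_measurable_times_ennreal borel_measurable_const mB)
        have "(\<integral>\<^sup>+x\<in>B1. ennreal (SH x) \<partial>lebesgue) \<le>
          (\<integral>\<^sup>+x. (\<Sum>i<N. ennreal (SG x) * indicator Ann (2 ^ i *\<^sub>R x))
          + (ennreal (200 * B\<^sup>2 * c\<^sup>2) * indicator B1 (c *\<^sub>R x)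
          + (2 * (ennreal (SG x) * indicator Ann (2 ^ N *\<^sub>R x)) + 2 * (ennreal (SG x) * indicator Ann (2 ^ Suc N *\<^sub>R x)))) \<partial>lebesgue)"
          by (rule nn_integral_mono_AE[OF pt])
        also have "\<dots> = (\<integral>\<^sup>+x. (\<Sum>i<N. ennreal (SG x) * indicator Ann (2 ^ i *\<^sub>R x))
          + (ennreal (200 * B\<^sup>2 * c\<^sup>2) * indicator B1 (c *\<^sub>R x)
          + (2 * (ennreal (SG x) * indicator Ann (2 ^ N *\<^sub>R x)) + 2 * (ennreal (SG x) * indicator Ann (2 ^ Suc N *\<^sub>R x)))) \<partial>lborel)"
          by (rule nn_integral_completion)
        also have "\<dots> = (\<Sum>i<N. \<integral>\<^sup>+x. ennreal (SG x) * indicator Ann (2 ^ i *\<^sub>R x) \<partial>lborel)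
          + ((\<integral>\<^sup>+x. ennreal (200 * B\<^sup>2 * c\<^sup>2) * indicator B1 (c *\<^sub>R x) \<partial>lborel)
          + (2 * (\<integral>\<^sup>+x. ennreal (SG x) * indicator Ann (2 ^ N *\<^sub>R x) \<partial>lborel) + 2 * (\<integral>\<^sup>+x. ennreal (SG x) * indicator Ann (2 ^ Suc N *\<^sub>R x) \<partial>lborel)))"
          by (rule gen) (intro mf mp)+
        also have "(\<integral>\<^sup>+x. ennreal (200 * B\<^sup>2 * c\<^sup>2) * indicator B1 (c *\<^sub>R x) \<partial>lborel) = ennreal (200 * B\<^sup>2 * c\<^sup>2 * measure lborel B1 / c\<^sup>2)"
          by (subst nn_integral_scaled_disc[symmetric]) (simp_all add: c0 nn_integral_completion)
        also have "200 * B\<^sup>2 * c\<^sup>2 * measure lborel B1 / c\<^sup>2 = 200 * B\<^sup>2 * m" using c0 by (simp add: m_def)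
        also have "(\<Sum>i<N. \<integral>\<^sup>+x. ennreal (SG x) * indicator Ann (2 ^ i *\<^sub>R x) \<partial>lborel)
          + (ennreal (200 * B\<^sup>2 * m)
          + (2 * (\<integral>\<^sup>+x. ennreal (SG x) * indicator Ann (2 ^ N *\<^sub>R x) \<partial>lborel) + 2 * (\<integral>\<^sup>+x. ennreal (SG x) * indicator Ann (2 ^ Suc N *\<^sub>R x) \<partial>lborel)))
          = of_nat N * ?I + (ennreal (200 * B\<^sup>2 * m) + (2 * ?I + 2 * ?I))"
          unfolding SG_def I by simp
        \<comment> \<open>The two annuli around the transition each enter with factor 2, which makes
          the 4.\<close>
        also have "\<dots> = of_nat (N + 4) * ?I + ennreal (200 * B\<^sup>2 * m)"
          by (simp add: algebra_simps flip: distrib_right)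
        also have "\<dots> \<le> of_nat (N + 4) * ?I + ennreal C" by (intro add_left_mono ennreal_leI C0)
        finally show ?thesis .
      qed
      have Ifin: "(\<integral>\<^sup>+x\<in>Ann. ennreal (hess_sq Ann u x) \<partial>lebesgue) < \<infinity>"
        by (rule W2_hessian_finite[OF _ _ W]) (auto intro: open_Diff)
      have LpH: "Lp 2 B1 (H l j)" for l j
        unfolding Lp_def
      proof
        show "H l j \<in> borel_measurable (lebesgue_on B1)" by (rule measurable_restrict_space1[OF measurable_completion]) (simp add: Hm)
        have "(norm (H l j x))\<^sup>2 \<le> SH x" for x
        proof -
          have "(norm (H l j x))\<^sup>2 \<le> (\<Sum>j\<in>UNIV. (norm (H l j x))\<^sup>2)" by (intro member_le_sum) auto
          also have "\<dots> \<le> SH x" unfolding SH_def by (intro member_le_sum[where f = "\<lambda>l. \<Sum>j\<in>UNIV. (norm (H l j x))\<^sup>2"]) (auto intro: sum_nonneg)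
          finally show ?thesis .
        qed
        then have "(\<integral>\<^sup>+x\<in>B1. ennreal ((norm (H l j x))\<^sup>2) \<partial>lebesgue) \<le> (\<integral>\<^sup>+x\<in>B1. ennreal (SH x) \<partial>lebesgue)"
          by (intro nn_integral_mono mult_right_mono ennreal_leI) auto
        also note hb
        also have "of_nat (N + 4) * (\<integral>\<^sup>+x\<in>Ann. ennreal (hess_sq Ann u x) \<partial>lebesgue) + ennreal C < \<infinity>"
          using Ifin by (simp add: ennreal_mult_less_top of_nat_less_top del: of_nat_add)
        finally show "(\<integral>\<^sup>+x\<in>B1. ennreal ((norm (H l j x))\<^sup>2) \<partial>lebesgue) < \<infinity>" .
      qed
      have vW: "W2 2 B1 v" unfolding W2_def using Lpv LpH vg gH by blast
      have hv: "(\<integral>\<^sup>+x\<in>B1. ennreal (hess_sq B1 v x) \<partial>lebesgue) = (\<integral>\<^sup>+x\<in>B1. ennreal (SH x) \<partial>lebesgue)"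
        by (rule nn_integral_cong_AE, rule eventually_mono[OF hess]) (auto simp: indicator_def)
      have dist: "(\<integral>\<^sup>+x\<in>B1. ennreal ((infdist (Du B1 v x) O23)\<^sup>2) \<partial>lebesgue) \<le> ennreal (C / 4 ^ N)"
      proof -
        have "(\<integral>\<^sup>+x\<in>B1. ennreal ((infdist (Du B1 v x) O23)\<^sup>2) \<partial>lebesgue) \<le> (\<integral>\<^sup>+x. ennreal K * indicator B1 (c *\<^sub>R x) \<partial>lebesgue)"
          using Du(1) O
        proof (intro nn_integral_mono_AE, eventually_elim)
          fix x assume a: "x \<in> B1 \<longrightarrow> Du B1 v x = jac gv x" "x \<in> B1 \<longrightarrow> jac g x \<in> O23"
          show "ennreal ((infdist (Du B1 v x) O23)\<^sup>2) * indicator B1 x \<le> ennreal K * indicator B1 (c *\<^sub>R x)"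
          proof (cases "x \<in> B1")
            case True
            have "infdist (jac gv x) O23 \<le> norm (jac gv x - jac g x)" using infdist_le[of "jac g x" O23 "jac gv x"] a True by (simp add: dist_norm)
            then have "(infdist (jac gv x) O23)\<^sup>2 \<le> (norm (jac gv x - jac g x))\<^sup>2" by (intro power_mono infdist_nonneg)
            also have "\<dots> \<le> K * indicator B1 (c *\<^sub>R x)" using jdiff a True by blast
            finally have "ennreal ((infdist (Du B1 v x) O23)\<^sup>2) \<le> ennreal (K * indicator B1 (c *\<^sub>R x))" using a True by (simp add: ennreal_leI)
            then show ?thesis using True by (auto simp: indicator_def split: if_splits)
          qed simp
        qed
        also have "\<dots> = ennreal (K * m / c\<^sup>2)" unfolding m_def by (rule nn_integral_scaled_disc[OF K0(1) c0])
        also have "\<dots> \<le> ennreal (C / 4 ^ N)" unfolding c2 using C0 by (intro ennreal_leI divide_right_mono) auto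
        finally show ?thesis .
      qed
      have conv: "(\<integral>\<^sup>+x\<in>B1. ennreal (norm (v x - u x) ^ 4) + ennreal (norm (Du B1 v x - Du B1 u x) ^ 4) \<partial>lebesgue) \<le> ennreal (C / 4 ^ N)"
      proof -
        have "(\<integral>\<^sup>+x\<in>B1. ennreal (norm (v x - u x) ^ 4) + ennreal (norm (Du B1 v x - Du B1 u x) ^ 4) \<partial>lebesgue)
          \<le> (\<integral>\<^sup>+x. ennreal (1 + K\<^sup>2) * indicator B1 (c *\<^sub>R x) \<partial>lebesgue)"
          using Du O
        proof (intro nn_integral_mono_AE, eventually_elim)
          fix x assume a: "x \<in> B1 \<longrightarrow> Du B1 v x = jac gv x" "x \<in> B1 \<longrightarrow> Du B1 u x = jac g x" "x \<in> B1 \<longrightarrow> jac g x \<in> O23"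
          show "(ennreal (norm (v x - u x) ^ 4) + ennreal (norm (Du B1 v x - Du B1 u x) ^ 4)) * indicator B1 x
            \<le> ennreal (1 + K\<^sup>2) * indicator B1 (c *\<^sub>R x)"
          proof (cases "x \<in> B1")
            case True
            have uU: "u x = U x" using Uu[of x] True by simp
            have "norm (v x - u x) \<le> indicator B1 (c *\<^sub>R x)"
            proof (cases "1/2 < c * norm x")
              case False
              then have "c *\<^sub>R x \<in> B1" using c0 by simp
              moreover have "norm (v x - u x) \<le> 1 * 1"
              proof -
                have "v x - u x = (s x - 1) *\<^sub>R U x" unfolding uU v_def by (simp add: algebra_simps)
                then show ?thesis unfolding norm_scaleR using s01[of x] nU[OF True] True
                  by (simp only: norm_scaleR) (intro mult_mono, auto)
              qed
              ultimately show ?thesis by simp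
            qed (use outer_eq(1) uU in simp)
            then have 1: "norm (v x - u x) ^ 4 \<le> indicator B1 (c *\<^sub>R x) ^ 4" by (intro power_mono) auto
            have "((norm (jac gv x - jac g x))\<^sup>2)\<^sup>2 \<le> (K * indicator B1 (c *\<^sub>R x))\<^sup>2" using jdiff a True by (intro power_mono) auto
            then have 2: "norm (Du B1 v x - Du B1 u x) ^ 4 \<le> (K * indicator B1 (c *\<^sub>R x))\<^sup>2" using a True by (simp add: power_mult[symmetric])
            have "ennreal (norm (v x - u x) ^ 4) + ennreal (norm (Du B1 v x - Du B1 u x) ^ 4)
              \<le> ennreal (indicator B1 (c *\<^sub>R x) ^ 4 + (K * indicator B1 (c *\<^sub>R x))\<^sup>2)"
              using add_mono[OF 1 2] by (subst ennreal_plus[symmetric]) (auto intro!: ennreal_leI simp del: ennreal_plus)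
            also have "\<dots> = ennreal (1 + K\<^sup>2) * indicator B1 (c *\<^sub>R x)" by (cases "\<bar>c\<bar> * norm x < 1") simp_all
            finally show ?thesis using True by simp
          qed simp
        qed
        also have "\<dots> = ennreal ((1 + K\<^sup>2) * m / c\<^sup>2)" unfolding m_def by (rule nn_integral_scaled_disc[OF _ c0]) simp
        also have "\<dots> \<le> ennreal (C / 4 ^ N)" unfolding c2 using C0 by (intro ennreal_leI divide_right_mono) auto
        finally show ?thesis .
      qed
      show "\<exists>v. v \<in> Xsp \<and> W2 2 B1 v \<and>
      (\<integral>\<^sup>+x\<in>B1. ennreal (hess_sq B1 v x) \<partial>lebesgue) \<le> of_nat (N + 4) * (\<integral>\<^sup>+x\<in>Ann. ennreal (hess_sq Ann u x) \<partial>lebesgue) + ennreal C \<and>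
      (\<integral>\<^sup>+x\<in>B1. ennreal ((infdist (Du B1 v x) O23)\<^sup>2) \<partial>lebesgue) \<le> ennreal (C / 4 ^ N) \<and>
      (\<integral>\<^sup>+x\<in>B1. ennreal (norm (v x - u x) ^ 4) + ennreal (norm (Du B1 v x - Du B1 u x) ^ 4) \<partial>lebesgue) \<le> ennreal (C / 4 ^ N)"
        by (intro exI[of _ v] conjI vX vW hb[folded hv] dist conv)
    qed
  qed
qed

section \<open>Choice of the cutoff scale and the upper bound\<close>

lemma dyadic_scale_exists:
  fixes h :: real
  assumes h: "0 < h" "h < 1"
  shows "\<exists>N. 1 / 4 ^ N \<le> 4 * h\<^sup>2 \<and> real N * ln 2 \<le> \<bar>ln h\<bar>"
proof -
  \<comment> \<open>\<open>N\<close> will be the predecessor of the least exponent whose power of 2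
    exceeds 1/h. Then 2^N \<le> 1/h bounds the number of annuli, and 1/h < 2^(N+1) bounds the radius
    of the cutoff disc.\<close>
  obtain n where "1 / h < 2 ^ n" using real_arch_pow[of 2 "1 / h"] by auto
  then obtain k where k: "\<forall>i<k. \<not> 1 / h < 2 ^ i" "1 / h < 2 ^ k"
    using ex_least_nat_le[of "\<lambda>i. 1 / h < 2 ^ i" n] by auto
  have "k \<noteq> 0"
  proof
    assume "k = 0"
    then have "1 / h < 1" using k(2) by simp
    then show False using h by (simp add: field_simps)
  qed
  then obtain N where N: "k = Suc N" using not0_implies_Suc by blast
  have lo: "2 ^ N \<le> 1 / h" and hi: "1 / h < 2 ^ Suc N" using k N by (auto simp: not_less)
  have "(1 / h)\<^sup>2 \<le> (2 ^ Suc N)\<^sup>2" using h hi by (intro power_mono) auto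
  also have "(2 ^ Suc N)\<^sup>2 = 4 * (4::real) ^ N" by (simp add: power_mult_distrib power_mult[symmetric] power_mult[of 2 2] mult.commute[of N 2])
  finally have "1 / 4 ^ N \<le> 4 * h\<^sup>2" using h by (simp add: field_simps)
  moreover have "real N * ln 2 = ln (2 ^ N)" by (simp add: ln_realpow)
  then have "real N * ln 2 \<le> \<bar>ln h\<bar>"
    using ln_mono[OF lo] h by (simp add: ln_div)
  ultimately show ?thesis by blast
qed

text \<open>\<open>N\<close> annuli divided by |ln h| give at most \<open>I / ln 2\<close>. The four
  surplus annuli and the constants are divided by |ln h|; the 5 collects the \<open>C\<close> of the
  Hessian bound and 4 from 4^(-N) \<le> 4 h^2 in the distance term.\<close>

lemma Ebar_recovery_le:
  assumes h: "0 < h" "h < 1" and v: "v \<in> Xsp" "W2 2 B1 v" and I: "I \<ge> 0" and C: "C \<ge> 0"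
    and N: "1 / 4 ^ N \<le> 4 * h\<^sup>2" "real N * ln 2 \<le> \<bar>ln h\<bar>"
    and hess: "(\<integral>\<^sup>+x\<in>B1. ennreal (hess_sq B1 v x) \<partial>lebesgue) \<le> of_nat (N + 4) * ennreal I + ennreal C"
    and dist: "(\<integral>\<^sup>+x\<in>B1. ennreal ((infdist (Du B1 v x) O23)\<^sup>2) \<partial>lebesgue) \<le> ennreal (C / 4 ^ N)"
  shows "Ebar h v \<le> ennreal (I / ln 2 + (4 * I + 5 * C) / \<bar>ln h\<bar>)"
proof -
  define L where "L = \<bar>ln h\<bar>"
  have L: "L > 0" using h by (simp add: L_def)
  have "of_nat (N + 4) * ennreal I + ennreal C = ennreal (real (N + 4) * I + C)"
    unfolding ennreal_of_nat_eq_real_of_nat using I C by (simp add: ennreal_mult'[symmetric] del: of_nat_add)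
  then have "Eh h v \<le> ennreal (h\<^sup>2) * ennreal (real (N + 4) * I + C) + ennreal (C / 4 ^ N)"
    unfolding Eh_def using hess dist by (intro add_mono mult_left_mono) auto
  also have "\<dots> = ennreal (h\<^sup>2 * (real (N + 4) * I + C) + C / 4 ^ N)"
    using I C by (simp add: ennreal_mult'[symmetric] ennreal_plus[symmetric] del: ennreal_plus of_nat_add)
  finally have "Ebar h v \<le> ennreal (1 / (h\<^sup>2 * L)) * ennreal (h\<^sup>2 * (real (N + 4) * I + C) + C / 4 ^ N)"
    unfolding Ebar_def L_def using v by (simp add: mult_left_mono)
  also have "\<dots> = ennreal (1 / (h\<^sup>2 * L) * (h\<^sup>2 * (real (N + 4) * I + C) + C / 4 ^ N))"
    using L by (intro ennreal_mult'[symmetric]) simp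
  also have "1 / (h\<^sup>2 * L) * (h\<^sup>2 * (real (N + 4) * I + C) + C / 4 ^ N) \<le> I / ln 2 + (4 * I + 5 * C) / L"
  proof -
    have "C / 4 ^ N \<le> h\<^sup>2 * (4 * C)" using mult_left_mono[OF N(1) C] by (simp add: mult_ac)
    then have "1 / (h\<^sup>2 * L) * (h\<^sup>2 * (real (N + 4) * I + C) + C / 4 ^ N) \<le> 1 / (h\<^sup>2 * L) * (h\<^sup>2 * (real (N + 4) * I + C + 4 * C))"
      using L by (intro mult_left_mono) (simp_all add: algebra_simps)
    also have "\<dots> = (real N * I + (4 * I + 5 * C)) / L" using h L by (simp add: field_simps)
    also have "\<dots> = real N / L * I + (4 * I + 5 * C) / L" by (simp add: add_divide_distrib)
    also have "real N / L \<le> 1 / ln 2" using N(2) L unfolding L_def[symmetric] by (simp add: field_simps)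
    then have "real N / L * I + (4 * I + 5 * C) / L \<le> 1 / ln 2 * I + (4 * I + 5 * C) / L"
      by (intro add_right_mono mult_right_mono I)
    finally show ?thesis by simp
  qed
  finally show ?thesis unfolding L_def by (simp add: ennreal_leI)
qed

theorem gamma_limsup:
  assumes hs: "\<And>k. 0 < hs k" "\<And>k. hs k < 1" "hs \<longlonglongrightarrow> 0" and u: "u \<in> Xsp"
  shows "\<exists>us. (\<forall>k. us k \<in> Xsp) \<and> W14_conv us u \<and> limsup (\<lambda>k. Ebar (hs k) (us k)) \<le> E0 u"
proof (cases "W2 2 Ann u \<and> one_hom_isometry u")
  case False
  then have "E0 u = \<infinity>" unfolding E0_def by (intro if_not_P) blast
  \<comment> \<open>Against an infinite target energy the constant sequence suffices.\<close>
  then show ?thesis using u by (intro exI[of _ "\<lambda>_. u"]) (simp add: W14_conv_def)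
next
  case True
  then have W: "W2 2 Ann u" and iso: "one_hom_isometry u" by auto
  define I where "I = enn2real (\<integral>\<^sup>+x\<in>Ann. ennreal (hess_sq Ann u x) \<partial>lebesgue)"
  have "(\<integral>\<^sup>+x\<in>Ann. ennreal (hess_sq Ann u x) \<partial>lebesgue) < \<infinity>"
    by (rule W2_hessian_finite[OF _ _ W]) (auto intro: open_Diff)
  then have Ieq: "(\<integral>\<^sup>+x\<in>Ann. ennreal (hess_sq Ann u x) \<partial>lebesgue) = ennreal I" and I0: "I \<ge> 0"
    by (simp_all add: I_def)
  obtain C where C: "C \<ge> 0" and
    ex: "\<And>N. \<exists>v. v \<in> Xsp \<and> W2 2 B1 v \<and>
      (\<integral>\<^sup>+x\<in>B1. ennreal (hess_sq B1 v x) \<partial>lebesgue) \<le> of_nat (N + 4) * ennreal I + ennreal C \<and>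
      (\<integral>\<^sup>+x\<in>B1. ennreal ((infdist (Du B1 v x) O23)\<^sup>2) \<partial>lebesgue) \<le> ennreal (C / 4 ^ N) \<and>
      (\<integral>\<^sup>+x\<in>B1. ennreal (norm (v x - u x) ^ 4) + ennreal (norm (Du B1 v x - Du B1 u x) ^ 4) \<partial>lebesgue) \<le> ennreal (C / 4 ^ N)"
    by (rule recovery_map[OF u W iso, unfolded Ieq]) blast
  have "\<exists>v. v \<in> Xsp \<and> Ebar (hs k) v \<le> ennreal (I / ln 2 + (4 * I + 5 * C) / \<bar>ln (hs k)\<bar>) \<and>
      (\<integral>\<^sup>+x\<in>B1. ennreal (norm (v x - u x) ^ 4) + ennreal (norm (Du B1 v x - Du B1 u x) ^ 4) \<partial>lebesgue) \<le> ennreal (C * (4 * (hs k)\<^sup>2))" for k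
  proof -
    obtain N where N: "1 / 4 ^ N \<le> 4 * (hs k)\<^sup>2" "real N * ln 2 \<le> \<bar>ln (hs k)\<bar>"
      using dyadic_scale_exists[OF hs(1,2)[of k]] by blast
    obtain v where v: "v \<in> Xsp" "W2 2 B1 v"
      "(\<integral>\<^sup>+x\<in>B1. ennreal (hess_sq B1 v x) \<partial>lebesgue) \<le> of_nat (N + 4) * ennreal I + ennreal C"
      "(\<integral>\<^sup>+x\<in>B1. ennreal ((infdist (Du B1 v x) O23)\<^sup>2) \<partial>lebesgue) \<le> ennreal (C / 4 ^ N)"
      "(\<integral>\<^sup>+x\<in>B1. ennreal (norm (v x - u x) ^ 4) + ennreal (norm (Du B1 v x - Du B1 u x) ^ 4) \<partial>lebesgue) \<le> ennreal (C / 4 ^ N)"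
      using ex[of N] by blast
    have "ennreal (C / 4 ^ N) \<le> ennreal (C * (4 * (hs k)\<^sup>2))"
      using mult_left_mono[OF N(1) C] by (intro ennreal_leI) simp
    with v(5) have "(\<integral>\<^sup>+x\<in>B1. ennreal (norm (v x - u x) ^ 4) + ennreal (norm (Du B1 v x - Du B1 u x) ^ 4) \<partial>lebesgue) \<le> ennreal (C * (4 * (hs k)\<^sup>2))"
      by (rule order_trans)
    then show ?thesis using v(1) Ebar_recovery_le[OF hs(1,2) v(1,2) I0 C N v(3,4)] by blast
  qed
  then have "\<forall>k. \<exists>v. v \<in> Xsp \<and> Ebar (hs k) v \<le> ennreal (I / ln 2 + (4 * I + 5 * C) / \<bar>ln (hs k)\<bar>) \<and>
      (\<integral>\<^sup>+x\<in>B1. ennreal (norm (v x - u x) ^ 4) + ennreal (norm (Du B1 v x - Du B1 u x) ^ 4) \<partial>lebesgue) \<le> ennreal (C * (4 * (hs k)\<^sup>2))"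
    by blast
  from choice[OF this] obtain us where us: "\<And>k. us k \<in> Xsp"
    "\<And>k. Ebar (hs k) (us k) \<le> ennreal (I / ln 2 + (4 * I + 5 * C) / \<bar>ln (hs k)\<bar>)"
    "\<And>k. (\<integral>\<^sup>+x\<in>B1. ennreal (norm (us k x - u x) ^ 4) + ennreal (norm (Du B1 (us k) x - Du B1 u x) ^ 4) \<partial>lebesgue) \<le> ennreal (C * (4 * (hs k)\<^sup>2))"
    by blast
  have "(\<lambda>k. C * (4 * (hs k)\<^sup>2)) \<longlonglongrightarrow> C * (4 * 0\<^sup>2)" by (intro tendsto_intros hs(3))
  then have "(\<lambda>k. ennreal (C * (4 * (hs k)\<^sup>2))) \<longlonglongrightarrow> ennreal 0" by (intro tendsto_ennrealI) simp
  then have z: "(\<lambda>k. ennreal (C * (4 * (hs k)\<^sup>2))) \<longlonglongrightarrow> 0" by simp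
  have conv: "W14_conv us u"
    unfolding W14_conv_def
    by (rule tendsto_sandwich[OF _ _ tendsto_const z]) (simp_all add: us(3))
  \<comment> \<open>Positivity makes |ln h| tend to infinity, so the remainder over |ln h| vanishes
    and only \<open>I / ln 2\<close>, which is \<open>E0 u\<close>, is left.\<close>
  have "filterlim hs (at_right 0) sequentially"
    using hs by (simp add: filterlim_at less_imp_neq[OF hs(1), symmetric])
  then have "filterlim (\<lambda>k. ln (hs k)) at_bot sequentially" by (rule filterlim_compose[OF ln_at_0])
  then have "filterlim (\<lambda>k. - ln (hs k)) at_top sequentially" by (simp add: filterlim_uminus_at_bot)
  moreover have "- ln (hs k) = \<bar>ln (hs k)\<bar>" for k using hs(1,2)[of k] by simp
  ultimately have "filterlim (\<lambda>k. \<bar>ln (hs k)\<bar>) at_top sequentially" by (simp only:)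
  then have "(\<lambda>k. (4 * I + 5 * C) / \<bar>ln (hs k)\<bar>) \<longlonglongrightarrow> 0"
    by (intro real_tendsto_divide_at_top[OF tendsto_const])
  then have "(\<lambda>k. I / ln 2 + (4 * I + 5 * C) / \<bar>ln (hs k)\<bar>) \<longlonglongrightarrow> I / ln 2 + 0" by (intro tendsto_intros)
  then have "(\<lambda>k. ennreal (I / ln 2 + (4 * I + 5 * C) / \<bar>ln (hs k)\<bar>)) \<longlonglongrightarrow> ennreal (I / ln 2)" by (intro tendsto_ennrealI) simp
  then have "limsup (\<lambda>k. ennreal (I / ln 2 + (4 * I + 5 * C) / \<bar>ln (hs k)\<bar>)) = ennreal (I / ln 2)"
    by (rule lim_imp_Limsup[rotated]) simp
  moreover have "limsup (\<lambda>k. Ebar (hs k) (us k)) \<le> limsup (\<lambda>k. ennreal (I / ln 2 + (4 * I + 5 * C) / \<bar>ln (hs k)\<bar>))"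
    by (intro Limsup_mono) (simp add: us(2))
  moreover have "E0 u = ennreal (I / ln 2)"
    unfolding E0_def Ieq using u W iso by (simp add: ennreal_mult'[symmetric])
  ultimately show ?thesis using us(1) conv by (intro exI[of _ us]) simp
qed

theorem theorem1p1:
  fixes hs :: "nat \<Rightarrow> real"
  assumes "\<forall>k. 0 < hs k \<and> hs k < 1"
    and "hs \<longlonglongrightarrow> 0"
  shows "(\<forall>u\<in>Xsp. \<forall>us. (\<forall>k. us k \<in> Xsp) \<and> W14_conv us u
            \<longrightarrow> E0 u \<le> liminf (\<lambda>k. Ebar (hs k) (us k)))
       \<and> (\<forall>u\<in>Xsp. \<exists>us. (\<forall>k. us k \<in> Xsp) \<and> W14_conv us u
            \<and> limsup (\<lambda>k. Ebar (hs k) (us k)) \<le> E0 u)"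
proof -
  have "0 < hs k" "hs k < 1" for k using assms(1) by auto
  then show ?thesis using gamma_liminf[OF _ _ assms(2)] gamma_limsup[OF _ _ assms(2)] by blast
qed

end
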